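(* Work in the setting of the context: in particular the hypotheses (A1)–(A4) of the context hold, $U^\varepsilon$ are the weak entropy solutions appearing there, and $u$ is the limit function, i.e. $U^\varepsilon\to(u,e(u))$ in $[L^p_{loc}(\mathbb R\times(0,\infty)\times\Gamma)]^2$, $1\le p<\infty$, along a subsequence $\varepsilon\to0$. Then $$\lim_{T\to0^+}\frac1T\int_0^T\int_V\int_\Gamma|u(x,t,y)-u_0(x,y)|\,\rho(y)\,dy\,dx\,dt=0\qquad\text{for every }V\Subset\mathbb R .$$ Further, suppose in addition that for every convex entropy pair $(\ell,q)$ over $\pi_1(D)$ (i.e. $\ell$ convex and $C^2$, $q'=\ell'f'$) one has $$\int_0^\infty\int_{\mathbb R}\int_\Gamma\big(\ell(u)\,\partial_t\varphi+q(u)\,\partial_x\varphi\big)\rho\,dy\,dx\,dt\ge0\qquad\text{for all }0\le\varphi\in C_c^\infty(\mathbb R\times(0,\infty)\times\Gamma).$$ Then $u$ is the unique weak entropy solution of the reduced equation $\partial_tu+\partial_xf(u)=0$ with initial condition $u_0$.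
   Context: Parameter domain. $N\in\mathbb N$, $\Gamma=[-1,1]^N$, and $\rho(y)=\prod_{j=1}^N\rho_j(y_j):\Gamma\to[0,\infty)$ is a probability density with $\rho\in L^\infty(\Gamma)$ and $\operatorname{supp}\rho:=\overline{\{y\in\Gamma:\rho(y)\ne0\}}=\overline\Gamma$. System. $D\subseteq\mathbb R^2$ is open and convex; $U=(u,v)$; $\pi_1(u,v)=u$. $F=(f_1,f_2):\overline D\to\mathbb R^2$ and $r:\overline D\to\mathbb R$ are $C^2$. The matrix $\partial_UF(U)$ has real distinct eigenvalues $\Lambda_-(U)<\Lambda_+(U)$. For each $u\in\pi_1(\overline D)$ there is a unique point $(u,e(u))\in\overline D$ with $r(u,e(u))=0$, and $\partial_vr(u,e(u))>0$; $e$ is $C^2$; $\partial_{vv}r\equiv0$ on $\overline D$; $\partial_vf_1(u,e(u))\ne0$ for all $u\in\pi_1(\overline D)$. $K:=\{(u,e(u)):u\in\pi_1(\overline D)\}$, $f(u):=f_1(u,e(u))$. Full system ($\varepsilon>0$): $\partial_tU^\varepsilon+\partial_xF(U^\varepsilon)+\frac1\varepsilon(0,r(U^\varepsilon))=0$, $U^\varepsilon(x,0,y)=U_0^\varepsilon(x,y)$. Reduced equation: $\partial_tu+\partial_xf(u)=0$, $u(x,0,y)=u_0(x,y)$. Entropies. For $S\subset\overline D$, a convex entropy over $S$ is a $C^2$ function $\eta:S\to\mathbb R$ such that on $S$: (i) $\partial_{UU}\eta\,\partial_UF$ is symmetric; (ii) $\partial_v\eta(U)r(U)\ge0$, with equality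 iff $U\in K$ (equivalently $r(U)=0$); (iii) $\partial_{UU}\eta\ge0$ as a quadratic form. Strongly convex: $\partial_{UU}\eta\ge c>0$ on $S$. An entropy pair $(\eta,Q)$ also has $Q:S\to\mathbb R$ with $\partial_U\eta\,\partial_UF=\partial_UQ$. Weak entropy solution of the full system with data $U_0^\varepsilon\in[L^\infty(\mathbb R\times\Gamma)]^2$ taking values in $\overline D$: $U^\varepsilon\in[L^\infty(\mathbb R\times(0,\infty)\times\Gamma)]^2$ with values in $\overline D$ such that (a) $\int_0^\infty\!\int_{\mathbb R}\!\int_\Gamma(U^\varepsilon\cdot\partial_t\varphi+F(U^\varepsilon)\cdot\partial_x\varphi-\frac1\varepsilon r(U^\varepsilon)\varphi_2)\rho+\int_{\mathbb R}\!\int_\Gamma U_0^\varepsilon\cdot\varphi(x,0,y)\rho=0$ for all $\varphi=(\varphi_1,\varphi_2)\in[C_c^\infty(\mathbb R\times[0,\infty)\times\Gamma)]^2$; (b) $\int_0^\infty\!\int_{\mathbb R}\!\int_\Gamma(\eta(U^\varepsilon)\partial_t\varphi+Q(U^\varepsilon)\partial_x\varphi-\frac1\varepsilon\partial_v\eta(U^\varepsilon)r(U^\varepsilon)\varphi)\rho\ge0$ for every convex entropy pair $(\eta,Q)$ over $\overline D$ and every $0\le\varphi\in C_c^\infty(\mathbb R\times(0,\infty)\times\Gamma)$; (c) $\lim_{T\to0^+}\frac1T\int_0^T\!\int_V\!\int_\Gamma|U^\varepsilon-U_0^\varepsilon|\rho=0$ for every $V\Subset\mathbb R$. Weak entropy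 solution of the reduced equation with data $u_0\in L^\infty(\mathbb R\times\Gamma)$ taking values in $\pi_1(\overline D)$: $u\in L^\infty(\mathbb R\times(0,\infty)\times\Gamma)$ with values in $\pi_1(\overline D)$ such that (a) $\int_0^\infty\!\int_{\mathbb R}\!\int_\Gamma(u\,\partial_t\varphi+f(u)\partial_x\varphi)\rho+\int_{\mathbb R}\!\int_\Gamma u_0\varphi(x,0,y)\rho=0$ for all $\varphi\in C_c^\infty(\mathbb R\times[0,\infty)\times\Gamma)$; (b) $\int_0^\infty\!\int_{\mathbb R}\!\int_\Gamma(\ell(u)\partial_t\varphi+q(u)\partial_x\varphi)\rho\ge0$ for every convex $\ell:\mathbb R\to\mathbb R$ of class $C^2(\pi_1(\overline D))$, $q(u)=\int^u\ell'f'$, and every $0\le\varphi\in C_c^\infty(\mathbb R\times(0,\infty)\times\Gamma)$; (c) $\lim_{T\to0^+}\frac1T\int_0^T\!\int_V\!\int_\Gamma|u-u_0|\rho=0$ for every $V\Subset\mathbb R$. Weighted local spaces: $g_n\to g$ in $L^1_{\rho^k,loc}$ means $\int_{C}|g_n-g|\rho^k\to0$ on every compact subset $C$ of the domain. Hypotheses. (A1) Strict subcharacteristic condition: $\Lambda_-(u,e(u))<f'(u)<\Lambda_+(u,e(u))$, $u\in\pi_1(D)$. $B,B'$ are bounded open convex subsets of $D$, $B\cap K\ne\emptyset$, $B\Subset B'\Subset D$; $\ell_1:\pi_1(D)\to\mathbb R$ is a strictly convex $C^2$ function, $\ell_2=\ell_1+Cf$ with $0<C<\inf_{\overline{\pi_1(B')}}\ell_1''/\sup_{\overline{\pi_1(B')}}|f''|$.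 $\gamma>0$ is such that, with $B_\gamma:=B\cap\{(u,v)\in D:|v-e(u)|<\gamma\}$, there are strongly convex entropy pairs $(\eta_i,Q_i)$, $i=1,2$, on $\overline{B_\gamma}$ with $\eta_i(u,e(u))=\ell_i(u)$ on $\pi_1(\overline{B_\gamma})$, $\partial_v\eta_i\,r>0$ on $\overline{B_\gamma}\setminus K$, $\partial_v\eta_i(u,e(u))=0$ (note that $B_\gamma$ is bounded, open, and convex). Without loss of generality one can assume that there exists an entropy pair $(\eta,Q)$ on $B_\gamma$ such that $\eta$ is an extension of $u\mapsto|u|^2$, i.e. $\eta(u,e(u))=|u|^2$ (if this is not the case, the constant $\gamma$ can be further restricted). (A2) $\varepsilon$ ranges over a positive sequence tending to $0$; $U_0^\varepsilon$ takes values in $\overline{B_\gamma}$; $U^\varepsilon$ are weak entropy solutions of the full system with data $U_0^\varepsilon$, taking values in $\overline{B_\gamma}$; there are $\overline U:\Gamma\to K$ and $\beta>0$ independent of $\varepsilon$ with $\int_{\mathbb R}\int_\Gamma|U_0^\varepsilon-\overline U|^2\rho\,dy\,dx\le\beta^2$; $f''\ne0$ a.e. in $\pi_1(\overline{B_\gamma})$. (A3) $U_0^\varepsilon=(u_0^\varepsilon,v_0^\varepsilon)$ converges almost everywhere to a function $(u_0,v_0)$ taking values in $D$ and satisfying $v_0=e(u_0)$. (A4) For every $\varepsilon$, $U^\varepsilon$ is the unique limit in $[L^1_{\rho^2,loc}(\mathbb R\times(0,\infty)\times\Gamma)]^2$ as $\nu\to0$ of classical solutions $U^{\varepsilon,\nu}=(u^{\varepsilon,\nu},v^{\varepsilon,\nu})$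 of $\partial_tU^{\varepsilon,\nu}+\partial_xF(U^{\varepsilon,\nu})+\frac1\varepsilon(0,r(U^{\varepsilon,\nu}))=\nu\,\partial_{xx}U^{\varepsilon,\nu}$, $U^{\varepsilon,\nu}|_{t=0}=U_0^{\varepsilon,\nu}$, where $U_0^{\varepsilon,\nu}$ are smooth approximations of $U_0^\varepsilon$ converging to $U_0^\varepsilon$ in $[L^1_{\rho,loc}(\mathbb R\times\Gamma)]^2$; both $U^{\varepsilon,\nu}$ and $U_0^{\varepsilon,\nu}$ take values in $\overline{B_\gamma}$ for every $\nu$.
   Formalization: Uniqueness is meant almost everywhere with respect to ρ dy dx dt (ρ may vanish on a set of positive measure), and a weak entropy solution of the reduced equation is also required to have f(u) bounded, which is automatic when π₁(D̄) is closed, so that the flux integrals are defined. *)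

theory Defs
  imports "HOL-Analysis.Analysis"
begin

abbreviation pr1 :: "real^2 \<Rightarrow> real" where
  "pr1 U \<equiv> U $ 1"

abbreviation st :: "real \<Rightarrow> real \<Rightarrow> real^2" where
  "st u v \<equiv> vector [u, v]"

text \<open>
  \<open>C\<^sup>2\<close> regularity on a set \<open>S\<close> that need not be open. The derivatives are one-sided (relative
  to \<open>S\<close>) at boundary points; for a convex \<open>S\<close> with nonempty interior this is the same as
  \<open>C\<^sup>2\<close> in the interior with derivatives up to order two extending continuously to \<open>S\<close>.
  The gradient and the Hessian are arguments, because a derivative relative to \<open>S\<close> can fail to
  be unique at a cusp of \<open>S\<close>; as continuous functions on \<open>S\<close> they are determined by their values
  in the interior whenever \<open>S\<close> lies in the closure of its interior.
\<close>

definition C2_with :: "(real^2) set \<Rightarrow> (real^2 \<Rightarrow> real) \<Rightarrow> (real^2 \<Rightarrow> real^2) \<Rightarrow>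
    (real^2 \<Rightarrow> real^2^2) \<Rightarrow> bool" where
  "C2_with S g Dg Hg \<longleftrightarrow>
     (\<forall>U\<in>S. (g has_derivative (\<lambda>h. Dg U \<bullet> h)) (at U within S)) \<and>
     (\<forall>U\<in>S. (Dg has_derivative (\<lambda>h. Hg U *v h)) (at U within S)) \<and>
     continuous_on S Hg"

definition C2_real_with :: "real set \<Rightarrow> (real \<Rightarrow> real) \<Rightarrow> (real \<Rightarrow> real) \<Rightarrow> (real \<Rightarrow> real) \<Rightarrow> bool" where
  "C2_real_with I g g' g'' \<longleftrightarrow>
     (\<forall>s\<in>I. (g has_real_derivative g' s) (at s within I)) \<and>
     (\<forall>s\<in>I. (g' has_real_derivative g'' s) (at s within I)) \<and>
     continuous_on I g''"

definition strictly_convex_on :: "real set \<Rightarrow> (real \<Rightarrow> real) \<Rightarrow> bool" where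
  "strictly_convex_on I g \<longleftrightarrow> convex I \<and>
     (\<forall>a\<in>I. \<forall>b\<in>I. \<forall>s. a \<noteq> b \<and> 0 < s \<and> s < 1 \<longrightarrow>
        g ((1 - s) * a + s * b) < (1 - s) * g a + s * g b)"

primrec Ck :: "nat \<Rightarrow> ('a::euclidean_space \<Rightarrow> 'b::real_normed_vector) \<Rightarrow> bool" where
  "Ck 0 g \<longleftrightarrow> continuous_on UNIV g"
| "Ck (Suc k) g \<longleftrightarrow> (\<forall>z. g differentiable (at z)) \<and>
     (\<forall>b\<in>Basis. Ck k (\<lambda>z. frechet_derivative g (at z) b))"

definition smooth :: "('a::euclidean_space \<Rightarrow> 'b::real_normed_vector) \<Rightarrow> bool" where
  "smooth g \<longleftrightarrow> (\<forall>k. Ck k g)"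

definition smooth_on :: "'a::euclidean_space set \<Rightarrow> ('a \<Rightarrow> 'b::real_normed_vector) \<Rightarrow> bool" where
  "smooth_on S g \<longleftrightarrow> (\<exists>h. smooth h \<and> (\<forall>z\<in>S. h z = g z))"

text \<open>
  \<open>C\<^sub>c\<^sup>\<infinity>(S)\<close> for a set \<open>S\<close> that is not open: (globally smooth extensions of) functions on \<open>S\<close>
  whose support is a compact subset of \<open>S\<close>. They need not vanish on the part of the boundary that
  belongs to \<open>S\<close>.
\<close>

definition test_fun :: "'a::euclidean_space set \<Rightarrow> ('a \<Rightarrow> real) \<Rightarrow> bool" where
  "test_fun S \<phi> \<longleftrightarrow> smooth \<phi> \<and> (\<exists>C. compact C \<and> C \<subseteq> S \<and> (\<forall>z\<in>S - C. \<phi> z = 0))"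

definition Linf :: "'a::euclidean_space set \<Rightarrow> ('a \<Rightarrow> 'b::real_normed_vector) \<Rightarrow> bool" where
  "Linf S g \<longleftrightarrow> g \<in> borel_measurable (lebesgue_on S) \<and>
     (\<exists>M. AE z in lebesgue_on S. norm (g z) \<le> M)"

definition tendsto_Lp_loc :: "real \<Rightarrow> ('a::euclidean_space \<Rightarrow> real) \<Rightarrow> 'a set \<Rightarrow>
    ('i \<Rightarrow> 'a \<Rightarrow> 'b::real_normed_vector) \<Rightarrow> ('a \<Rightarrow> 'b) \<Rightarrow> 'i filter \<Rightarrow> bool" where
  "tendsto_Lp_loc p w S G g Fl \<longleftrightarrow>
     (\<forall>C. compact C \<and> C \<subseteq> S \<longrightarrow>
        ((\<lambda>i. \<integral>\<^sup>+ z. ennreal (norm (G i z - g z) powr p * w z) \<partial>lebesgue_on C) \<longlongrightarrow> 0) Fl)"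

text \<open>Space-time-parameter points are triples \<open>(x, t, y)\<close>, points of the initial data are pairs \<open>(x, y)\<close>.\<close>

definition Gam :: "(real^'n) set" where
  "Gam = cbox (- 1) 1"

definition domT :: "(real \<times> real \<times> (real^'n)) set" where
  "domT = UNIV \<times> {0<..} \<times> Gam"

definition domT0 :: "(real \<times> real \<times> (real^'n)) set" where
  "domT0 = UNIV \<times> {0..} \<times> Gam"

definition dom0 :: "(real \<times> (real^'n)) set" where
  "dom0 = UNIV \<times> Gam"

definition parameter_density :: "((real^'n) \<Rightarrow> real) \<Rightarrow> bool" where
  "parameter_density \<rho> \<longleftrightarrow>
     (\<exists>\<rho>j :: 'n \<Rightarrow> real \<Rightarrow> real. \<forall>y\<in>Gam. \<rho> y = (\<Prod>j\<in>UNIV. \<rho>j j (y $ j))) \<and>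
     (\<forall>y\<in>Gam. 0 \<le> \<rho> y) \<and>
     Linf Gam \<rho> \<and>
     (LINT y|lebesgue_on Gam. \<rho> y) = 1 \<and>
     closure {y\<in>Gam. \<rho> y \<noteq> 0} = Gam"

definition dx :: "(real \<times> real \<times> (real^'n) \<Rightarrow> real) \<Rightarrow> real \<times> real \<times> (real^'n) \<Rightarrow> real" where
  "dx \<phi> z = frechet_derivative \<phi> (at z) (1, 0, 0)"

definition dt :: "(real \<times> real \<times> (real^'n) \<Rightarrow> real) \<Rightarrow> real \<times> real \<times> (real^'n) \<Rightarrow> real" where
  "dt \<phi> z = frechet_derivative \<phi> (at z) (0, 1, 0)"

text \<open>The condition \<open>V \<Subset> \<real>\<close> is rendered as: \<open>V\<close> measurable and bounded.\<close>

definition attains_initial_data :: "((real^'n) \<Rightarrow> real) \<Rightarrow> (real \<times> real \<times> (real^'n) \<Rightarrow> 'b::real_normed_vector) \<Rightarrow>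
    (real \<times> (real^'n) \<Rightarrow> 'b) \<Rightarrow> bool" where
  "attains_initial_data \<rho> w w0 \<longleftrightarrow>
     (\<forall>V. V \<in> sets lebesgue \<and> bounded V \<longrightarrow>
        ((\<lambda>T. 1 / T * (LINT (x, t, y)|lebesgue_on (V \<times> {0<..<T} \<times> Gam).
                 norm (w (x, t, y) - w0 (x, y)) * \<rho> y)) \<longlongrightarrow> 0) (at_right 0))"

definition eigval :: "real^2^2 \<Rightarrow> real \<Rightarrow> bool" where
  "eigval A \<mu> \<longleftrightarrow> (\<exists>\<xi>. \<xi> \<noteq> 0 \<and> A *v \<xi> = \<mu> *\<^sub>R \<xi>)"

definition equil :: "(real^2) set \<Rightarrow> (real \<Rightarrow> real) \<Rightarrow> (real^2) set" where
  "equil D e = (\<lambda>u. st u (e u)) ` (pr1 ` closure D)"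

definition flux :: "(real^2 \<Rightarrow> real^2) \<Rightarrow> (real \<Rightarrow> real) \<Rightarrow> real \<Rightarrow> real" where
  "flux F e u = F (st u (e u)) $ 1"

definition relaxation_system :: "(real^2) set \<Rightarrow> (real^2 \<Rightarrow> real^2) \<Rightarrow> (real^2 \<Rightarrow> real^2^2) \<Rightarrow>
    (real^2 \<Rightarrow> real) \<Rightarrow> (real^2 \<Rightarrow> real) \<Rightarrow> (real^2 \<Rightarrow> real) \<Rightarrow> (real \<Rightarrow> real) \<Rightarrow> bool" where
  "relaxation_system D F DF \<Lambda>m \<Lambda>p r e \<longleftrightarrow>
     open D \<and> convex D \<and>
     (\<forall>i. \<exists>HF. C2_with (closure D) (\<lambda>U. F U $ i) (\<lambda>U. DF U $ i) HF) \<and>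
     (\<forall>U\<in>closure D. \<Lambda>m U < \<Lambda>p U \<and> eigval (DF U) (\<Lambda>m U) \<and> eigval (DF U) (\<Lambda>p U)) \<and>
     (\<exists>Dr Hr. C2_with (closure D) r Dr Hr \<and>
        (\<forall>u\<in>pr1 ` closure D. Dr (st u (e u)) $ 2 > 0) \<and>
        (\<forall>U\<in>closure D. Hr U $ 2 $ 2 = 0)) \<and>
     (\<forall>u\<in>pr1 ` closure D. \<forall>v. st u v \<in> closure D \<and> r (st u v) = 0 \<longleftrightarrow> v = e u) \<and>
     (\<exists>e' e''. C2_real_with (pr1 ` closure D) e e' e'') \<and>
     (\<forall>u\<in>pr1 ` closure D. DF (st u (e u)) $ 1 $ 2 \<noteq> 0)"

definition convex_entropy :: "(real^2) set \<Rightarrow> (real^2 \<Rightarrow> real^2^2) \<Rightarrow> (real^2 \<Rightarrow> real) \<Rightarrow> (real^2) set \<Rightarrow>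
    (real^2 \<Rightarrow> real) \<Rightarrow> (real^2 \<Rightarrow> real^2) \<Rightarrow> (real^2 \<Rightarrow> real^2^2) \<Rightarrow> bool" where
  "convex_entropy K DF r S \<eta> D\<eta> H\<eta> \<longleftrightarrow>
     C2_with S \<eta> D\<eta> H\<eta> \<and>
     (\<forall>U\<in>S. transpose (H\<eta> U ** DF U) = H\<eta> U ** DF U) \<and>
     (\<forall>U\<in>S. D\<eta> U $ 2 * r U \<ge> 0 \<and> (D\<eta> U $ 2 * r U = 0 \<longleftrightarrow> U \<in> K)) \<and>
     (\<forall>U\<in>S. \<forall>\<xi>. \<xi> \<bullet> (H\<eta> U *v \<xi>) \<ge> 0)"

definition strongly_convex_entropy :: "(real^2) set \<Rightarrow> (real^2 \<Rightarrow> real^2^2) \<Rightarrow> (real^2 \<Rightarrow> real) \<Rightarrow> (real^2) set \<Rightarrow>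
    (real^2 \<Rightarrow> real) \<Rightarrow> (real^2 \<Rightarrow> real^2) \<Rightarrow> (real^2 \<Rightarrow> real^2^2) \<Rightarrow> bool" where
  "strongly_convex_entropy K DF r S \<eta> D\<eta> H\<eta> \<longleftrightarrow>
     convex_entropy K DF r S \<eta> D\<eta> H\<eta> \<and>
     (\<exists>c>0. \<forall>U\<in>S. \<forall>\<xi>. \<xi> \<bullet> (H\<eta> U *v \<xi>) \<ge> c * (norm \<xi>)\<^sup>2)"

definition entropy_flux :: "(real^2 \<Rightarrow> real^2^2) \<Rightarrow> (real^2) set \<Rightarrow> (real^2 \<Rightarrow> real^2) \<Rightarrow> (real^2 \<Rightarrow> real) \<Rightarrow> bool" where
  "entropy_flux DF S D\<eta> Q \<longleftrightarrow>
     (\<forall>U\<in>S. (Q has_derivative (\<lambda>h. (D\<eta> U v* DF U) \<bullet> h)) (at U within S))"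

definition weak_entropy_sol_full :: "((real^'n) \<Rightarrow> real) \<Rightarrow> (real^2) set \<Rightarrow> (real^2 \<Rightarrow> real^2) \<Rightarrow>
    (real^2 \<Rightarrow> real^2^2) \<Rightarrow> (real^2 \<Rightarrow> real) \<Rightarrow> (real \<Rightarrow> real) \<Rightarrow> real \<Rightarrow>
    (real \<times> (real^'n) \<Rightarrow> real^2) \<Rightarrow> (real \<times> real \<times> (real^'n) \<Rightarrow> real^2) \<Rightarrow> bool" where
  "weak_entropy_sol_full \<rho> D F DF r e \<epsilon> U0 U \<longleftrightarrow>
     Linf dom0 U0 \<and> (AE z in lebesgue_on dom0. U0 z \<in> closure D) \<and>
     Linf domT U \<and> (AE z in lebesgue_on domT. U z \<in> closure D) \<and>
     (\<forall>\<phi>1 \<phi>2. test_fun domT0 \<phi>1 \<and> test_fun domT0 \<phi>2 \<longrightarrow>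
        (LINT (x, t, y)|lebesgue_on domT.
           (U (x, t, y) \<bullet> st (dt \<phi>1 (x, t, y)) (dt \<phi>2 (x, t, y))
            + F (U (x, t, y)) \<bullet> st (dx \<phi>1 (x, t, y)) (dx \<phi>2 (x, t, y))
            - 1 / \<epsilon> * r (U (x, t, y)) * \<phi>2 (x, t, y)) * \<rho> y)
        + (LINT (x, y)|lebesgue_on dom0. (U0 (x, y) \<bullet> st (\<phi>1 (x, 0, y)) (\<phi>2 (x, 0, y))) * \<rho> y)
        = 0) \<and>
     (\<forall>\<eta> D\<eta> H\<eta> Q \<phi>.
        convex_entropy (equil D e) DF r (closure D) \<eta> D\<eta> H\<eta> \<and> entropy_flux DF (closure D) D\<eta> Q \<and>
        test_fun domT \<phi> \<and> (\<forall>z\<in>domT. 0 \<le> \<phi> z) \<longrightarrow>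
        (LINT (x, t, y)|lebesgue_on domT.
           (\<eta> (U (x, t, y)) * dt \<phi> (x, t, y) + Q (U (x, t, y)) * dx \<phi> (x, t, y)
            - 1 / \<epsilon> * (D\<eta> (U (x, t, y)) $ 2) * r (U (x, t, y)) * \<phi> (x, t, y)) * \<rho> y) \<ge> 0) \<and>
     attains_initial_data \<rho> U U0"

text \<open>
  Weak entropy solutions of the reduced equation. The clause \<open>Linf domT (\<lambda>z. f (u z))\<close> says that the
  flux term is a bounded function, so that the integrals are meaningful. It only matters when the
  interval \<open>\<pi>\<^sub>1(closure D)\<close> omits one of its finite end points (where \<open>f\<close> may be unbounded); otherwise
  it follows from \<open>u\<close> being bounded with values in that interval, see \<open>Linf_compose\<close> below.
\<close>

definition weak_entropy_sol_reduced :: "((real^'n) \<Rightarrow> real) \<Rightarrow> (real^2) set \<Rightarrow> (real \<Rightarrow> real) \<Rightarrow>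
    (real \<times> (real^'n) \<Rightarrow> real) \<Rightarrow> (real \<times> real \<times> (real^'n) \<Rightarrow> real) \<Rightarrow> bool" where
  "weak_entropy_sol_reduced \<rho> D f u0 u \<longleftrightarrow>
     Linf dom0 u0 \<and> (AE z in lebesgue_on dom0. u0 z \<in> pr1 ` closure D) \<and>
     Linf domT u \<and> (AE z in lebesgue_on domT. u z \<in> pr1 ` closure D) \<and>
     Linf domT (\<lambda>z. f (u z)) \<and>
     (\<forall>\<phi>. test_fun domT0 \<phi> \<longrightarrow>
        (LINT (x, t, y)|lebesgue_on domT.
           (u (x, t, y) * dt \<phi> (x, t, y) + f (u (x, t, y)) * dx \<phi> (x, t, y)) * \<rho> y)
        + (LINT (x, y)|lebesgue_on dom0. u0 (x, y) * \<phi> (x, 0, y) * \<rho> y) = 0) \<and>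
     (\<forall>l l' l'' q \<phi>.
        convex_on UNIV l \<and> C2_real_with (pr1 ` closure D) l l' l'' \<and>
        (\<forall>s\<in>pr1 ` closure D. (q has_real_derivative
             l' s * vector_derivative f (at s within pr1 ` closure D)) (at s within pr1 ` closure D)) \<and>
        test_fun domT \<phi> \<and> (\<forall>z\<in>domT. 0 \<le> \<phi> z) \<longrightarrow>
        (LINT (x, t, y)|lebesgue_on domT.
           (l (u (x, t, y)) * dt \<phi> (x, t, y) + q (u (x, t, y)) * dx \<phi> (x, t, y)) * \<rho> y) \<ge> 0) \<and>
     attains_initial_data \<rho> u u0"

text \<open>
  The hypotheses only see \<open>\<rho>\<close>-weighted integrals, and \<open>closure {\<rho> \<noteq> 0} = \<Gamma>\<close> does not prevent \<open>\<rho>\<close> from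
  vanishing on a set of positive Lebesgue measure. Uniqueness is therefore meant almost everywhere
  with respect to \<open>\<rho> dy dx dt\<close>.
\<close>

definition unique_weak_entropy_sol_reduced :: "((real^'n) \<Rightarrow> real) \<Rightarrow> (real^2) set \<Rightarrow> (real \<Rightarrow> real) \<Rightarrow>
    (real \<times> (real^'n) \<Rightarrow> real) \<Rightarrow> (real \<times> real \<times> (real^'n) \<Rightarrow> real) \<Rightarrow> bool" where
  "unique_weak_entropy_sol_reduced \<rho> D f u0 u \<longleftrightarrow>
     weak_entropy_sol_reduced \<rho> D f u0 u \<and>
     (\<forall>w. weak_entropy_sol_reduced \<rho> D f u0 w \<longrightarrow>
        (AE (x, t, y) in lebesgue_on domT. \<rho> y \<noteq> 0 \<longrightarrow> w (x, t, y) = u (x, t, y)))"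

lemma Linf_compose:
  fixes w :: "'a::euclidean_space \<Rightarrow> real" and g :: "real \<Rightarrow> real"
  assumes S: "S \<in> sets lebesgue" and w: "Linf S w" and I: "closed I" "continuous_on I g"
    and wI: "AE z in lebesgue_on S. w z \<in> I"
  shows "Linf S (\<lambda>z. g (w z))"
proof -
  from w obtain M where M: "AE z in lebesgue_on S. norm (w z) \<le> M"
    and wm: "w \<in> borel_measurable (lebesgue_on S)"
    by (auto simp: Linf_def)
  have "compact (I \<inter> {-M..M})"
    using I(1) by (simp add: closed_Int_compact)
  then have "compact (g ` (I \<inter> {-M..M}))"
    using I(2) by (meson compact_continuous_image continuous_on_subset inf_le1)
  then obtain B where B: "\<And>s. s \<in> I \<inter> {-M..M} \<Longrightarrow> norm (g s) \<le> B"
    using compact_imp_bounded bounded_iff by (metis imageI)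
  have bd: "AE z in lebesgue_on S. norm (g (w z)) \<le> B"
    using M wI by eventually_elim (rule B, auto simp: abs_le_iff)
  have gm: "(\<lambda>s. indicat_real I s *\<^sub>R g s) \<in> borel_measurable borel"
    using I by (intro borel_measurable_continuous_on_indicator) auto
  have m1: "(\<lambda>z. indicat_real I (w z) *\<^sub>R g (w z)) \<in> borel_measurable (lebesgue_on S)"
    using measurable_compose[OF wm gm] .
  have "AE z in lebesgue. z \<in> S \<longrightarrow> w z \<in> I"
    using wI S by (simp add: AE_restrict_space_iff)
  then have "AE z in lebesgue. (if z \<in> S then indicat_real I (w z) *\<^sub>R g (w z) else 0)
      = (if z \<in> S then g (w z) else 0)"
    by eventually_elim simp
  then have "(\<lambda>z. if z \<in> S then g (w z) else 0) \<in> borel_measurable lebesgue"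
    by (rule borel_measurable_AE[OF borel_measurable_if_I[OF m1 S]])
  then have "(\<lambda>z. g (w z)) \<in> borel_measurable (lebesgue_on S)"
    by (rule borel_measurable_if_D)
  with bd show ?thesis by (auto simp: Linf_def)
qed

definition Bgam :: "(real^2) set \<Rightarrow> (real \<Rightarrow> real) \<Rightarrow> (real^2) set \<Rightarrow> real \<Rightarrow> (real^2) set" where
  "Bgam D e B \<gamma> = B \<inter> {U\<in>D. \<bar>U $ 2 - e (U $ 1)\<bar> < \<gamma>}"

definition compactly_in :: "'a::euclidean_space set \<Rightarrow> 'a set \<Rightarrow> bool" where
  "compactly_in A A' \<longleftrightarrow> compact (closure A) \<and> closure A \<subseteq> A'"

text \<open>
  In the bound on \<open>C\<close> the denominator is positive, since \<open>f'' \<noteq> 0\<close> almost everywhere on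
  \<open>\<pi>\<^sub>1(closure B\<^sub>\<gamma>)\<close> by \<open>hyp_A2\<close>.
\<close>

definition hyp_A1 :: "(real^2) set \<Rightarrow> (real^2 \<Rightarrow> real^2) \<Rightarrow> (real^2 \<Rightarrow> real^2^2) \<Rightarrow> (real^2 \<Rightarrow> real) \<Rightarrow>
    (real^2 \<Rightarrow> real) \<Rightarrow> (real^2 \<Rightarrow> real) \<Rightarrow> (real \<Rightarrow> real) \<Rightarrow> (real^2) set \<Rightarrow> (real^2) set \<Rightarrow>
    (real \<Rightarrow> real) \<Rightarrow> (real \<Rightarrow> real) \<Rightarrow> real \<Rightarrow> real \<Rightarrow> bool" where
  "hyp_A1 D F DF \<Lambda>m \<Lambda>p r e B B' l1 l2 C \<gamma> \<longleftrightarrow>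
     (\<forall>u\<in>pr1 ` D. \<Lambda>m (st u (e u)) < deriv (flux F e) u \<and> deriv (flux F e) u < \<Lambda>p (st u (e u))) \<and>
     bounded B \<and> open B \<and> convex B \<and> B \<subseteq> D \<and>
     bounded B' \<and> open B' \<and> convex B' \<and> B' \<subseteq> D \<and>
     B \<inter> equil D e \<noteq> {} \<and> compactly_in B B' \<and> compactly_in B' D \<and>
     strictly_convex_on (pr1 ` D) l1 \<and>
     (\<exists>l1' l1''. C2_real_with (pr1 ` D) l1 l1' l1'') \<and>
     (\<forall>u\<in>pr1 ` D. l2 u = l1 u + C * flux F e u) \<and>
     0 < C \<and>
     C < (INF u\<in>closure (pr1 ` B'). deriv (deriv l1) u) /
         (SUP u\<in>closure (pr1 ` B'). \<bar>deriv (deriv (flux F e)) u\<bar>) \<and>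
     0 < \<gamma> \<and>
     (\<forall>l\<in>{l1, l2}. \<exists>\<eta> D\<eta> H\<eta> Q.
        strongly_convex_entropy (equil D e) DF r (closure (Bgam D e B \<gamma>)) \<eta> D\<eta> H\<eta> \<and>
        entropy_flux DF (closure (Bgam D e B \<gamma>)) D\<eta> Q \<and>
        (\<forall>u\<in>pr1 ` closure (Bgam D e B \<gamma>). \<eta> (st u (e u)) = l u) \<and>
        (\<forall>U\<in>closure (Bgam D e B \<gamma>) - equil D e. D\<eta> U $ 2 * r U > 0) \<and>
        (\<forall>u\<in>pr1 ` closure (Bgam D e B \<gamma>). D\<eta> (st u (e u)) $ 2 = 0)) \<and>
     (\<exists>\<eta> D\<eta> H\<eta> Q.
        convex_entropy (equil D e) DF r (Bgam D e B \<gamma>) \<eta> D\<eta> H\<eta> \<and>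
        entropy_flux DF (Bgam D e B \<gamma>) D\<eta> Q \<and>
        (\<forall>u\<in>pr1 ` Bgam D e B \<gamma>. \<eta> (st u (e u)) = \<bar>u\<bar>\<^sup>2))"

definition hyp_A2 :: "((real^'n) \<Rightarrow> real) \<Rightarrow> (real^2) set \<Rightarrow> (real^2 \<Rightarrow> real^2) \<Rightarrow> (real^2 \<Rightarrow> real^2^2) \<Rightarrow>
    (real^2 \<Rightarrow> real) \<Rightarrow> (real \<Rightarrow> real) \<Rightarrow> (real^2) set \<Rightarrow> real \<Rightarrow> (nat \<Rightarrow> real) \<Rightarrow>
    (nat \<Rightarrow> real \<times> (real^'n) \<Rightarrow> real^2) \<Rightarrow> (nat \<Rightarrow> real \<times> real \<times> (real^'n) \<Rightarrow> real^2) \<Rightarrow> bool" where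
  "hyp_A2 \<rho> D F DF r e B \<gamma> \<epsilon> U0 U \<longleftrightarrow>
     (\<forall>n. 0 < \<epsilon> n) \<and> \<epsilon> \<longlonglongrightarrow> 0 \<and>
     (\<forall>n. AE z in lebesgue_on dom0. U0 n z \<in> closure (Bgam D e B \<gamma>)) \<and>
     (\<forall>n. weak_entropy_sol_full \<rho> D F DF r e (\<epsilon> n) (U0 n) (U n)) \<and>
     (\<forall>n. AE z in lebesgue_on domT. U n z \<in> closure (Bgam D e B \<gamma>)) \<and>
     (\<exists>Ub \<beta>. Ub \<in> borel_measurable (lebesgue_on Gam) \<and> (\<forall>y\<in>Gam. Ub y \<in> equil D e) \<and> 0 < \<beta> \<and>
        (\<forall>n. (\<integral>\<^sup>+ (x, y). ennreal ((norm (U0 n (x, y) - Ub y))\<^sup>2 * \<rho> y) \<partial>lebesgue_on dom0)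
              \<le> ennreal (\<beta>\<^sup>2))) \<and>
     (AE u in lebesgue_on (pr1 ` closure (Bgam D e B \<gamma>)). deriv (deriv (flux F e)) u \<noteq> 0)"

definition hyp_A3 :: "(real^2) set \<Rightarrow> (real \<Rightarrow> real) \<Rightarrow> (nat \<Rightarrow> real \<times> (real^'n) \<Rightarrow> real^2) \<Rightarrow>
    (real \<times> (real^'n) \<Rightarrow> real) \<Rightarrow> (real \<times> (real^'n) \<Rightarrow> real) \<Rightarrow> bool" where
  "hyp_A3 D e U0 u0 v0 \<longleftrightarrow>
     (AE z in lebesgue_on dom0. (\<lambda>n. U0 n z) \<longlonglongrightarrow> st (u0 z) (v0 z)) \<and>
     (AE z in lebesgue_on dom0. st (u0 z) (v0 z) \<in> D \<and> v0 z = e (u0 z))"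

definition classical_viscous_sol :: "(real^2 \<Rightarrow> real^2) \<Rightarrow> (real^2 \<Rightarrow> real) \<Rightarrow> real \<Rightarrow> real \<Rightarrow>
    (real \<times> (real^'n) \<Rightarrow> real^2) \<Rightarrow> (real \<times> real \<times> (real^'n) \<Rightarrow> real^2) \<Rightarrow> bool" where
  "classical_viscous_sol F r \<epsilon> \<nu> W0 W \<longleftrightarrow>
     (\<forall>y\<in>Gam.
        continuous_on (UNIV \<times> {0..}) (\<lambda>(x, t). W (x, t, y)) \<and>
        (\<forall>x. W (x, 0, y) = W0 (x, y)) \<and>
        (\<exists>Wt Wx Wxx :: real \<times> real \<Rightarrow> real^2.
           continuous_on (UNIV \<times> {0<..}) Wt \<and>
           continuous_on (UNIV \<times> {0<..}) Wx \<and>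
           continuous_on (UNIV \<times> {0<..}) Wxx \<and>
           (\<forall>x. \<forall>t>0.
              ((\<lambda>s. W (x, s, y)) has_vector_derivative Wt (x, t)) (at t) \<and>
              ((\<lambda>s. W (s, t, y)) has_vector_derivative Wx (x, t)) (at x) \<and>
              ((\<lambda>s. Wx (s, t)) has_vector_derivative Wxx (x, t)) (at x) \<and>
              Wt (x, t) + vector_derivative (\<lambda>s. F (W (s, t, y))) (at x)
                + (1 / \<epsilon>) *\<^sub>R st 0 (r (W (x, t, y))) = \<nu> *\<^sub>R Wxx (x, t))))"

text \<open>
  The last clause spells out that the limit is unique; as limits in the weighted space it can only be
  so up to sets that are null for \<open>\<rho> dy dx dt\<close>.
\<close>

definition hyp_A4 :: "((real^'n) \<Rightarrow> real) \<Rightarrow> (real^2) set \<Rightarrow> (real^2 \<Rightarrow> real^2) \<Rightarrow> (real^2 \<Rightarrow> real) \<Rightarrow>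
    (real \<Rightarrow> real) \<Rightarrow> (real^2) set \<Rightarrow> real \<Rightarrow> (nat \<Rightarrow> real) \<Rightarrow>
    (nat \<Rightarrow> real \<times> (real^'n) \<Rightarrow> real^2) \<Rightarrow> (nat \<Rightarrow> real \<times> real \<times> (real^'n) \<Rightarrow> real^2) \<Rightarrow> bool" where
  "hyp_A4 \<rho> D F r e B \<gamma> \<epsilon> U0 U \<longleftrightarrow>
     (\<forall>n. \<exists>W0 W.
        (\<forall>\<nu>>0. smooth_on dom0 (W0 \<nu>) \<and>
           W \<nu> \<in> borel_measurable (lebesgue_on domT) \<and>
           classical_viscous_sol F r (\<epsilon> n) \<nu> (W0 \<nu>) (W \<nu>) \<and>
           (\<forall>z\<in>dom0. W0 \<nu> z \<in> closure (Bgam D e B \<gamma>)) \<and>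
           (\<forall>z\<in>domT. W \<nu> z \<in> closure (Bgam D e B \<gamma>))) \<and>
        tendsto_Lp_loc 1 (\<lambda>(x, y). \<rho> y) dom0 W0 (U0 n) (at_right 0) \<and>
        tendsto_Lp_loc 1 (\<lambda>(x, t, y). (\<rho> y)\<^sup>2) domT W (U n) (at_right 0) \<and>
        (\<forall>Z. Z \<in> borel_measurable (lebesgue_on domT) \<and>
           tendsto_Lp_loc 1 (\<lambda>(x, t, y). (\<rho> y)\<^sup>2) domT W Z (at_right 0) \<longrightarrow>
           (AE (x, t, y) in lebesgue_on domT. \<rho> y \<noteq> 0 \<longrightarrow> Z (x, t, y) = U n (x, t, y))))"

end

theory Submission
  imports Defs
begin

text \<open>
  The a.e. limit of the weak forms of the full systems is the weak form of the reduced equation for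
  \<open>u\<close> with data \<open>u\<^sub>0\<close>. The entropy inequality for the extension of \<open>\<ell>\<^sub>1\<close> is derived from the classical
  viscous solutions, for fixed \<open>y\<close> and with test functions that do not vanish at \<open>t = 0\<close>, and passed
  to the limits \<open>\<nu> \<rightarrow> 0\<close> and \<open>\<epsilon> \<rightarrow> 0\<close>; so it carries the initial term \<open>\<ell>\<^sub>1(u\<^sub>0)\<close>. With cutoffs concentrated
  on a layer of thickness \<open>T\<close>, the two together show that the time average over the layer of the
  relative entropy \<open>\<ell>\<^sub>1(u) - \<ell>\<^sub>1(u\<^sub>0) - \<ell>\<^sub>1'(u\<^sub>0) (u - u\<^sub>0)\<close> tends to \<open>0\<close>, where \<open>\<ell>\<^sub>1'(u\<^sub>0)\<close> is approximated
  by polynomials to serve as a test function. Strict convexity turns this into the initial trace.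

  Uniqueness is Kruzhkov's argument. The variables are doubled in all of \<open>(x, t, y)\<close>, since the
  entropy inequalities hold only integrated over \<open>y\<close>; as \<open>\<rho>\<close> is merely bounded and measurable, this yields
  Kato's inequality with the weight \<open>\<rho>\<^sup>2\<close>, which vanishes exactly where \<open>\<rho>\<close> does. A cutoff to a backward
  cone finishes the proof: \<open>u\<close> stays in a compact subinterval of the interior of \<open>\<pi>\<^sub>1(closure D)\<close>, so
  \<open>\<bar>f(w) - f(u)\<bar> \<le> L \<bar>w - u\<bar>\<close> for every competitor \<open>w\<close>, even if \<open>w\<close> reaches the boundary.
\<close>

subsection \<open>Smooth functions\<close>

text \<open>Two obstacles shape the trace argument. (1) The entropy inequality in the definition of
  a weak solution of the full system is tested only with functions vanishing near t = 0 and only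
  with entropies on all of the closure of D, while the entropies of (A1) live on the closure of
  B_\<gamma>; and the trace of each U^\<epsilon> carries no rate uniform in \<epsilon>. For a
  classical viscous solution the balance of such an entropy keeps its term at t = 0; dissipation and
  viscous production have a sign and are dropped, so that 1/\<epsilon> disappears. (2) The
  coefficient l1'(u0) of the relative entropy depends on (x, y) and cannot be part of an entropy. So
  l1(u) - l1(u0) is controlled by the entropy inequality, and the part linear in u - u0 by the weak
  form, an equation that accepts multipliers of either sign. In the layer the time derivative of the
  cutoff has mass independent of T, whereas the cutoff itself has mass O(T): the flux terms vanish
  without any control of derivatives of u. In the uniqueness proof the mollifier is left
  unnormalized, since only the sign of a quantity continuous at 0 is read off.\<close>

lemma Ck_Suc_imp_Ck: "Ck (Suc k) g \<Longrightarrow> Ck k g"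
proof (induction k arbitrary: g)
  case 0
  then show ?case
    by (auto simp: continuous_on_eq_continuous_at differentiable_imp_continuous_within)
next
  case (Suc k)
  then show ?case by (metis Ck.simps(2))
qed

text \<open>\<open>Ck\<close> is phrased with \<open>frechet_derivative\<close>; a derivative on the
  whole space is unique, so any explicitly computed \<open>g'\<close> may stand in for it. The
  closure properties below rest on this rule.\<close>

lemma Ck_SucI:
  assumes "\<And>z. (g has_derivative g' z) (at z)" "\<And>b. b \<in> Basis \<Longrightarrow> Ck k (\<lambda>z. g' z b)"
  shows "Ck (Suc k) g"
proof -
  have "frechet_derivative g (at z) = g' z" for z
    using frechet_derivative_at[OF assms(1)] by simp
  then show ?thesis
    using assms by (auto simp: differentiable_def)
qed

lemma Ck_SucD:
  assumes "Ck (Suc k) g"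
  shows "(g has_derivative frechet_derivative g (at z)) (at z)"
    "b \<in> Basis \<Longrightarrow> Ck k (\<lambda>z. frechet_derivative g (at z) b)"
  using assms frechet_derivative_works by auto

lemma Ck_const: "Ck k (\<lambda>z. c)"
proof (induction k arbitrary: c)
  case (Suc k)
  show ?case by (rule Ck_SucI[where g' = "\<lambda>z h. 0"]) (auto intro: Suc)
qed auto

lemma Ck_bounded_linear: "bounded_linear L \<Longrightarrow> Ck k L"
proof (cases k)
  case 0
  then show "bounded_linear L \<Longrightarrow> Ck k L" by (simp add: linear_continuous_on)
next
  case (Suc m)
  assume "bounded_linear L"
  then show ?thesis unfolding Suc
    by (intro Ck_SucI[where g' = "\<lambda>z. L"]) (auto intro: Ck_const bounded_linear_imp_has_derivative)
qed

lemma Ck_add: "Ck k f \<Longrightarrow> Ck k g \<Longrightarrow> Ck k (\<lambda>z. f z + g z)"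
proof (induction k arbitrary: f g)
  case (Suc k)
  show ?case
    by (rule Ck_SucI[OF has_derivative_add[OF Ck_SucD(1)[OF Suc.prems(1)] Ck_SucD(1)[OF Suc.prems(2)]]])
       (intro Suc.IH Ck_SucD(2) Suc.prems)
qed (auto intro: continuous_intros)

text \<open>In the product rule one factor stays undifferentiated; \<open>Ck_Suc_imp_Ck\<close>
  demotes it from order k + 1 to k before the induction hypothesis applies.\<close>

lemma Ck_mult:
  fixes f g :: "'a::euclidean_space \<Rightarrow> real"
  shows "Ck k f \<Longrightarrow> Ck k g \<Longrightarrow> Ck k (\<lambda>z. f z * g z)"
proof (induction k arbitrary: f g)
  case (Suc k)
  show ?case
    by (rule Ck_SucI[OF has_derivative_mult[OF Ck_SucD(1)[OF Suc.prems(1)] Ck_SucD(1)[OF Suc.prems(2)]]])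
       (intro Ck_add Suc.IH Ck_SucD(2) Suc.prems Ck_Suc_imp_Ck[OF Suc.prems(1)] Ck_Suc_imp_Ck[OF Suc.prems(2)])
qed (auto intro: continuous_intros)

text \<open>The outer function has one real variable, so the chain rule gives f'(g z) times a
  derivative of g, a product of scalars within reach of \<open>Ck_mult\<close>. The induction
  generalises over f, because f' takes its place.\<close>

lemma Ck_compose:
  fixes f :: "real \<Rightarrow> real" and g :: "'a::euclidean_space \<Rightarrow> real"
  shows "Ck k f \<Longrightarrow> Ck k g \<Longrightarrow> Ck k (\<lambda>z. f (g z))"
proof (induction k arbitrary: f)
  case 0
  then show ?case by (auto intro: continuous_on_compose2)
next
  case (Suc k)
  have d: "((\<lambda>z. f (g z)) has_derivative
      (\<lambda>h. frechet_derivative f (at (g z)) 1 * frechet_derivative g (at z) h)) (at z)" for z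
  proof -
    have "frechet_derivative f (at (g z)) s = frechet_derivative f (at (g z)) 1 * s" for s
      using linear_scale[OF has_derivative_linear[OF Ck_SucD(1)[OF Suc.prems(1), of "g z"]], of s 1]
      by simp
    then have "frechet_derivative f (at (g z)) = (\<lambda>s. frechet_derivative f (at (g z)) 1 * s)"
      by (rule ext)
    then have "(f has_derivative (\<lambda>s. frechet_derivative f (at (g z)) 1 * s)) (at (g z))"
      using Ck_SucD(1)[OF Suc.prems(1), of "g z"] by metis
    from has_derivative_compose[OF Ck_SucD(1)[OF Suc.prems(2), of z] this] show ?thesis
      .
  qed
  have "Ck k (\<lambda>s. frechet_derivative f (at s) 1)"
    by (rule Ck_SucD(2)[OF Suc.prems(1)]) simp
  from Suc.IH[OF this Ck_Suc_imp_Ck[OF Suc.prems(2)]] show ?case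
    by (intro Ck_SucI[OF d] Ck_mult Ck_SucD(2)[OF Suc.prems(2)])
qed

lemma smooth_const: "smooth (\<lambda>z. c)"
  and smooth_bounded_linear: "bounded_linear L \<Longrightarrow> smooth L"
  and smooth_add: "smooth f \<Longrightarrow> smooth g \<Longrightarrow> smooth (\<lambda>z. f z + g z)"
  by (auto simp: smooth_def Ck_const Ck_bounded_linear Ck_add)

lemma smooth_mult:
  fixes f g :: "'a::euclidean_space \<Rightarrow> real"
  shows "smooth f \<Longrightarrow> smooth g \<Longrightarrow> smooth (\<lambda>z. f z * g z)"
  by (auto simp: smooth_def Ck_mult)

lemma smooth_diff:
  fixes f g :: "'a::euclidean_space \<Rightarrow> real"
  assumes "smooth f" "smooth g"
  shows "smooth (\<lambda>z. f z - g z)"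
  using smooth_add[OF assms(1) smooth_mult[OF smooth_const[of "-1"] assms(2)]] by simp

lemma smooth_compose:
  fixes f :: "real \<Rightarrow> real" and g :: "'a::euclidean_space \<Rightarrow> real"
  shows "smooth f \<Longrightarrow> smooth g \<Longrightarrow> smooth (\<lambda>z. f (g z))"
  by (auto simp: smooth_def Ck_compose)

lemma smooth_has_derivative: "smooth g \<Longrightarrow> (g has_derivative frechet_derivative g (at z)) (at z)"
  by (rule Ck_SucD(1)[of 0]) (simp add: smooth_def del: Ck.simps)

lemma smooth_imp_continuous_on: "smooth g \<Longrightarrow> continuous_on S g"
  by (metis Ck.simps(1) continuous_on_subset smooth_def subset_UNIV)

lemma smooth_sum:
  fixes f :: "'i \<Rightarrow> 'a::euclidean_space \<Rightarrow> real"
  assumes "\<And>i. i \<in> A \<Longrightarrow> smooth (f i)"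
  shows "smooth (\<lambda>z. \<Sum>i\<in>A. f i z)"
  using assms by (induction A rule: infinite_finite_induct) (auto intro: smooth_const smooth_add)

lemma smooth_inner_self: "smooth (\<lambda>z::'a::euclidean_space. z \<bullet> z)"
proof -
  have "(\<lambda>z::'a. z \<bullet> z) = (\<lambda>z. \<Sum>b\<in>Basis. (z \<bullet> b) * (z \<bullet> b))"
    by (subst euclidean_inner) (rule refl)
  moreover have "smooth (\<lambda>z::'a. \<Sum>b\<in>Basis. (z \<bullet> b) * (z \<bullet> b))"
    by (rule smooth_sum, rule smooth_mult)
       (rule smooth_bounded_linear, rule bounded_linear_inner_left)+
  ultimately show ?thesis by simp
qed

lemma smooth_real_polynomial_function:
  fixes p :: "'a::euclidean_space \<Rightarrow> real"
  shows "real_polynomial_function p \<Longrightarrow> smooth p"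
  by (induction rule: real_polynomial_function.induct)
     (auto intro: smooth_bounded_linear smooth_const smooth_add smooth_mult)

text \<open>Differentiating in direction b yields the derivative of g in direction L b, which need
  not be a basis vector; expanding L b in the basis leaves a finite combination of basis
  derivatives. The uses are the reading of a function of (x, y) as a function of (x, t, y) and the
  translation of a mollifier.\<close>

lemma smooth_compose_affine:
  fixes g :: "'b::euclidean_space \<Rightarrow> real" and L :: "'a::euclidean_space \<Rightarrow> 'b"
  assumes "smooth g" "bounded_linear L"
  shows "smooth (\<lambda>z. g (L z + c))"
proof -
  have L: "linear L" using assms(2) by (simp add: bounded_linear.linear)
  have "Ck k g \<Longrightarrow> Ck k (\<lambda>z. g (L z + c))" for k
  proof (induction k arbitrary: g)
    case 0
    then have "continuous_on UNIV g" by simp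
    then have "continuous_on UNIV (\<lambda>z. g (L z + c))"
      by (rule continuous_on_compose2)
         (auto intro!: continuous_on_add[OF linear_continuous_on[OF assms(2)]] continuous_on_const)
    then show ?case by simp
  next
    case (Suc k)
    have d: "((\<lambda>z. g (L z + c)) has_derivative
        (\<lambda>h. frechet_derivative g (at (L z + c)) (L h))) (at z)" for z
    proof (rule has_derivative_compose[OF _ Ck_SucD(1)[OF Suc.prems], of "\<lambda>z. L z + c" "\<lambda>h. L h"])
      show "((\<lambda>z. L z + c) has_derivative L) (at z)"
        using has_derivative_add[OF bounded_linear_imp_has_derivative[OF assms(2)] has_derivative_const]
        by simp
    qed
    show ?case
    proof (rule Ck_SucI[OF d])
      fix b :: 'a
      have "frechet_derivative g (at w) (L b) =
          (\<Sum>i\<in>Basis. (L b \<bullet> i) * frechet_derivative g (at w) i)" for w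
        using linear_sum[OF has_derivative_linear[OF Ck_SucD(1)[OF Suc.prems, of w]],
            of "\<lambda>i. (L b \<bullet> i) *\<^sub>R i" Basis]
          linear_scale[OF has_derivative_linear[OF Ck_SucD(1)[OF Suc.prems, of w]]]
        by (simp add: euclidean_representation)
      moreover have "Ck k (\<lambda>z. \<Sum>i\<in>A. (L b \<bullet> i) * frechet_derivative g (at (L z + c)) i)"
        if "A \<subseteq> Basis" for A
        using finite_subset[OF that finite_Basis] that
      proof (induction A rule: finite_induct)
        case (insert i A)
        have "Ck k (\<lambda>z. (L b \<bullet> i) * frechet_derivative g (at (L z + c)) i)"
          using insert.prems by (intro Ck_mult Ck_const Suc.IH Ck_SucD(2) Suc.prems) auto
        with insert show ?case by (simp add: Ck_add)
      qed (simp add: Ck_const)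
      ultimately show "Ck k (\<lambda>z. frechet_derivative g (at (L z + c)) (L b))"
        by simp
    qed
  qed
  with assms(1) show ?thesis by (auto simp: smooth_def)
qed

section \<open>Flat functions and smooth cutoffs\<close>

text \<open>The functions x^(-k) exp(-1/x), extended by 0, are closed under differentiation up to
  linear combinations: the derivative of member k is member k + 2 minus k times member k + 1. One
  induction then makes all of them smooth. The cutoffs are built from member 0, whose derivative is
  member 2.\<close>

definition flat_exp :: "nat \<Rightarrow> real \<Rightarrow> real" where
  "flat_exp k x = (if x > 0 then inverse x ^ k * exp (- inverse x) else 0)"

abbreviation bump :: "real \<Rightarrow> real" where
  "bump \<equiv> flat_exp 0"

lemma flat_exp_nonneg: "0 \<le> flat_exp k x"
  by (simp add: flat_exp_def)

lemma flat_exp_pos: "0 < x \<Longrightarrow> 0 < flat_exp k x"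
  by (simp add: flat_exp_def)

lemma flat_exp_eq_0: "x \<le> 0 \<Longrightarrow> flat_exp k x = 0"
  by (simp add: flat_exp_def)

lemma bump_less_1: "bump x < 1"
  by (simp add: flat_exp_def)

lemma flat_exp_tendsto_0: "(flat_exp k \<longlongrightarrow> 0) (at 0)"
proof -
  have "((\<lambda>x. (\<lambda>y. y ^ k / exp y) (inverse x)) \<longlongrightarrow> (0::real)) (at_right 0)"
    by (rule filterlim_compose[OF tendsto_power_div_exp_0 filterlim_inverse_at_top_right])
  moreover have "\<forall>\<^sub>F x in at_right 0. inverse x ^ k / exp (inverse x) = flat_exp k x"
    using eventually_at_right_less[of 0]
    by eventually_elim (simp add: flat_exp_def exp_minus divide_inverse)
  ultimately have r: "(flat_exp k \<longlongrightarrow> 0) (at_right 0)"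
    by (blast intro: Lim_transform_eventually)
  have "\<forall>\<^sub>F x::real in at_left 0. 0 = flat_exp k x"
    by (auto simp: eventually_at_left_field flat_exp_def intro!: exI[of _ "-1"])
  then have "(flat_exp k \<longlongrightarrow> 0) (at_left 0)"
    using tendsto_const[of 0 "at_left (0::real)"] by (blast intro: Lim_transform_eventually)
  with r show ?thesis by (simp add: filterlim_at_split)
qed

lemma flat_exp_has_derivative:
  "(flat_exp k has_real_derivative flat_exp (k + 2) x - real k * flat_exp (k + 1) x) (at x)"
proof -
  consider "x > 0" | "x < 0" | "x = 0" by linarith
  then show ?thesis
  proof cases
    case 1
    have d1: "((\<lambda>x. inverse x ^ k) has_real_derivative - real k * inverse x ^ (k + 1)) (at x)"
      using DERIV_power[OF DERIV_inverse[of x], of k] 1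
      by (cases k) (auto simp: power2_eq_square algebra_simps)
    have d2: "((\<lambda>x. exp (- inverse x)) has_real_derivative inverse x ^ 2 * exp (- inverse x)) (at x)"
      using 1 by (auto intro!: derivative_eq_intros simp: power2_eq_square)
    have "((\<lambda>x. inverse x ^ k * exp (- inverse x)) has_real_derivative
        flat_exp (k + 2) x - real k * flat_exp (k + 1) x) (at x)"
      using DERIV_mult[OF d1 d2] 1 by (simp add: flat_exp_def power2_eq_square algebra_simps)
    then show ?thesis
      by (rule has_field_derivative_transform_within_open[where S = "{0<..}"])
         (use 1 in \<open>auto simp: flat_exp_def\<close>)
  next
    case 2
    have "((\<lambda>x::real. 0::real) has_real_derivative flat_exp (k + 2) x - real k * flat_exp (k + 1) x) (at x)"
      using 2 by (auto simp: flat_exp_eq_0)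
    then show ?thesis
      by (rule has_field_derivative_transform_within_open[where S = "{..<0}"])
         (use 2 in \<open>auto simp: flat_exp_def\<close>)
  next
    case 3
    \<comment> \<open>The difference quotient at 0 is the next member of the family, whose limit at
      0 is already known.\<close>
    have "(flat_exp k x - flat_exp k 0) / (x - 0) = flat_exp (k + 1) x" for x
      by (simp add: flat_exp_def divide_inverse)
    then have "(flat_exp k has_real_derivative 0) (at 0)"
      using flat_exp_tendsto_0[of "k + 1"] by (simp add: has_field_derivative_iff)
    then show ?thesis using 3 by (simp add: flat_exp_eq_0)
  qed
qed

lemma bump_has_derivative: "(bump has_real_derivative flat_exp 2 x) (at x)"
  using flat_exp_has_derivative[of 0 x] by (simp add: numeral_2_eq_2)

lemma smooth_flat_exp: "smooth (flat_exp k)"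
  unfolding smooth_def
proof
  fix m show "Ck m (flat_exp k)"
  proof (induction m arbitrary: k)
    case 0
    then show ?case
      using DERIV_isCont[OF flat_exp_has_derivative[of k]] by (simp add: continuous_on_eq_continuous_at)
  next
    case (Suc m)
    have "Ck m (\<lambda>x. flat_exp (k + 2) x + (- real k) * flat_exp (k + 1) x)"
      by (intro Ck_add Ck_mult Ck_const Suc)
    then show ?case
      using flat_exp_has_derivative
      by (intro Ck_SucI[where g' = "\<lambda>x h. (flat_exp (k + 2) x - real k * flat_exp (k + 1) x) * h"])
         (auto simp: has_field_derivative_def)
  qed
qed

lemma bump_mono: "x \<le> y \<Longrightarrow> bump x \<le> bump y"
  by (auto simp: flat_exp_def le_imp_inverse_le)

lemma continuous_flat_exp: "continuous_on S (flat_exp k)"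
  by (rule smooth_imp_continuous_on[OF smooth_flat_exp])

lemma has_derivative_bump_compose [derivative_intros]:
  assumes "(g has_derivative g') (at z)"
  shows "((\<lambda>z. bump (g z)) has_derivative (\<lambda>h. g' h * flat_exp 2 (g z))) (at z)"
  using has_derivative_compose[OF assms bump_has_derivative[of "g z", unfolded has_field_derivative_def]]
  by (simp add: mult.commute)

lemma borel_measurable_flat_exp [measurable]: "flat_exp k \<in> borel_measurable borel"
  by (rule borel_measurable_continuous_onI[OF continuous_flat_exp])

text \<open>A smooth switch from \<open>0\<close> (on \<open>s \<le> 1\<close>) to a positive constant (on \<open>s \<ge> 2\<close>).\<close>

definition ramp :: "real \<Rightarrow> real" where
  "ramp s = bump (exp (- 1) - bump (2 - s))"

definition ramp' :: "real \<Rightarrow> real" where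
  "ramp' s = flat_exp 2 (exp (- 1) - bump (2 - s)) * flat_exp 2 (2 - s)"

text \<open>For s \<le> 1 the inner bump is at least exp(-1), its value at 1, so the outer argument
  is not positive. For s \<ge> 2 the inner bump is 0 and the plateau value is
  \<open>bump (exp (- 1))\<close>. The step profile thus arises by composition, without integrating
  a bump.\<close>

lemma ramp_eq_0: "s \<le> 1 \<Longrightarrow> ramp s = 0"
  unfolding ramp_def using bump_mono[of 1 "2 - s"] by (intro flat_exp_eq_0) (simp add: flat_exp_def)

lemma ramp_const: "2 \<le> s \<Longrightarrow> ramp s = bump (exp (- 1))"
  by (simp add: ramp_def flat_exp_eq_0)

lemma ramp'_eq_0: "s \<le> 1 \<or> 2 \<le> s \<Longrightarrow> ramp' s = 0"
  unfolding ramp'_def using bump_mono[of 1 "2 - s"]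
  by (auto intro!: flat_exp_eq_0 simp: flat_exp_def)

lemma ramp'_nonneg: "0 \<le> ramp' s"
  by (simp add: ramp'_def flat_exp_nonneg)

lemma ramp_nonneg: "0 \<le> ramp s" and ramp_less_1: "ramp s < 1"
  by (simp_all add: ramp_def flat_exp_nonneg bump_less_1)

lemma smooth_ramp: "smooth ramp"
proof -
  have "smooth (\<lambda>s::real. 2 - s)"
    by (intro smooth_diff smooth_const smooth_bounded_linear bounded_linear_ident)
  then have "smooth (\<lambda>s. exp (- 1) - bump (2 - s))"
    by (rule smooth_diff[OF smooth_const smooth_compose[OF smooth_flat_exp]])
  then show ?thesis unfolding ramp_def[abs_def] by (intro smooth_compose[OF smooth_flat_exp])
qed

lemma has_derivative_ramp_compose [derivative_intros]:
  assumes "(g has_derivative g') (at z)"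
  shows "((\<lambda>z. ramp (g z)) has_derivative (\<lambda>h. g' h * ramp' (g z))) (at z)"
  unfolding ramp_def ramp'_def
  by (auto intro!: derivative_eq_intros assms)

lemma continuous_ramp': "continuous_on S ramp'"
proof -
  have "continuous_on S (\<lambda>s. bump (2 - s))" "continuous_on S (\<lambda>s. flat_exp 2 (2 - s))"
    by (rule continuous_on_compose2[OF continuous_flat_exp[of UNIV]]; auto intro!: continuous_intros)+
  then show ?thesis
    unfolding ramp'_def[abs_def]
    by (intro continuous_on_mult continuous_on_compose2[OF continuous_flat_exp[of UNIV]] continuous_on_diff
        continuous_on_const) auto
qed

lemma ramp'_bounded: obtains M where "0 < M" "\<And>s. ramp' s \<le> M"
proof -
  have "bounded (ramp' ` {1..2})"
    by (intro compact_imp_bounded compact_continuous_image continuous_ramp') auto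
  then obtain M where M: "0 < M" "\<And>s. s \<in> {1..2} \<Longrightarrow> \<bar>ramp' s\<bar> \<le> M"
    by (force simp: bounded_pos)
  have "ramp' s \<le> M" for s
    using M(1) M(2)[of s] ramp'_eq_0[of s] by (cases "s \<in> {1..2}") auto
  with M(1) show ?thesis by (rule that)
qed


subsection \<open>Lebesgue integration\<close>

text \<open>Completed Lebesgue measure on a product is not the product of the completed measures, so
  Fubini and translation arguments are carried out for Borel functions under \<open>lborel\<close>;
  this lemma is the way there.\<close>

lemma borel_representative:
  fixes g :: "'a::euclidean_space \<Rightarrow> real"
  assumes g: "g \<in> borel_measurable (lebesgue_on S)" and S: "S \<in> sets lebesgue"
  obtains g' where "g' \<in> borel_measurable borel" "AE z in lebesgue_on S. g z = g' z"
proof -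
  have "(\<lambda>z. if z \<in> S then g z else 0) \<in> borel_measurable lebesgue"
    by (rule borel_measurable_if_I[OF g S])
  from completion_ex_borel_measurable_real[OF this] obtain g' where
    g': "g' \<in> borel_measurable lborel" "AE z in lborel. (if z \<in> S then g z else 0) = g' z"
    by blast
  have "AE z in lebesgue. (if z \<in> S then g z else 0) = g' z"
    using g'(2) by (rule AE_completion)
  then have "AE z in lebesgue_on S. g z = g' z"
    using S by (auto simp: AE_restrict_space_iff elim!: eventually_mono)
  with g'(1) show ?thesis by (auto intro: that)
qed

lemma AE_lborel_prod_swap:
  fixes Q :: "'a::euclidean_space \<times> 'b::euclidean_space \<Rightarrow> bool"
  assumes "AE z in lborel. Q z"
  shows "AE y in lborel. AE x in lborel. Q (x, y)"
proof -
  from AE_E3[OF assms] obtain N where N: "\<And>z. z \<notin> N \<Longrightarrow> Q z" "N \<in> null_sets lborel"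
    by auto
  have "AE z in lborel \<Otimes>\<^sub>M lborel. z \<notin> N"
    using AE_not_in[OF N(2)] unfolding lborel_prod .
  then have "AE x in lborel. AE y in lborel. (x, y) \<notin> N"
    by (rule lborel_pair.AE_pair)
  moreover have "{z \<in> space (lborel \<Otimes>\<^sub>M lborel). (fst z, snd z) \<notin> N} \<in> sets (lborel \<Otimes>\<^sub>M lborel)"
    unfolding lborel_prod using N(2) by (auto simp: null_sets_def Compl_eq[symmetric])
  ultimately have "AE y in lborel. AE x in lborel. (x, y) \<notin> N"
    using lborel_pair.AE_commute[of "\<lambda>x y. (x, y) \<notin> N"] by simp
  then show ?thesis by (rule eventually_mono) (auto elim!: eventually_mono intro: N(1))
qed

text \<open>Integration over the first coordinate is innermost. A Borel representative satisfies
  Fubini's theorem for \<open>lborel\<close>, and for almost every y its section agrees almost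
  everywhere with the section of g, so the statement carries over to the completion.\<close>

lemma lebesgue_Fubini_snd:
  fixes g :: "'a::euclidean_space \<times> 'b::euclidean_space \<Rightarrow> real"
  assumes g: "integrable lebesgue g"
  shows "AE y in lebesgue. integrable lebesgue (\<lambda>x. g (x, y))" (is ?A)
    and "integrable lebesgue (\<lambda>y. LINT x|lebesgue. g (x, y))" (is ?B)
    and "(LINT y|lebesgue. LINT x|lebesgue. g (x, y)) = integral\<^sup>L lebesgue g" (is ?C)
proof -
  from completion_ex_borel_measurable_real[of g lborel] g obtain g' where
    g': "g' \<in> borel_measurable lborel" "AE z in lborel. g z = g' z"
    by (auto simp: borel_measurable_integrable)
  have ae: "AE z in lebesgue. g z = g' z" using g'(2) by (rule AE_completion)
  have g'c: "g' \<in> borel_measurable lebesgue" using g'(1) by (rule measurable_completion)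
  have int': "integrable lebesgue g'"
    using g ae g'c by (subst integrable_cong_AE[of _ _ g]) (auto elim: eventually_mono)
  then have "integrable lborel g'" using g'(1) by (simp add: integrable_completion)
  then have i2: "integrable (lborel \<Otimes>\<^sub>M lborel) (case_prod (\<lambda>x y. g' (x, y)))"
    by (simp add: lborel_prod)
  note ae2 = AE_lborel_prod_swap[OF g'(2)]
  have sec: "AE y in lborel. integrable lebesgue (\<lambda>x. g (x, y)) \<and>
      (LINT x|lebesgue. g (x, y)) = (LINT x|lborel. g' (x, y))"
    using lborel_pair.AE_integrable_snd[OF i2] ae2
  proof eventually_elim
    case (elim y)
    have m: "(\<lambda>x. g' (x, y)) \<in> borel_measurable lborel" using elim(1) by auto
    then have m': "(\<lambda>x. g' (x, y)) \<in> borel_measurable lebesgue" by (rule measurable_completion)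
    have a: "AE x in lebesgue. g (x, y) = g' (x, y)" using elim(2) by (rule AE_completion)
    have mg: "(\<lambda>x. g (x, y)) \<in> borel_measurable lebesgue"
      by (rule borel_measurable_AE[OF m']) (use a in \<open>auto elim: eventually_mono\<close>)
    have "integrable lebesgue (\<lambda>x. g (x, y))"
      using elim(1) m a by (subst integrable_cong_AE[OF mg m' a]) (simp add: integrable_completion)
    moreover have "(LINT x|lebesgue. g (x, y)) = (LINT x|lborel. g' (x, y))"
      by (subst integral_cong_AE[OF mg m' a]) (rule integral_completion[OF m])
    ultimately show ?case by simp
  qed
  then show ?A by (intro AE_completion) (auto elim: eventually_mono)
  have m0: "(\<lambda>y. LINT x|lborel. g' (x, y)) \<in> borel_measurable lborel"
    using lborel_pair.integrable_snd[OF i2] by auto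
  then have m1: "(\<lambda>y. LINT x|lborel. g' (x, y)) \<in> borel_measurable lebesgue"
    by (rule measurable_completion)
  have a1: "AE y in lebesgue. (LINT x|lborel. g' (x, y)) = (LINT x|lebesgue. g (x, y))"
    using sec by (intro AE_completion) (auto elim: eventually_mono)
  have m2: "(\<lambda>y. LINT x|lebesgue. g (x, y)) \<in> borel_measurable lebesgue"
    by (rule borel_measurable_AE[OF m1 a1])
  show ?B
    using lborel_pair.integrable_snd[OF i2] m0
    by (subst integrable_cong_AE[OF m2 m1]) (use a1 in \<open>auto simp: integrable_completion elim: eventually_mono\<close>)
  have "(LINT y|lebesgue. LINT x|lebesgue. g (x, y)) = (LINT y|lebesgue. LINT x|lborel. g' (x, y))"
    by (rule integral_cong_AE[OF m2 m1]) (use a1 in \<open>auto elim: eventually_mono\<close>)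
  also have "\<dots> = (LINT y|lborel. LINT x|lborel. g' (x, y))"
    by (rule integral_completion[OF m0])
  also have "\<dots> = integral\<^sup>L lborel g'"
    using lborel_pair.integral_snd[OF i2] by (simp add: lborel_prod)
  also have "\<dots> = integral\<^sup>L lebesgue g'" by (rule integral_completion[symmetric, OF g'(1)])
  also have "\<dots> = integral\<^sup>L lebesgue g"
    by (rule integral_cong_AE) (use g ae g'c in \<open>auto elim: eventually_mono\<close>)
  finally show ?C .
qed

text \<open>A null set of points (x, y) remains null as a cylinder of points (x, t, y). In this way
  statements about the initial data, which hold almost everywhere in (x, y), become available in
  space-time.\<close>

lemma AE_lborel_insert_middle:
  fixes Q :: "'a::euclidean_space \<times> 'c::euclidean_space \<Rightarrow> bool"
  assumes "AE p in lborel. Q p"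
  shows "AE z in (lborel :: ('a \<times> 'b::euclidean_space \<times> 'c) measure). Q (fst z, snd (snd z))"
proof -
  from AE_E3[OF assms] obtain N where N: "\<And>z. z \<notin> N \<Longrightarrow> Q z" "N \<in> null_sets lborel"
    by auto
  then have [measurable]: "N \<in> sets borel" by (auto simp: null_sets_def)
  have "Measurable.pred borel (\<lambda>z::'a \<times> 'b \<times> 'c. (fst z, snd (snd z)) \<notin> N)"
    "Measurable.pred borel (\<lambda>z::'b \<times> 'c. (x, snd z) \<notin> N)" for x
    unfolding borel_prod[symmetric] by measurable
  then have sets: "{z::'a \<times> 'b \<times> 'c. (fst z, snd (snd z)) \<notin> N} \<in> sets borel"
    "{z::'b \<times> 'c. (x, snd z) \<notin> N} \<in> sets borel" for x
    by (auto simp: pred_def)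
  have "AE z in lborel \<Otimes>\<^sub>M lborel. z \<notin> N"
    using AE_not_in[OF N(2)] unfolding lborel_prod .
  then have "AE x in lborel. AE y in lborel. (x, y) \<notin> N"
    by (rule lborel_pair.AE_pair)
  then have "AE x in lborel. AE p in (lborel :: ('b \<times> 'c) measure). (x, snd p) \<notin> N"
  proof eventually_elim
    case (elim x)
    have "AE p in (lborel :: 'b measure) \<Otimes>\<^sub>M lborel. (x, snd p) \<notin> N"
    proof (rule lborel_pair.AE_pair_measure)
      show "{p \<in> space ((lborel :: 'b measure) \<Otimes>\<^sub>M lborel). (x, snd p) \<notin> N} \<in> sets (lborel \<Otimes>\<^sub>M lborel)"
        unfolding lborel_prod using sets by simp
    qed (use elim in simp)
    then show ?case unfolding lborel_prod .
  qed
  then have "AE z in (lborel :: 'a measure) \<Otimes>\<^sub>M (lborel :: ('b \<times> 'c) measure). (fst z, snd (snd z)) \<notin> N"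
  proof (intro lborel_pair.AE_pair_measure)
    show "{z \<in> space ((lborel :: 'a measure) \<Otimes>\<^sub>M (lborel :: ('b \<times> 'c) measure)). (fst z, snd (snd z)) \<notin> N}
        \<in> sets (lborel \<Otimes>\<^sub>M lborel)"
      unfolding lborel_prod using sets by simp
  qed simp
  then show ?thesis
    unfolding lborel_prod by (rule eventually_mono) (rule N(1))
qed

text \<open>A function of t times a function of (x, y) is a product although the coordinates
  interleave. Fubini is applied twice: for fixed x the factor k(t) splits from b(x, .), and the
  result is then integrated in x.\<close>

lemma lborel_integral_insert_middle:
  fixes k :: "'b::euclidean_space \<Rightarrow> real" and b :: "'a::euclidean_space \<times> 'c::euclidean_space \<Rightarrow> real"
  assumes k: "integrable lborel k" and b: "integrable lborel b"
  shows "integrable lborel (\<lambda>z::'a \<times> 'b \<times> 'c. k (fst (snd z)) * b (fst z, snd (snd z)))" (is ?A)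
    and "(LINT z|lborel. k (fst (snd z)) * b (fst z, snd (snd z)) :: real) =
      (LINT t|lborel. k t) * (LINT p|lborel. b p)" (is ?B)
proof -
  have [measurable]: "k \<in> borel_measurable borel" "b \<in> borel_measurable borel"
    using borel_measurable_integrable[OF k] borel_measurable_integrable[OF b] by simp_all
  let ?G = "\<lambda>z::'a \<times> 'b \<times> 'c. k (fst (snd z)) * b (fst z, snd (snd z))"
  have Gm: "?G \<in> borel_measurable (borel \<Otimes>\<^sub>M (borel \<Otimes>\<^sub>M borel))" by measurable
  then have Gm': "?G \<in> borel_measurable borel" by (simp add: borel_prod)
  have b2: "integrable (lborel \<Otimes>\<^sub>M lborel) b" using b by (simp add: lborel_prod)
  have bx: "AE x in lborel. integrable lborel (\<lambda>y. b (x, y))"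
    using lborel_pair.AE_integrable_fst'[OF b2] .
  have prod: "integrable (lborel \<Otimes>\<^sub>M lborel) (\<lambda>p::'b \<times> 'c. k (fst p) * h (snd p)) \<and>
      (LINT p|(lborel \<Otimes>\<^sub>M lborel). k (fst p) * h (snd p)) = (LINT t|lborel. k t) * (LINT y|lborel. h y)"
    if h: "integrable lborel h" for h :: "'c \<Rightarrow> real"
  proof -
    have [measurable]: "h \<in> borel_measurable borel" using borel_measurable_integrable[OF h] by simp
    have "integrable (lborel \<Otimes>\<^sub>M lborel) (\<lambda>p::'b \<times> 'c. k (fst p) * h (snd p))"
      by (rule lborel_pair.Fubini_integrable) (use k h in \<open>auto simp: abs_mult\<close>)
    then show ?thesis
      using lborel_pair.integral_fst'[of "\<lambda>p::'b \<times> 'c. k (fst p) * h (snd p)"] by simp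
  qed
  have inner: "AE x in lborel. integrable lborel (\<lambda>p. ?G (x, p)) \<and>
     (LINT p|lborel. ?G (x, p)) = (LINT t|lborel. k t) * (LINT y|lborel. b (x, y)) \<and>
     (LINT p|lborel. norm (?G (x, p))) \<le> (LINT t|lborel. \<bar>k t\<bar>) * (LINT y|lborel. \<bar>b (x, y)\<bar>)"
    using bx
  proof eventually_elim
    case (elim x)
    have "integrable lborel (\<lambda>y. \<bar>b (x, y)\<bar>)" using elim by simp
    have "(LINT p|lborel. norm (?G (x, p))) = (LINT t|lborel. \<bar>k t\<bar>) * (LINT y|lborel. \<bar>b (x, y)\<bar>)"
    proof -
      have "integrable (lborel \<Otimes>\<^sub>M lborel) (\<lambda>p::'b \<times> 'c. \<bar>k (fst p)\<bar> * \<bar>b (x, snd p)\<bar>)"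
        using conjunct1[OF prod[OF elim], THEN integrable_abs] by (simp add: abs_mult)
      from lborel_pair.integral_fst'[OF this] show ?thesis
        by (simp add: abs_mult lborel_prod)
    qed
    with prod[OF elim] show ?case by (simp add: lborel_prod)
  qed
  have "integrable ((lborel :: 'a measure) \<Otimes>\<^sub>M (lborel :: ('b \<times> 'c) measure)) ?G"
  proof (rule lborel_pair.Fubini_integrable)
    have "integrable lborel (\<lambda>x. (LINT t|lborel. \<bar>k t\<bar>) * (LINT y|lborel. \<bar>b (x, y)\<bar>))"
      using lborel_pair.integrable_fst'[OF integrable_abs[OF b2]] by simp
    then show "integrable lborel (\<lambda>x. LINT y|lborel. norm (?G (x, y)))"
    proof (rule Bochner_Integration.integrable_bound)
      show "(\<lambda>x. LINT y|lborel. norm (?G (x, y))) \<in> borel_measurable lborel"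
        using Gm unfolding borel_prod
        by (intro lborel.borel_measurable_lebesgue_integral) (simp add: lborel_prod split_beta')
      show "AE x in lborel. norm (LINT y|lborel. norm (?G (x, y)))
         \<le> norm ((LINT t|lborel. \<bar>k t\<bar>) * (LINT y|lborel. \<bar>b (x, y)\<bar>))"
        using inner by eventually_elim (auto simp: integral_nonneg_AE)
    qed
    show "AE x in lborel. integrable lborel (\<lambda>y. ?G (x, y))" using inner by eventually_elim simp
    show "?G \<in> borel_measurable (lborel \<Otimes>\<^sub>M lborel)" using Gm' by (simp add: lborel_prod)
  qed
  then show ?A by (simp add: lborel_prod)
  from lborel_pair.integral_fst'[OF \<open>integrable (lborel \<Otimes>\<^sub>M lborel) ?G\<close>]
  have "(LINT z|lborel. ?G z) = (LINT x|lborel. LINT p|lborel. ?G (x, p))"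
    by (simp add: lborel_prod)
  also have "\<dots> = (LINT x|lborel. (LINT t|lborel. k t) * (LINT y|lborel. b (x, y)))"
  proof (rule integral_cong_AE)
    show "(\<lambda>x. LINT p|lborel. ?G (x, p)) \<in> borel_measurable lborel"
      using Gm unfolding borel_prod
      by (intro lborel.borel_measurable_lebesgue_integral) (simp add: lborel_prod split_beta')
    show "(\<lambda>x. (LINT t|lborel. k t) * (LINT y|lborel. b (x, y))) \<in> borel_measurable lborel"
      by measurable
    show "AE x in lborel. (LINT p|lborel. ?G (x, p)) = (LINT t|lborel. k t) * (LINT y|lborel. b (x, y))"
      using inner by eventually_elim simp
  qed
  also have "\<dots> = (LINT t|lborel. k t) * (LINT p|lborel. b p)"
    using lborel_pair.integral_fst'[OF b2] by (simp add: lborel_prod)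
  finally show ?B .
qed

section \<open>Almost everywhere subsequences, approximation and translation in L^1\<close>

text \<open>A diagonal choice makes the weighted error on the k-th compact set less than 2^(-k); on
  each fixed compact set the errors are then summable, hence tend to 0 at almost every point.
  Dividing by the weight restricts the conclusion to the points where w does not vanish.\<close>

lemma AE_subseq_of_tendsto_Lp_loc:
  fixes G :: "nat \<Rightarrow> 'a::euclidean_space \<Rightarrow> 'b::euclidean_space"
  assumes lim: "tendsto_Lp_loc 1 w S G g sequentially"
    and G: "\<And>i. G i \<in> borel_measurable (lebesgue_on S)" and g: "g \<in> borel_measurable (lebesgue_on S)"
    and w: "w \<in> borel_measurable (lebesgue_on S)" "\<And>z. z \<in> S \<Longrightarrow> 0 \<le> w z"
    and C: "\<And>j::nat. compact (C j)" "\<And>i j. i \<le> j \<Longrightarrow> C i \<subseteq> C j" "S = (\<Union>j. C j)"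
  obtains \<tau> where "strict_mono \<tau>"
    "AE z in lebesgue_on S. w z \<noteq> 0 \<longrightarrow> (\<lambda>k. G (\<tau> k) z) \<longlonglongrightarrow> g z"
proof -
  define a where "a i j = (\<integral>\<^sup>+ z. ennreal (norm (G i z - g z) powr 1 * w z) \<partial>lebesgue_on (C j))" for i j
  have CS: "C j \<subseteq> S" for j using C(3) by auto
  have Cm: "C j \<in> sets lebesgue" for j using C(1) by (simp add: lmeasurable_compact fmeasurableD)
  have S: "S \<in> sets lebesgue" unfolding C(3) using Cm by auto
  have "(\<lambda>i. a i j) \<longlonglongrightarrow> 0" for j
    using lim C(1) CS unfolding tendsto_Lp_loc_def a_def by auto
  then have "\<exists>N. \<forall>i\<ge>N. a i j < ennreal ((1/2) ^ j)" for j
    using order_tendstoD(2)[of "\<lambda>i. a i j" 0 sequentially "ennreal ((1/2) ^ j)"]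
    by (auto simp: eventually_sequentially)
  then obtain N where N: "\<And>j i. N j \<le> i \<Longrightarrow> a i j < ennreal ((1/2) ^ j)" by metis
  \<comment> \<open>The maximum serves two purposes: the indices increase strictly, and the k-th one
    is at least N k.\<close>
  define \<tau> where "\<tau> = rec_nat (N 0) (\<lambda>k m. max (Suc m) (N (Suc k)))"
  have \<tau>_Suc: "\<tau> (Suc k) = max (Suc (\<tau> k)) (N (Suc k))" and \<tau>_0: "\<tau> 0 = N 0" for k
    by (simp_all add: \<tau>_def)
  have "strict_mono \<tau>" by (rule strict_monoI_Suc) (simp add: \<tau>_Suc)
  have "N k \<le> \<tau> k" for k by (cases k) (simp_all add: \<tau>_Suc \<tau>_0)
  then have small: "a (\<tau> k) k < ennreal ((1/2) ^ k)" for k by (rule N)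
  have Gm: "(\<lambda>z. norm (G i z - g z) powr 1 * w z) \<in> borel_measurable (lebesgue_on (C j))" for i j
  proof -
    have "(\<lambda>z. norm (G i z - g z) powr 1 * w z) \<in> borel_measurable (lebesgue_on S)"
      using G g w by measurable
    then show ?thesis by (rule measurable_restrict_mono[OF _ CS])
  qed
  have AEj: "AE z in lebesgue_on (C j). w z \<noteq> 0 \<longrightarrow> (\<lambda>k. G (\<tau> k) z) \<longlonglongrightarrow> g z" for j
  proof -
    \<comment> \<open>Starting at index j puts the fixed set C j inside C (k + j), where the error
      is below 2^(-(k + j)).\<close>
    let ?d = "\<lambda>k z. norm (G (\<tau> (k + j)) z - g z) powr 1 * w z"
    have "a (\<tau> (k + j)) j \<le> a (\<tau> (k + j)) (k + j)" for k
    proof -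
      have "C j \<subseteq> C (k + j)" by (rule C(2)) simp
      then show ?thesis unfolding a_def
        using Cm by (subst (1 2) nn_integral_restrict_space)
          (auto intro!: nn_integral_mono split: split_indicator)
    qed
    then have "a (\<tau> (k + j)) j \<le> ennreal ((1/2) ^ k)" for k
      using small[of "k + j"] order.strict_implies_order[OF order.strict_trans1]
      by (smt (verit, best) ennreal_leI less_le_trans linorder_not_le nle_le order.trans power_decreasing le_add1 zero_le_divide_1_iff divide_le_eq_1_pos zero_le_numeral one_le_numeral)
    then have "(\<Sum>k. a (\<tau> (k + j)) j) \<le> (\<Sum>k. ennreal ((1/2) ^ k))"
      by (intro suminf_le) auto
    also have "\<dots> < \<infinity>"
      by (subst suminf_ennreal2) (auto intro: summable_geometric)
    finally have "(\<integral>\<^sup>+ z. (\<Sum>k. ennreal (?d k z)) \<partial>lebesgue_on (C j)) \<noteq> \<infinity>"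
      using Gm by (subst nn_integral_suminf) (auto simp: a_def)
    then have "AE z in lebesgue_on (C j). (\<Sum>k. ennreal (?d k z)) \<noteq> \<infinity>"
      using Gm by (intro nn_integral_PInf_AE) auto
    moreover have "AE z in lebesgue_on (C j). z \<in> C j" using Cm by (simp add: AE_restrict_space_iff)
    ultimately show ?thesis
    proof eventually_elim
      case (elim z)
      then have wz: "0 \<le> w z" using w(2) CS by auto
      have "summable (\<lambda>k. ?d k z)"
        using elim(1) wz by (intro summable_suminf_not_top) auto
      then have "(\<lambda>k. ?d k z) \<longlonglongrightarrow> 0" by (rule summable_LIMSEQ_zero)
      then have l: "(\<lambda>k. norm (G (\<tau> k) z - g z) powr 1 * w z) \<longlonglongrightarrow> 0" by (rule LIMSEQ_offset)
      show ?case
      proof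
        assume "w z \<noteq> 0"
        with tendsto_divide[OF l tendsto_const, of "w z"]
        have "(\<lambda>k. norm (G (\<tau> k) z - g z)) \<longlonglongrightarrow> 0" by simp
        then show "(\<lambda>k. G (\<tau> k) z) \<longlonglongrightarrow> g z"
          by (simp add: tendsto_norm_zero_iff LIM_zero_iff)
      qed
    qed
  qed
  have "AE z in lebesgue. \<forall>j. z \<in> C j \<longrightarrow> w z \<noteq> 0 \<longrightarrow> (\<lambda>k. G (\<tau> k) z) \<longlonglongrightarrow> g z"
    using AEj Cm by (subst AE_all_countable) (simp add: AE_restrict_space_iff)
  then have "AE z in lebesgue_on S. w z \<noteq> 0 \<longrightarrow> (\<lambda>k. G (\<tau> k) z) \<longlonglongrightarrow> g z"
    using S C(3) by (auto simp: AE_restrict_space_iff elim!: eventually_mono)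
  with \<open>strict_mono \<tau>\<close> show ?thesis by (rule that)
qed

text \<open>Measurability in the sense of \<open>measurable_on\<close> already supplies continuous
  functions converging to g off a negligible set. Truncating them at height M preserves continuity
  and the limit and provides the dominating constant 2M.\<close>

lemma continuous_L1_approx:
  fixes g :: "'a::euclidean_space \<Rightarrow> real"
  assumes g: "g \<in> borel_measurable (lebesgue_on K)" and M: "\<And>z. z \<in> K \<Longrightarrow> \<bar>g z\<bar> \<le> M"
    and K: "compact K" and e: "0 < e" and M0: "0 \<le> M"
  obtains c where "continuous_on UNIV c" "\<And>z. \<bar>c z\<bar> \<le> M" "(LINT z|lebesgue_on K. \<bar>g z - c z\<bar>) < e"
proof -
  have Km: "K \<in> sets lebesgue" "emeasure lebesgue K < \<infinity>"
    using lmeasurable_compact[OF K] by (auto simp: fmeasurable_def)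
  have "g measurable_on K" using g Km by (simp add: measurable_on_iff_borel_measurable)
  then obtain N h where N: "negligible N" and h: "\<And>n::nat. continuous_on UNIV (h n)"
    and lim: "\<And>z. z \<notin> N \<Longrightarrow> (\<lambda>n. h n z) \<longlonglongrightarrow> (if z \<in> K then g z else 0)"
    unfolding measurable_on_def by blast
  define c where "c n z = max (- M) (min M (h n z))" for n z
  have cc: "continuous_on UNIV (c n)" for n unfolding c_def by (intro continuous_intros h)
  have cb: "\<bar>c n z\<bar> \<le> M" for n z using M0 by (auto simp: c_def)
  have cm: "c n \<in> borel_measurable (lebesgue_on K)" for n
    by (rule continuous_imp_measurable_on_sets_lebesgue[OF continuous_on_subset[OF cc]]) (use Km in auto)
  have "(\<lambda>n. LINT z|lebesgue_on K. \<bar>g z - c n z\<bar>) \<longlonglongrightarrow> (LINT z|lebesgue_on K. 0)"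
  proof (rule integral_dominated_convergence)
    show "integrable (lebesgue_on K) (\<lambda>z. 2 * M)"
      using Km by (simp add: integrable_restrict_space lmeasurable_iff_integrable[symmetric] fmeasurable_def)
    have "AE z in lebesgue. z \<notin> N" using N by (simp add: negligible_iff_null_sets AE_not_in)
    then show "AE z in lebesgue_on K. (\<lambda>n. \<bar>g z - c n z\<bar>) \<longlonglongrightarrow> 0"
      unfolding AE_restrict_space_iff[of K lebesgue, simplified, OF Km(1)]
    proof eventually_elim
      case (elim z)
      show ?case
      proof
        assume z: "z \<in> K"
        with lim[OF elim] have "(\<lambda>n. h n z) \<longlonglongrightarrow> g z" by simp
        then have "(\<lambda>n. \<bar>g z - c n z\<bar>) \<longlonglongrightarrow> \<bar>g z - max (- M) (min M (g z))\<bar>"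
          unfolding c_def by (intro tendsto_intros)
        moreover have "max (- M) (min M (g z)) = g z" using M[OF z] by auto
        ultimately show "(\<lambda>n. \<bar>g z - c n z\<bar>) \<longlonglongrightarrow> 0" by simp
      qed
    qed
    show "AE z in lebesgue_on K. norm \<bar>g z - c n z\<bar> \<le> 2 * M" for n
      using M cb[of n] unfolding AE_restrict_space_iff[of K lebesgue, simplified, OF Km(1)]
      by (intro AE_I2) (smt (verit) real_norm_def)
  qed (use g cm in measurable)
  then have "\<forall>\<^sub>F n in sequentially. (LINT z|lebesgue_on K. \<bar>g z - c n z\<bar>) < e"
    using e by (intro order_tendstoD(2)) auto
  then obtain n where "(LINT z|lebesgue_on K. \<bar>g z - c n z\<bar>) < e"
    using eventually_happens'[OF sequentially_bot] by blast
  with cc cb show ?thesis by (rule that)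
qed


lemma lborel_integral_translation:
  fixes f :: "'a::euclidean_space \<Rightarrow> real"
  assumes "f \<in> borel_measurable borel"
  shows "(LINT z|lborel. f (z + c)) = (LINT z|lborel. f z)"
    and "integrable lborel f \<Longrightarrow> integrable lborel (\<lambda>z. f (z + c))"
proof -
  have "(LINT z|lborel. f z) = (LINT z|distr lborel borel ((+) c). f z)"
    by (simp only: lborel_distr_plus)
  also have "\<dots> = (LINT z|lborel. f (c + z))"
    using assms by (subst integral_distr) auto
  finally show "(LINT z|lborel. f (z + c)) = (LINT z|lborel. f z)" by (simp add: add.commute)
  assume "integrable lborel f"
  then have "integrable (distr lborel borel ((+) c)) f" by (simp only: lborel_distr_plus)
  then show "integrable lborel (\<lambda>z. f (z + c))"
    using assms by (subst (asm) integrable_distr_eq) (auto simp: add.commute)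
qed

lemma integrable_lborel_bounded_support:
  fixes f :: "'a::euclidean_space \<Rightarrow> real"
  assumes f: "f \<in> borel_measurable borel" and K: "bounded K"
    and b: "\<And>z. \<bar>f z\<bar> \<le> M" and s: "\<And>z. z \<notin> K \<Longrightarrow> f z = 0"
  shows "integrable lborel f"
proof -
  have "emeasure lborel (closure K) < \<infinity>"
    by (rule emeasure_bounded_finite[OF bounded_closure[OF K]])
  then show ?thesis
    using f b s closure_subset[of K]
    by (intro integrableI_bounded_set[where A = "closure K" and B = M]) auto
qed

text \<open>On a neighbourhood of K, g is replaced by a continuous function c at small cost in L^1.
  The translated error costs the same by translation invariance, and c itself is uniformly
  continuous. Continuity of translations is what lets the doubled variables be merged without
  Lebesgue points.\<close>

lemma L1_translation_continuous:
  fixes g :: "'a::euclidean_space \<Rightarrow> real"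
  assumes g [measurable]: "g \<in> borel_measurable borel" and M: "\<And>z. \<bar>g z\<bar> \<le> M" and K: "compact K"
  shows "((\<lambda>\<zeta>. LINT z|lborel. indicator K z * \<bar>g (z + \<zeta>) - g z\<bar>) \<longlongrightarrow> 0) (at 0)"
proof (rule tendstoI)
  fix e :: real assume e: "0 < e"
  \<comment> \<open>The unit neighbourhood of K contains every translate z + \<zeta> with z in K and
    norm of \<zeta> at most 1, so c need be close to g only there.\<close>
  define K' where "K' = {z + \<zeta> | z \<zeta>. z \<in> K \<and> \<zeta> \<in> cball 0 1}"
  have K': "compact K'" unfolding K'_def by (rule compact_sums[OF K compact_cball])
  have M0: "0 \<le> M" using M[of 0] by simp
  have [measurable]: "K \<in> sets borel" "K' \<in> sets borel"
    using K K' by (auto simp: borel_closed compact_imp_closed)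
  have KK': "K \<subseteq> K'"
  proof
    fix z assume "z \<in> K"
    then show "z \<in> K'" unfolding K'_def by (intro CollectI exI[of _ z] exI[of _ 0]) simp
  qed
  have "g \<in> borel_measurable (lebesgue_on K')"
    by (rule measurable_restrict_space1, rule measurable_completion) simp
  from continuous_L1_approx[OF this M K', of "e / 4"] M0 e
  obtain c where c: "continuous_on UNIV c" "\<And>z. \<bar>c z\<bar> \<le> M"
    and ce: "(LINT z|lebesgue_on K'. \<bar>g z - c z\<bar>) < e / 4"
    by auto
  have [measurable]: "c \<in> borel_measurable borel" by (rule borel_measurable_continuous_onI[OF c(1)])
  have gc: "\<bar>g z - c z\<bar> \<le> 2 * M" for z using M[of z] c(2)[of z] by linarith
  define d where "d z = indicator K' z * \<bar>g z - c z\<bar>" for z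
  have d[measurable]: "d \<in> borel_measurable borel" unfolding d_def by measurable
  have dint: "integrable lborel d"
    by (rule integrable_lborel_bounded_support[OF d compact_imp_bounded[OF K'], of "2 * M"])
       (use gc M0 in \<open>auto simp: d_def indicator_def\<close>)
  have "(LINT z|lebesgue_on K'. \<bar>g z - c z\<bar>) = (LINT z|lborel. d z)"
    by (simp add: integral_restrict_space d_def integral_completion)
  with ce have de: "(LINT z|lborel. d z) < e / 4" by simp
  define m where "m = measure lborel K"
  have "uniformly_continuous_on K' c"
    by (rule compact_uniformly_continuous[OF continuous_on_subset[OF c(1)] K']) simp
  \<comment> \<open>The summand 1 keeps the denominator positive when K has measure 0.\<close>
  moreover have "0 < e / (4 * (m + 1))" using e by (simp add: m_def add_nonneg_pos)
  ultimately obtain \<delta> where \<delta>: "0 < \<delta>"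
    "\<And>z z'. z \<in> K' \<Longrightarrow> z' \<in> K' \<Longrightarrow> dist z' z < \<delta> \<Longrightarrow> \<bar>c z' - c z\<bar> < e / (4 * (m + 1))"
    unfolding uniformly_continuous_on_def dist_real_def by blast
  have kint: "integrable lborel (\<lambda>z. indicator K z * (e / (4 * (m + 1))) :: real)"
    by (rule integrable_lborel_bounded_support[OF _ compact_imp_bounded[OF K], of _ "e / (4 * (m + 1))"])
       (use e m_def in \<open>auto simp: indicator_def\<close>)
  have "\<bar>LINT z|lborel. indicator K z * \<bar>g (z + \<zeta>) - g z\<bar>\<bar> < e" if \<zeta>: "norm \<zeta> < min 1 \<delta>" for \<zeta>
  proof -
    have i1: "integrable lborel (\<lambda>z. d (z + \<zeta>) + indicator K z * (e / (4 * (m + 1))) + d z)"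
      using lborel_integral_translation(2)[OF d dint] dint kint by auto
    have "(LINT z|lborel. indicator K z * \<bar>g (z + \<zeta>) - g z\<bar>)
      \<le> (LINT z|lborel. d (z + \<zeta>) + indicator K z * (e / (4 * (m + 1))) + d z)"
    proof (rule integral_mono[OF _ i1])
      show "integrable lborel (\<lambda>z. indicator K z * \<bar>g (z + \<zeta>) - g z\<bar>)"
        by (rule integrable_lborel_bounded_support[OF _ compact_imp_bounded[OF K], of _ "2 * M"])
           (use M M0 in \<open>auto simp: indicator_def intro: order.trans[OF abs_triangle_ineq4] add_mono[of _ M _ M, simplified]\<close>)
      fix z
      show "indicator K z * \<bar>g (z + \<zeta>) - g z\<bar> \<le> d (z + \<zeta>) + indicator K z * (e / (4 * (m + 1))) + d z"
      proof (cases "z \<in> K")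
        case True
        then have "z + \<zeta> \<in> K'" 
          unfolding K'_def using \<zeta> by (intro CollectI exI[of _ z] exI[of _ \<zeta>]) simp
        moreover have "z \<in> K'" using True KK' by auto
        moreover have "\<bar>c (z + \<zeta>) - c z\<bar> < e / (4 * (m + 1))"
          using \<delta>(2)[OF \<open>z \<in> K'\<close> \<open>z + \<zeta> \<in> K'\<close>] \<zeta> by (simp add: dist_norm)
        ultimately show ?thesis using True by (simp add: d_def)
      next
        case False
        then show ?thesis by (simp add: d_def)
      qed
    qed
    also have "\<dots> = (LINT z|lborel. d z) + m * (e / (4 * (m + 1))) + (LINT z|lborel. d z)"
      using lborel_integral_translation[OF d, of \<zeta>] dint kint
      by (simp add: m_def)
    also have "\<dots> \<le> (LINT z|lborel. d z) + e / 4 + (LINT z|lborel. d z)"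
    proof -
      have "0 < 4 * (m + 1)" by (simp add: m_def add_nonneg_pos)
      then have "m * e / (4 * (m + 1)) \<le> e / 4"
        using e by (subst pos_divide_le_eq) (auto simp: algebra_simps)
      then show ?thesis by simp
    qed
    also have "\<dots> < e" using de e by linarith
    finally have "(LINT z|lborel. indicator K z * \<bar>g (z + \<zeta>) - g z\<bar>) < e" .
    moreover have "0 \<le> (LINT z|lborel. indicator K z * \<bar>g (z + \<zeta>) - g z\<bar>)"
      by (intro integral_nonneg_AE) simp
    ultimately show ?thesis by simp
  qed
  then show "\<forall>\<^sub>F \<zeta> in at 0. dist (LINT z|lborel. indicator K z * \<bar>g (z + \<zeta>) - g z\<bar>) 0 < e"
    using \<delta>(1) by (auto simp: eventually_at intro!: exI[of _ "min 1 \<delta>"])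
qed

lemma integrable_mult_bounded:
  fixes w G :: "'a \<Rightarrow> real"
  assumes "integrable M w" "G \<in> borel_measurable M" "AE z in M. \<bar>G z\<bar> \<le> B"
  shows "integrable M (\<lambda>z. G z * w z)"
proof (rule Bochner_Integration.integrable_bound[OF integrable_mult_right[OF integrable_abs[OF assms(1)], of B]])
  show "AE z in M. norm (G z * w z) \<le> norm (B * \<bar>w z\<bar>)"
    using assms(3)
  proof eventually_elim
    case (elim z)
    then have "\<bar>G z\<bar> \<le> \<bar>B\<bar>" by linarith
    then show ?case by (simp add: abs_mult mult_right_mono)
  qed
qed (use assms in measurable)

text \<open>Convergence is required only where the weight is nonzero. This is the form that fits
  hypotheses weighted by \<rho>, which give no information on the zero set of \<rho>.\<close>

lemma bounded_convergence_weighted: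
  fixes w g :: "'a \<Rightarrow> real" and G :: "nat \<Rightarrow> 'a \<Rightarrow> real"
  assumes w: "integrable M w" and G: "\<And>i. G i \<in> borel_measurable M" and g: "g \<in> borel_measurable M"
    and B: "\<And>i. AE z in M. \<bar>G i z\<bar> \<le> B" and lim: "AE z in M. w z \<noteq> 0 \<longrightarrow> (\<lambda>i. G i z) \<longlonglongrightarrow> g z"
  shows "(\<lambda>i. LINT z|M. G i z * w z) \<longlonglongrightarrow> (LINT z|M. g z * w z)"
proof (rule integral_dominated_convergence)
  show "integrable M (\<lambda>z. \<bar>B\<bar> * \<bar>w z\<bar>)" using w by simp
  show "AE z in M. (\<lambda>i. G i z * w z) \<longlonglongrightarrow> g z * w z"
    using lim
  proof eventually_elim
    case (elim z)
    then show ?case by (cases "w z = 0") (auto intro: tendsto_mult)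
  qed
  show "AE z in M. norm (G i z * w z) \<le> \<bar>B\<bar> * \<bar>w z\<bar>" for i
    using B[of i] by eventually_elim (auto simp: abs_mult intro!: mult_right_mono)
qed (use w G g in measurable)

text \<open>g is continuous only on S, and W lies in S only almost everywhere; cutting g off outside
  S makes it Borel on the whole space and changes the composition on a null set only.\<close>

lemma borel_measurable_compose_AE:
  fixes W :: "'a::euclidean_space \<Rightarrow> 'b::euclidean_space" and g :: "'b \<Rightarrow> real"
  assumes X: "X \<in> sets lebesgue" and W: "W \<in> borel_measurable (lebesgue_on X)"
    and S: "S \<in> sets borel" "continuous_on S g" and WS: "AE z in lebesgue_on X. W z \<in> S"
  shows "(\<lambda>z. g (W z)) \<in> borel_measurable (lebesgue_on X)"
proof -
  have gm: "(\<lambda>s. indicat_real S s *\<^sub>R g s) \<in> borel_measurable borel"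
    using S by (intro borel_measurable_continuous_on_indicator) auto
  have m1: "(\<lambda>z. indicat_real S (W z) *\<^sub>R g (W z)) \<in> borel_measurable (lebesgue_on X)"
    using measurable_compose[OF W gm] .
  have "AE z in lebesgue. z \<in> X \<longrightarrow> W z \<in> S"
    using WS X by (simp add: AE_restrict_space_iff)
  then have "AE z in lebesgue. (if z \<in> X then indicat_real S (W z) *\<^sub>R g (W z) else 0)
      = (if z \<in> X then g (W z) else 0)"
    by eventually_elim simp
  then have "(\<lambda>z. if z \<in> X then g (W z) else 0) \<in> borel_measurable lebesgue"
    by (rule borel_measurable_AE[OF borel_measurable_if_I[OF m1 X]])
  then show ?thesis by (rule borel_measurable_if_D)
qed

lemma AE_lborel_snd:
  assumes "AE y in (lborel :: 'b::euclidean_space measure). Q y"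
  shows "AE z in (lborel :: ('a::euclidean_space \<times> 'b) measure). Q (snd z)"
proof -
  from AE_E3[OF assms] obtain N where N: "\<And>z. z \<notin> N \<Longrightarrow> Q z" "N \<in> null_sets lborel"
    by auto
  then have [measurable]: "N \<in> sets borel" by (auto simp: null_sets_def)
  have "AE z in (lborel :: 'a measure) \<Otimes>\<^sub>M (lborel :: 'b measure). snd z \<notin> N"
  proof (intro lborel_pair.AE_pair_measure)
    have "Measurable.pred (borel \<Otimes>\<^sub>M borel) (\<lambda>z::'a \<times> 'b. snd z \<notin> N)" by measurable
    then show "{z \<in> space ((lborel :: 'a measure) \<Otimes>\<^sub>M (lborel :: 'b measure)). snd z \<notin> N}
        \<in> sets (lborel \<Otimes>\<^sub>M lborel)"
      unfolding borel_prod lborel_prod by (auto simp: pred_def)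
  qed (use AE_not_in[OF N(2)] in simp)
  then show ?thesis
    unfolding lborel_prod by (rule eventually_mono) (rule N(1))
qed

subsection \<open>The space-time-parameter domain\<close>

lemma compact_Gam: "compact Gam"
  by (simp add: Gam_def)

lemma domains_borel [measurable]: "domT \<in> sets borel" "dom0 \<in> sets borel" "Gam \<in> sets borel"
  unfolding domT_def dom0_def Gam_def by (auto intro!: borel_Times)

lemma domains_lebesgue [simp]: "domT \<in> sets lebesgue" "dom0 \<in> sets lebesgue" "Gam \<in> sets lebesgue"
  by (auto intro!: sets_completionI_sets)

lemma AE_domT_iff:
  "(AE z in lebesgue_on domT. Q z) \<longleftrightarrow> (AE z in lborel. z \<in> domT \<longrightarrow> Q z)"
  by (simp add: AE_restrict_space_iff AE_completion_iff)

lemma AE_dom0_iff: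
  "(AE z in lebesgue_on dom0. Q z) \<longleftrightarrow> (AE z in lborel. z \<in> dom0 \<longrightarrow> Q z)"
  by (simp add: AE_restrict_space_iff AE_completion_iff)

lemma AE_Gam_iff:
  "(AE z in lebesgue_on Gam. Q z) \<longleftrightarrow> (AE z in lborel. z \<in> Gam \<longrightarrow> Q z)"
  by (simp add: AE_restrict_space_iff AE_completion_iff)

lemma AE_lift_Gam:
  fixes Q :: "real^'n \<Rightarrow> bool"
  assumes "AE y in lebesgue_on Gam. Q y"
  shows "AE z in lebesgue_on domT. Q (snd (snd z))" "AE z in lebesgue_on dom0. Q (snd z)"
proof -
  have a: "AE y in lborel. y \<in> Gam \<longrightarrow> Q y" using assms by (simp add: AE_Gam_iff)
  from AE_lborel_snd[OF a, where 'a = real] show "AE z in lebesgue_on dom0. Q (snd z)"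
    unfolding AE_dom0_iff by (rule eventually_mono) (auto simp: dom0_def)
  from AE_lborel_snd[OF AE_lborel_snd[OF a, where 'a = real], where 'a = real]
  show "AE z in lebesgue_on domT. Q (snd (snd z))"
    unfolding AE_domT_iff by (rule eventually_mono) (auto simp: domT_def)
qed

lemma AE_lift_dom0:
  fixes Q :: "real \<times> (real^'n) \<Rightarrow> bool"
  assumes "AE p in lebesgue_on dom0. Q p"
  shows "AE z in lebesgue_on domT. Q (fst z, snd (snd z))"
  using AE_lborel_insert_middle[OF assms[unfolded AE_dom0_iff], where 'b = real]
  unfolding AE_domT_iff by (rule eventually_mono) (auto simp: dom0_def domT_def)

lemma borel_measurable_lebesgue_onI:
  "f \<in> borel_measurable borel \<Longrightarrow> f \<in> borel_measurable (lebesgue_on S)"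
  by (rule measurable_restrict_space1, rule measurable_completion) simp

lemma borel_measurable_lebesgue_on_AE:
  fixes f g :: "'a::euclidean_space \<Rightarrow> real"
  assumes f: "f \<in> borel_measurable (lebesgue_on S)" and S: "S \<in> sets lebesgue"
    and ae: "AE z in lebesgue_on S. f z = g z"
  shows "g \<in> borel_measurable (lebesgue_on S)"
proof -
  have "AE z in lebesgue. (if z \<in> S then f z else 0) = (if z \<in> S then g z else 0)"
    using ae S by (auto simp: AE_restrict_space_iff elim!: eventually_mono)
  then show ?thesis
    by (intro borel_measurable_if_D borel_measurable_AE[OF borel_measurable_if_I[OF f S]])
qed

lemma borel_measurable_pair_borel:
  "fst \<in> borel_measurable (borel :: ('a::second_countable_topology \<times> 'b::second_countable_topology) measure)"
  "snd \<in> borel_measurable (borel :: ('a \<times> 'b) measure)"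
  unfolding borel_prod[symmetric] by measurable

lemma borel_measurable_lift_dom0:
  fixes b :: "real \<times> (real^'n) \<Rightarrow> real"
  assumes "b \<in> borel_measurable (lebesgue_on dom0)"
  shows "(\<lambda>z. b (fst z, snd (snd z))) \<in> borel_measurable (lebesgue_on domT)"
proof -
  from borel_representative[OF assms] obtain b' where
    b': "b' \<in> borel_measurable borel" "AE p in lebesgue_on dom0. b p = b' p" by auto
  have "(\<lambda>z::real \<times> real \<times> (real^'n). (fst z, snd (snd z))) \<in> borel_measurable borel"
    by (intro borel_measurable_Pair measurable_compose[OF _ borel_measurable_pair_borel(2)]
        borel_measurable_pair_borel)
  then have "(\<lambda>z::real \<times> real \<times> (real^'n). b' (fst z, snd (snd z))) \<in> borel_measurable borel"
    by (rule measurable_compose[OF _ b'(1)])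
  then show ?thesis
    by (intro borel_measurable_lebesgue_on_AE[OF borel_measurable_lebesgue_onI])
       (use AE_lift_dom0[OF b'(2)] in \<open>auto elim: eventually_mono\<close>)
qed

lemma borel_measurable_lift_Gam:
  fixes b :: "real^'n \<Rightarrow> real"
  assumes "b \<in> borel_measurable (lebesgue_on Gam)"
  shows "(\<lambda>z. b (snd z)) \<in> borel_measurable (lebesgue_on dom0)"
    and "(\<lambda>z. b (snd (snd z))) \<in> borel_measurable (lebesgue_on domT)"
proof -
  from borel_representative[OF assms] obtain b' where
    b': "b' \<in> borel_measurable borel" "AE p in lebesgue_on Gam. b p = b' p" by auto
  have "(\<lambda>z::real \<times> (real^'n). b' (snd z)) \<in> borel_measurable borel"
    by (rule measurable_compose[OF borel_measurable_pair_borel(2) b'(1)])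
  then show "(\<lambda>z. b (snd z)) \<in> borel_measurable (lebesgue_on dom0)"
    by (intro borel_measurable_lebesgue_on_AE[OF borel_measurable_lebesgue_onI])
       (use AE_lift_Gam(2)[OF b'(2)] in \<open>auto elim: eventually_mono\<close>)
  from borel_measurable_lift_dom0[OF this]
  show "(\<lambda>z. b (snd (snd z))) \<in> borel_measurable (lebesgue_on domT)" by simp
qed

lemma integrable_domT_kernel:
  fixes k :: "real \<times> real \<times> (real^'n) \<Rightarrow> real"
  assumes \<rho>: "Linf Gam \<rho>" and k: "k \<in> borel_measurable borel"
    and b: "\<And>z. z \<in> domT \<Longrightarrow> \<bar>k z\<bar> \<le> M"
    and s: "\<And>x t y. (x, t, y) \<in> domT \<Longrightarrow> \<bar>x\<bar> > R \<or> t > R \<Longrightarrow> k (x, t, y) = 0"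
  shows "integrable (lebesgue_on domT) (\<lambda>z. k z * \<rho> (snd (snd z)))"
proof -
  from \<rho> obtain B where B: "AE y in lebesgue_on Gam. norm (\<rho> y) \<le> B"
    and \<rho>m: "\<rho> \<in> borel_measurable (lebesgue_on Gam)" by (auto simp: Linf_def)
  define A where "A = {-R..R} \<times> {0..R} \<times> (Gam :: (real^'n) set)"
  have A: "compact A" unfolding A_def by (intro compact_Times compact_Gam) auto
  have "A \<in> sets (lebesgue_on UNIV)" "emeasure lebesgue A < \<infinity>"
    using lmeasurable_compact[OF A] by (auto simp: fmeasurable_def lebesgue_on_UNIV_eq)
  then have Am: "A \<in> sets lebesgue" by (simp add: lebesgue_on_UNIV_eq)
  \<comment> \<open>The bound on k at this one point of \<open>domT\<close> yields that M is
    nonnegative.\<close>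
  have "(0, 1, 0) \<in> (domT :: (real \<times> real \<times> (real^'n)) set)"
    by (auto simp: domT_def Gam_def mem_box_cart)
  from order.trans[OF abs_ge_zero b[OF this]] have M0: "0 \<le> M" .
  have "integrable lebesgue (\<lambda>z. if z \<in> domT then k z else 0)"
  proof (rule integrableI_bounded_set[where A = A and B = M])
    show "(\<lambda>z. if z \<in> domT then k z else 0) \<in> borel_measurable lebesgue"
      by (intro borel_measurable_if_I borel_measurable_lebesgue_onI k) simp
    show "AE z in lebesgue. z \<in> A \<longrightarrow> norm (if z \<in> domT then k z else 0) \<le> M"
      using b M0 by (intro AE_I2) simp
    show "AE z in lebesgue. z \<notin> A \<longrightarrow> (if z \<in> domT then k z else 0) = 0"
    proof (rule AE_I2, intro impI)
      fix z assume "z \<notin> A"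
      then have "z \<in> domT \<Longrightarrow> \<bar>fst z\<bar> > R \<or> fst (snd z) > R"
        by (cases z) (auto simp: A_def domT_def)
      then show "(if z \<in> domT then k z else 0) = 0"
        using s[of "fst z" "fst (snd z)" "snd (snd z)"] by simp
    qed
  qed (use Am \<open>emeasure lebesgue A < \<infinity>\<close> in auto)
  moreover have "(\<lambda>z. indicat_real domT z *\<^sub>R k z) = (\<lambda>z. if z \<in> domT then k z else 0)"
    by (auto simp: indicator_def)
  ultimately have "integrable (lebesgue_on domT) k"
    by (simp add: integrable_restrict_space)
  moreover have "AE z in lebesgue_on domT. \<bar>\<rho> (snd (snd z))\<bar> \<le> B"
    using AE_lift_Gam(1)[OF B] by simp
  ultimately show ?thesis
    using integrable_mult_bounded[OF _ borel_measurable_lift_Gam(2)[OF \<rho>m]]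
    by (simp add: mult.commute)
qed

lemma integrable_dom0_kernel:
  fixes k :: "real \<times> (real^'n) \<Rightarrow> real"
  assumes \<rho>: "Linf Gam \<rho>" and k: "k \<in> borel_measurable (lebesgue_on dom0)"
    and b: "AE z in lebesgue_on dom0. \<bar>k z\<bar> \<le> M"
    and s: "AE z in lebesgue_on dom0. \<bar>fst z\<bar> > R \<longrightarrow> k z = 0"
  shows "integrable (lebesgue_on dom0) (\<lambda>z. k z * \<rho> (snd z))"
proof -
  from \<rho> obtain B where B: "AE y in lebesgue_on Gam. norm (\<rho> y) \<le> B"
    and \<rho>m: "\<rho> \<in> borel_measurable (lebesgue_on Gam)" by (auto simp: Linf_def)
  define A where "A = {-R..R} \<times> (Gam :: (real^'n) set)"
  have A: "compact A" unfolding A_def by (intro compact_Times compact_Gam) auto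
  have "A \<in> sets lebesgue" "emeasure lebesgue A < \<infinity>"
    using lmeasurable_compact[OF A] by (auto simp: fmeasurable_def)
  moreover have "A \<subseteq> dom0" by (auto simp: A_def dom0_def)
  ultimately have Am: "A \<in> sets (lebesgue_on dom0)" "emeasure (lebesgue_on dom0) A < \<infinity>"
    by (auto simp: sets_restrict_space_iff emeasure_restrict_space)
  have dom: "AE z in lebesgue_on dom0. z \<in> dom0" by (simp add: AE_dom0_iff)
  have "integrable (lebesgue_on dom0) k"
  proof (rule integrableI_bounded_set[where A = A and B = M])
    show "AE z in lebesgue_on dom0. z \<in> A \<longrightarrow> norm (k z) \<le> M"
      using b by eventually_elim simp
    show "AE z in lebesgue_on dom0. z \<notin> A \<longrightarrow> k z = 0"
      using s dom by eventually_elim (auto simp: A_def dom0_def abs_le_iff)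
  qed (use Am k in auto)
  moreover have "AE z in lebesgue_on dom0. \<bar>\<rho> (snd z)\<bar> \<le> B"
    using AE_lift_Gam(2)[OF B] by simp
  ultimately show ?thesis
    using integrable_mult_bounded[OF _ borel_measurable_lift_Gam(1)[OF \<rho>m]]
    by (simp add: mult.commute)
qed

lemma continuous_dx_dt:
  fixes \<phi> :: "real \<times> real \<times> (real^'n) \<Rightarrow> real"
  assumes "smooth \<phi>"
  shows "continuous_on A (dx \<phi>)" "continuous_on A (dt \<phi>)"
proof -
  have "Ck (Suc 0) \<phi>" using assms by (simp add: smooth_def del: Ck.simps)
  then have *: "continuous_on UNIV (\<lambda>z. frechet_derivative \<phi> (at z) b)" if "b \<in> Basis" for b
    using Ck_SucD(2)[of 0 \<phi> b] that by simp
  have "(1, 0, 0) \<in> (Basis :: (real \<times> real \<times> (real^'n)) set)"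
    "(0, 1, 0) \<in> (Basis :: (real \<times> real \<times> (real^'n)) set)"
    by (auto simp: Basis_prod_def image_iff zero_prod_def)
  from *[OF this(1)] *[OF this(2)] show "continuous_on A (dx \<phi>)" "continuous_on A (dt \<phi>)"
    unfolding dx_def[abs_def] dt_def[abs_def] by (auto intro: continuous_on_subset)
qed

text \<open>A test function is controlled only on S: nothing is known about its values for y outside
  \<open>Gam\<close> or, in general, for negative t. Its t and x derivatives at a point of
  \<open>domT\<close> are nevertheless determined by values in \<open>domT\<close>, because these
  directions leave y fixed and small steps keep t positive.\<close>

lemma test_fun_bounds:
  fixes \<phi> :: "real \<times> real \<times> (real^'n) \<Rightarrow> real"
  assumes \<phi>: "test_fun S \<phi>" and S: "S = domT \<or> S = domT0"
  obtains R M where "0 < R" "\<And>z. z \<in> S \<Longrightarrow> \<bar>\<phi> z\<bar> \<le> M"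
    "\<And>z. z \<in> domT \<Longrightarrow> \<bar>dt \<phi> z\<bar> \<le> M" "\<And>z. z \<in> domT \<Longrightarrow> \<bar>dx \<phi> z\<bar> \<le> M"
    "\<And>x t y. (x, t, y) \<in> S \<Longrightarrow> \<bar>x\<bar> > R \<or> t > R \<Longrightarrow> \<phi> (x, t, y) = 0"
    "\<And>x t y. (x, t, y) \<in> domT \<Longrightarrow> \<bar>x\<bar> > R \<or> t > R \<Longrightarrow> dt \<phi> (x, t, y) = 0 \<and> dx \<phi> (x, t, y) = 0"
proof -
  from \<phi> obtain C where sm: "smooth \<phi>" and C: "compact C" "C \<subseteq> S" "\<And>z. z \<in> S - C \<Longrightarrow> \<phi> z = 0"
    by (auto simp: test_fun_def)
  from compact_imp_bounded[OF C(1)] obtain R where R: "0 < R" "\<And>z. z \<in> C \<Longrightarrow> norm z \<le> R"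
    by (auto simp: bounded_pos)
  have sub: "domT \<subseteq> S" using S by (auto simp: domT_def domT0_def)
  have z0: "\<phi> z = 0" if "z \<in> S" "R < norm z" for z
    using that C(3)[of z] R(2)[of z] by auto
  \<comment> \<open>The function vanishes near 0 along the line z + s d, which stays in
    \<open>domT\<close> and outside the ball of radius R for small s.\<close>
  have d0: "frechet_derivative \<phi> (at z) d = 0"
    if z: "z \<in> domT" "R < norm z" and d: "d = (1, 0, 0) \<or> d = (0, 1, 0)" for z d
  proof -
    have "((\<lambda>s::real. z + s *\<^sub>R d) has_derivative (\<lambda>s. s *\<^sub>R d)) (at 0)"
      by (auto intro!: derivative_eq_intros)
    from has_derivative_compose[OF this, of \<phi> "frechet_derivative \<phi> (at z)"] smooth_has_derivative[OF sm, of z]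
    have "((\<lambda>s. \<phi> (z + s *\<^sub>R d)) has_derivative (\<lambda>s. frechet_derivative \<phi> (at z) (s *\<^sub>R d))) (at 0)"
      by simp
    moreover have "(\<lambda>s. frechet_derivative \<phi> (at z) (s *\<^sub>R d)) = (\<lambda>s. frechet_derivative \<phi> (at z) d * s)"
      using linear_scale[OF has_derivative_linear[OF smooth_has_derivative[OF sm]]]
      by (auto simp: mult.commute)
    ultimately have D: "((\<lambda>s. \<phi> (z + s *\<^sub>R d)) has_real_derivative frechet_derivative \<phi> (at z) d) (at 0)"
      by (simp add: has_field_derivative_def)
    have "((\<lambda>s. norm (z + s *\<^sub>R d)) \<longlongrightarrow> norm (z + 0 *\<^sub>R d)) (at 0)"
      by (intro tendsto_intros)
    then have e1: "\<forall>\<^sub>F s in at 0. R < norm (z + s *\<^sub>R d)"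
      using z(2) by (intro order_tendstoD(1)) auto
    have "((\<lambda>s. fst (snd (z + s *\<^sub>R d))) \<longlongrightarrow> fst (snd (z + 0 *\<^sub>R d))) (at 0)"
      by (intro tendsto_intros)
    then have e2: "\<forall>\<^sub>F s in at 0. 0 < fst (snd (z + s *\<^sub>R d))"
      using z(1) by (intro order_tendstoD(1)) (auto simp: domT_def)
    have "\<forall>\<^sub>F s in at 0. \<phi> (z + s *\<^sub>R d) = 0"
      using e1 e2
    proof eventually_elim
      case (elim s)
      have "z + s *\<^sub>R d \<in> domT"
        using z(1) d elim(2) by (cases z) (auto simp: domT_def)
      with elim(1) sub show ?case by (intro z0) auto
    qed
    then have ev: "\<forall>\<^sub>F s in nhds 0. \<phi> (z + s *\<^sub>R d) = 0"
      using z0[of z] z sub by (auto simp: eventually_nhds_conv_at)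
    have "((\<lambda>s. 0) has_real_derivative frechet_derivative \<phi> (at z) d) (at 0)"
      using D ev by (subst (asm) DERIV_cong_ev[OF refl ev refl])
    then show ?thesis using DERIV_unique DERIV_const by blast
  qed
  have bd: "\<exists>M. \<forall>z\<in>cball 0 R. \<bar>g z\<bar> \<le> M" if "continuous_on UNIV g" for g :: "real \<times> real \<times> (real^'n) \<Rightarrow> real"
    using compact_imp_bounded[OF compact_continuous_image[OF continuous_on_subset[OF that subset_UNIV] compact_cball[of 0 R]]]
    by (auto simp: bounded_iff)
  obtain M1 where M1: "\<And>z. norm z \<le> R \<Longrightarrow> \<bar>\<phi> z\<bar> \<le> M1"
    using bd[OF smooth_imp_continuous_on[OF sm]] by (metis mem_cball_0)
  obtain M2 where M2: "\<And>z. norm z \<le> R \<Longrightarrow> \<bar>dt \<phi> z\<bar> \<le> M2"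
    using bd[OF continuous_dx_dt(2)[OF sm]] by (metis mem_cball_0)
  obtain M3 where M3: "\<And>z. norm z \<le> R \<Longrightarrow> \<bar>dx \<phi> z\<bar> \<le> M3"
    using bd[OF continuous_dx_dt(1)[OF sm]] by (metis mem_cball_0)
  note M = M1 M2 M3
  have big: "R < norm (x, t, y)" if "\<bar>x\<bar> > R \<or> t > R" for x t and y :: "real^'n"
    using that norm_fst_le[of x "(t, y)"] norm_snd_le[of "(t, y)" x] norm_fst_le[of t y] by auto
  define M where "M = max 0 (max M1 (max M2 M3))"
  show ?thesis
  proof (rule that[of R M])
    show "\<bar>\<phi> z\<bar> \<le> M" if "z \<in> S" for z
      using M(1)[of z] z0[OF that] by (cases "norm z \<le> R") (auto simp: M_def)
    show "\<bar>dt \<phi> z\<bar> \<le> M" if "z \<in> domT" for z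
      using M(2)[of z] d0[OF that] by (cases "norm z \<le> R") (auto simp: M_def dt_def)
    show "\<bar>dx \<phi> z\<bar> \<le> M" if "z \<in> domT" for z
      using M(3)[of z] d0[OF that] by (cases "norm z \<le> R") (auto simp: M_def dx_def)
  qed (use R z0 d0 big in \<open>auto simp: dt_def dx_def\<close>)
qed

lemma integrable_test_fun_derivatives:
  fixes \<phi> :: "real \<times> real \<times> (real^'n) \<Rightarrow> real"
  assumes \<rho>: "Linf Gam \<rho>" and \<phi>: "test_fun S \<phi>" "S = domT \<or> S = domT0"
  shows "integrable (lebesgue_on domT) (\<lambda>z. dt \<phi> z * \<rho> (snd (snd z)))"
    and "integrable (lebesgue_on domT) (\<lambda>z. dx \<phi> z * \<rho> (snd (snd z)))"
proof -
  have "smooth \<phi>" using \<phi>(1) by (simp add: test_fun_def)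
  then have m: "dt \<phi> \<in> borel_measurable borel" "dx \<phi> \<in> borel_measurable borel"
    by (auto intro: borel_measurable_continuous_onI continuous_dx_dt)
  from test_fun_bounds[OF \<phi>] obtain R M where *: "\<And>z. z \<in> domT \<Longrightarrow> \<bar>dt \<phi> z\<bar> \<le> M"
    "\<And>z. z \<in> domT \<Longrightarrow> \<bar>dx \<phi> z\<bar> \<le> M"
    "\<And>x t y. (x, t, y) \<in> domT \<Longrightarrow> \<bar>x\<bar> > R \<or> t > R \<Longrightarrow> dt \<phi> (x, t, y) = 0 \<and> dx \<phi> (x, t, y) = 0"
    by metis
  show "integrable (lebesgue_on domT) (\<lambda>z. dt \<phi> z * \<rho> (snd (snd z)))"
    "integrable (lebesgue_on domT) (\<lambda>z. dx \<phi> z * \<rho> (snd (snd z)))"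
    by (rule integrable_domT_kernel[OF \<rho> m(1) *(1), of R], use * in auto)
       (rule integrable_domT_kernel[OF \<rho> m(2) *(2), of R], use * in auto)
qed

lemma integrable_test_fun_initial:
  fixes \<phi> :: "real \<times> real \<times> (real^'n) \<Rightarrow> real"
  assumes \<rho>: "Linf Gam \<rho>" and \<phi>: "test_fun domT0 \<phi>"
  shows "integrable (lebesgue_on dom0) (\<lambda>p. \<phi> (fst p, 0, snd p) * \<rho> (snd p))"
proof -
  have "smooth \<phi>" using \<phi>(1) by (simp add: test_fun_def)
  then have "continuous_on UNIV (\<lambda>p::real \<times> (real^'n). \<phi> (fst p, 0, snd p))"
    by (rule continuous_on_compose2[OF smooth_imp_continuous_on[of \<phi> UNIV]]) (auto intro!: continuous_intros)
  then have m: "(\<lambda>p::real \<times> (real^'n). \<phi> (fst p, 0, snd p)) \<in> borel_measurable (lebesgue_on dom0)"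
    by (intro borel_measurable_lebesgue_onI borel_measurable_continuous_onI)
  from test_fun_bounds[OF \<phi>] obtain R M where *: "\<And>z. z \<in> domT0 \<Longrightarrow> \<bar>\<phi> z\<bar> \<le> M"
    "\<And>x t y. (x, t, y) \<in> domT0 \<Longrightarrow> \<bar>x\<bar> > R \<or> t > R \<Longrightarrow> \<phi> (x, t, y) = 0"
    by metis
  have "(fst p, 0, snd p) \<in> domT0" if "p \<in> dom0" for p :: "real \<times> (real^'n)"
    using that by (auto simp: dom0_def domT0_def)
  then show ?thesis
    by (intro integrable_dom0_kernel[OF \<rho> m, of M R]) (use * in \<open>auto simp: AE_dom0_iff intro!: AE_I2\<close>)
qed


subsection \<open>The entropy inequality with initial data\<close>

text \<open>Entropies are differentiable only relative to the set S, possibly at boundary points. A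
  curve with values in S sees no other directions, so the relative derivative suffices for the chain
  rule.\<close>

lemma has_vector_derivative_compose_into:
  assumes "(c has_vector_derivative v) (at a)" "open A" "a \<in> A" "c ` A \<subseteq> S"
    and "(g has_derivative g') (at (c a) within S)"
  shows "((\<lambda>s. g (c s)) has_vector_derivative g' v) (at a)"
proof -
  have "(g has_derivative g') (at (c a) within c ` A)"
    by (rule has_derivative_subset[OF assms(5,4)])
  moreover have "(c has_vector_derivative v) (at a within A)"
    using assms(1) by (rule has_vector_derivative_at_within)
  ultimately have "((g \<circ> c) has_vector_derivative g' v) (at a within A)"
    by (intro vector_derivative_diff_chain_within)
  then show ?thesis by (simp add: at_within_open[OF assms(3,2)] o_def)
qed

locale convex_entropy_pair =
  fixes S :: "(real^2) set" and \<eta> Q r :: "real^2 \<Rightarrow> real" and D\<eta> :: "real^2 \<Rightarrow> real^2"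
    and H\<eta> DF :: "real^2 \<Rightarrow> real^2^2" and F :: "real^2 \<Rightarrow> real^2"
  assumes S: "compact S"
    and \<eta>: "\<And>V. V \<in> S \<Longrightarrow> (\<eta> has_derivative (\<lambda>h. D\<eta> V \<bullet> h)) (at V within S)"
    and D\<eta>: "\<And>V. V \<in> S \<Longrightarrow> (D\<eta> has_derivative (\<lambda>h. H\<eta> V *v h)) (at V within S)"
    and psd: "\<And>V \<xi>. V \<in> S \<Longrightarrow> 0 \<le> \<xi> \<bullet> (H\<eta> V *v \<xi>)"
    and Q: "\<And>V. V \<in> S \<Longrightarrow> (Q has_derivative (\<lambda>h. (D\<eta> V v* DF V) \<bullet> h)) (at V within S)"
    and F: "\<And>V i. V \<in> S \<Longrightarrow> ((\<lambda>U. F U $ i) has_derivative (\<lambda>h. DF V $ i \<bullet> h)) (at V within S)"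
    and diss: "\<And>V. V \<in> S \<Longrightarrow> 0 \<le> D\<eta> V $ 2 * r V"

text \<open>The cutoff is \<kappa>(x) \<theta>(t). Nothing forces \<theta>(0) = 0, which is the
  source of the initial term; \<kappa>'' enters through the viscous term; and y is absent because
  the entropy balance is derived for each fixed y before integrating against \<rho>.\<close>

locale product_cutoff =
  fixes \<kappa> \<kappa>' \<kappa>'' \<theta> \<theta>' :: "real \<Rightarrow> real" and R T :: real
  assumes \<kappa>: "\<And>x. (\<kappa> has_real_derivative \<kappa>' x) (at x)" "\<And>x. (\<kappa>' has_real_derivative \<kappa>'' x) (at x)"
      "continuous_on UNIV \<kappa>''" "\<And>x. 0 \<le> \<kappa> x"
      "\<And>x. R \<le> \<bar>x\<bar> \<Longrightarrow> \<kappa> x = 0" "\<And>x. R \<le> \<bar>x\<bar> \<Longrightarrow> \<kappa>' x = 0" "\<And>x. R \<le> \<bar>x\<bar> \<Longrightarrow> \<kappa>'' x = 0" "0 < R"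
    and \<theta>: "\<And>t. (\<theta> has_real_derivative \<theta>' t) (at t)" "continuous_on UNIV \<theta>'" "\<And>t. 0 \<le> \<theta> t"
      "\<And>t. T \<le> t \<Longrightarrow> \<theta> t = 0" "\<And>t. T \<le> t \<Longrightarrow> \<theta>' t = 0" "0 < T"
begin

lemma continuous_\<kappa>: "continuous_on A \<kappa>" "continuous_on A \<kappa>'" "continuous_on A \<kappa>''"
  using \<kappa>(1-3) by (auto intro: DERIV_continuous_on continuous_on_subset has_field_derivative_at_within)

lemma continuous_\<theta>: "continuous_on A \<theta>" "continuous_on A \<theta>'"
  using \<theta>(1,2) by (auto intro: DERIV_continuous_on continuous_on_subset has_field_derivative_at_within)

lemma integrable_domT_product_kernel:
  fixes a b :: "real \<Rightarrow> real" and \<rho> :: "real^'n \<Rightarrow> real"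
  assumes \<rho>: "Linf Gam \<rho>" and ab: "continuous_on UNIV a" "continuous_on UNIV b"
    "\<And>x. R \<le> \<bar>x\<bar> \<Longrightarrow> a x = 0" "\<And>t. T \<le> t \<Longrightarrow> b t = 0"
  shows "integrable (lebesgue_on domT) (\<lambda>z. (a (fst z) * b (fst (snd z))) * \<rho> (snd (snd z)))"
proof -
  have c: "continuous_on UNIV (\<lambda>z::real \<times> real \<times> (real^'n). a (fst z))"
     "continuous_on UNIV (\<lambda>z::real \<times> real \<times> (real^'n). b (fst (snd z)))"
    by (rule continuous_on_compose2[OF ab(1)], auto intro!: continuous_intros)
       (rule continuous_on_compose2[OF ab(2)], auto intro!: continuous_intros)
  have "bounded (a ` {-R..R})" "bounded (b ` {0..T})"
    by (intro compact_imp_bounded compact_continuous_image continuous_on_subset[OF ab(1)]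
       continuous_on_subset[OF ab(2)]; simp)+
  then obtain A1 A2 where "\<forall>x\<in>{-R..R}. \<bar>a x\<bar> \<le> A1" "\<forall>t\<in>{0..T}. \<bar>b t\<bar> \<le> A2"
    by (auto simp: bounded_iff)
  then have A: "\<And>x. x \<in> {-R..R} \<Longrightarrow> \<bar>a x\<bar> \<le> A1" "\<And>t. t \<in> {0..T} \<Longrightarrow> \<bar>b t\<bar> \<le> A2"
    by simp_all
  have A0: "0 \<le> A1" "0 \<le> A2" using A(1)[of 0] A(2)[of 0] \<kappa>(8) \<theta>(6) by auto
  have A': "\<bar>a x\<bar> \<le> A1" "0 \<le> t \<Longrightarrow> \<bar>b t\<bar> \<le> A2" for x t
  proof -
    show "\<bar>a x\<bar> \<le> A1" using A(1)[of x] ab(3)[of x] A0 by (cases "x \<in> {-R..R}") auto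
    show "\<bar>b t\<bar> \<le> A2" if "0 \<le> t" using A(2)[of t] ab(4)[of t] A0 that by (cases "T \<le> t") auto
  qed
  show ?thesis
  proof (rule integrable_domT_kernel[OF \<rho>, of _ "A1 * A2" "max R T"])
    show "(\<lambda>z::real \<times> real \<times> (real^'n). a (fst z) * b (fst (snd z))) \<in> borel_measurable borel"
      by (intro borel_measurable_continuous_onI continuous_on_mult c)
    show "\<bar>a (fst z) * b (fst (snd z))\<bar> \<le> A1 * A2" if "z \<in> domT" for z :: "real \<times> real \<times> (real^'n)"
      unfolding abs_mult using that A0 by (intro mult_mono A') (auto simp: domT_def)
    show "a (fst (x, t, y)) * b (fst (snd (x, t, y))) = 0" if "(x, t, y) \<in> domT" "max R T < \<bar>x\<bar> \<or> max R T < t"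
      for x t and y :: "real^'n"
      using that(2) ab(3)[of x] ab(4)[of t] by auto
  qed
qed

lemma integrable_dom0_cutoff:
  fixes \<rho> :: "real^'n \<Rightarrow> real"
  assumes \<rho>: "Linf Gam \<rho>"
  shows "integrable (lebesgue_on dom0) (\<lambda>p. (\<kappa> (fst p) * \<theta> 0) * \<rho> (snd p))"
proof -
  have c: "continuous_on UNIV (\<lambda>p::real \<times> (real^'n). \<kappa> (fst p) * \<theta> 0)"
    by (intro continuous_intros continuous_on_compose2[OF continuous_\<kappa>(1)[of UNIV]]) auto
  have "bounded (\<kappa> ` {-R..R})"
    by (intro compact_imp_bounded compact_continuous_image continuous_\<kappa>) simp
  then obtain A where A: "\<forall>x\<in>{-R..R}. \<bar>\<kappa> x\<bar> \<le> A" by (auto simp: bounded_iff)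
  have "0 \<le> A" using bspec[OF A, of 0] \<kappa>(8) by auto
  then have A': "\<bar>\<kappa> x\<bar> \<le> A" for x
    using bspec[OF A, of x] \<kappa>(5)[of x] by (cases "x \<in> {-R..R}") auto
  show ?thesis
  proof (rule integrable_dom0_kernel[OF \<rho>, of _ "A * \<theta> 0" R])
    show "(\<lambda>p::real \<times> (real^'n). \<kappa> (fst p) * \<theta> 0) \<in> borel_measurable (lebesgue_on dom0)"
      by (intro borel_measurable_lebesgue_onI borel_measurable_continuous_onI c)
    show "AE z in lebesgue_on dom0. \<bar>\<kappa> (fst z) * \<theta> 0\<bar> \<le> A * \<theta> 0"
      by (intro AE_I2) (auto simp: abs_mult \<theta>(3) intro!: mult_right_mono A')
    show "AE z in lebesgue_on dom0. R < \<bar>fst z\<bar> \<longrightarrow> \<kappa> (fst z) * \<theta> 0 = 0"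
      by (intro AE_I2) (auto simp: \<kappa>(5))
  qed
qed

end

locale entropy_cutoff = convex_entropy_pair + product_cutoff
begin

lemma continuous_entropy: "continuous_on S \<eta>" "continuous_on S Q" "continuous_on S D\<eta>"
  using \<eta> Q D\<eta> by (auto simp: continuous_on_eq_continuous_within intro: has_derivative_continuous)

text \<open>With M(t) the integral of \<eta>(W) \<kappa> and N(t) that of \<nu> \<eta>(W) \<kappa>''
  + Q(W) \<kappa>', the equation gives M' \<le> N: the viscous term splits into an exact second
  derivative and a term of favourable sign by convexity, and the source is dissipative.
  Multiplication by \<theta> and integration in t moves the time derivative onto \<theta>.\<close>

lemma viscous_entropy_section:
  fixes W Wt Wx Wxx :: "real \<times> real \<Rightarrow> real^2"
  assumes W: "continuous_on (UNIV \<times> {0..}) W" "\<And>x t. 0 \<le> t \<Longrightarrow> W (x, t) \<in> S"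
    and cont: "continuous_on (UNIV \<times> {0<..}) Wt" 
    and dWt: "\<And>x t. 0 < t \<Longrightarrow> ((\<lambda>s. W (x, s)) has_vector_derivative Wt (x, t)) (at t)"
    and dWx: "\<And>x t. 0 < t \<Longrightarrow> ((\<lambda>s. W (s, t)) has_vector_derivative Wx (x, t)) (at x)"
    and dWxx: "\<And>x t. 0 < t \<Longrightarrow> ((\<lambda>s. Wx (s, t)) has_vector_derivative Wxx (x, t)) (at x)"
    and pde: "\<And>x t. 0 < t \<Longrightarrow> Wt (x, t) + vector_derivative (\<lambda>s. F (W (s, t))) (at x)
        + (1 / \<epsilon>) *\<^sub>R st 0 (r (W (x, t))) = \<nu> *\<^sub>R Wxx (x, t)"
    and \<epsilon>: "0 < \<epsilon>" and \<nu>: "0 < \<nu>"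
  shows "0 \<le> integral {0..T} (\<lambda>t. integral {-R..R} (\<lambda>x. \<eta> (W (x, t)) * \<kappa> x * \<theta>' t
      + Q (W (x, t)) * \<kappa>' x * \<theta> t + \<nu> * \<eta> (W (x, t)) * \<kappa>'' x * \<theta> t))
    + integral {-R..R} (\<lambda>x. \<eta> (W (x, 0)) * \<kappa> x * \<theta> 0)"
proof -
  note c\<eta> = continuous_entropy and c\<kappa> = continuous_\<kappa> and c\<theta> = continuous_\<theta>
  have Wswap: "continuous_on ({0..} \<times> UNIV) (\<lambda>p. W (snd p, fst p))"
    by (rule continuous_on_compose2[OF W(1)]) (auto intro!: continuous_intros)
  have sub: "(\<lambda>p. W (snd p, fst p)) ` ({0..} \<times> UNIV) \<subseteq> S" using W(2) by auto
  note cW = continuous_on_compose2[OF c\<eta>(1) Wswap sub] continuous_on_compose2[OF c\<eta>(2) Wswap sub]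
    continuous_on_compose2[OF c\<eta>(3) Wswap sub]
  have cX: "continuous_on A (\<lambda>p. g (snd p))" if "continuous_on UNIV g"
    for A :: "(real \<times> real) set" and g :: "real \<Rightarrow> real"
    by (rule continuous_on_compose2[OF that]) (auto intro!: continuous_intros)
  define M where "M t = integral {-R..R} (\<lambda>x. \<eta> (W (x, t)) * \<kappa> x)" for t
  define N where "N t = integral {-R..R} (\<lambda>x. \<nu> * (\<eta> (W (x, t)) * \<kappa>'' x) + Q (W (x, t)) * \<kappa>' x)" for t
  have cpar: "continuous_on ({0..} \<times> {-R..R}) (\<lambda>(t, x). \<eta> (W (x, t)) * \<kappa> x)"
    "continuous_on ({0..} \<times> {-R..R}) (\<lambda>(t, x). \<nu> * (\<eta> (W (x, t)) * \<kappa>'' x) + Q (W (x, t)) * \<kappa>' x)"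
    unfolding case_prod_beta
    by (intro continuous_intros cX c\<kappa> continuous_on_subset[OF cW(1)] continuous_on_subset[OF cW(2)]; auto)+
  have cM: "continuous_on {0..} M" and cN: "continuous_on {0..} N"
    unfolding M_def[abs_def] N_def[abs_def]
    using integral_continuous_on_param[of "{0..}" "-R" R, unfolded box_real, OF cpar(1)]
      integral_continuous_on_param[of "{0..}" "-R" R, unfolded box_real, OF cpar(2)]
    by simp_all
  have sec: "continuous_on {-R..R} (\<lambda>x. \<eta> (W (x, t)) * \<kappa> x)"
     "continuous_on {-R..R} (\<lambda>x. \<nu> * (\<eta> (W (x, t)) * \<kappa>'' x) + Q (W (x, t)) * \<kappa>' x)" if "0 \<le> t" for t
  proof -
    have *: "continuous_on {-R..R} (Pair t)" "Pair t ` {-R..R} \<subseteq> {0..} \<times> {-R..R}"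
      using that by (auto intro!: continuous_intros)
    show "continuous_on {-R..R} (\<lambda>x. \<eta> (W (x, t)) * \<kappa> x)"
      "continuous_on {-R..R} (\<lambda>x. \<nu> * (\<eta> (W (x, t)) * \<kappa>'' x) + Q (W (x, t)) * \<kappa>' x)"
      using continuous_on_compose2[OF cpar(1) *] continuous_on_compose2[OF cpar(2) *] by simp_all
  qed
  have dM: "\<exists>m. (M has_real_derivative m) (at t) \<and> m \<le> N t" if t: "0 < t" for t
  proof -
    define g where "g s x = (D\<eta> (W (x, s)) \<bullet> Wt (x, s)) * \<kappa> x" for s x
    have cg: "continuous_on ({0<..} \<times> {-R..R}) (\<lambda>(s, x). g s x)"
    proof -
      have "continuous_on ({0<..} \<times> {-R..R}) (\<lambda>p. Wt (snd p, fst p))"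
        by (rule continuous_on_compose2[OF cont]) (auto intro!: continuous_intros)
      moreover have "continuous_on ({0<..} \<times> {-R..R}) (\<lambda>p. D\<eta> (W (snd p, fst p)))"
        by (rule continuous_on_subset[OF cW(3)]) auto
      ultimately show ?thesis
        unfolding g_def case_prod_beta
        by (intro continuous_on_mult continuous_on_inner cX[OF c\<kappa>(1)])
    qed
    have dt: "((\<lambda>s. \<eta> (W (x, s)) * \<kappa> x) has_real_derivative g s x) (at s within {0<..})"
      if "s \<in> {0<..}" for s x
    proof -
      have "((\<lambda>s. \<eta> (W (x, s))) has_vector_derivative D\<eta> (W (x, s)) \<bullet> Wt (x, s)) (at s)"
        by (rule has_vector_derivative_compose_into[OF dWt, of s "{0<..}" _ S])
           (use that W(2) \<eta> in auto)
      then have "((\<lambda>s. \<eta> (W (x, s))) has_real_derivative D\<eta> (W (x, s)) \<bullet> Wt (x, s)) (at s)"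
        by (simp add: has_real_derivative_iff_has_vector_derivative)
      then have "((\<lambda>s. \<eta> (W (x, s)) * \<kappa> x) has_real_derivative g s x) (at s)"
        unfolding g_def by (rule DERIV_cmult_right)
      then show ?thesis by (rule has_field_derivative_at_within)
    qed
    have "(M has_real_derivative integral {-R..R} (g t)) (at t within {0<..})"
      unfolding M_def[abs_def]
      by (rule leibniz_rule_field_derivative[of "{0<..}" "-R" R "\<lambda>s x. \<eta> (W (x, s)) * \<kappa> x" g t,
            unfolded box_real])
         (use dt cg t integrable_continuous_real[OF sec(1)] in auto)
    then have D: "(M has_real_derivative integral {-R..R} (g t)) (at t)"
      using at_within_open[of t "{0<..}"] t by simp
    \<comment> \<open>Both integrations by parts in x are bundled into one antiderivative:
      \<open>Z\<close> vanishes at both end points because \<kappa> and \<kappa>' do, and its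
      derivative \<open>z\<close> is the exact part of the entropy balance.\<close>
    define Z where "Z x = \<nu> * (D\<eta> (W (x, t)) \<bullet> Wx (x, t)) * \<kappa> x - \<nu> * \<eta> (W (x, t)) * \<kappa>' x
        - Q (W (x, t)) * \<kappa> x" for x
    define z where "z x = (\<nu> * ((H\<eta> (W (x, t)) *v Wx (x, t)) \<bullet> Wx (x, t) + D\<eta> (W (x, t)) \<bullet> Wxx (x, t))
        - (D\<eta> (W (x, t)) v* DF (W (x, t))) \<bullet> Wx (x, t)) * \<kappa> x
        - (\<nu> * (\<eta> (W (x, t)) * \<kappa>'' x) + Q (W (x, t)) * \<kappa>' x)" for x
    have Zd: "(Z has_real_derivative z x) (at x)" for x
    proof -
      have into: "(\<lambda>s. W (s, t)) ` UNIV \<subseteq> S" and WS: "W (x, t) \<in> S" using W(2) t by auto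
      have 1: "((\<lambda>s. \<eta> (W (s, t))) has_real_derivative D\<eta> (W (x, t)) \<bullet> Wx (x, t)) (at x)"
        using has_vector_derivative_compose_into[OF dWx[OF t] open_UNIV UNIV_I into \<eta>[OF WS]]
        by (simp add: has_real_derivative_iff_has_vector_derivative)
      have 2: "((\<lambda>s. Q (W (s, t))) has_real_derivative (D\<eta> (W (x, t)) v* DF (W (x, t))) \<bullet> Wx (x, t)) (at x)"
        using has_vector_derivative_compose_into[OF dWx[OF t] open_UNIV UNIV_I into Q[OF WS]]
        by (simp add: has_real_derivative_iff_has_vector_derivative)
      have 3: "((\<lambda>s. D\<eta> (W (s, t)) \<bullet> Wx (s, t)) has_real_derivative
          (H\<eta> (W (x, t)) *v Wx (x, t)) \<bullet> Wx (x, t) + D\<eta> (W (x, t)) \<bullet> Wxx (x, t)) (at x)"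
        using has_vector_derivative_compose_into[OF dWx[OF t] open_UNIV UNIV_I into D\<eta>[OF WS]]
          dWxx[OF t, of x]
        unfolding has_real_derivative_iff_has_vector_derivative has_vector_derivative_def
        by (auto intro!: derivative_eq_intros simp: algebra_simps)
      show ?thesis
        unfolding Z_def z_def
        by (auto intro!: derivative_eq_intros 1 2 3 \<kappa>(1,2) simp: algebra_simps)
    qed
    have zint: "(z has_integral 0) {-R..R}"
    proof -
      have "(z has_integral (Z R - Z (-R))) {-R..R}"
        using \<kappa>(8) by (intro fundamental_theorem_of_calculus)
          (auto simp: has_real_derivative_iff_has_vector_derivative[symmetric] intro: has_field_derivative_at_within[OF Zd])
      then show ?thesis by (simp add: Z_def \<kappa>(5,6))
    qed
    have le: "g t x \<le> z x + (\<nu> * (\<eta> (W (x, t)) * \<kappa>'' x) + Q (W (x, t)) * \<kappa>' x)" for x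
    proof -
      have WS: "W (x, t) \<in> S" using W(2) t by auto
      have "((\<lambda>s. F (W (s, t)) $ i) has_vector_derivative DF (W (x, t)) $ i \<bullet> Wx (x, t)) (at x)" for i
        by (rule has_vector_derivative_compose_into[OF dWx[OF t] open_UNIV UNIV_I _ F[OF WS]])
           (use W(2) t in auto)
      then have "((\<lambda>s. F (W (s, t))) has_vector_derivative DF (W (x, t)) *v Wx (x, t)) (at x)"
        unfolding has_vector_derivative_def has_derivative_componentwise_within[of "\<lambda>s. F (W (s, t))"]
        by (auto simp: Basis_vec_def inner_axis matrix_vector_mul_component)
      then have "Wt (x, t) = \<nu> *\<^sub>R Wxx (x, t) - DF (W (x, t)) *v Wx (x, t) - (1 / \<epsilon>) *\<^sub>R st 0 (r (W (x, t)))"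
        using pde[OF t, of x] by (simp add: vector_derivative_at algebra_simps)
      moreover have "D\<eta> (W (x, t)) \<bullet> st 0 (r (W (x, t))) = D\<eta> (W (x, t)) $ 2 * r (W (x, t))"
        by (simp add: inner_vec_def sum_2)
      ultimately have "D\<eta> (W (x, t)) \<bullet> Wt (x, t) = \<nu> * (D\<eta> (W (x, t)) \<bullet> Wxx (x, t))
          - (D\<eta> (W (x, t)) v* DF (W (x, t))) \<bullet> Wx (x, t) - (1 / \<epsilon>) * (D\<eta> (W (x, t)) $ 2 * r (W (x, t)))"
        by (simp add: inner_diff_right dot_lmul_matrix)
      moreover have "0 \<le> (1 / \<epsilon>) * (D\<eta> (W (x, t)) $ 2 * r (W (x, t)))"
        using diss[OF WS] \<epsilon> by simp
      moreover have "0 \<le> \<nu> * ((H\<eta> (W (x, t)) *v Wx (x, t)) \<bullet> Wx (x, t))"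
        using psd[OF WS, of "Wx (x, t)"] \<nu> by (simp add: inner_commute)
      ultimately have "D\<eta> (W (x, t)) \<bullet> Wt (x, t) \<le>
         \<nu> * ((H\<eta> (W (x, t)) *v Wx (x, t)) \<bullet> Wx (x, t) + D\<eta> (W (x, t)) \<bullet> Wxx (x, t))
          - (D\<eta> (W (x, t)) v* DF (W (x, t))) \<bullet> Wx (x, t)"
        by (simp add: algebra_simps)
      from mult_right_mono[OF this \<kappa>(4)[of x]] show ?thesis
        by (simp add: g_def z_def)
    qed
    have "continuous_on {-R..R} (g t)"
      using continuous_on_compose2[OF cg, of "{-R..R}" "Pair t"] t
      by (force intro!: continuous_on_Pair continuous_on_const continuous_on_id)
    then have gi: "(g t has_integral integral {-R..R} (g t)) {-R..R}"
      by (intro integrable_integral integrable_continuous_real)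
    have "((\<lambda>x. \<nu> * (\<eta> (W (x, t)) * \<kappa>'' x) + Q (W (x, t)) * \<kappa>' x) has_integral N t) {-R..R}"
      unfolding N_def using sec(2)[of t] t by (intro integrable_integral integrable_continuous_real) auto
    from has_integral_le[OF gi has_integral_add[OF zint this]] le
    have "integral {-R..R} (g t) \<le> N t" by simp
    with D show ?thesis by blast
  qed
  define J where "J t = N t * \<theta> t + M t * \<theta>' t" for t
  have cJ: "continuous_on {0..T} J"
    unfolding J_def[abs_def]
    by (intro continuous_intros c\<theta> continuous_on_subset[OF cM] continuous_on_subset[OF cN]) auto
  \<comment> \<open>M is known to be differentiable only for t > 0. Monotonicity of this function,
    continuous up to t = 0, replaces an integration by parts that would need M' up to the initial
    time.\<close>
  define \<Phi> where "\<Phi> t = M t * \<theta> t - integral {0..t} J" for t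
  have "\<Phi> T \<le> \<Phi> 0"
  proof (rule DERIV_nonpos_imp_decreasing_open[where f = \<Phi> and a = 0 and b = T])
    show "continuous_on {0..T} \<Phi>"
      unfolding \<Phi>_def[abs_def]
      by (intro continuous_intros c\<theta> continuous_on_subset[OF cM] indefinite_integral_continuous_1
          integrable_continuous_real cJ) auto
    fix t assume t: "0 < t" "t < T"
    from dM[OF t(1)] obtain m where m: "(M has_real_derivative m) (at t)" "m \<le> N t" by blast
    have "((\<lambda>x. integral {0..x} J) has_real_derivative J t) (at t within {0..T})"
      using t by (intro integral_has_real_derivative cJ) auto
    then have "((\<lambda>x. integral {0..x} J) has_real_derivative J t) (at t)"
      using at_within_interior[of t "{0..T}"] t by simp
    with m(1) have "(\<Phi> has_real_derivative m * \<theta> t + M t * \<theta>' t - J t) (at t)"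
      unfolding \<Phi>_def[abs_def] by (auto intro!: derivative_eq_intros \<theta>(1))
    moreover have "m * \<theta> t + M t * \<theta>' t - J t \<le> 0"
      using mult_right_mono[OF m(2) \<theta>(3)[of t]] by (simp add: J_def)
    ultimately show "\<exists>y. (\<Phi> has_real_derivative y) (at t) \<and> y \<le> 0" by blast
  qed (use \<theta>(6) in simp)
  then have main: "0 \<le> integral {0..T} J + M 0 * \<theta> 0"
    by (simp add: \<Phi>_def \<theta>(4))
  have "integral {0..T} J = integral {0..T} (\<lambda>t. integral {-R..R} (\<lambda>x. \<eta> (W (x, t)) * \<kappa> x * \<theta>' t
      + Q (W (x, t)) * \<kappa>' x * \<theta> t + \<nu> * \<eta> (W (x, t)) * \<kappa>'' x * \<theta> t))"
  proof (rule integral_cong)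
    fix t assume "t \<in> {0..T}"
    then have t: "0 \<le> t" by simp
    have i: "(\<lambda>x. (\<nu> * (\<eta> (W (x, t)) * \<kappa>'' x) + Q (W (x, t)) * \<kappa>' x) * \<theta> t) integrable_on {-R..R}"
      "(\<lambda>x. (\<eta> (W (x, t)) * \<kappa> x) * \<theta>' t) integrable_on {-R..R}"
      using sec[OF t] by (auto intro!: integrable_continuous_real continuous_intros)
    have "J t = integral {-R..R} (\<lambda>x. (\<nu> * (\<eta> (W (x, t)) * \<kappa>'' x) + Q (W (x, t)) * \<kappa>' x) * \<theta> t)
        + integral {-R..R} (\<lambda>x. (\<eta> (W (x, t)) * \<kappa> x) * \<theta>' t)"
      by (simp add: J_def N_def M_def)
    also have "\<dots> = integral {-R..R} (\<lambda>x. (\<nu> * (\<eta> (W (x, t)) * \<kappa>'' x) + Q (W (x, t)) * \<kappa>' x) * \<theta> t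
        + (\<eta> (W (x, t)) * \<kappa> x) * \<theta>' t)"
      by (rule integral_add[OF i, symmetric])
    finally show "J t = integral {-R..R} (\<lambda>x. \<eta> (W (x, t)) * \<kappa> x * \<theta>' t
      + Q (W (x, t)) * \<kappa>' x * \<theta> t + \<nu> * \<eta> (W (x, t)) * \<kappa>'' x * \<theta> t)"
      by (simp add: algebra_simps)
  qed
  with main show ?thesis by (simp add: M_def)
qed


lemma LINT_lebesgue_eq_integral:
  fixes f :: "real \<Rightarrow> real"
  assumes "continuous_on {a..b} f" "\<And>x. x \<notin> {a..b} \<Longrightarrow> f x = 0"
  shows "(LINT x|lebesgue. f x) = integral {a..b} f"
proof -
  have "(LINT x|lebesgue. f x) = (LINT x|lebesgue. indicat_real {a..b} x *\<^sub>R f x)"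
    by (rule Bochner_Integration.integral_cong) (use assms(2) in \<open>auto simp: indicator_def\<close>)
  also have "\<dots> = (LINT x|lebesgue_on {a..b}. f x)"
    by (rule integral_restrict_space[symmetric]) simp
  also have "\<dots> = integral {a..b} f"
    by (rule lebesgue_integral_eq_integral[OF continuous_imp_integrable_real[OF assms(1)]]) simp
  finally show ?thesis .
qed

text \<open>The inequality of each section is multiplied by \<rho>(y) \<ge> 0 and integrated over y.
  Fubini is used with x innermost and y outermost; continuity down to t = 0 holds for fixed y, where
  W(x, 0, y) coincides with the initial datum.\<close>

lemma viscous_entropy_domT:
  fixes W :: "real \<times> real \<times> (real^'n) \<Rightarrow> real^2" and W0 :: "real \<times> (real^'n) \<Rightarrow> real^2"
    and \<rho> :: "real^'n \<Rightarrow> real" and \<epsilon> \<nu> :: real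
  assumes Wm: "W \<in> borel_measurable (lebesgue_on domT)" "W0 \<in> borel_measurable (lebesgue_on dom0)"
    and WS: "\<And>z. z \<in> domT \<Longrightarrow> W z \<in> S" "\<And>p. p \<in> dom0 \<Longrightarrow> W0 p \<in> S"
    and visc: "classical_viscous_sol F r \<epsilon> \<nu> W0 W" and \<epsilon>: "0 < \<epsilon>" and \<nu>: "0 < \<nu>"
    and \<rho>: "Linf Gam \<rho>" "\<And>y. y \<in> Gam \<Longrightarrow> 0 \<le> \<rho> y"
  shows "0 \<le> (LINT z|lebesgue_on domT. (\<eta> (W z) * \<kappa> (fst z) * \<theta>' (fst (snd z))
      + Q (W z) * \<kappa>' (fst z) * \<theta> (fst (snd z)) + \<nu> * \<eta> (W z) * \<kappa>'' (fst z) * \<theta> (fst (snd z))) * \<rho> (snd (snd z)))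
    + (LINT p|lebesgue_on dom0. \<eta> (W0 p) * \<kappa> (fst p) * \<theta> 0 * \<rho> (snd p))"
proof -
  let ?J = "\<lambda>z::real \<times> real \<times> (real^'n). \<eta> (W z) * \<kappa> (fst z) * \<theta>' (fst (snd z))
      + Q (W z) * \<kappa>' (fst z) * \<theta> (fst (snd z)) + \<nu> * \<eta> (W z) * \<kappa>'' (fst z) * \<theta> (fst (snd z))"
  let ?I = "\<lambda>p::real \<times> (real^'n). \<eta> (W0 p) * \<kappa> (fst p) * \<theta> 0"
  have bd: "\<exists>B. \<forall>V\<in>S. \<bar>g V\<bar> \<le> B" if "continuous_on S g" for g :: "real^2 \<Rightarrow> real"
    using compact_imp_bounded[OF compact_continuous_image[OF that S]] by (auto simp: bounded_iff)
  from bd[OF continuous_entropy(1)] obtain B1 where B1: "\<And>V. V \<in> S \<Longrightarrow> \<bar>\<eta> V\<bar> \<le> B1" by blast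
  from bd[OF continuous_entropy(2)] obtain B2 where B2: "\<And>V. V \<in> S \<Longrightarrow> \<bar>Q V\<bar> \<le> B2" by blast
  have Sb: "S \<in> sets borel" using S by (simp add: borel_closed compact_imp_closed)
  have mT: "(\<lambda>z. \<eta> (W z)) \<in> borel_measurable (lebesgue_on domT)" "(\<lambda>z. Q (W z)) \<in> borel_measurable (lebesgue_on domT)"
    using WS by (auto intro!: borel_measurable_compose_AE[OF _ Wm(1) Sb] continuous_entropy AE_I2 simp: AE_domT_iff)
  have m0: "(\<lambda>z. \<eta> (W0 z)) \<in> borel_measurable (lebesgue_on dom0)"
    using WS by (auto intro!: borel_measurable_compose_AE[OF _ Wm(2) Sb] continuous_entropy AE_I2 simp: AE_dom0_iff)
  note kint = integrable_domT_product_kernel[OF \<rho>(1)]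
  have iT: "integrable (lebesgue_on domT) (\<lambda>z. ?J z * \<rho> (snd (snd z)))"
  proof -
    have "AE z in lebesgue_on domT. \<bar>\<eta> (W z)\<bar> \<le> B1" "AE z in lebesgue_on domT. \<bar>Q (W z)\<bar> \<le> B2"
      using WS B1 B2 by (auto simp: AE_domT_iff intro!: AE_I2)
    note 1 = integrable_mult_bounded[OF kint mT(1) this(1)] integrable_mult_bounded[OF kint mT(2) this(2)]
    have "integrable (lebesgue_on domT) (\<lambda>z. \<eta> (W z) * ((\<kappa> (fst z) * \<theta>' (fst (snd z))) * \<rho> (snd (snd z)))
        + Q (W z) * ((\<kappa>' (fst z) * \<theta> (fst (snd z))) * \<rho> (snd (snd z)))
        + \<nu> * (\<eta> (W z) * ((\<kappa>'' (fst z) * \<theta> (fst (snd z))) * \<rho> (snd (snd z)))))"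
      by (intro Bochner_Integration.integrable_add integrable_mult_right 1 continuous_\<kappa> continuous_\<theta> \<kappa>(5-7) \<theta>(4,5))
    then show ?thesis by (simp add: algebra_simps)
  qed
  have i0: "integrable (lebesgue_on dom0) (\<lambda>p. ?I p * \<rho> (snd p))"
  proof -
    note integrable_dom0_cutoff[OF \<rho>(1)]
    from integrable_mult_bounded[OF this m0, of B1] WS B1 show ?thesis
      by (auto simp: AE_dom0_iff mult.assoc intro!: AE_I2)
  qed
  define g where "g z = indicat_real domT z *\<^sub>R (?J z * \<rho> (snd (snd z)))" for z
  define g0 where "g0 p = indicat_real dom0 p *\<^sub>R (?I p * \<rho> (snd p))" for p
  have gi: "integrable lebesgue g" using iT unfolding g_def by (simp add: integrable_restrict_space)
  have g0i: "integrable lebesgue g0" using i0 unfolding g0_def by (simp add: integrable_restrict_space)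
  \<comment> \<open>Integrating out x leaves a function of (t, y), to which Fubini is applied a
    second time to isolate y.\<close>
  define H where "H p = (LINT x|lebesgue. g (x, p))" for p
  have Hi: "integrable lebesgue H" and HL: "(LINT p|lebesgue. H p) = (LINT z|lebesgue. g z)"
    using lebesgue_Fubini_snd[OF gi] by (simp_all add: H_def[abs_def])
  note F1 = lebesgue_Fubini_snd[OF Hi] and F0 = lebesgue_Fubini_snd[OF g0i]
  have sec: "0 \<le> (LINT t|lebesgue. H (t, y)) + (LINT x|lebesgue. g0 (x, y))" for y
  proof (cases "y \<in> Gam")
    case False
    then have "g (x, t, y) = 0" "g0 (x, y) = 0" for x t
      by (auto simp: g_def g0_def domT_def dom0_def)
    then show ?thesis by (simp add: H_def)
  next
    case y: True
    from bspec[OF visc[unfolded classical_viscous_sol_def] y] obtain Wt Wx Wxx :: "real \<times> real \<Rightarrow> real^2"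
      where w1: "continuous_on (UNIV \<times> {0..}) (\<lambda>(x, t). W (x, t, y))"
        "\<forall>x. W (x, 0, y) = W0 (x, y)" "continuous_on (UNIV \<times> {0<..}) Wt"
        "\<forall>x. \<forall>t>0. ((\<lambda>s. W (x, s, y)) has_vector_derivative Wt (x, t)) (at t) \<and>
          ((\<lambda>s. W (s, t, y)) has_vector_derivative Wx (x, t)) (at x) \<and>
          ((\<lambda>s. Wx (s, t)) has_vector_derivative Wxx (x, t)) (at x) \<and>
          Wt (x, t) + vector_derivative (\<lambda>s. F (W (s, t, y))) (at x)
            + (1 / \<epsilon>) *\<^sub>R st 0 (r (W (x, t, y))) = \<nu> *\<^sub>R Wxx (x, t)"
      by (elim conjE exE) (rule that)
    note w = w1(1) w1(2)[rule_format] w1(3)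
      w1(4)[rule_format, THEN conjunct1] w1(4)[rule_format, THEN conjunct2, THEN conjunct1]
      w1(4)[rule_format, THEN conjunct2, THEN conjunct2, THEN conjunct1]
      w1(4)[rule_format, THEN conjunct2, THEN conjunct2, THEN conjunct2]
    have inS: "W (x, t, y) \<in> S" if "0 \<le> t" for x t
      using that WS(1)[of "(x, t, y)"] WS(2)[of "(x, y)"] w(2)[of x] y
      by (cases "t = 0") (auto simp: domT_def dom0_def)
    let ?w = "\<lambda>(x, t). W (x, t, y)"
    have main: "0 \<le> integral {0..T} (\<lambda>t. integral {-R..R} (\<lambda>x. ?J (x, t, y)))
      + integral {-R..R} (\<lambda>x. ?I (x, y))"
      using viscous_entropy_section[of ?w Wt Wx Wxx \<epsilon> \<nu>] w inS \<epsilon> \<nu> by simp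
    have Wswap: "continuous_on ({0..} \<times> UNIV) (\<lambda>p. W (snd p, fst p, y))"
    proof -
      have *: "continuous_on ({0..} \<times> UNIV) (\<lambda>p::real \<times> real. (snd p, fst p))"
        "(\<lambda>p::real \<times> real. (snd p, fst p)) ` ({0..} \<times> UNIV) \<subseteq> UNIV \<times> {0..}"
        by (auto intro!: continuous_on_Pair continuous_on_fst continuous_on_snd continuous_on_id)
      show ?thesis using continuous_on_compose2[OF w(1) *] by simp
    qed
    have sub: "(\<lambda>p. W (snd p, fst p, y)) ` ({0..} \<times> UNIV) \<subseteq> S" using inS by auto
    note cW = continuous_on_compose2[OF continuous_entropy(1) Wswap sub]
      continuous_on_compose2[OF continuous_entropy(2) Wswap sub]
    have cX: "continuous_on A (\<lambda>p. h (snd p))" "continuous_on A (\<lambda>p. h (fst p))" if "continuous_on UNIV h"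
      for A :: "(real \<times> real) set" and h :: "real \<Rightarrow> real"
      by (rule continuous_on_compose2[OF that]; auto intro!: continuous_on_fst continuous_on_snd continuous_on_id)+
    have cJ: "continuous_on ({0..} \<times> {-R..R}) (\<lambda>(t, x). ?J (x, t, y))"
      unfolding case_prod_beta fst_conv snd_conv
      by (intro continuous_on_add continuous_on_mult continuous_on_const cX continuous_\<kappa> continuous_\<theta>
          continuous_on_subset[OF cW(1)] continuous_on_subset[OF cW(2)]) auto
    have cJt: "continuous_on {-R..R} (\<lambda>x. ?J (x, t, y))" if "0 \<le> t" for t
    proof -
      have *: "continuous_on {-R..R} (Pair t)" "Pair t ` {-R..R} \<subseteq> {0..} \<times> {-R..R}"
        using that by (auto intro!: continuous_on_Pair continuous_on_const continuous_on_id)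
      show ?thesis using continuous_on_compose2[OF cJ *] by simp
    qed
    have HK: "H (t, y) = (if 0 < t then integral {-R..R} (\<lambda>x. ?J (x, t, y)) * \<rho> y else 0)" for t
    proof (cases "0 < t")
      case True
      have "H (t, y) = (LINT x|lebesgue. ?J (x, t, y) * \<rho> y)"
        unfolding H_def g_def using True y by (simp add: domT_def)
      also have "\<dots> = integral {-R..R} (\<lambda>x. ?J (x, t, y) * \<rho> y)"
      proof (rule LINT_lebesgue_eq_integral)
        show "continuous_on {-R..R} (\<lambda>x. ?J (x, t, y) * \<rho> y)"
          using cJt[of t] True by (intro continuous_on_mult continuous_on_const) auto
        show "?J (x, t, y) * \<rho> y = 0" if "x \<notin> {-R..R}" for x
        proof -
          have "R \<le> \<bar>x\<bar>" using that by auto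
          then show ?thesis by (simp add: \<kappa>(5-7))
        qed
      qed
      also have "\<dots> = integral {-R..R} (\<lambda>x. ?J (x, t, y)) * \<rho> y" by (rule integral_mult_left)
      finally show ?thesis using True by simp
    next
      case False
      then show ?thesis by (simp add: H_def g_def domT_def)
    qed
    have cI: "continuous_on {0..T} (\<lambda>t. integral {-R..R} (\<lambda>x. ?J (x, t, y)))"
      using integral_continuous_on_param[of "{0..}" "-R" R, unfolded box_real, OF cJ]
      by (rule continuous_on_subset) auto
    have "(LINT t|lebesgue. H (t, y)) = (LINT t|lebesgue. indicat_real {0..T} t * (integral {-R..R} (\<lambda>x. ?J (x, t, y)) * \<rho> y))"
    proof (rule integral_cong_AE)
      show mH: "(\<lambda>t. indicat_real {0..T} t * (integral {-R..R} (\<lambda>x. ?J (x, t, y)) * \<rho> y)) \<in> borel_measurable lebesgue"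
      proof -
        have "(\<lambda>t. indicat_real {0..T} t *\<^sub>R (integral {-R..R} (\<lambda>x. ?J (x, t, y)) * \<rho> y)) \<in> borel_measurable borel"
          by (intro borel_measurable_continuous_on_indicator continuous_on_mult cI continuous_on_const) auto
        then show ?thesis by (intro measurable_completion) simp
      qed
      \<comment> \<open>At t = 0 the two sides may differ: \<open>domT\<close> excludes the initial
        time, while the indicator of [0, T] includes it.\<close>
      have ne: "AE t in lebesgue. t \<noteq> (0::real)"
        by (rule AE_completion) (rule AE_lborel_singleton)
      show ae: "AE t in lebesgue. H (t, y) = indicat_real {0..T} t * (integral {-R..R} (\<lambda>x. ?J (x, t, y)) * \<rho> y)"
        using ne
      proof eventually_elim
        case (elim t)
        have "T < t \<Longrightarrow> ?J (x, t, y) = 0" for x by (simp add: \<theta>(4,5))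
        then have "T < t \<Longrightarrow> integral {-R..R} (\<lambda>x. ?J (x, t, y)) = 0" by simp
        then show ?case using elim \<theta>(6) by (auto simp: HK indicator_def)
      qed
      show "(\<lambda>t. H (t, y)) \<in> borel_measurable lebesgue"
        by (rule borel_measurable_AE[OF mH]) (use ae in \<open>auto elim: eventually_mono\<close>)
    qed
    also have "\<dots> = integral {0..T} (\<lambda>t. indicat_real {0..T} t * (integral {-R..R} (\<lambda>x. ?J (x, t, y)) * \<rho> y))"
    proof (rule LINT_lebesgue_eq_integral)
      have "continuous_on {0..T} (\<lambda>t. integral {-R..R} (\<lambda>x. ?J (x, t, y)) * \<rho> y)"
        by (intro continuous_on_mult cI continuous_on_const)
      then show "continuous_on {0..T} (\<lambda>t. indicat_real {0..T} t * (integral {-R..R} (\<lambda>x. ?J (x, t, y)) * \<rho> y))"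
        by (rule continuous_on_eq) simp
    qed simp
    also have "\<dots> = integral {0..T} (\<lambda>t. integral {-R..R} (\<lambda>x. ?J (x, t, y)) * \<rho> y)"
      by (rule integral_cong) simp
    also have "\<dots> = integral {0..T} (\<lambda>t. integral {-R..R} (\<lambda>x. ?J (x, t, y))) * \<rho> y" by (rule integral_mult_left)
    finally have e1: "(LINT t|lebesgue. H (t, y)) = integral {0..T} (\<lambda>t. integral {-R..R} (\<lambda>x. ?J (x, t, y))) * \<rho> y" .
    have "continuous_on {-R..R} (\<lambda>x. \<eta> (W (x, 0, y)))"
    proof -
      have *: "continuous_on {-R..R} (Pair (0::real))" "Pair (0::real) ` {-R..R} \<subseteq> {0..} \<times> (UNIV :: real set)"
        by (auto intro!: continuous_on_Pair continuous_on_const continuous_on_id)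
      show ?thesis using continuous_on_compose2[OF cW(1) *] by simp
    qed
    then have c0: "continuous_on {-R..R} (\<lambda>x. ?I (x, y) * \<rho> y)"
      unfolding w(2) by (simp, intro continuous_on_mult continuous_\<kappa> continuous_on_const)
    have "(LINT x|lebesgue. g0 (x, y)) = (LINT x|lebesgue. ?I (x, y) * \<rho> y)"
      using y by (simp add: g0_def dom0_def)
    also have "\<dots> = integral {-R..R} (\<lambda>x. ?I (x, y) * \<rho> y)"
    proof (rule LINT_lebesgue_eq_integral[OF c0])
      show "?I (x, y) * \<rho> y = 0" if "x \<notin> {-R..R}" for x
      proof -
        have "R \<le> \<bar>x\<bar>" using that by auto
        then show ?thesis by (simp add: \<kappa>(5))
      qed
    qed
    also have "\<dots> = integral {-R..R} (\<lambda>x. ?I (x, y)) * \<rho> y" by (rule integral_mult_left)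
    finally have "(LINT x|lebesgue. g0 (x, y)) = integral {-R..R} (\<lambda>x. ?I (x, y)) * \<rho> y" .
    with e1 mult_nonneg_nonneg[OF main \<rho>(2)[OF y]] show ?thesis
      by (simp add: distrib_right)
  qed
  have "(LINT z|lebesgue_on domT. ?J z * \<rho> (snd (snd z))) = (LINT y|lebesgue. LINT t|lebesgue. H (t, y))"
    unfolding F1(3) HL by (simp add: integral_restrict_space g_def[abs_def])
  moreover have "(LINT p|lebesgue_on dom0. ?I p * \<rho> (snd p)) = (LINT y|lebesgue. LINT x|lebesgue. g0 (x, y))"
    unfolding F0(3) by (simp add: integral_restrict_space g0_def[abs_def])
  ultimately have "(LINT z|lebesgue_on domT. ?J z * \<rho> (snd (snd z))) + (LINT p|lebesgue_on dom0. ?I p * \<rho> (snd p))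
     = (LINT y|lebesgue. (LINT t|lebesgue. H (t, y)) + (LINT x|lebesgue. g0 (x, y)))"
    using Bochner_Integration.integral_add[OF F1(2) F0(2)] by simp
  also have "0 \<le> \<dots>" by (intro integral_nonneg_AE AE_I2 sec)
  finally show ?thesis .
qed

end


context entropy_cutoff
begin

lemma entropy_bounded:
  obtains B where "\<And>V. V \<in> S \<Longrightarrow> \<bar>\<eta> V\<bar> \<le> B" "\<And>V. V \<in> S \<Longrightarrow> \<bar>Q V\<bar> \<le> B"
proof -
  have bd: "\<exists>B. \<forall>V\<in>S. \<bar>g V\<bar> \<le> B" if "continuous_on S g" for g :: "real^2 \<Rightarrow> real"
    using compact_imp_bounded[OF compact_continuous_image[OF that S]] by (auto simp: bounded_iff)
  from bd[OF continuous_entropy(1)] obtain B1 where B1: "\<forall>V\<in>S. \<bar>\<eta> V\<bar> \<le> B1" by blast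
  from bd[OF continuous_entropy(2)] obtain B2 where B2: "\<forall>V\<in>S. \<bar>Q V\<bar> \<le> B2" by blast
  show ?thesis by (rule that[of "max B1 B2"]) (use B1 B2 in force)+
qed

text \<open>One limit lemma for two passages: vanishing viscosity at fixed \<epsilon>, where \<nu>
  tends to 0, and the relaxation limit, where it is applied with \<nu> = 0. Values in the compact
  set S bound \<eta> and Q, and every weight carries the factor \<rho>, so convergence where \<rho>
  is nonzero is enough.\<close>

lemma entropy_inequality_limit:
  fixes V :: "nat \<Rightarrow> real \<times> real \<times> (real^'n) \<Rightarrow> real^2" and V0 :: "nat \<Rightarrow> real \<times> (real^'n) \<Rightarrow> real^2"
    and U :: "real \<times> real \<times> (real^'n) \<Rightarrow> real^2" and U0 :: "real \<times> (real^'n) \<Rightarrow> real^2"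
    and \<rho> :: "real^'n \<Rightarrow> real" and \<nu> :: "nat \<Rightarrow> real"
  assumes \<rho>: "Linf Gam \<rho>"
    and V: "\<And>i. V i \<in> borel_measurable (lebesgue_on domT)" "\<And>i. AE z in lebesgue_on domT. V i z \<in> S"
    and V0: "\<And>i. V0 i \<in> borel_measurable (lebesgue_on dom0)" "\<And>i. AE z in lebesgue_on dom0. V0 i z \<in> S"
    and U: "U \<in> borel_measurable (lebesgue_on domT)" "AE z in lebesgue_on domT. U z \<in> S"
    and U0: "U0 \<in> borel_measurable (lebesgue_on dom0)" "AE z in lebesgue_on dom0. U0 z \<in> S"
    and lim: "AE z in lebesgue_on domT. \<rho> (snd (snd z)) \<noteq> 0 \<longrightarrow> (\<lambda>i. V i z) \<longlonglongrightarrow> U z"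
    and lim0: "AE p in lebesgue_on dom0. \<rho> (snd p) \<noteq> 0 \<longrightarrow> (\<lambda>i. V0 i p) \<longlonglongrightarrow> U0 p"
    and \<nu>: "\<nu> \<longlonglongrightarrow> 0"
    and ineq: "\<And>i. 0 \<le> (LINT z|lebesgue_on domT. (\<eta> (V i z) * \<kappa> (fst z) * \<theta>' (fst (snd z))
      + Q (V i z) * \<kappa>' (fst z) * \<theta> (fst (snd z)) + \<nu> i * \<eta> (V i z) * \<kappa>'' (fst z) * \<theta> (fst (snd z))) * \<rho> (snd (snd z)))
    + (LINT p|lebesgue_on dom0. \<eta> (V0 i p) * \<kappa> (fst p) * \<theta> 0 * \<rho> (snd p))"
  shows "0 \<le> (LINT z|lebesgue_on domT. (\<eta> (U z) * \<kappa> (fst z) * \<theta>' (fst (snd z))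
      + Q (U z) * \<kappa>' (fst z) * \<theta> (fst (snd z))) * \<rho> (snd (snd z)))
    + (LINT p|lebesgue_on dom0. \<eta> (U0 p) * \<kappa> (fst p) * \<theta> 0 * \<rho> (snd p))"
proof -
  obtain B where B: "\<And>V. V \<in> S \<Longrightarrow> \<bar>\<eta> V\<bar> \<le> B" "\<And>V. V \<in> S \<Longrightarrow> \<bar>Q V\<bar> \<le> B"
    using entropy_bounded by blast
  have Sb: "S \<in> sets borel" using S by (simp add: borel_closed compact_imp_closed)
  have mT: "(\<lambda>z. g (W z)) \<in> borel_measurable (lebesgue_on domT)"
    if "W \<in> borel_measurable (lebesgue_on domT)" "AE z in lebesgue_on domT. W z \<in> S" "continuous_on S g"
    for W :: "real \<times> real \<times> (real^'n) \<Rightarrow> real^2" and g :: "real^2 \<Rightarrow> real"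
    by (rule borel_measurable_compose_AE[OF _ that(1) Sb that(3) that(2)]) simp
  have m0: "(\<lambda>z. g (W z)) \<in> borel_measurable (lebesgue_on dom0)"
    if "W \<in> borel_measurable (lebesgue_on dom0)" "AE z in lebesgue_on dom0. W z \<in> S" "continuous_on S g"
    for W :: "real \<times> (real^'n) \<Rightarrow> real^2" and g :: "real^2 \<Rightarrow> real"
    by (rule borel_measurable_compose_AE[OF _ that(1) Sb that(3) that(2)]) simp
  have allT: "AE z in lebesgue_on domT. \<forall>i. V i z \<in> S" using V(2) by (simp add: AE_all_countable)
  have all0: "AE z in lebesgue_on dom0. \<forall>i. V0 i z \<in> S" using V0(2) by (simp add: AE_all_countable)
  define w1 w2 w3 w0 where
    "w1 z = (\<kappa> (fst z) * \<theta>' (fst (snd z))) * \<rho> (snd (snd z))" and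
    "w2 z = (\<kappa>' (fst z) * \<theta> (fst (snd z))) * \<rho> (snd (snd z))" and
    "w3 z = (\<kappa>'' (fst z) * \<theta> (fst (snd z))) * \<rho> (snd (snd z))" and
    "w0 p = (\<kappa> (fst p) * \<theta> 0) * \<rho> (snd p)" for z :: "real \<times> real \<times> (real^'n)" and p :: "real \<times> (real^'n)"
  have w: "integrable (lebesgue_on domT) w1" "integrable (lebesgue_on domT) w2"
    "integrable (lebesgue_on domT) w3" "integrable (lebesgue_on dom0) w0"
    unfolding w1_def[abs_def] w2_def[abs_def] w3_def[abs_def] w0_def[abs_def]
    using integrable_domT_product_kernel[OF \<rho> continuous_\<kappa>(1) continuous_\<theta>(2) \<kappa>(5) \<theta>(5)]
      integrable_domT_product_kernel[OF \<rho> continuous_\<kappa>(2) continuous_\<theta>(1) \<kappa>(6) \<theta>(4)]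
      integrable_domT_product_kernel[OF \<rho> continuous_\<kappa>(3) continuous_\<theta>(1) \<kappa>(7) \<theta>(4)]
      integrable_dom0_cutoff[OF \<rho>] by simp_all
  have LT: "(\<lambda>i. LINT z|lebesgue_on domT. g (V i z) * k z) \<longlonglongrightarrow> (LINT z|lebesgue_on domT. g (U z) * k z)"
    if g: "continuous_on S g" "\<And>V. V \<in> S \<Longrightarrow> \<bar>g V\<bar> \<le> B" and k: "integrable (lebesgue_on domT) k"
      "\<And>z. k z \<noteq> 0 \<Longrightarrow> \<rho> (snd (snd z)) \<noteq> 0" for g :: "real^2 \<Rightarrow> real" and k
  proof (rule bounded_convergence_weighted[OF k(1) mT[OF V g(1)] mT[OF U g(1)], where B = B])
    show "AE z in lebesgue_on domT. \<bar>g (V i z)\<bar> \<le> B" for i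
      using V(2)[of i] by eventually_elim (rule g(2))
    show "AE z in lebesgue_on domT. k z \<noteq> 0 \<longrightarrow> (\<lambda>i. g (V i z)) \<longlonglongrightarrow> g (U z)"
      using lim allT U(2)
    proof eventually_elim
      case (elim z)
      then show ?case
        using k(2)[of z] continuous_on_tendsto_compose[OF g(1), of "\<lambda>i. V i z" "U z" sequentially] by auto
    qed
  qed
  have L0: "(\<lambda>i. LINT z|lebesgue_on dom0. \<eta> (V0 i z) * w0 z) \<longlonglongrightarrow> (LINT z|lebesgue_on dom0. \<eta> (U0 z) * w0 z)"
  proof (rule bounded_convergence_weighted[OF w(4) m0[OF V0 continuous_entropy(1)] m0[OF U0 continuous_entropy(1)], where B = B])
    show "AE z in lebesgue_on dom0. \<bar>\<eta> (V0 i z)\<bar> \<le> B" for i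
      using V0(2)[of i] by eventually_elim (rule B(1))
    show "AE z in lebesgue_on dom0. w0 z \<noteq> 0 \<longrightarrow> (\<lambda>i. \<eta> (V0 i z)) \<longlonglongrightarrow> \<eta> (U0 z)"
      using lim0 all0 U0(2)
    proof eventually_elim
      case (elim z)
      then show ?case
        using continuous_on_tendsto_compose[OF continuous_entropy(1), of "\<lambda>i. V0 i z" "U0 z" sequentially]
        by (auto simp: w0_def)
    qed
  qed
  have l1: "(\<lambda>i. LINT z|lebesgue_on domT. \<eta> (V i z) * w1 z) \<longlonglongrightarrow> (LINT z|lebesgue_on domT. \<eta> (U z) * w1 z)"
    by (rule LT[OF continuous_entropy(1) B(1) w(1)]) (auto simp: w1_def)
  have l2: "(\<lambda>i. LINT z|lebesgue_on domT. Q (V i z) * w2 z) \<longlonglongrightarrow> (LINT z|lebesgue_on domT. Q (U z) * w2 z)"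
    by (rule LT[OF continuous_entropy(2) B(2) w(2)]) (auto simp: w2_def)
  have l3: "(\<lambda>i. LINT z|lebesgue_on domT. \<eta> (V i z) * w3 z) \<longlonglongrightarrow> (LINT z|lebesgue_on domT. \<eta> (U z) * w3 z)"
    by (rule LT[OF continuous_entropy(1) B(1) w(3)]) (auto simp: w3_def)
  have int: "integrable (lebesgue_on domT) (\<lambda>z. g (W z) * k z)"
    if "W \<in> borel_measurable (lebesgue_on domT)" "AE z in lebesgue_on domT. W z \<in> S"
      "continuous_on S g" "\<And>V. V \<in> S \<Longrightarrow> \<bar>g V\<bar> \<le> B" "integrable (lebesgue_on domT) k"
    for W :: "real \<times> real \<times> (real^'n) \<Rightarrow> real^2" and g :: "real^2 \<Rightarrow> real" and k
    by (rule integrable_mult_bounded[OF that(5) mT[OF that(1-3)], where B = B]) (use that(2,4) in \<open>auto elim: eventually_mono\<close>)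
  note i1 = int[OF _ _ continuous_entropy(1) B(1) w(1)] and i2 = int[OF _ _ continuous_entropy(2) B(2) w(2)]
    and i3 = int[OF _ _ continuous_entropy(1) B(1) w(3)]
  have eq: "(LINT z|lebesgue_on domT. (\<eta> (W z) * \<kappa> (fst z) * \<theta>' (fst (snd z))
      + Q (W z) * \<kappa>' (fst z) * \<theta> (fst (snd z)) + n * \<eta> (W z) * \<kappa>'' (fst z) * \<theta> (fst (snd z))) * \<rho> (snd (snd z)))
     = (LINT z|lebesgue_on domT. \<eta> (W z) * w1 z) + (LINT z|lebesgue_on domT. Q (W z) * w2 z)
       + n * (LINT z|lebesgue_on domT. \<eta> (W z) * w3 z)"
    if "W \<in> borel_measurable (lebesgue_on domT)" "AE z in lebesgue_on domT. W z \<in> S"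
    for W :: "real \<times> real \<times> (real^'n) \<Rightarrow> real^2" and n
  proof -
    have "(\<lambda>z. (\<eta> (W z) * \<kappa> (fst z) * \<theta>' (fst (snd z))
      + Q (W z) * \<kappa>' (fst z) * \<theta> (fst (snd z)) + n * \<eta> (W z) * \<kappa>'' (fst z) * \<theta> (fst (snd z))) * \<rho> (snd (snd z)))
      = (\<lambda>z. \<eta> (W z) * w1 z + Q (W z) * w2 z + n * (\<eta> (W z) * w3 z))"
      by (auto simp: w1_def w2_def w3_def algebra_simps)
    then show ?thesis using i1[OF that] i2[OF that] i3[OF that] by simp
  qed
  have e0: "(LINT p|lebesgue_on dom0. \<eta> (W p) * \<kappa> (fst p) * \<theta> 0 * \<rho> (snd p)) = (LINT p|lebesgue_on dom0. \<eta> (W p) * w0 p)" for W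
    by (simp add: w0_def mult.assoc)
  have lm: "(\<lambda>i. (LINT z|lebesgue_on domT. \<eta> (V i z) * w1 z) + (LINT z|lebesgue_on domT. Q (V i z) * w2 z)
       + \<nu> i * (LINT z|lebesgue_on domT. \<eta> (V i z) * w3 z) + (LINT z|lebesgue_on dom0. \<eta> (V0 i z) * w0 z))
     \<longlonglongrightarrow> (LINT z|lebesgue_on domT. \<eta> (U z) * w1 z) + (LINT z|lebesgue_on domT. Q (U z) * w2 z)
       + 0 * (LINT z|lebesgue_on domT. \<eta> (U z) * w3 z) + (LINT z|lebesgue_on dom0. \<eta> (U0 z) * w0 z)"
    by (intro tendsto_intros l1 l2 l3 L0 \<nu>)
  have nn: "0 \<le> (LINT z|lebesgue_on domT. \<eta> (V i z) * w1 z) + (LINT z|lebesgue_on domT. Q (V i z) * w2 z)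
       + \<nu> i * (LINT z|lebesgue_on domT. \<eta> (V i z) * w3 z) + (LINT z|lebesgue_on dom0. \<eta> (V0 i z) * w0 z)" for i
    using ineq[of i] unfolding eq[OF V] e0 .
  have "0 \<le> (LINT z|lebesgue_on domT. \<eta> (U z) * w1 z) + (LINT z|lebesgue_on domT. Q (U z) * w2 z)
       + 0 * (LINT z|lebesgue_on domT. \<eta> (U z) * w3 z) + (LINT z|lebesgue_on dom0. \<eta> (U0 z) * w0 z)"
    by (rule LIMSEQ_le_const[OF lm]) (use nn in blast)
  then show ?thesis unfolding eq[OF U, of 0, symmetric] e0 by simp
qed

end

lemma tendsto_Lp_loc_compose:
  assumes "tendsto_Lp_loc p w S G g Fl" "filterlim s Fl F'"
  shows "tendsto_Lp_loc p w S (\<lambda>i. G (s i)) g F'"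
  unfolding tendsto_Lp_loc_def
proof (intro allI impI)
  fix C assume "compact C \<and> C \<subseteq> S"
  with assms(1) have "((\<lambda>i. \<integral>\<^sup>+ z. ennreal (norm (G i z - g z) powr p * w z) \<partial>lebesgue_on C) \<longlongrightarrow> 0) Fl"
    unfolding tendsto_Lp_loc_def by blast
  from filterlim_compose[OF this assms(2)]
  show "((\<lambda>i. \<integral>\<^sup>+ z. ennreal (norm (G (s i) z - g z) powr p * w z) \<partial>lebesgue_on C) \<longlongrightarrow> 0) F'" .
qed

text \<open>Compact subsets of \<open>domT\<close> stay away from t = 0; the lower time bound 1 / (j
  + 1) accounts for that and is also defined for j = 0.\<close>

lemma domT_exhaustion:
  fixes C :: "nat \<Rightarrow> (real \<times> real \<times> (real^'n)) set"
  assumes "C = (\<lambda>j. {- real j..real j} \<times> {1 / (real j + 1)..real j} \<times> Gam)"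
  shows "compact (C j)" "i \<le> j \<Longrightarrow> C i \<subseteq> C j" "domT = (\<Union>j. C j)"
proof -
  show "compact (C j)" unfolding assms by (intro compact_Times compact_Gam) auto
  show "C i \<subseteq> C j" if "i \<le> j"
  proof -
    have "1 / (real j + 1) \<le> 1 / (real i + 1)" using that by (intro divide_left_mono) auto
    then show ?thesis using that unfolding assms by (auto intro: order.trans)
  qed
  show "domT = (\<Union>j. C j)"
  proof (rule set_eqI)
    fix z :: "real \<times> real \<times> (real^'n)"
    obtain x t y where z: "z = (x, t, y)" by (cases z) auto
    show "z \<in> domT \<longleftrightarrow> z \<in> (\<Union>j. C j)"
    proof
      assume "z \<in> domT"
      then have t: "0 < t" and y: "y \<in> Gam" by (auto simp: z domT_def)
      obtain j where j: "max \<bar>x\<bar> (max t (1 / t)) < real j" using reals_Archimedean2 by blast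
      have "1 < t * real j" using j t by (simp add: field_simps)
      then have "1 / (real j + 1) \<le> t" using t by (simp add: field_simps)
      then have "z \<in> C j" using j y unfolding assms z by auto
      then show "z \<in> (\<Union>j. C j)" by blast
    next
      assume "z \<in> (\<Union>j. C j)"
      then obtain j where "z \<in> C j" by blast
      then have "1 / (real j + 1) \<le> t" "y \<in> Gam" unfolding assms z by auto
      moreover have "0 < 1 / (real j + 1)" by simp
      ultimately have "0 < t" by linarith
      then show "z \<in> domT" using \<open>y \<in> Gam\<close> unfolding z domT_def by auto
    qed
  qed
qed

lemma dom0_exhaustion:
  fixes C :: "nat \<Rightarrow> (real \<times> (real^'n)) set"
  assumes "C = (\<lambda>j. {- real j..real j} \<times> Gam)"
  shows "compact (C j)" "i \<le> j \<Longrightarrow> C i \<subseteq> C j" "dom0 = (\<Union>j. C j)"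
proof -
  show "compact (C j)" unfolding assms by (intro compact_Times compact_Gam) auto
  show "i \<le> j \<Longrightarrow> C i \<subseteq> C j" unfolding assms by (auto intro: order.trans)
  show "dom0 = (\<Union>j. C j)"
  proof (rule set_eqI)
    fix z :: "real \<times> (real^'n)"
    obtain x y where z: "z = (x, y)" by (cases z) auto
    obtain j where j: "\<bar>x\<bar> < real j" using reals_Archimedean2 by blast
    then have "y \<in> Gam \<Longrightarrow> z \<in> C j" unfolding assms z by auto
    then show "z \<in> dom0 \<longleftrightarrow> z \<in> (\<Union>j. C j)" unfolding z assms dom0_def by auto
  qed
qed

lemma smooth_on_borel_measurable:
  fixes W :: "'a::euclidean_space \<Rightarrow> 'b::euclidean_space"
  assumes "smooth_on S W" "S \<in> sets lebesgue"
  shows "W \<in> borel_measurable (lebesgue_on S)"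
proof -
  from assms(1) obtain h where h: "smooth h" "\<And>z. z \<in> S \<Longrightarrow> h z = W z" by (auto simp: smooth_on_def)
  have "h \<in> borel_measurable (lebesgue_on S)"
    by (intro borel_measurable_lebesgue_onI borel_measurable_continuous_onI smooth_imp_continuous_on h(1))
  then show ?thesis
    by (subst measurable_cong[of _ _ h]) (auto simp: h(2)[symmetric])
qed

text \<open>The hypotheses give convergence with weight \<rho>^2 in space-time and \<rho> at the
  initial time. Both weights are nonzero at the same y, so a common subsequence converges almost
  everywhere where \<rho> does not vanish, which is all that the limit lemma asks for.\<close>

lemma (in entropy_cutoff) entropy_inequality_vanishing_viscosity:
  fixes W :: "real \<Rightarrow> real \<times> real \<times> (real^'n) \<Rightarrow> real^2" and W0 :: "real \<Rightarrow> real \<times> (real^'n) \<Rightarrow> real^2"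
    and U :: "real \<times> real \<times> (real^'n) \<Rightarrow> real^2" and U0 :: "real \<times> (real^'n) \<Rightarrow> real^2"
    and \<rho> :: "real^'n \<Rightarrow> real"
  assumes \<rho>: "Linf Gam \<rho>" "\<And>y. y \<in> Gam \<Longrightarrow> 0 \<le> \<rho> y" and \<epsilon>: "0 < \<epsilon>"
    and W: "\<And>\<nu>. 0 < \<nu> \<Longrightarrow> smooth_on dom0 (W0 \<nu>)" "\<And>\<nu>. 0 < \<nu> \<Longrightarrow> W \<nu> \<in> borel_measurable (lebesgue_on domT)"
      "\<And>\<nu>. 0 < \<nu> \<Longrightarrow> classical_viscous_sol F r \<epsilon> \<nu> (W0 \<nu>) (W \<nu>)"
      "\<And>\<nu> z. 0 < \<nu> \<Longrightarrow> z \<in> dom0 \<Longrightarrow> W0 \<nu> z \<in> S" "\<And>\<nu> z. 0 < \<nu> \<Longrightarrow> z \<in> domT \<Longrightarrow> W \<nu> z \<in> S"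
    and lim: "tendsto_Lp_loc 1 (\<lambda>(x, y). \<rho> y) dom0 W0 U0 (at_right 0)"
      "tendsto_Lp_loc 1 (\<lambda>(x, t, y). (\<rho> y)\<^sup>2) domT W U (at_right 0)"
    and U: "U \<in> borel_measurable (lebesgue_on domT)" "AE z in lebesgue_on domT. U z \<in> S"
    and U0: "U0 \<in> borel_measurable (lebesgue_on dom0)" "AE z in lebesgue_on dom0. U0 z \<in> S"
  shows "0 \<le> (LINT z|lebesgue_on domT. (\<eta> (U z) * \<kappa> (fst z) * \<theta>' (fst (snd z))
      + Q (U z) * \<kappa>' (fst z) * \<theta> (fst (snd z))) * \<rho> (snd (snd z)))
    + (LINT p|lebesgue_on dom0. \<eta> (U0 p) * \<kappa> (fst p) * \<theta> 0 * \<rho> (snd p))"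
proof -
  have \<rho>m: "\<rho> \<in> borel_measurable (lebesgue_on Gam)" using \<rho>(1) by (simp add: Linf_def)
  define s where "s i = inverse (real (Suc i))" for i
  have s0: "0 < s i" for i by (simp add: s_def)
  have sl: "s \<longlonglongrightarrow> 0" unfolding s_def by (rule LIMSEQ_inverse_real_of_nat)
  then have sf: "filterlim s (at_right 0) sequentially"
    using s0 less_imp_neq[OF s0] by (auto simp: filterlim_at intro!: always_eventually)
  have W0m: "W0 (s i) \<in> borel_measurable (lebesgue_on dom0)" for i
    by (rule smooth_on_borel_measurable[OF W(1)[OF s0]]) simp
  have w0: "(\<lambda>(x, y). \<rho> y) \<in> borel_measurable (lebesgue_on dom0)"
    using borel_measurable_lift_Gam(1)[OF \<rho>m] by (simp add: case_prod_beta')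
  have wT: "(\<lambda>(x, t, y). (\<rho> y)\<^sup>2) \<in> borel_measurable (lebesgue_on domT)"
    using borel_measurable_power[OF borel_measurable_lift_Gam(2)[OF \<rho>m], of 2] by (simp add: case_prod_beta')
  obtain \<tau> where \<tau>: "strict_mono \<tau>"
    "AE z in lebesgue_on domT. (case z of (x, t, y) \<Rightarrow> (\<rho> y)\<^sup>2) \<noteq> 0 \<longrightarrow> (\<lambda>k. W (s (\<tau> k)) z) \<longlonglongrightarrow> U z"
    by (rule AE_subseq_of_tendsto_Lp_loc[OF tendsto_Lp_loc_compose[OF lim(2) sf] W(2)[OF s0] U(1) wT _
        domT_exhaustion[OF refl]]) (auto simp: domT_def)
  have \<tau>f: "filterlim \<tau> sequentially sequentially" by (rule filterlim_subseq[OF \<tau>(1)])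
  \<comment> \<open>The second extraction is made within the first, so that one sequence of
    viscosities serves both the solutions and their data.\<close>
  obtain \<tau>' where \<tau>': "strict_mono \<tau>'"
    "AE z in lebesgue_on dom0. (case z of (x, y) \<Rightarrow> \<rho> y) \<noteq> 0 \<longrightarrow> (\<lambda>k. W0 (s (\<tau> (\<tau>' k))) z) \<longlonglongrightarrow> U0 z"
    by (rule AE_subseq_of_tendsto_Lp_loc[OF tendsto_Lp_loc_compose[OF tendsto_Lp_loc_compose[OF lim(1) sf] \<tau>f]
         W0m U0(1) w0 _ dom0_exhaustion[OF refl]]) (auto simp: dom0_def \<rho>(2))
  have \<tau>'f: "filterlim \<tau>' sequentially sequentially" by (rule filterlim_subseq[OF \<tau>'(1)])
  let ?s = "\<lambda>k. s (\<tau> (\<tau>' k))"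
  show ?thesis
  proof (rule entropy_inequality_limit[OF \<rho>(1), of "\<lambda>k. W (?s k)" "\<lambda>k. W0 (?s k)" U U0 ?s])
    show "W (?s i) \<in> borel_measurable (lebesgue_on domT)" for i by (rule W(2)[OF s0])
    show "AE z in lebesgue_on domT. W (?s i) z \<in> S" for i
      unfolding AE_domT_iff by (intro AE_I2 impI W(5)[OF s0])
    show "W0 (?s i) \<in> borel_measurable (lebesgue_on dom0)" for i by (rule W0m)
    show "AE z in lebesgue_on dom0. W0 (?s i) z \<in> S" for i
      unfolding AE_dom0_iff by (intro AE_I2 impI W(4)[OF s0])
    show "AE z in lebesgue_on domT. \<rho> (snd (snd z)) \<noteq> 0 \<longrightarrow> (\<lambda>i. W (?s i) z) \<longlonglongrightarrow> U z"
      using \<tau>(2)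
    proof eventually_elim
      case (elim z)
      show ?case
      proof
        assume "\<rho> (snd (snd z)) \<noteq> 0"
        with elim have "(\<lambda>k. W (s (\<tau> k)) z) \<longlonglongrightarrow> U z" by (auto simp: case_prod_beta')
        from filterlim_compose[OF this \<tau>'f] show "(\<lambda>i. W (?s i) z) \<longlonglongrightarrow> U z" .
      qed
    qed
    show "AE p in lebesgue_on dom0. \<rho> (snd p) \<noteq> 0 \<longrightarrow> (\<lambda>i. W0 (?s i) p) \<longlonglongrightarrow> U0 p"
      using \<tau>'(2) by eventually_elim (simp add: case_prod_beta')
    show "?s \<longlonglongrightarrow> 0"
      using filterlim_compose[OF filterlim_compose[OF sl \<tau>f] \<tau>'f] .
  qed (use U U0 viscous_entropy_domT[OF W(2)[OF s0] W0m W(5)[OF s0] W(4)[OF s0] W(3)[OF s0] \<epsilon> s0 \<rho>] in auto)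
qed

subsection \<open>Integrals of products of a function of time and a function of the data variables\<close>

text \<open>With this factorisation the mass of the time cutoff separates from the integral over (x,
  y). The indicator of positive times belongs to the time factor because \<open>domT\<close> carries
  the constraint t > 0.\<close>

lemma domT_integral_product:
  fixes k :: "real \<Rightarrow> real" and b :: "real \<times> (real^'n) \<Rightarrow> real"
  assumes k: "integrable lborel (\<lambda>t. indicat_real {0<..} t * k t)" and b: "integrable (lebesgue_on dom0) b"
  shows "integrable (lebesgue_on domT) (\<lambda>z. k (fst (snd z)) * b (fst z, snd (snd z)))"
    and "(LINT z|lebesgue_on domT. k (fst (snd z)) * b (fst z, snd (snd z)))
      = (LINT t|lborel. indicat_real {0<..} t * k t) * (LINT p|lebesgue_on dom0. b p)"
proof -
  let ?k = "\<lambda>t. indicat_real {0<..} t * k t"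
  have bi: "integrable lebesgue (\<lambda>p. indicat_real dom0 p * b p)"
    using b by (simp add: integrable_restrict_space)
  from completion_ex_borel_measurable_real[of "\<lambda>p. indicat_real dom0 p * b p" lborel] bi
  obtain b' where b': "b' \<in> borel_measurable lborel" "AE p in lborel. indicat_real dom0 p * b p = b' p"
    by (auto simp: borel_measurable_integrable)
  have b'c: "b' \<in> borel_measurable lebesgue" using b'(1) by (rule measurable_completion)
  have aec: "AE p in lebesgue. indicat_real dom0 p * b p = b' p" using b'(2) by (rule AE_completion)
  have "integrable lebesgue b'"
    using bi aec b'c by (subst integrable_cong_AE[of _ _ "\<lambda>p. indicat_real dom0 p * b p"]) (auto elim: eventually_mono)
  then have b'i: "integrable lborel b'" using b'(1) by (simp add: integrable_completion)
  have b'L: "(LINT p|lborel. b' p) = (LINT p|lebesgue_on dom0. b p)"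
  proof -
    have "(LINT p|lebesgue_on dom0. b p) = (LINT p|lebesgue. indicat_real dom0 p * b p)"
      by (simp add: integral_restrict_space)
    also have "\<dots> = (LINT p|lebesgue. b' p)"
      by (rule integral_cong_AE) (use bi b'c aec in auto)
    finally show ?thesis using b'(1) by (simp add: integral_completion)
  qed
  let ?G = "\<lambda>z::real \<times> real \<times> (real^'n). ?k (fst (snd z)) * b' (fst z, snd (snd z))"
  note G = lborel_integral_insert_middle[OF k b'i]
  have Gb: "?G \<in> borel_measurable lborel" using borel_measurable_integrable[OF G(1)] .
  have Gc: "?G \<in> borel_measurable lebesgue" using Gb by (rule measurable_completion)
  have ae: "AE z in lebesgue. ?G z = indicat_real domT z * (k (fst (snd z)) * b (fst z, snd (snd z)))"
  proof (rule AE_completion)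
    show "AE z in lborel. ?G z = indicat_real domT z * (k (fst (snd z)) * b (fst z, snd (snd z)))"
      using AE_lborel_insert_middle[OF b'(2), where 'b = real]
    proof eventually_elim
      case (elim z)
      have "indicat_real domT z = indicat_real {0<..} (fst (snd z)) * indicat_real dom0 (fst z, snd (snd z))"
        by (cases z) (auto simp: domT_def dom0_def indicator_def)
      with elim show ?case by (simp add: mult_ac)
    qed
  qed
  have m: "(\<lambda>z. indicat_real domT z * (k (fst (snd z)) * b (fst z, snd (snd z)))) \<in> borel_measurable lebesgue"
    by (rule borel_measurable_AE[OF Gc ae])
  have "integrable lebesgue ?G" using G(1) Gb by (simp add: integrable_completion)
  then have "integrable lebesgue (\<lambda>z. indicat_real domT z * (k (fst (snd z)) * b (fst z, snd (snd z))))"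
    using ae m Gc by (subst integrable_cong_AE[of _ _ ?G]) (auto elim: eventually_mono)
  then show "integrable (lebesgue_on domT) (\<lambda>z. k (fst (snd z)) * b (fst z, snd (snd z)))"
    by (simp add: integrable_restrict_space)
  have "(LINT z|lebesgue_on domT. k (fst (snd z)) * b (fst z, snd (snd z)))
     = (LINT z|lebesgue. indicat_real domT z * (k (fst (snd z)) * b (fst z, snd (snd z))))"
    by (simp add: integral_restrict_space)
  also have "\<dots> = (LINT z|lebesgue. ?G z)"
    by (rule integral_cong_AE) (use m Gc ae in \<open>auto elim: eventually_mono\<close>)
  also have "\<dots> = (LINT z|lborel. ?G z)" by (rule integral_completion[OF Gb])
  also have "\<dots> = (LINT t|lborel. ?k t) * (LINT p|lborel. b' p)" by (rule G(2))
  finally show "(LINT z|lebesgue_on domT. k (fst (snd z)) * b (fst z, snd (snd z)))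
      = (LINT t|lborel. ?k t) * (LINT p|lebesgue_on dom0. b p)" by (simp add: b'L)
qed

text \<open>The spatial factor is supported in the interval [-R, R] and the temporal factor is a
  bump in 2 - t / T, so the layer ends at t = 2T. The second derivative in x involves members 3 and
  4 of the flat family.\<close>

lemma product_cutoff_bump:
  assumes R: "0 < R" and T: "0 < T"
  shows "product_cutoff (\<lambda>x. bump (R\<^sup>2 - x\<^sup>2)) (\<lambda>x. - 2 * x * flat_exp 2 (R\<^sup>2 - x\<^sup>2))
     (\<lambda>x. - 2 * flat_exp 2 (R\<^sup>2 - x\<^sup>2) + 4 * x\<^sup>2 * (flat_exp 4 (R\<^sup>2 - x\<^sup>2) - 2 * flat_exp 3 (R\<^sup>2 - x\<^sup>2)))
     (\<lambda>t. bump (2 - t / T)) (\<lambda>t. - flat_exp 2 (2 - t / T) / T) R (2 * T)"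
proof
  have ev: "((\<lambda>x. flat_exp k (R\<^sup>2 - x\<^sup>2)) has_real_derivative
      (flat_exp (k + 2) (R\<^sup>2 - x\<^sup>2) - real k * flat_exp (k + 1) (R\<^sup>2 - x\<^sup>2)) * (- 2 * x)) (at x)" for k x
    by (rule DERIV_chain2[OF flat_exp_has_derivative]) (auto intro!: derivative_eq_intros)
  show "((\<lambda>x. bump (R\<^sup>2 - x\<^sup>2)) has_real_derivative - 2 * x * flat_exp 2 (R\<^sup>2 - x\<^sup>2)) (at x)" for x
    using ev[of 0 x] by (simp add: numeral_2_eq_2 mult_ac)
  have "((\<lambda>x. (- 2 * x) * flat_exp 2 (R\<^sup>2 - x\<^sup>2)) has_real_derivative
      (- 2) * flat_exp 2 (R\<^sup>2 - x\<^sup>2) + (flat_exp (2 + 2) (R\<^sup>2 - x\<^sup>2) - real 2 * flat_exp (2 + 1) (R\<^sup>2 - x\<^sup>2)) * (- 2 * x) * (- 2 * x)) (at x)" for x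
    by (rule DERIV_mult[OF _ ev]) (auto intro!: derivative_eq_intros)
  then show "((\<lambda>x. - 2 * x * flat_exp 2 (R\<^sup>2 - x\<^sup>2)) has_real_derivative
      - 2 * flat_exp 2 (R\<^sup>2 - x\<^sup>2) + 4 * x\<^sup>2 * (flat_exp 4 (R\<^sup>2 - x\<^sup>2) - 2 * flat_exp 3 (R\<^sup>2 - x\<^sup>2))) (at x)" for x
    by (simp add: power2_eq_square algebra_simps eval_nat_numeral)
  have cf: "continuous_on UNIV (\<lambda>x. flat_exp k (R\<^sup>2 - x\<^sup>2))" "continuous_on UNIV (\<lambda>t. flat_exp k (2 - t / T))" for k
    by (rule continuous_on_compose2[OF continuous_flat_exp[of UNIV]]; use T in \<open>auto intro!: continuous_intros\<close>)+
  show "continuous_on UNIV (\<lambda>x. - 2 * flat_exp 2 (R\<^sup>2 - x\<^sup>2) + 4 * x\<^sup>2 * (flat_exp 4 (R\<^sup>2 - x\<^sup>2) - 2 * flat_exp 3 (R\<^sup>2 - x\<^sup>2)))"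
    by (intro continuous_on_add continuous_on_mult continuous_on_diff continuous_on_const cf continuous_on_power continuous_on_id)
  have z: "R\<^sup>2 - x\<^sup>2 \<le> 0" if "R \<le> \<bar>x\<bar>" for x
    using that R by (simp add: abs_le_square_iff[symmetric])
  show "bump (R\<^sup>2 - x\<^sup>2) = 0" "- 2 * x * flat_exp 2 (R\<^sup>2 - x\<^sup>2) = 0"
    "- 2 * flat_exp 2 (R\<^sup>2 - x\<^sup>2) + 4 * x\<^sup>2 * (flat_exp 4 (R\<^sup>2 - x\<^sup>2) - 2 * flat_exp 3 (R\<^sup>2 - x\<^sup>2)) = 0" if "R \<le> \<bar>x\<bar>" for x
    using z[OF that] by (simp_all add: flat_exp_eq_0)
  have "((\<lambda>t. bump (2 - t / T)) has_real_derivative flat_exp 2 (2 - t / T) * (- (1 / T))) (at t)" for t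
    by (rule DERIV_chain2[OF bump_has_derivative]) (use T in \<open>auto intro!: derivative_eq_intros\<close>)
  then show "((\<lambda>t. bump (2 - t / T)) has_real_derivative - flat_exp 2 (2 - t / T) / T) (at t)" for t by simp
  show "continuous_on UNIV (\<lambda>t. - flat_exp 2 (2 - t / T) / T)"
    using T by (intro continuous_on_divide continuous_on_minus continuous_on_const cf) auto
  have z2: "2 - t / T \<le> 0" if "2 * T \<le> t" for t using that T by (simp add: field_simps)
  show "bump (2 - t / T) = 0" "- flat_exp 2 (2 - t / T) / T = 0" if "2 * T \<le> t" for t
    using z2[OF that] by (simp_all add: flat_exp_eq_0)
qed (use assms in \<open>auto simp: flat_exp_nonneg\<close>)


subsection \<open>Attainment of the initial data\<close>

text \<open>The scaling that drives the trace argument: minus the time derivative of the cutoff has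
  mass \<open>bump 2\<close>, the value of the cutoff at t = 0, for every T, whereas the cutoff
  itself has mass at most 2T.\<close>

lemma time_cutoff_integrals:
  assumes T: "0 < T"
  shows "integrable lborel (\<lambda>t. indicat_real {0<..} t * (flat_exp 2 (2 - t / T) / T))"
    and "(LINT t|lborel. indicat_real {0<..} t * (flat_exp 2 (2 - t / T) / T)) = bump 2"
    and "integrable lborel (\<lambda>t. indicat_real {0<..} t * bump (2 - t / T))"
    and "0 \<le> (LINT t|lborel. indicat_real {0<..} t * bump (2 - t / T))"
    and "(LINT t|lborel. indicat_real {0<..} t * bump (2 - t / T)) \<le> 2 * T"
proof -
  interpret c: product_cutoff "\<lambda>x. bump (1\<^sup>2 - x\<^sup>2)" "\<lambda>x. - 2 * x * flat_exp 2 (1\<^sup>2 - x\<^sup>2)"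
     "\<lambda>x. - 2 * flat_exp 2 (1\<^sup>2 - x\<^sup>2) + 4 * x\<^sup>2 * (flat_exp 4 (1\<^sup>2 - x\<^sup>2) - 2 * flat_exp 3 (1\<^sup>2 - x\<^sup>2))"
     "\<lambda>t. bump (2 - t / T)" "\<lambda>t. - flat_exp 2 (2 - t / T) / T" 1 "2 * T"
    by (rule product_cutoff_bump) (use T in auto)
  have [measurable]: "(\<lambda>t. flat_exp k (2 - t / T)) \<in> borel_measurable borel" for k by measurable
  let ?k = "\<lambda>t. flat_exp 2 (2 - t / T) / T"
  have kc: "continuous_on UNIV ?k" using c.\<theta>(2) continuous_on_minus[of UNIV "\<lambda>t. - flat_exp 2 (2 - t / T) / T"] by simp
  have "has_bochner_integral lborel (\<lambda>t. ?k t * indicator {0..2 * T} t)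
      (- bump (2 - (2 * T) / T) - (- bump (2 - 0 / T)))"
  proof (rule has_bochner_integral_FTC_Icc_real)
    show "((\<lambda>t. - bump (2 - t / T)) has_real_derivative ?k t) (at t)" for t
      using DERIV_minus[OF c.\<theta>(1)[of t]] by simp
    show "isCont ?k t" for t using kc by (simp add: continuous_on_eq_continuous_at)
  qed (use T in simp)
  then have h: "has_bochner_integral lborel (\<lambda>t. ?k t * indicator {0..2 * T} t) (bump 2)"
    using T by (simp add: flat_exp_eq_0)
  have ae: "AE t in lborel. indicat_real {0<..} t * ?k t = ?k t * indicator {0..2 * T} t"
    using AE_lborel_singleton[of 0]
  proof eventually_elim
    case (elim t)
    have "2 * T < t \<Longrightarrow> ?k t = 0" using c.\<theta>(5)[of t] by simp
    with elim show ?case by (auto simp: indicator_def)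
  qed
  show "integrable lborel (\<lambda>t. indicat_real {0<..} t * ?k t)"
    by (subst integrable_cong_AE[OF _ _ ae]) (use h in \<open>auto simp: has_bochner_integral_iff\<close>)
  show "(LINT t|lborel. indicat_real {0<..} t * ?k t) = bump 2"
    by (subst integral_cong_AE[OF _ _ ae]) (use h in \<open>auto simp: has_bochner_integral_iff\<close>)
  have b: "0 \<le> indicat_real {0<..} t * bump (2 - t / T)"
    "indicat_real {0<..} t * bump (2 - t / T) \<le> indicator {0..2 * T} t" for t
    using c.\<theta>(4)[of t] bump_less_1[of "2 - t / T"] flat_exp_nonneg[of 0 "2 - t / T"]
    by (auto simp: indicator_def not_le less_imp_le)
  have i2: "integrable lborel (indicat_real {0..2 * T})" by (rule integrable_real_indicator) (use T in auto)
  show i1: "integrable lborel (\<lambda>t. indicat_real {0<..} t * bump (2 - t / T))"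
    by (rule Bochner_Integration.integrable_bound[OF i2]) (use b in \<open>auto simp del: abs_mult\<close>)
  show "0 \<le> (LINT t|lborel. indicat_real {0<..} t * bump (2 - t / T))"
    by (intro integral_nonneg_AE AE_I2 b)
  have "(LINT t|lborel. indicat_real {0<..} t * bump (2 - t / T)) \<le> (LINT t|lborel. indicat_real {0..2 * T} t)"
    by (rule integral_mono[OF i1 i2 b(2)])
  also have "\<dots> = 2 * T" using T by simp
  finally show "(LINT t|lborel. indicat_real {0<..} t * bump (2 - t / T)) \<le> 2 * T" .
qed

lemma integrable_dom0_continuous:
  fixes c :: "real \<times> (real^'n) \<Rightarrow> real"
  assumes \<rho>: "Linf Gam \<rho>" and c: "continuous_on UNIV c" and s: "\<And>x y. \<bar>x\<bar> > R \<Longrightarrow> c (x, y) = 0"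
  shows "integrable (lebesgue_on dom0) (\<lambda>p. c p * \<rho> (snd p))"
proof -
  have "bounded (c ` ({-R..R} \<times> Gam))"
    by (intro compact_imp_bounded compact_continuous_image continuous_on_subset[OF c] compact_Times compact_Gam) auto
  then obtain M where M: "\<forall>p\<in>{-R..R} \<times> Gam. \<bar>c p\<bar> \<le> M" by (auto simp: bounded_iff)
  have "AE p in lebesgue_on dom0. \<bar>c p\<bar> \<le> max 0 M"
    unfolding AE_dom0_iff
  proof (intro AE_I2 impI)
    fix p :: "real \<times> (real^'n)" assume "p \<in> dom0"
    then show "\<bar>c p\<bar> \<le> max 0 M"
      using bspec[OF M, of p] s[of "fst p" "snd p"]
      by (cases p; cases "fst p \<in> {-R..R}") (auto simp: dom0_def le_max_iff_disj)
  qed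
  then show ?thesis
    by (intro integrable_dom0_kernel[OF \<rho>, of _ "max 0 M" R] borel_measurable_lebesgue_onI
        borel_measurable_continuous_onI c) (auto simp: s AE_dom0_iff)
qed

text \<open>The trace argument is separated from its origin: \<open>l\<close> stands for the entropy
  on the equilibrium curve, \<open>fu\<close> and \<open>qu\<close> for the flux and the entropy
  flux of the limit, of which only measurability and boundedness matter. Strict convexity enters as
  strict position above the tangent, the positivity of the relative entropy.\<close>

locale initial_layer =
  fixes \<rho> :: "real^'n \<Rightarrow> real" and J :: "real set" and l l' :: "real \<Rightarrow> real"
    and u fu qu :: "real \<times> real \<times> (real^'n) \<Rightarrow> real" and u0 :: "real \<times> (real^'n) \<Rightarrow> real" and B :: real
  assumes \<rho>: "Linf Gam \<rho>" "\<And>y. y \<in> Gam \<Longrightarrow> 0 \<le> \<rho> y"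
    and J: "compact J" "continuous_on J l" "continuous_on J l'"
      "\<And>a b. a \<in> J \<Longrightarrow> b \<in> J \<Longrightarrow> a \<noteq> b \<Longrightarrow> l b + l' b * (a - b) < l a"
    and B: "\<And>a. a \<in> J \<Longrightarrow> \<bar>a\<bar> \<le> B" "\<And>a. a \<in> J \<Longrightarrow> \<bar>l a\<bar> \<le> B" "\<And>a. a \<in> J \<Longrightarrow> \<bar>l' a\<bar> \<le> B" "0 \<le> B"
    and u: "u \<in> borel_measurable (lebesgue_on domT)" "AE z in lebesgue_on domT. u z \<in> J"
    and u0: "u0 \<in> borel_measurable (lebesgue_on dom0)" "AE p in lebesgue_on dom0. u0 p \<in> J"
    and fu: "fu \<in> borel_measurable (lebesgue_on domT)" "AE z in lebesgue_on domT. \<bar>fu z\<bar> \<le> B"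
    and qu: "qu \<in> borel_measurable (lebesgue_on domT)" "AE z in lebesgue_on domT. \<bar>qu z\<bar> \<le> B"
    and weak: "\<And>\<phi>. test_fun domT0 \<phi> \<Longrightarrow>
      (LINT z|lebesgue_on domT. (u z * dt \<phi> z + fu z * dx \<phi> z) * \<rho> (snd (snd z)))
      + (LINT p|lebesgue_on dom0. u0 p * \<phi> (fst p, 0, snd p) * \<rho> (snd p)) = 0"
    and ent: "\<And>R T. 0 < R \<Longrightarrow> 0 < T \<Longrightarrow>
      0 \<le> (LINT z|lebesgue_on domT. (l (u z) * bump (R\<^sup>2 - (fst z)\<^sup>2) * (- flat_exp 2 (2 - fst (snd z) / T) / T)
        + qu z * (- 2 * fst z * flat_exp 2 (R\<^sup>2 - (fst z)\<^sup>2)) * bump (2 - fst (snd z) / T)) * \<rho> (snd (snd z)))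
      + (LINT p|lebesgue_on dom0. l (u0 p) * bump (R\<^sup>2 - (fst p)\<^sup>2) * bump (2 - 0 / T) * \<rho> (snd p))"
begin

text \<open>Up to sign this is the time derivative of the temporal cutoff, times a kernel in (x, y)
  and the density: an averaging kernel over the layer. Its companion \<open>wx\<close> carries the
  cutoff itself and multiplies the flux terms.\<close>

definition wt :: "real \<Rightarrow> (real \<times> (real^'n) \<Rightarrow> real) \<Rightarrow> real \<times> real \<times> (real^'n) \<Rightarrow> real" where
  "wt T c z = flat_exp 2 (2 - fst (snd z) / T) / T * (c (fst z, snd (snd z)) * \<rho> (snd (snd z)))"

definition wx :: "real \<Rightarrow> (real \<times> (real^'n) \<Rightarrow> real) \<Rightarrow> real \<times> real \<times> (real^'n) \<Rightarrow> real" where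
  "wx T c z = bump (2 - fst (snd z) / T) * (c (fst z, snd (snd z)) * \<rho> (snd (snd z)))"

definition kernel :: "real \<Rightarrow> (real \<times> (real^'n) \<Rightarrow> real) \<Rightarrow> bool" where
  "kernel R c \<longleftrightarrow> continuous_on UNIV c \<and> (\<forall>x y. \<bar>x\<bar> > R \<longrightarrow> c (x, y) = 0)"

definition \<kappa> :: "real \<Rightarrow> real \<times> (real^'n) \<Rightarrow> real" where
  "\<kappa> R p = bump (R\<^sup>2 - (fst p)\<^sup>2)"

lemma kernel_integrable: "kernel R c \<Longrightarrow> integrable (lebesgue_on dom0) (\<lambda>p. c p * \<rho> (snd p))"
  unfolding kernel_def by (intro integrable_dom0_continuous[OF \<rho>(1), of _ R]) auto

lemma kernel_mult: "kernel R c \<Longrightarrow> continuous_on UNIV g \<Longrightarrow> kernel R (\<lambda>p. c p * g p)"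
  unfolding kernel_def by (auto intro: continuous_on_mult)

lemma kernel_abs: "kernel R c \<Longrightarrow> kernel R (\<lambda>p. \<bar>c p\<bar>)"
  unfolding kernel_def by (auto intro: continuous_on_rabs)

lemma kernel_\<kappa>: "0 < R \<Longrightarrow> kernel R (\<kappa> R)"
proof -
  assume R: "0 < R"
  have "continuous_on UNIV (\<kappa> R)"
    unfolding \<kappa>_def[abs_def]
    by (rule continuous_on_compose2[OF continuous_flat_exp[of UNIV]])
       (auto intro!: continuous_on_diff continuous_on_const continuous_on_power continuous_on_fst continuous_on_id)
  moreover have "R\<^sup>2 - x\<^sup>2 \<le> 0" if "\<bar>x\<bar> > R" for x
    using that R by (simp add: abs_le_square_iff[symmetric])
  ultimately show "kernel R (\<kappa> R)" unfolding kernel_def \<kappa>_def by (auto intro: flat_exp_eq_0)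
qed

lemma \<kappa>_nonneg: "0 \<le> \<kappa> R p" and \<kappa>_le_1: "\<kappa> R p \<le> 1"
  using bump_less_1[of "R\<^sup>2 - (fst p)\<^sup>2"] by (simp_all add: \<kappa>_def flat_exp_nonneg less_imp_le)

lemma wt_integral:
  assumes T: "0 < T" and b: "integrable (lebesgue_on dom0) (\<lambda>p. b p * (c p * \<rho> (snd p)))"
  shows "integrable (lebesgue_on domT) (\<lambda>z. b (fst z, snd (snd z)) * wt T c z)"
    and "(LINT z|lebesgue_on domT. b (fst z, snd (snd z)) * wt T c z) = bump 2 * (LINT p|lebesgue_on dom0. b p * (c p * \<rho> (snd p)))"
proof -
  have e: "(\<lambda>z. b (fst z, snd (snd z)) * wt T c z) = (\<lambda>z. flat_exp 2 (2 - fst (snd z) / T) / T *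
        (\<lambda>p. b p * (c p * \<rho> (snd p))) (fst z, snd (snd z)))"
    by (simp add: wt_def mult_ac)
  show "integrable (lebesgue_on domT) (\<lambda>z. b (fst z, snd (snd z)) * wt T c z)"
    unfolding e by (rule domT_integral_product(1)[OF time_cutoff_integrals(1)[OF T] b])
  show "(LINT z|lebesgue_on domT. b (fst z, snd (snd z)) * wt T c z) = bump 2 * (LINT p|lebesgue_on dom0. b p * (c p * \<rho> (snd p)))"
    unfolding e domT_integral_product(2)[OF time_cutoff_integrals(1)[OF T] b] time_cutoff_integrals(2)[OF T] ..
qed

lemma wt_integrable: "0 < T \<Longrightarrow> kernel R c \<Longrightarrow> integrable (lebesgue_on domT) (wt T c)"
  using domT_integral_product(1)[OF time_cutoff_integrals(1) kernel_integrable, of T R c]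
  by (simp add: wt_def[abs_def])

lemma wx_integrable: "0 < T \<Longrightarrow> kernel R c \<Longrightarrow> integrable (lebesgue_on domT) (wx T c)"
  using domT_integral_product(1)[OF time_cutoff_integrals(3) kernel_integrable, of T R c]
  by (simp add: wx_def[abs_def])

text \<open>The integral of the time cutoff is at most 2T, so every bounded flux contributes O(T),
  with a constant that depends only on the kernel.\<close>

lemma wx_bound:
  assumes T: "0 < T" and c: "kernel R c" and b: "b \<in> borel_measurable (lebesgue_on domT)"
    "AE z in lebesgue_on domT. \<bar>b z\<bar> \<le> B"
  shows "\<bar>LINT z|lebesgue_on domT. b z * wx T c z\<bar> \<le> (2 * B * (LINT p|lebesgue_on dom0. \<bar>c p\<bar> * \<rho> (snd p))) * T"
proof -
  have dom: "AE z in lebesgue_on domT. z \<in> domT" by (simp add: AE_domT_iff)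
  have i1: "integrable (lebesgue_on domT) (\<lambda>z. b z * wx T c z)"
    by (rule integrable_mult_bounded[OF wx_integrable[OF T c] b])
  have i2: "integrable (lebesgue_on domT) (\<lambda>z. B * wx T (\<lambda>p. \<bar>c p\<bar>) z)"
    using wx_integrable[OF T kernel_abs[OF c]] by simp
  have "\<bar>LINT z|lebesgue_on domT. b z * wx T c z\<bar> \<le> (LINT z|lebesgue_on domT. \<bar>b z * wx T c z\<bar>)"
    by (rule integral_abs_bound)
  also have "\<dots> \<le> (LINT z|lebesgue_on domT. B * wx T (\<lambda>p. \<bar>c p\<bar>) z)"
  proof (rule integral_mono_AE[OF integrable_abs[OF i1] i2])
    show "AE z in lebesgue_on domT. \<bar>b z * wx T c z\<bar> \<le> B * wx T (\<lambda>p. \<bar>c p\<bar>) z"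
      using b(2) dom
    proof eventually_elim
      case (elim z)
      have "\<bar>wx T c z\<bar> = wx T (\<lambda>p. \<bar>c p\<bar>) z"
        using elim(2) \<rho>(2)[of "snd (snd z)"] by (auto simp: wx_def abs_mult flat_exp_nonneg domT_def)
      then show ?case using elim(1) by (simp add: abs_mult) (metis abs_ge_zero mult_right_mono)
    qed
  qed
  also have "\<dots> = B * ((LINT t|lborel. indicat_real {0<..} t * bump (2 - t / T)) * (LINT p|lebesgue_on dom0. \<bar>c p\<bar> * \<rho> (snd p)))"
    using domT_integral_product(2)[OF time_cutoff_integrals(3)[OF T] kernel_integrable[OF kernel_abs[OF c]]]
    by (simp add: wx_def[abs_def])
  also have "\<dots> \<le> B * ((2 * T) * (LINT p|lebesgue_on dom0. \<bar>c p\<bar> * \<rho> (snd p)))"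
  proof (intro mult_left_mono mult_right_mono time_cutoff_integrals(5)[OF T] B(4))
    show "0 \<le> (LINT p|lebesgue_on dom0. \<bar>c p\<bar> * \<rho> (snd p))"
      by (intro integral_nonneg_AE) (auto simp: AE_dom0_iff dom0_def \<rho>(2) intro!: AE_I2)
  qed
  finally show ?thesis by (simp add: mult_ac)
qed

lemma l_measurable: "(\<lambda>z. l (u z)) \<in> borel_measurable (lebesgue_on domT)"
  "(\<lambda>p. l (u0 p)) \<in> borel_measurable (lebesgue_on dom0)" "(\<lambda>p. l' (u0 p)) \<in> borel_measurable (lebesgue_on dom0)"
proof -
  have Jb: "J \<in> sets borel" using J(1) by (simp add: borel_closed compact_imp_closed)
  show "(\<lambda>z. l (u z)) \<in> borel_measurable (lebesgue_on domT)"
    by (rule borel_measurable_compose_AE[OF _ u(1) Jb J(2) u(2)]) simp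
  show "(\<lambda>p. l (u0 p)) \<in> borel_measurable (lebesgue_on dom0)" "(\<lambda>p. l' (u0 p)) \<in> borel_measurable (lebesgue_on dom0)"
    by (rule borel_measurable_compose_AE[OF _ u0(1) Jb J(2) u0(2)], simp)
       (rule borel_measurable_compose_AE[OF _ u0(1) Jb J(3) u0(2)], simp)
qed

lemma bounds_AE: "AE z in lebesgue_on domT. \<bar>u z\<bar> \<le> B" "AE z in lebesgue_on domT. \<bar>l (u z)\<bar> \<le> B"
  "AE p in lebesgue_on dom0. \<bar>u0 p\<bar> \<le> B" "AE p in lebesgue_on dom0. \<bar>l (u0 p)\<bar> \<le> B"
  "AE p in lebesgue_on dom0. \<bar>l' (u0 p)\<bar> \<le> B"
  using u(2) u0(2) B by (auto elim: eventually_mono)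

text \<open>The mass of \<open>wt\<close> equals the cutoff at t = 0, so the initial term of the
  entropy inequality can be rewritten as an integral of l(u0) against the same kernel as l(u). What
  remains on the other side is a flux term of order T.\<close>

lemma entropy_step:
  assumes R: "0 < R"
  obtains C1 where "\<And>T. 0 < T \<Longrightarrow>
    (LINT z|lebesgue_on domT. (l (u z) - l (u0 (fst z, snd (snd z)))) * wt T (\<kappa> R) z) \<le> C1 * T"
proof -
  define c where "c p = - 2 * fst p * flat_exp 2 (R\<^sup>2 - (fst p)\<^sup>2)" for p :: "real \<times> (real^'n)"
  have c: "kernel R c"
  proof -
    have "continuous_on UNIV (\<lambda>p::real \<times> (real^'n). flat_exp 2 (R\<^sup>2 - (fst p)\<^sup>2))"
      by (rule continuous_on_compose2[OF continuous_flat_exp[of UNIV]])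
         (auto intro!: continuous_on_diff continuous_on_const continuous_on_power continuous_on_fst continuous_on_id)
    then have "continuous_on UNIV c"
      unfolding c_def[abs_def] by (intro continuous_on_mult continuous_on_const continuous_on_fst continuous_on_id)
    moreover have "R\<^sup>2 - x\<^sup>2 \<le> 0" if "\<bar>x\<bar> > R" for x
      using that R by (simp add: abs_le_square_iff[symmetric])
    ultimately show ?thesis unfolding kernel_def c_def by (auto simp: flat_exp_eq_0)
  qed
  show ?thesis
  proof (rule that)
    fix T :: real assume T: "0 < T"
    note k = kernel_\<kappa>[OF R]
    have i1: "integrable (lebesgue_on domT) (\<lambda>z. l (u z) * wt T (\<kappa> R) z)"
      by (rule integrable_mult_bounded[OF wt_integrable[OF T k] l_measurable(1) bounds_AE(2)])
    have i2: "integrable (lebesgue_on domT) (\<lambda>z. qu z * wx T c z)"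
      by (rule integrable_mult_bounded[OF wx_integrable[OF T c] qu])
    have i3: "integrable (lebesgue_on domT) (\<lambda>z. l (u0 (fst z, snd (snd z))) * wt T (\<kappa> R) z)"
      by (rule integrable_mult_bounded[OF wt_integrable[OF T k] borel_measurable_lift_dom0[OF l_measurable(2)]
            AE_lift_dom0[OF bounds_AE(4)]])
    have "(LINT z|lebesgue_on domT. (l (u z) * bump (R\<^sup>2 - (fst z)\<^sup>2) * (- flat_exp 2 (2 - fst (snd z) / T) / T)
        + qu z * (- 2 * fst z * flat_exp 2 (R\<^sup>2 - (fst z)\<^sup>2)) * bump (2 - fst (snd z) / T)) * \<rho> (snd (snd z)))
      = (LINT z|lebesgue_on domT. qu z * wx T c z - l (u z) * wt T (\<kappa> R) z)"
      by (rule Bochner_Integration.integral_cong) (simp_all add: wx_def wt_def c_def \<kappa>_def algebra_simps)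
    also have "\<dots> = (LINT z|lebesgue_on domT. qu z * wx T c z) - (LINT z|lebesgue_on domT. l (u z) * wt T (\<kappa> R) z)"
      by (rule Bochner_Integration.integral_diff[OF i2 i1])
    finally have e1: "(LINT z|lebesgue_on domT. (l (u z) * bump (R\<^sup>2 - (fst z)\<^sup>2) * (- flat_exp 2 (2 - fst (snd z) / T) / T)
        + qu z * (- 2 * fst z * flat_exp 2 (R\<^sup>2 - (fst z)\<^sup>2)) * bump (2 - fst (snd z) / T)) * \<rho> (snd (snd z)))
      = (LINT z|lebesgue_on domT. qu z * wx T c z) - (LINT z|lebesgue_on domT. l (u z) * wt T (\<kappa> R) z)" .
    have "(LINT p|lebesgue_on dom0. l (u0 p) * bump (R\<^sup>2 - (fst p)\<^sup>2) * bump (2 - 0 / T) * \<rho> (snd p))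
      = bump 2 * (LINT p|lebesgue_on dom0. l (u0 p) * (\<kappa> R p * \<rho> (snd p)))"
      by (subst integral_mult_right_zero[symmetric]) (simp add: \<kappa>_def mult_ac)
    also have "\<dots> = (LINT z|lebesgue_on domT. l (u0 (fst z, snd (snd z))) * wt T (\<kappa> R) z)"
      by (rule wt_integral(2)[OF T integrable_mult_bounded[OF kernel_integrable[OF k] l_measurable(2) bounds_AE(4)], symmetric])
    finally have e2: "(LINT p|lebesgue_on dom0. l (u0 p) * bump (R\<^sup>2 - (fst p)\<^sup>2) * bump (2 - 0 / T) * \<rho> (snd p))
       = (LINT z|lebesgue_on domT. l (u0 (fst z, snd (snd z))) * wt T (\<kappa> R) z)" .
    have "(LINT z|lebesgue_on domT. (l (u z) - l (u0 (fst z, snd (snd z)))) * wt T (\<kappa> R) z)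
      = (LINT z|lebesgue_on domT. l (u z) * wt T (\<kappa> R) z) - (LINT z|lebesgue_on domT. l (u0 (fst z, snd (snd z))) * wt T (\<kappa> R) z)"
      using i1 i3 by (simp add: left_diff_distrib)
    also have "\<dots> \<le> (LINT z|lebesgue_on domT. qu z * wx T c z)"
      using ent[OF R T] unfolding e1 e2 by simp
    also have "\<dots> \<le> (2 * B * (LINT p|lebesgue_on dom0. \<bar>c p\<bar> * \<rho> (snd p))) * T"
      using wx_bound[OF T c qu] by simp
    finally show "(LINT z|lebesgue_on domT. (l (u z) - l (u0 (fst z, snd (snd z)))) * wt T (\<kappa> R) z)
      \<le> (2 * B * (LINT p|lebesgue_on dom0. \<bar>c p\<bar> * \<rho> (snd p))) * T" .
  qed
qed

text \<open>The same computation with the weak form, for the test function bump(2 - t/T) \<kappa>(x)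
  p(x, y). Being an equation, the weak form admits polynomials p of any sign and bounds the absolute
  value. The test function does not vanish at t = 0, which brings in u0.\<close>

lemma weak_step:
  assumes R: "0 < R" and p: "real_polynomial_function p"
  obtains C2 where "\<And>T. 0 < T \<Longrightarrow>
    \<bar>LINT z|lebesgue_on domT. (u z - u0 (fst z, snd (snd z))) * wt T (\<lambda>q. \<kappa> R q * p q) z\<bar> \<le> C2 * T"
proof -
  define g where "g q = \<kappa> R q * p q" for q
  have pc: "continuous_on UNIV p" by (rule smooth_imp_continuous_on[OF smooth_real_polynomial_function[OF p]])
  have gk: "kernel R g" unfolding g_def by (rule kernel_mult[OF kernel_\<kappa>[OF R] pc])
  have sf: "smooth (\<lambda>q::real \<times> (real^'n). R\<^sup>2 - fst q * fst q)"
    by (intro smooth_diff smooth_const smooth_mult smooth_bounded_linear bounded_linear_fst)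
  have gs: "smooth g"
    unfolding g_def \<kappa>_def power2_eq_square[of "fst _"]
    by (rule smooth_mult[OF smooth_compose[OF smooth_flat_exp sf] smooth_real_polynomial_function[OF p]])
  define gx where "gx q = frechet_derivative g (at q) (1, 0)" for q
  have gd: "(g has_derivative frechet_derivative g (at q)) (at q)" for q by (rule smooth_has_derivative[OF gs])
  have gx: "kernel R gx"
    unfolding kernel_def
  proof (intro conjI allI impI)
    have "(1, 0) \<in> (Basis :: (real \<times> (real^'n)) set)" by (auto simp: Basis_prod_def)
    moreover have "Ck (Suc 0) g" using gs by (simp add: smooth_def del: Ck.simps)
    ultimately show "continuous_on UNIV gx"
      unfolding gx_def[abs_def] using Ck_SucD(2)[of 0 g "(1, 0)"] by simp
    fix x :: real and y :: "real^'n" assume x: "R < \<bar>x\<bar>"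
    \<comment> \<open>The kernel vanishes on an open neighbourhood of any point with R <
      \<bar>x\<bar>, hence so does its x derivative there.\<close>
    have "open ({x. R < \<bar>x\<bar>} \<times> (UNIV :: (real^'n) set))"
      by (intro open_Times open_UNIV open_Collect_less continuous_intros)
    then have "(g has_derivative (\<lambda>h. 0)) (at (x, y))"
      by (rule has_derivative_transform_within_open[OF has_derivative_const[of 0]])
         (use x gk in \<open>auto simp: kernel_def\<close>)
    from frechet_derivative_at[OF this] show "gx (x, y) = 0" by (metis gx_def)
  qed
  show ?thesis
  proof (rule that)
    fix T :: real assume T: "0 < T"
    define \<phi> where "\<phi> z = bump (2 - fst (snd z) / T) * g (fst z, snd (snd z))" for z :: "real \<times> real \<times> (real^'n)"
    have L: "bounded_linear (\<lambda>z::real \<times> real \<times> (real^'n). (fst z, snd (snd z)))"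
      by (intro bounded_linear_Pair bounded_linear_fst bounded_linear_compose[OF bounded_linear_snd bounded_linear_snd])
    have st: "smooth (\<lambda>z::real \<times> real \<times> (real^'n). 2 - fst (snd z) * (1 / T))"
      by (intro smooth_diff smooth_const smooth_mult smooth_bounded_linear
          bounded_linear_compose[OF bounded_linear_fst bounded_linear_snd])
    have "smooth \<phi>"
      unfolding \<phi>_def[abs_def]
      using smooth_mult[OF smooth_compose[OF smooth_flat_exp[of 0] st] smooth_compose_affine[OF gs L, of 0]] by simp
    moreover have "\<phi> z = 0" if "z \<in> domT0 - {-R..R} \<times> {0..2 * T} \<times> Gam" for z
    proof -
      obtain x t y where z: "z = (x, t, y)" by (cases z) auto
      have "R < \<bar>x\<bar> \<or> 2 * T < t" using that unfolding z domT0_def by auto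
      then show ?thesis
      proof
        assume "R < \<bar>x\<bar>" then show ?thesis using gk by (simp add: z \<phi>_def kernel_def)
      next
        assume "2 * T < t"
        then have "2 - t / T \<le> 0" using T by (simp add: field_simps)
        then show ?thesis by (simp add: z \<phi>_def flat_exp_eq_0)
      qed
    qed
    ultimately have test: "test_fun domT0 \<phi>"
      unfolding test_fun_def
      by (intro conjI exI[of _ "{-R..R} \<times> {0..2 * T} \<times> Gam"] compact_Times compact_Gam) (auto simp: domT0_def)
    have d: "(\<phi> has_derivative (\<lambda>h. bump (2 - fst (snd z) / T) * frechet_derivative g (at (fst z, snd (snd z))) (fst h, snd (snd h))
        + (- (fst (snd h) / T) * flat_exp 2 (2 - fst (snd z) / T)) * g (fst z, snd (snd z)))) (at z)" for z
    proof -
      have "((\<lambda>z. g (fst z, snd (snd z))) has_derivative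
          (\<lambda>h. frechet_derivative g (at (fst z, snd (snd z))) (fst h, snd (snd h)))) (at z)"
        using has_derivative_compose[OF bounded_linear_imp_has_derivative[OF L] gd] by simp
      moreover have "((\<lambda>z::real \<times> real \<times> (real^'n). 2 - fst (snd z) / T) has_derivative (\<lambda>h. - (fst (snd h) / T))) (at z)"
        using T by (auto intro!: derivative_eq_intros)
      ultimately show ?thesis unfolding \<phi>_def[abs_def]
        by (intro has_derivative_mult has_derivative_bump_compose)
    qed
    have fd: "frechet_derivative \<phi> (at z) = (\<lambda>h. bump (2 - fst (snd z) / T) * frechet_derivative g (at (fst z, snd (snd z))) (fst h, snd (snd h))
        + (- (fst (snd h) / T) * flat_exp 2 (2 - fst (snd z) / T)) * g (fst z, snd (snd z)))" for z
      using frechet_derivative_at[OF d[of z]] by simp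
    have dt: "dt \<phi> z = - (flat_exp 2 (2 - fst (snd z) / T) / T) * g (fst z, snd (snd z))" for z
      using linear_0[OF has_derivative_linear[OF gd]] unfolding dt_def fd by (simp add: zero_prod_def)
    have dx: "dx \<phi> z = bump (2 - fst (snd z) / T) * gx (fst z, snd (snd z))" for z
      unfolding dx_def fd gx_def by simp
    have i1: "integrable (lebesgue_on domT) (\<lambda>z. u z * wt T g z)"
      by (rule integrable_mult_bounded[OF wt_integrable[OF T gk] u(1) bounds_AE(1)])
    have i2: "integrable (lebesgue_on domT) (\<lambda>z. fu z * wx T gx z)"
      by (rule integrable_mult_bounded[OF wx_integrable[OF T gx] fu])
    have i3: "integrable (lebesgue_on domT) (\<lambda>z. u0 (fst z, snd (snd z)) * wt T g z)"
      by (rule integrable_mult_bounded[OF wt_integrable[OF T gk] borel_measurable_lift_dom0[OF u0(1)]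
            AE_lift_dom0[OF bounds_AE(3)]])
    have "(LINT z|lebesgue_on domT. (u z * dt \<phi> z + fu z * dx \<phi> z) * \<rho> (snd (snd z)))
       = (LINT z|lebesgue_on domT. fu z * wx T gx z - u z * wt T g z)"
      by (rule Bochner_Integration.integral_cong) (simp_all add: wx_def wt_def dt dx algebra_simps)
    also have "\<dots> = (LINT z|lebesgue_on domT. fu z * wx T gx z) - (LINT z|lebesgue_on domT. u z * wt T g z)"
      by (rule Bochner_Integration.integral_diff[OF i2 i1])
    finally have e1: "(LINT z|lebesgue_on domT. (u z * dt \<phi> z + fu z * dx \<phi> z) * \<rho> (snd (snd z)))
       = (LINT z|lebesgue_on domT. fu z * wx T gx z) - (LINT z|lebesgue_on domT. u z * wt T g z)" .
    have "(LINT p|lebesgue_on dom0. u0 p * \<phi> (fst p, 0, snd p) * \<rho> (snd p))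
      = bump 2 * (LINT p|lebesgue_on dom0. u0 p * (g p * \<rho> (snd p)))"
      by (subst integral_mult_right_zero[symmetric]) (simp add: \<phi>_def mult_ac)
    also have "\<dots> = (LINT z|lebesgue_on domT. u0 (fst z, snd (snd z)) * wt T g z)"
      by (rule wt_integral(2)[OF T integrable_mult_bounded[OF kernel_integrable[OF gk] u0(1) bounds_AE(3)], symmetric])
    finally have e2: "(LINT p|lebesgue_on dom0. u0 p * \<phi> (fst p, 0, snd p) * \<rho> (snd p))
      = (LINT z|lebesgue_on domT. u0 (fst z, snd (snd z)) * wt T g z)" .
    have "(LINT z|lebesgue_on domT. (u z - u0 (fst z, snd (snd z))) * wt T g z)
      = (LINT z|lebesgue_on domT. u z * wt T g z) - (LINT z|lebesgue_on domT. u0 (fst z, snd (snd z)) * wt T g z)"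
      using i1 i3 by (simp add: left_diff_distrib)
    also have "\<dots> = (LINT z|lebesgue_on domT. fu z * wx T gx z)"
      using weak[OF test] unfolding e1 e2 by simp
    finally show "\<bar>LINT z|lebesgue_on domT. (u z - u0 (fst z, snd (snd z))) * wt T (\<lambda>q. \<kappa> R q * p q) z\<bar>
      \<le> (2 * B * (LINT p|lebesgue_on dom0. \<bar>gx p\<bar> * \<rho> (snd p))) * T"
      using wx_bound[OF T gx fu] by (simp add: g_def[abs_def])
  qed
qed

text \<open>The weak form accepts only smooth multipliers, so \<open>l' \<circ> u0\<close> has to be replaced by a polynomial.\<close>

lemma polynomial_approx:
  assumes R: "0 < R" and e: "0 < e"
  obtains p where "real_polynomial_function p"
    "integrable (lebesgue_on dom0) (\<lambda>q. \<bar>l' (u0 q) - p q\<bar> * (\<kappa> R q * \<rho> (snd q)))"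
    "(LINT q|lebesgue_on dom0. \<bar>l' (u0 q) - p q\<bar> * (\<kappa> R q * \<rho> (snd q))) \<le> e"
proof -
  define K where "K = {-R..R} \<times> (Gam :: (real^'n) set)"
  have K: "compact K" unfolding K_def by (intro compact_Times compact_Gam) auto
  have Km: "K \<in> sets lebesgue" "emeasure lebesgue K < \<infinity>"
    using lmeasurable_compact[OF K] by (auto simp: fmeasurable_def)
  have Kd: "K \<subseteq> dom0" by (auto simp: K_def dom0_def)
  \<comment> \<open>l'(u0) is bounded by B only almost everywhere; the truncation is bounded
    everywhere, as the L^1 approximation requires, and agrees with it almost everywhere.\<close>
  define g where "g q = max (- B) (min B (l' (u0 q)))" for q
  have gm: "g \<in> borel_measurable (lebesgue_on dom0)" unfolding g_def using l_measurable(3) by measurable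
  have gmK: "g \<in> borel_measurable (lebesgue_on K)" by (rule measurable_restrict_mono[OF gm Kd])
  have gB: "\<bar>g q\<bar> \<le> B" for q using B(4) by (auto simp: g_def)
  from \<rho>(1) obtain P where P: "AE y in lebesgue_on Gam. norm (\<rho> y) \<le> P" by (auto simp: Linf_def)
  define P' where "P' = max 1 P"
  have P'0: "0 < P'" by (simp add: P'_def)
  define m where "m = measure lebesgue K"
  have m0: "0 \<le> m" by (simp add: m_def)
  \<comment> \<open>The budget e is halved: one half for the L^1 approximation by a continuous
    function, the other for the uniform Stone-Weierstrass approximation, whose error is multiplied
    by the measure m of K. Both are divided by the bound P' of the density.\<close>
  define e1 where "e1 = e / (2 * P' * (m + 1))"
  have e1: "0 < e1" using e P'0 m0 by (simp add: e1_def)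
  have e2: "0 < e / (2 * P')" using e P'0 by simp
  obtain c where c: "continuous_on UNIV c" "\<And>z. \<bar>c z\<bar> \<le> B" "(LINT z|lebesgue_on K. \<bar>g z - c z\<bar>) < e / (2 * P')"
    using continuous_L1_approx[OF gmK gB K e2 B(4)] by blast
  obtain p where p: "real_polynomial_function p" "\<And>q. q \<in> K \<Longrightarrow> \<bar>c q - p q\<bar> < e1"
    using Stone_Weierstrass_real_polynomial_function[OF K continuous_on_subset[OF c(1)] e1] by auto
  have cm: "c \<in> borel_measurable (lebesgue_on K)"
    by (intro borel_measurable_lebesgue_onI borel_measurable_continuous_onI c(1))
  have i1: "integrable (lebesgue_on K) (\<lambda>z. \<bar>g z - c z\<bar>)"
  proof (rule integrableI_bounded_set[where A = K and B = "2 * B"])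
    show "AE x in lebesgue_on K. x \<in> K \<longrightarrow> norm \<bar>g x - c x\<bar> \<le> 2 * B"
    proof (intro AE_I2 impI)
      fix x show "norm \<bar>g x - c x\<bar> \<le> 2 * B" using gB[of x] c(2)[of x] by simp
    qed
    show "AE x in lebesgue_on K. x \<notin> K \<longrightarrow> \<bar>g x - c x\<bar> = 0" using Km by (simp add: AE_restrict_space_iff)
  qed (use Km gmK cm in \<open>auto simp: emeasure_restrict_space\<close>)
  have i2: "integrable (lebesgue_on K) (\<lambda>z. e1)"
    using Km by (simp add: integrable_restrict_space lmeasurable_iff_integrable[symmetric] fmeasurable_def)
  have pc: "continuous_on UNIV p" by (rule smooth_imp_continuous_on[OF smooth_real_polynomial_function[OF p(1)]])
  have ik: "integrable (lebesgue_on K) (\<lambda>z. P' * (\<bar>g z - c z\<bar> + e1))" using i1 i2 by simp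
  have KI: "K \<inter> space lebesgue \<in> sets lebesgue" and dI: "dom0 \<inter> space lebesgue \<in> sets lebesgue"
    using Km by simp_all
  have eqK: "(\<lambda>z. indicat_real dom0 z *\<^sub>R (indicat_real K z * G z)) = (\<lambda>z. indicat_real K z *\<^sub>R G z)"
    for G :: "real \<times> (real^'n) \<Rightarrow> real"
    by (rule ext) (use Kd in \<open>auto simp: indicator_def\<close>)
  have ik0: "integrable (lebesgue_on dom0) (\<lambda>z. indicator K z * (P' * (\<bar>g z - c z\<bar> + e1)))"
    using ik unfolding integrable_restrict_space[OF KI] integrable_restrict_space[OF dI] eqK .
  have aeP: "AE q in lebesgue_on dom0. \<bar>\<rho> (snd q)\<bar> \<le> P" using AE_lift_Gam(2)[OF P] by simp
  have dom: "AE q in lebesgue_on dom0. q \<in> dom0" by (simp add: AE_dom0_iff)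
  have ile: "AE q in lebesgue_on dom0. \<bar>l' (u0 q) - p q\<bar> * (\<kappa> R q * \<rho> (snd q)) \<le> indicator K q * (P' * (\<bar>g q - c q\<bar> + e1))
     \<and> 0 \<le> \<bar>l' (u0 q) - p q\<bar> * (\<kappa> R q * \<rho> (snd q))"
    using bounds_AE(5) aeP dom
  proof eventually_elim
    case (elim q)
    have g: "g q = l' (u0 q)" using elim(1) by (auto simp: g_def)
    have \<rho>0: "0 \<le> \<rho> (snd q)" using elim(3) \<rho>(2) by (auto simp: dom0_def)
    have nn: "0 \<le> \<bar>l' (u0 q) - p q\<bar> * (\<kappa> R q * \<rho> (snd q))" using \<rho>0 \<kappa>_nonneg by simp
    show ?case
    proof (cases "q \<in> K")
      case True
      have "\<bar>l' (u0 q) - p q\<bar> \<le> \<bar>g q - c q\<bar> + e1" using p(2)[OF True] g by linarith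
      moreover have "\<kappa> R q * \<rho> (snd q) \<le> P'"
      proof -
        have "\<kappa> R q * \<rho> (snd q) \<le> 1 * P'"
          using elim(2) \<rho>0 by (intro mult_mono \<kappa>_le_1) (auto simp: P'_def)
        then show ?thesis by simp
      qed
      ultimately have "\<bar>l' (u0 q) - p q\<bar> * (\<kappa> R q * \<rho> (snd q)) \<le> (\<bar>g q - c q\<bar> + e1) * P'"
        using \<rho>0 \<kappa>_nonneg[of R q] e1 by (intro mult_mono) auto
      then show ?thesis using True nn by (simp add: mult.commute)
    next
      case False
      then have "R < \<bar>fst q\<bar>" using elim(3) by (cases q) (auto simp: K_def dom0_def)
      then have "\<kappa> R q = 0" using kernel_\<kappa>[OF R] by (cases q) (auto simp: kernel_def)
      then show ?thesis using False by simp
    qed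
  qed
  have il: "integrable (lebesgue_on dom0) (\<lambda>q. \<bar>l' (u0 q) - p q\<bar> * (\<kappa> R q * \<rho> (snd q)))"
  proof (rule Bochner_Integration.integrable_bound[OF ik0])
    show "(\<lambda>q. \<bar>l' (u0 q) - p q\<bar> * (\<kappa> R q * \<rho> (snd q))) \<in> borel_measurable (lebesgue_on dom0)"
      using l_measurable(3) borel_measurable_integrable[OF kernel_integrable[OF kernel_\<kappa>[OF R]]]
        borel_measurable_lebesgue_onI[OF borel_measurable_continuous_onI[OF pc]] by measurable
    show "AE q in lebesgue_on dom0. norm (\<bar>l' (u0 q) - p q\<bar> * (\<kappa> R q * \<rho> (snd q)))
       \<le> norm (indicator K q * (P' * (\<bar>g q - c q\<bar> + e1)))"
      using ile by eventually_elim (simp add: abs_of_nonneg)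
  qed
  have "(LINT q|lebesgue_on dom0. \<bar>l' (u0 q) - p q\<bar> * (\<kappa> R q * \<rho> (snd q)))
     \<le> (LINT q|lebesgue_on dom0. indicator K q * (P' * (\<bar>g q - c q\<bar> + e1)))"
    by (rule integral_mono_AE[OF il ik0]) (use ile in eventually_elim, simp)
  also have "\<dots> = (LINT q|lebesgue_on K. P' * (\<bar>g q - c q\<bar> + e1))"
    unfolding integral_restrict_space[OF KI] integral_restrict_space[OF dI] eqK ..
  also have "\<dots> = P' * ((LINT q|lebesgue_on K. \<bar>g q - c q\<bar>) + m * e1)"
  proof -
    have "(LINT q|lebesgue_on K. e1) = m * e1"
      using Km by (simp add: m_def measure_restrict_space)
    then show ?thesis using i1 i2 by simp
  qed
  also have "\<dots> \<le> P' * (e / (2 * P') + e / (2 * P'))"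
  proof (intro mult_left_mono add_mono)
    have "m * e1 \<le> (m + 1) * e1" using e1 by simp
    also have "(m + 1) * e1 = e / (2 * P')" 
    proof -
      have "m + 1 \<noteq> 0" using m0 by linarith
      then show ?thesis by (simp add: e1_def)
    qed
    finally show "m * e1 \<le> e / (2 * P')" .
  qed (use c(3) P'0 in auto)
  also have "\<dots> = e" using P'0 by (simp add: field_simps)
  finally show ?thesis using p(1) il that by blast
qed

lemma relative_entropy_nonneg:
  "a \<in> J \<Longrightarrow> b \<in> J \<Longrightarrow> 0 \<le> l a - l b - l' b * (a - b)"
  using J(4)[of a b] by (cases "a = b") auto

lemma wt_nonneg_AE: "0 < T \<Longrightarrow> AE z in lebesgue_on domT. 0 \<le> wt T (\<kappa> R) z"
  unfolding AE_domT_iff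
  by (intro AE_I2 impI) (auto simp: wt_def domT_def \<rho>(2) flat_exp_nonneg \<kappa>_nonneg)

lemma relative_entropy_integrable:
  assumes R: "0 < R" and T: "0 < T"
  shows "integrable (lebesgue_on domT) (\<lambda>z. (l (u z) - l (u0 (fst z, snd (snd z)))
      - l' (u0 (fst z, snd (snd z))) * (u z - u0 (fst z, snd (snd z)))) * wt T (\<kappa> R) z)"
proof (rule integrable_mult_bounded[OF wt_integrable[OF T kernel_\<kappa>[OF R]], of _ "B + B + B * (B + B)"])
  show "(\<lambda>z. l (u z) - l (u0 (fst z, snd (snd z))) - l' (u0 (fst z, snd (snd z))) * (u z - u0 (fst z, snd (snd z))))
    \<in> borel_measurable (lebesgue_on domT)"
    using l_measurable(1) borel_measurable_lift_dom0[OF l_measurable(2)] borel_measurable_lift_dom0[OF l_measurable(3)]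
      borel_measurable_lift_dom0[OF u0(1)] u(1) by measurable
  show "AE z in lebesgue_on domT. \<bar>l (u z) - l (u0 (fst z, snd (snd z))) -
      l' (u0 (fst z, snd (snd z))) * (u z - u0 (fst z, snd (snd z)))\<bar> \<le> B + B + B * (B + B)"
    using u(2) AE_lift_dom0[OF u0(2)]
  proof eventually_elim
    case (elim z)
    let ?a = "u z" and ?b = "u0 (fst z, snd (snd z))"
    have "\<bar>l' ?b * (?a - ?b)\<bar> \<le> B * (B + B)"
      unfolding abs_mult using B(1)[OF elim(1)] B(1)[OF elim(2)] B(3)[OF elim(2)] B(4)
      by (intro mult_mono) auto
    then show ?case using B(2)[OF elim(1)] B(2)[OF elim(2)] by linarith
  qed
qed

text \<open>Writing l'(u0) = p + (l'(u0) - p) splits the relative entropy into the entropy part, the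
  weak-form part with multiplier p, and an error at most 2B times the weighted L^1 distance of
  l'(u0) and p. The first two contribute at most O(T) from above; nonnegativity supplies the lower
  bound.\<close>

lemma relative_entropy_limit:
  assumes R: "0 < R"
  shows "((\<lambda>T. LINT z|lebesgue_on domT. (l (u z) - l (u0 (fst z, snd (snd z)))
      - l' (u0 (fst z, snd (snd z))) * (u z - u0 (fst z, snd (snd z)))) * wt T (\<kappa> R) z) \<longlongrightarrow> 0) (at_right 0)"
    (is "(?f \<longlongrightarrow> 0) _")
proof (rule tendstoI)
  fix e :: real assume e: "0 < e"
  \<comment> \<open>Chosen so that the approximation error 2 B e' is at most e / 2; the summand 1
    covers B = 0.\<close>
  define e' where "e' = e / (4 * (B + 1))"
  have e': "0 < e'" using e B(4) by (simp add: e'_def)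
  obtain p where p: "real_polynomial_function p"
    "integrable (lebesgue_on dom0) (\<lambda>q. \<bar>l' (u0 q) - p q\<bar> * (\<kappa> R q * \<rho> (snd q)))"
    "(LINT q|lebesgue_on dom0. \<bar>l' (u0 q) - p q\<bar> * (\<kappa> R q * \<rho> (snd q))) \<le> e'"
    using polynomial_approx[OF R e'] by blast
  obtain C1 where C1: "\<And>T. 0 < T \<Longrightarrow>
    (LINT z|lebesgue_on domT. (l (u z) - l (u0 (fst z, snd (snd z)))) * wt T (\<kappa> R) z) \<le> C1 * T"
    using entropy_step[OF R] by blast
  obtain C2 where C2: "\<And>T. 0 < T \<Longrightarrow>
    \<bar>LINT z|lebesgue_on domT. (u z - u0 (fst z, snd (snd z))) * wt T (\<lambda>q. \<kappa> R q * p q) z\<bar> \<le> C2 * T"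
    using weak_step[OF R p(1)] by blast
  have pc: "continuous_on UNIV p" by (rule smooth_imp_continuous_on[OF smooth_real_polynomial_function[OF p(1)]])
  have bound: "?f T \<le> C1 * T + C2 * T + 2 * B * e'" if T: "0 < T" for T
  proof -
    let ?b = "\<lambda>z::real \<times> real \<times> (real^'n). u0 (fst z, snd (snd z))"
    let ?d = "\<lambda>z. \<bar>l' (?b z) - p (fst z, snd (snd z))\<bar> * wt T (\<kappa> R) z"
    have bm: "?b \<in> borel_measurable (lebesgue_on domT)" "(\<lambda>z. l (?b z)) \<in> borel_measurable (lebesgue_on domT)"
      using borel_measurable_lift_dom0[OF u0(1)] borel_measurable_lift_dom0[OF l_measurable(2)] by auto
    note wi = wt_integrable[OF T kernel_\<kappa>[OF R]] and wip = wt_integrable[OF T kernel_mult[OF kernel_\<kappa>[OF R] pc]]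
    have i1: "integrable (lebesgue_on domT) (\<lambda>z. (l (u z) - l (?b z)) * wt T (\<kappa> R) z)"
    proof (rule integrable_mult_bounded[OF wi, of _ "B + B"])
      show "AE z in lebesgue_on domT. \<bar>l (u z) - l (?b z)\<bar> \<le> B + B"
        using bounds_AE(2) AE_lift_dom0[OF bounds_AE(4)] by eventually_elim linarith
    qed (use l_measurable(1) bm in measurable)
    have ub: "AE z in lebesgue_on domT. \<bar>u z - ?b z\<bar> \<le> B + B"
      using bounds_AE(1) AE_lift_dom0[OF bounds_AE(3)] by eventually_elim linarith
    have um: "(\<lambda>z. u z - ?b z) \<in> borel_measurable (lebesgue_on domT)" using u(1) bm by measurable
    have i2: "integrable (lebesgue_on domT) (\<lambda>z. (u z - ?b z) * wt T (\<lambda>q. \<kappa> R q * p q) z)"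
      by (rule integrable_mult_bounded[OF wip um ub])
    note d = wt_integral[OF T p(2)]
    have "?f T \<le> (LINT z|lebesgue_on domT. (l (u z) - l (?b z)) * wt T (\<kappa> R) z
        - (u z - ?b z) * wt T (\<lambda>q. \<kappa> R q * p q) z + (B + B) * ?d z)"
    proof (rule integral_mono_AE[OF relative_entropy_integrable[OF R T]])
      show "integrable (lebesgue_on domT) (\<lambda>z. (l (u z) - l (?b z)) * wt T (\<kappa> R) z
        - (u z - ?b z) * wt T (\<lambda>q. \<kappa> R q * p q) z + (B + B) * ?d z)"
        by (intro Bochner_Integration.integrable_add Bochner_Integration.integrable_diff i1 i2 integrable_mult_right d(1))
      show "AE z in lebesgue_on domT. (l (u z) - l (?b z) - l' (?b z) * (u z - ?b z)) * wt T (\<kappa> R) z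
        \<le> (l (u z) - l (?b z)) * wt T (\<kappa> R) z - (u z - ?b z) * wt T (\<lambda>q. \<kappa> R q * p q) z + (B + B) * ?d z"
        using ub wt_nonneg_AE[OF T, of R]
      proof eventually_elim
        case (elim z)
        have w: "wt T (\<lambda>q. \<kappa> R q * p q) z = p (fst z, snd (snd z)) * wt T (\<kappa> R) z" by (simp add: wt_def)
        have "- ((u z - ?b z) * ((l' (?b z) - p (fst z, snd (snd z))) * wt T (\<kappa> R) z))
            \<le> \<bar>u z - ?b z\<bar> * ?d z"
        proof -
          have "\<bar>(u z - ?b z) * ((l' (?b z) - p (fst z, snd (snd z))) * wt T (\<kappa> R) z)\<bar> = \<bar>u z - ?b z\<bar> * ?d z"
            using elim(2) by (simp add: abs_mult)
          then show ?thesis by linarith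
        qed
        also have "\<dots> \<le> (B + B) * ?d z" using elim by (intro mult_right_mono) auto
        finally show ?case unfolding w by (simp add: algebra_simps)
      qed
    qed
    also have "\<dots> = (LINT z|lebesgue_on domT. (l (u z) - l (?b z)) * wt T (\<kappa> R) z)
        - (LINT z|lebesgue_on domT. (u z - ?b z) * wt T (\<lambda>q. \<kappa> R q * p q) z) + (B + B) * (LINT z|lebesgue_on domT. ?d z)"
      by (simp only: Bochner_Integration.integral_add[OF Bochner_Integration.integrable_diff[OF i1 i2] integrable_mult_right[OF d(1)]]
          Bochner_Integration.integral_diff[OF i1 i2] integral_mult_right_zero)
    also have "\<dots> \<le> C1 * T + C2 * T + (B + B) * e'"
    proof -
      have "(LINT z|lebesgue_on domT. ?d z) \<le> 1 * e'"
        unfolding d(2) using bump_less_1[of 2] p(3) flat_exp_nonneg[of 0 2]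
        by (intro mult_mono) (auto intro!: integral_nonneg_AE AE_I2 simp: AE_dom0_iff dom0_def \<rho>(2) \<kappa>_nonneg)
      then have "(B + B) * (LINT z|lebesgue_on domT. ?d z) \<le> (B + B) * e'"
        using B(4) by (intro mult_left_mono) auto
      then show ?thesis using C1[OF T] C2[OF T] by linarith
    qed
    finally show ?thesis by simp
  qed
  have small: "2 * B * e' \<le> e / 2"
  proof -
    have "2 * B * e' \<le> 2 * (B + 1) * e'" using e' by simp
    also have "\<dots> = e / 2"
    proof -
      have "4 * (B + 1) \<noteq> 0" using B(4) by simp
      then have "e' * (4 * (B + 1)) = e" unfolding e'_def by (rule nonzero_eq_divide_eq[THEN iffD1, OF _ refl])
      then show ?thesis by (simp add: algebra_simps)
    qed
    finally show ?thesis .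
  qed
  have "((\<lambda>T. C1 * T + C2 * T) \<longlongrightarrow> C1 * 0 + C2 * 0) (at_right 0)" by (intro tendsto_intros)
  then have "\<forall>\<^sub>F T in at_right 0. C1 * T + C2 * T < e / 2"
    using e by (intro order_tendstoD(2)) auto
  moreover have "\<forall>\<^sub>F T::real in at_right 0. 0 < T" by (rule eventually_at_right_less)
  ultimately show "\<forall>\<^sub>F T in at_right 0. dist (?f T) 0 < e"
  proof eventually_elim
    case (elim T)
    have "0 \<le> ?f T"
    proof (rule integral_nonneg_AE)
      show "AE z in lebesgue_on domT. 0 \<le> (l (u z) - l (u0 (fst z, snd (snd z))) -
         l' (u0 (fst z, snd (snd z))) * (u z - u0 (fst z, snd (snd z)))) * wt T (\<kappa> R) z"
        using u(2) AE_lift_dom0[OF u0(2)] wt_nonneg_AE[OF elim(2), of R]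
        by eventually_elim (auto intro!: mult_nonneg_nonneg relative_entropy_nonneg)
    qed
    with bound[OF elim(2)] small elim(1) show ?case by (simp add: dist_real_def)
  qed
qed

text \<open>On the compact set of pairs in J at distance at least \<alpha> the relative entropy is
  continuous and positive, hence bounded below by a positive constant; there the bounded distance is
  a multiple of it. Strict convexity thus suffices, without a quadratic lower bound.\<close>

lemma distance_le_relative_entropy:
  assumes \<alpha>: "0 < \<alpha>"
  obtains c where "0 \<le> c" "\<And>a b. a \<in> J \<Longrightarrow> b \<in> J \<Longrightarrow> \<bar>a - b\<bar> \<le> \<alpha> + c * (l a - l b - l' b * (a - b))"
proof -
  define A where "A = (J \<times> J) \<inter> {q. \<alpha> \<le> \<bar>fst q - snd q\<bar>}"
  define g where "g q = l (fst q) - l (snd q) - l' (snd q) * (fst q - snd q)" for q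
  have A: "compact A"
    unfolding A_def
    by (intro compact_Int_closed compact_Times J(1) closed_Collect_le continuous_intros)
  have g: "continuous_on A g"
    unfolding g_def[abs_def]
    by (intro continuous_on_diff continuous_on_mult continuous_on_fst continuous_on_snd continuous_on_id
        continuous_on_compose2[OF J(2)] continuous_on_compose2[OF J(3)]) (auto simp: A_def)
  show ?thesis
  proof (cases "A = {}")
    case True
    have "\<bar>a - b\<bar> \<le> \<alpha> + 0 * (l a - l b - l' b * (a - b))" if "a \<in> J" "b \<in> J" for a b
    proof -
      have "(a, b) \<notin> A" using True by simp
      then have "\<not> \<alpha> \<le> \<bar>a - b\<bar>" using that by (simp add: A_def)
      then show ?thesis by simp
    qed
    then show ?thesis by (rule that[of 0, OF order.refl])
  next
    case False
    from continuous_attains_inf[OF A False g] obtain q where q: "q \<in> A" "\<And>q'. q' \<in> A \<Longrightarrow> g q \<le> g q'" by blast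
    have "fst q \<noteq> snd q" using q(1) \<alpha> by (auto simp: A_def)
    then have g0: "0 < g q" using J(4)[of "fst q" "snd q"] q(1) by (auto simp: g_def A_def)
    \<comment> \<open>2B bounds the diameter of J, and g q is the minimum of the relative entropy
      over pairs at distance at least \<alpha>.\<close>
    define c where "c = 2 * B / g q"
    have c0: "0 \<le> c" using g0 B(4) by (simp add: c_def)
    show ?thesis
    proof (rule that[OF c0])
      fix a b assume ab: "a \<in> J" "b \<in> J"
      note nn = mult_nonneg_nonneg[OF c0 relative_entropy_nonneg[OF ab]]
      show "\<bar>a - b\<bar> \<le> \<alpha> + c * (l a - l b - l' b * (a - b))"
      proof (cases "\<bar>a - b\<bar> \<le> \<alpha>")
        case True
        then show ?thesis using nn by linarith
      next
        case False
        then have "(a, b) \<in> A" using ab by (auto simp: A_def)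
        from q(2)[OF this] have "g q \<le> l a - l b - l' b * (a - b)" by (simp add: g_def)
        from mult_left_mono[OF this c0] have "2 * B \<le> c * (l a - l b - l' b * (a - b))"
          using g0 by (simp add: c_def)
        moreover have "\<bar>a - b\<bar> \<le> 2 * B" using B(1)[OF ab(1)] B(1)[OF ab(2)] by linarith
        ultimately show ?thesis using \<alpha> by linarith
      qed
    qed
  qed
qed

lemma distance_limit:
  assumes R: "0 < R"
  shows "((\<lambda>T. LINT z|lebesgue_on domT. \<bar>u z - u0 (fst z, snd (snd z))\<bar> * wt T (\<kappa> R) z) \<longlongrightarrow> 0) (at_right 0)"
    (is "(?f \<longlongrightarrow> 0) _")
proof (rule tendstoI)
  fix e :: real assume e: "0 < e"
  let ?b = "\<lambda>z::real \<times> real \<times> (real^'n). u0 (fst z, snd (snd z))"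
  let ?E = "\<lambda>z. l (u z) - l (?b z) - l' (?b z) * (u z - ?b z)"
  define I where "I = (LINT p|lebesgue_on dom0. \<kappa> R p * \<rho> (snd p))"
  have I0: "0 \<le> I" unfolding I_def
    by (intro integral_nonneg_AE) (auto simp: AE_dom0_iff dom0_def \<rho>(2) \<kappa>_nonneg intro!: AE_I2)
  define \<alpha> where "\<alpha> = e / (2 * (I + 1))"
  have \<alpha>: "0 < \<alpha>" using e I0 by (simp add: \<alpha>_def)
  obtain c where c: "0 \<le> c" "\<And>a b. a \<in> J \<Longrightarrow> b \<in> J \<Longrightarrow> \<bar>a - b\<bar> \<le> \<alpha> + c * (l a - l b - l' b * (a - b))"
    using distance_le_relative_entropy[OF \<alpha>] by blast
  have bound: "0 \<le> ?f T \<and> ?f T \<le> e / 2 + c * (LINT z|lebesgue_on domT. ?E z * wt T (\<kappa> R) z)" if T: "0 < T" for T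
  proof -
    note wi = wt_integrable[OF T kernel_\<kappa>[OF R]] and Ei = relative_entropy_integrable[OF R T]
    have ub: "AE z in lebesgue_on domT. \<bar>\<bar>u z - ?b z\<bar>\<bar> \<le> B + B"
      using bounds_AE(1) AE_lift_dom0[OF bounds_AE(3)] by eventually_elim linarith
    have um: "(\<lambda>z. \<bar>u z - ?b z\<bar>) \<in> borel_measurable (lebesgue_on domT)"
      using u(1) borel_measurable_lift_dom0[OF u0(1)] by measurable
    have i: "integrable (lebesgue_on domT) (\<lambda>z. \<alpha> * wt T (\<kappa> R) z + c * (?E z * wt T (\<kappa> R) z))"
      by (intro Bochner_Integration.integrable_add integrable_mult_right wi Ei)
    have "?f T \<le> (LINT z|lebesgue_on domT. \<alpha> * wt T (\<kappa> R) z + c * (?E z * wt T (\<kappa> R) z))"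
    proof (rule integral_mono_AE[OF integrable_mult_bounded[OF wi um ub] i])
      show "AE z in lebesgue_on domT. \<bar>u z - ?b z\<bar> * wt T (\<kappa> R) z \<le> \<alpha> * wt T (\<kappa> R) z + c * (?E z * wt T (\<kappa> R) z)"
        using u(2) AE_lift_dom0[OF u0(2)] wt_nonneg_AE[OF T, of R]
      proof eventually_elim
        case (elim z)
        from mult_right_mono[OF c(2)[OF elim(1,2)] elim(3)] show ?case by (simp add: distrib_right mult.assoc)
      qed
    qed
    also have "\<dots> = \<alpha> * (LINT z|lebesgue_on domT. wt T (\<kappa> R) z) + c * (LINT z|lebesgue_on domT. ?E z * wt T (\<kappa> R) z)"
      by (simp only: Bochner_Integration.integral_add[OF integrable_mult_right[OF wi] integrable_mult_right[OF Ei]]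
          integral_mult_right_zero)
    also have "(LINT z|lebesgue_on domT. wt T (\<kappa> R) z) = bump 2 * I"
      using wt_integral(2)[OF T, of "\<lambda>_. 1" "\<kappa> R"] kernel_integrable[OF kernel_\<kappa>[OF R]] by (simp add: I_def)
    also have "\<alpha> * (bump 2 * I) \<le> \<alpha> * (1 * (I + 1))"
      using \<alpha> I0 bump_less_1[of 2] flat_exp_nonneg[of 0 2] by (intro mult_left_mono mult_mono) auto
    also have "\<alpha> * (1 * (I + 1)) = e / 2"
    proof -
      have "2 * (I + 1) \<noteq> 0" using I0 by simp
      then have "\<alpha> * (2 * (I + 1)) = e" unfolding \<alpha>_def by (rule nonzero_eq_divide_eq[THEN iffD1, OF _ refl])
      then show ?thesis by (simp add: algebra_simps)
    qed
    finally have "?f T \<le> e / 2 + c * (LINT z|lebesgue_on domT. ?E z * wt T (\<kappa> R) z)" by simp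
    moreover have "0 \<le> ?f T"
      using wt_nonneg_AE[OF T, of R] by (intro integral_nonneg_AE) (auto elim!: eventually_mono)
    ultimately show ?thesis by simp
  qed
  have "((\<lambda>T. c * (LINT z|lebesgue_on domT. ?E z * wt T (\<kappa> R) z)) \<longlongrightarrow> c * 0) (at_right 0)"
    by (intro tendsto_intros relative_entropy_limit[OF R])
  then have "\<forall>\<^sub>F T in at_right 0. c * (LINT z|lebesgue_on domT. ?E z * wt T (\<kappa> R) z) < e / 2"
    using e by (intro order_tendstoD(2)) auto
  moreover have "\<forall>\<^sub>F T::real in at_right 0. 0 < T" by (rule eventually_at_right_less)
  ultimately show "\<forall>\<^sub>F T in at_right 0. dist (?f T) 0 < e"
  proof eventually_elim
    case (elim T)
    with bound[OF elim(2)] show ?case by (simp add: dist_real_def)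
  qed
qed

text \<open>V is only Lebesgue measurable, and measurability of the product in the completed measure
  is obtained by replacing the indicator of V with a Borel function off a null set that lifts to a
  null cylinder.\<close>

lemma lebesgue_Times_domT:
  assumes "V \<in> sets lebesgue"
  shows "V \<times> {0<..<T} \<times> Gam \<in> sets (lebesgue_on (domT :: (real \<times> real \<times> (real^'n)) set))"
proof -
  have "indicat_real V \<in> borel_measurable lebesgue" using assms by simp
  from completion_ex_borel_measurable_real[OF this] obtain v where
    v: "v \<in> borel_measurable lborel" "AE x in lborel. indicat_real V x = v x" by blast
  have "AE q in (lborel :: (real \<times> (real^'n)) measure). indicat_real V (fst q) = v (fst q)"
  proof -
    from AE_E3[OF v(2)] obtain N where N: "\<And>x. x \<notin> N \<Longrightarrow> indicat_real V x = v x" "N \<in> null_sets lborel" by auto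
    then have [measurable]: "N \<in> sets borel" by (auto simp: null_sets_def)
    have "AE q in (lborel :: real measure) \<Otimes>\<^sub>M (lborel :: (real^'n) measure). fst q \<notin> N"
    proof (intro lborel_pair.AE_pair_measure)
      have "Measurable.pred (borel \<Otimes>\<^sub>M borel) (\<lambda>z::real \<times> (real^'n). fst z \<notin> N)" by measurable
      then show "{z \<in> space ((lborel :: real measure) \<Otimes>\<^sub>M (lborel :: (real^'n) measure)). fst z \<notin> N} \<in> sets (lborel \<Otimes>\<^sub>M lborel)"
        unfolding borel_prod lborel_prod by (auto simp: pred_def)
      show "AE x in lborel. AE y in (lborel :: (real^'n) measure). fst (x, y) \<notin> N"
        using AE_not_in[OF N(2)] by eventually_elim simp
    qed
    then show ?thesis unfolding lborel_prod by (rule eventually_mono) (rule N(1))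
  qed
  then have ae: "AE q in lebesgue_on dom0. v (fst (q :: real \<times> (real^'n))) = indicat_real V (fst q)"
    unfolding AE_dom0_iff by (rule eventually_mono) simp
  have "(\<lambda>q::real \<times> (real^'n). v (fst q)) \<in> borel_measurable (lebesgue_on dom0)"
    using v(1) by (intro borel_measurable_lebesgue_onI measurable_compose[OF borel_measurable_pair_borel(1)]) simp
  then have "(\<lambda>q::real \<times> (real^'n). indicat_real V (fst q)) \<in> borel_measurable (lebesgue_on dom0)"
    by (rule borel_measurable_lebesgue_on_AE[OF _ _ ae]) simp
  from borel_measurable_lift_dom0[OF this]
  have m: "(\<lambda>z::real \<times> real \<times> (real^'n). indicat_real V (fst z)) \<in> borel_measurable (lebesgue_on domT)" by simp
  have t: "(\<lambda>z::real \<times> real \<times> (real^'n). fst (snd z)) \<in> borel_measurable (lebesgue_on domT)"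
    by (intro borel_measurable_lebesgue_onI borel_measurable_continuous_onI continuous_intros)
  have "{z \<in> space (lebesgue_on (domT :: (real \<times> real \<times> (real^'n)) set)). indicat_real V (fst z) = 1 \<and> fst (snd z) < T}
      \<in> sets (lebesgue_on domT)"
    using m t by measurable
  moreover have "{z \<in> space (lebesgue_on (domT :: (real \<times> real \<times> (real^'n)) set)). indicat_real V (fst z) = 1 \<and> fst (snd z) < T}
    = V \<times> {0<..<T} \<times> Gam"
    by (auto simp: space_restrict_space domT_def indicator_def split: if_splits)
  ultimately show ?thesis by simp
qed

theorem attains_initial_data_limit: "attains_initial_data \<rho> u u0"
  unfolding attains_initial_data_def
proof (intro allI impI)
  fix V :: "real set" assume "V \<in> sets lebesgue \<and> bounded V"
  then have V: "V \<in> sets lebesgue" "bounded V" by auto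
  then obtain r where r: "0 < r" "\<And>x. x \<in> V \<Longrightarrow> \<bar>x\<bar> \<le> r" by (auto simp: bounded_pos)
  \<comment> \<open>Doubling the radius makes R^2 - x^2 at least 3 r^2 on V, so the spatial cutoff
    is bounded below there by \<open>bump (3 * r\<^sup>2)\<close>.\<close>
  define R where "R = 2 * r"
  have R: "0 < R" using r by (simp add: R_def)
  \<comment> \<open>The reciprocal of the product of two lower bounds: 1 / (4 e) for the temporal
    kernel and \<open>bump (3 * r\<^sup>2)\<close> for the spatial one.\<close>
  define C where "C = 4 * exp 1 / bump (3 * r\<^sup>2)"
  have b0: "0 < bump (3 * r\<^sup>2)" using r by (intro flat_exp_pos) simp
  have C0: "0 < C" using b0 by (simp add: C_def)
  let ?g = "\<lambda>z::real \<times> real \<times> (real^'n). \<bar>u z - u0 (fst z, snd (snd z))\<bar>"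
  let ?h = "\<lambda>T. 1 / T * (LINT (x, t, y)|lebesgue_on (V \<times> {0<..<T} \<times> Gam). norm (u (x, t, y) - u0 (x, y)) * \<rho> y)"
  have bound: "0 \<le> ?h T \<and> ?h T \<le> C * (LINT z|lebesgue_on domT. ?g z * wt T (\<kappa> R) z)" if T: "0 < T" for T
  proof -
    let ?A = "V \<times> {0<..<T} \<times> (Gam :: (real^'n) set)"
    have A: "?A \<in> sets (lebesgue_on domT)" by (rule lebesgue_Times_domT[OF V(1)])
    have Ad: "?A \<subseteq> domT" by (auto simp: domT_def)
    have AL: "?A \<inter> space lebesgue \<in> sets lebesgue" using A Ad by (simp add: sets_restrict_space_iff)
    have dL: "(domT :: (real \<times> real \<times> (real^'n)) set) \<inter> space lebesgue \<in> sets lebesgue" by simp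
    note wi = wt_integrable[OF T kernel_\<kappa>[OF R]]
    have ub: "AE z in lebesgue_on domT. \<bar>?g z\<bar> \<le> B + B"
      using bounds_AE(1) AE_lift_dom0[OF bounds_AE(3)] by eventually_elim linarith
    have um: "?g \<in> borel_measurable (lebesgue_on domT)"
      using u(1) borel_measurable_lift_dom0[OF u0(1)] by measurable
    have i1: "integrable (lebesgue_on domT) (\<lambda>z. C * (?g z * wt T (\<kappa> R) z))"
      by (intro integrable_mult_right integrable_mult_bounded[OF wi um ub])
    have key: "1 / T * (indicat_real ?A z * (?g z * \<rho> (snd (snd z)))) \<le> C * (?g z * wt T (\<kappa> R) z)"
      "0 \<le> indicat_real ?A z * (?g z * \<rho> (snd (snd z)))" if z: "z \<in> domT" for z
    proof -
      obtain x t y where zz: "z = (x, t, y)" by (cases z) auto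
      have t: "0 < t" and y: "0 \<le> \<rho> y" using z \<rho>(2) by (auto simp: zz domT_def)
      show "0 \<le> indicat_real ?A z * (?g z * \<rho> (snd (snd z)))" using y by (simp add: zz)
      have w0: "0 \<le> wt T (\<kappa> R) z" using T y by (simp add: zz wt_def flat_exp_nonneg \<kappa>_nonneg)
      show "1 / T * (indicat_real ?A z * (?g z * \<rho> (snd (snd z)))) \<le> C * (?g z * wt T (\<kappa> R) z)"
      proof (cases "z \<in> ?A")
        case False
        then show ?thesis using w0 C0 by simp
      next
        case True
        then have x: "\<bar>x\<bar> \<le> r" and tT: "t < T" using r(2) by (auto simp: zz)
        have k1: "bump (3 * r\<^sup>2) \<le> \<kappa> R (x, y)"
        proof -
          have "x\<^sup>2 \<le> r\<^sup>2" using x r(1) by (simp add: abs_le_square_iff[symmetric])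
          then show ?thesis unfolding \<kappa>_def by (intro bump_mono) (simp add: R_def power2_eq_square)
        qed
        \<comment> \<open>For 0 < t < T the argument s = 2 - t/T lies between 1 and 2, where s^(-2)
          \<ge> 1/4 and exp(-1/s) \<ge> exp(-1). The support up to 2T is what keeps the kernel
          positive throughout the layer of thickness T.\<close>
        have k2: "1 / (4 * exp 1) \<le> flat_exp 2 (2 - t / T)"
        proof -
          define s where "s = 2 - t / T"
          have s: "1 \<le> s" "s \<le> 2" using t tT T by (auto simp: s_def field_simps)
          have "inverse s ^ 2 \<ge> inverse 2 ^ 2" using s by (intro power_mono le_imp_inverse_le) auto
          moreover have "exp (- inverse s) \<ge> exp (- 1)" using s by (simp add: inverse_le_1_iff)
          ultimately have "inverse 2 ^ 2 * exp (- 1) \<le> inverse s ^ 2 * exp (- inverse s)" by (intro mult_mono) auto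
          then show ?thesis using s unfolding s_def[symmetric]
            by (simp add: flat_exp_def exp_minus power2_eq_square field_simps)
        qed
        have "1 = C * (1 / (4 * exp 1) * bump (3 * r\<^sup>2))" using b0 by (simp add: C_def)
        also have "\<dots> \<le> C * (flat_exp 2 (2 - t / T) * \<kappa> R (x, y))"
          using C0 b0 by (intro mult_left_mono mult_mono k1 k2) (auto simp: flat_exp_nonneg)
        finally have "(?g z * \<rho> y / T) * 1 \<le> (?g z * \<rho> y / T) * (C * (flat_exp 2 (2 - t / T) * \<kappa> R (x, y)))"
          using y T by (intro mult_left_mono) auto
        then show ?thesis using True by (simp add: zz wt_def mult_ac)
      qed
    qed
    have eqA: "(\<lambda>z. indicat_real domT z *\<^sub>R (indicat_real ?A z * G z)) = (\<lambda>z. indicat_real ?A z *\<^sub>R G z)"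
      for G :: "real \<times> real \<times> (real^'n) \<Rightarrow> real"
      by (rule ext) (use Ad in \<open>auto simp: indicator_def\<close>)
    have cp: "(\<lambda>(x, t, y). norm (u (x, t, y) - u0 (x, y)) * \<rho> y) = (\<lambda>z. ?g z * \<rho> (snd (snd z)))" by auto
    have e: "(LINT (x, t, y)|lebesgue_on ?A. norm (u (x, t, y) - u0 (x, y)) * \<rho> y)
       = (LINT z|lebesgue_on domT. indicat_real ?A z * (?g z * \<rho> (snd (snd z))))"
      unfolding cp integral_restrict_space[OF AL] integral_restrict_space[OF dL] eqA ..
    have dom: "AE z in lebesgue_on domT. z \<in> (domT :: (real \<times> real \<times> (real^'n)) set)" by (simp add: AE_domT_iff)
    have "0 \<le> ?h T" unfolding e using T dom key(2)
      by (intro mult_nonneg_nonneg integral_nonneg_AE) (auto elim!: eventually_mono)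
    moreover have "?h T \<le> C * (LINT z|lebesgue_on domT. ?g z * wt T (\<kappa> R) z)"
    proof -
      have "?h T = (LINT z|lebesgue_on domT. 1 / T * (indicat_real ?A z * (?g z * \<rho> (snd (snd z)))))"
        unfolding e by (rule integral_mult_right_zero[symmetric])
      also have "\<dots> \<le> (LINT z|lebesgue_on domT. C * (?g z * wt T (\<kappa> R) z))"
      proof (rule integral_mono_AE)
        have \<rho>m: "(\<lambda>z. \<rho> (snd (snd z))) \<in> borel_measurable (lebesgue_on domT)"
          using \<rho>(1) by (intro borel_measurable_lift_Gam(2)) (simp add: Linf_def)
        show "integrable (lebesgue_on domT) (\<lambda>z. 1 / T * (indicat_real ?A z * (?g z * \<rho> (snd (snd z)))))"
        proof (rule Bochner_Integration.integrable_bound[OF i1])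
          show "(\<lambda>z. 1 / T * (indicat_real ?A z * (?g z * \<rho> (snd (snd z))))) \<in> borel_measurable (lebesgue_on domT)"
            using um \<rho>m A by measurable
          show "AE z in lebesgue_on domT. norm (1 / T * (indicat_real ?A z * (?g z * \<rho> (snd (snd z)))))
              \<le> norm (C * (?g z * wt T (\<kappa> R) z))"
            using dom
          proof eventually_elim
            case (elim z)
            have "0 \<le> 1 / T * (indicat_real ?A z * (?g z * \<rho> (snd (snd z))))"
              by (rule mult_nonneg_nonneg[OF _ key(2)[OF elim]]) (use T in simp)
            with key(1)[OF elim] show ?case unfolding real_norm_def by linarith
          qed
        qed
      qed (use i1 dom key(1) in \<open>auto elim!: eventually_mono\<close>)
      also have "\<dots> = C * (LINT z|lebesgue_on domT. ?g z * wt T (\<kappa> R) z)" by (rule integral_mult_right_zero)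
      finally show ?thesis .
    qed
    ultimately show ?thesis by simp
  qed
  have lim: "((\<lambda>T. C * (LINT z|lebesgue_on domT. ?g z * wt T (\<kappa> R) z)) \<longlongrightarrow> 0) (at_right 0)"
    using tendsto_mult[OF tendsto_const distance_limit[OF R], of C] by simp
  have pos: "\<forall>\<^sub>F T::real in at_right 0. 0 < T" by (rule eventually_at_right_less)
  show "(?h \<longlongrightarrow> 0) (at_right 0)"
    by (rule tendsto_sandwich[OF _ _ tendsto_const lim]; rule eventually_mono[OF pos]) (use bound in blast)+
qed

end


subsection \<open>Kruzhkov entropies\<close>

lemma Icc_subset_convex: "convex I \<Longrightarrow> a \<in> I \<Longrightarrow> b \<in> I \<Longrightarrow> {a..b} \<subseteq> I" for I :: "real set"
  using closed_segment_subset[of a I b] by (cases "a \<le> b") (auto simp: closed_segment_eq_real_ivl)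

text \<open>I may contain or omit either end point. Around s and k a compact subinterval is found
  that fills a relative neighbourhood of s in I, so calculus on compact intervals carries over to
  derivatives within I.\<close>

lemma interval_neighbourhood:
  fixes I :: "real set"
  assumes I: "convex I" and s: "s \<in> I" "k \<in> I"
  obtains a b where "a \<in> I" "b \<in> I" "a \<le> s" "s \<le> b" "a \<le> k" "k \<le> b" "{a..b} \<subseteq> I"
    "at s within I = at s within {a..b}"
proof -
  obtain a where a: "a \<in> I" "a \<le> s" "a \<le> k" "\<And>x. x \<in> I \<Longrightarrow> x < s \<Longrightarrow> a < s"
  proof (cases "\<exists>x\<in>I. x < s")
    case True
    then obtain x where "x \<in> I" "x < s" by blast
    then show ?thesis using s by (intro that[of "min x k"]) (auto simp: min_def)
  next
    case False
    then have "s \<le> x" if "x \<in> I" for x using that not_le by blast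
    then show ?thesis using s False by (intro that[of s]) auto
  qed
  obtain b where b: "b \<in> I" "s \<le> b" "k \<le> b" "\<And>x. x \<in> I \<Longrightarrow> s < x \<Longrightarrow> s < b"
  proof (cases "\<exists>x\<in>I. s < x")
    case True
    then obtain x where "x \<in> I" "s < x" by blast
    then show ?thesis using s by (intro that[of "max x k"]) (auto simp: max_def)
  next
    case False
    then have "x \<le> s" if "x \<in> I" for x using that not_le by blast
    then show ?thesis using s False by (intro that[of s]) auto
  qed
  have sub: "{a..b} \<subseteq> I"
    by (rule Icc_subset_convex[OF I a(1) b(1)])
  \<comment> \<open>If s is an end point of I on one side, there are no points of I beyond it, and
    the window may extend by an arbitrary 1 on that side.\<close>
  define lo hi where "lo = (if a < s then a else s - 1)" and "hi = (if s < b then b else s + 1)"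
  have "at s within I = at s within {a..b}"
  proof (rule at_within_nhd[of s "{lo<..<hi}"])
    show "s \<in> {lo<..<hi}" by (auto simp: lo_def hi_def)
    show "I \<inter> {lo<..<hi} - {s} = {a..b} \<inter> {lo<..<hi} - {s}"
    proof (rule set_eqI, rule iffI)
      fix x assume x: "x \<in> I \<inter> {lo<..<hi} - {s}"
      then have "x < s \<Longrightarrow> a < s" "s < x \<Longrightarrow> s < b" using a(4) b(4) by auto
      with x a(2) b(2) show "x \<in> {a..b} \<inter> {lo<..<hi} - {s}"
        by (cases "x < s") (auto simp: lo_def hi_def)
    next
      fix x assume "x \<in> {a..b} \<inter> {lo<..<hi} - {s}"
      then show "x \<in> I \<inter> {lo<..<hi} - {s}" using sub by auto
    qed
  qed simp
  with a b sub show ?thesis using that by blast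
qed

lemma interval_antiderivative:
  fixes I :: "real set" and g :: "real \<Rightarrow> real"
  assumes I: "convex I" and g: "continuous_on I g" and k: "k \<in> I"
  obtains q where "q k = 0" "\<And>s. s \<in> I \<Longrightarrow> (q has_real_derivative g s) (at s within I)"
proof -
  define q where "q s = (if k \<le> s then integral {k..s} g else - integral {s..k} g)" for s
  have "(q has_real_derivative g s) (at s within I)" if s: "s \<in> I" for s
  proof -
    from interval_neighbourhood[OF I s k] obtain a b where ab: "a \<in> I" "b \<in> I" "a \<le> s" "s \<le> b" "a \<le> k" "k \<le> b"
      "{a..b} \<subseteq> I" "at s within I = at s within {a..b}" by blast
    have gc: "continuous_on {a..b} g" by (rule continuous_on_subset[OF g ab(7)])
    have gi: "g integrable_on {c..d}" if "a \<le> c" "d \<le> b" for c d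
      using that by (intro integrable_continuous_real continuous_on_subset[OF gc]) auto
    have qe: "integral {a..x} g - integral {a..k} g = q x" if "x \<in> {a..b}" for x
    proof (cases "k \<le> x")
      case True
      then have "integral {a..k} g + integral {k..x} g = integral {a..x} g"
        using that ab(5) by (intro Henstock_Kurzweil_Integration.integral_combine gi) auto
      then show ?thesis using True by (simp add: q_def)
    next
      case False
      then have "integral {a..x} g + integral {x..k} g = integral {a..k} g"
        using that ab(6) by (intro Henstock_Kurzweil_Integration.integral_combine gi) auto
      then show ?thesis using False by (simp add: q_def)
    qed
    have "((\<lambda>x. integral {a..x} g - integral {a..k} g) has_real_derivative g s - 0) (at s within {a..b})"
      using ab(3,4) by (intro DERIV_diff integral_has_real_derivative gc DERIV_const) auto
    then have "((\<lambda>x. integral {a..x} g - integral {a..k} g) has_real_derivative g s) (at s within {a..b})" by simp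
    then have "(q has_real_derivative g s) (at s within {a..b})"
      by (rule has_field_derivative_transform_within[OF _ zero_less_one]) (use ab qe in auto)
    then show ?thesis by (simp add: ab(8))
  qed
  moreover have "q k = 0" by (simp add: q_def)
  ultimately show ?thesis using that by blast
qed

text \<open>A smooth nondecreasing approximation of the sign of s - k. The argument of
  \<open>ramp\<close> crosses its transition interval [1, 2] while s runs from k - \<delta>/2 to k +
  \<delta>/2, and division by the plateau height normalises the limits to -1 and 1.\<close>

definition smooth_sgn :: "real \<Rightarrow> real \<Rightarrow> real \<Rightarrow> real" where
  "smooth_sgn \<delta> k s = 2 / bump (exp (- 1)) * ramp ((s - k) / \<delta> + 3 / 2) - 1"

lemma ramp_le: "ramp s \<le> bump (exp (- 1))"
  unfolding ramp_def by (intro bump_mono) (simp add: flat_exp_nonneg)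

lemma bump_exp_pos: "0 < bump (exp (- 1))"
  by (intro flat_exp_pos) simp

lemma abs_smooth_sgn_le: "\<bar>smooth_sgn \<delta> k s\<bar> \<le> 1"
proof -
  have "2 / bump (exp (- 1)) * ramp ((s - k) / \<delta> + 3 / 2) \<le> 2 / bump (exp (- 1)) * bump (exp (- 1))"
    using bump_exp_pos by (intro mult_left_mono ramp_le) simp
  moreover have "0 \<le> 2 / bump (exp (- 1)) * ramp ((s - k) / \<delta> + 3 / 2)"
    using bump_exp_pos ramp_nonneg by simp
  ultimately show ?thesis using bump_exp_pos by (simp add: smooth_sgn_def)
qed

lemma smooth_sgn_right: "0 < \<delta> \<Longrightarrow> k + \<delta> \<le> s \<Longrightarrow> smooth_sgn \<delta> k s = 1"
proof -
  assume "0 < \<delta>" "k + \<delta> \<le> s"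
  then have "1 \<le> (s - k) / \<delta>" by (simp add: field_simps)
  then show ?thesis using bump_exp_pos by (simp add: smooth_sgn_def ramp_const)
qed

lemma smooth_sgn_left: "0 < \<delta> \<Longrightarrow> s \<le> k - \<delta> \<Longrightarrow> smooth_sgn \<delta> k s = - 1"
proof -
  assume "0 < \<delta>" "s \<le> k - \<delta>"
  then have "(s - k) / \<delta> \<le> - 1" by (simp add: field_simps)
  then show ?thesis by (simp add: smooth_sgn_def ramp_eq_0)
qed

lemma smooth_sgn_has_derivative:
  assumes "0 < \<delta>"
  shows "(smooth_sgn \<delta> k has_real_derivative 2 / bump (exp (- 1)) * (ramp' ((s - k) / \<delta> + 3 / 2) / \<delta>)) (at s)"
proof -
  have "((\<lambda>s. (s - k) / \<delta> + 3 / 2) has_derivative (\<lambda>h. h / \<delta>)) (at s)"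
    using assms by (auto intro!: derivative_eq_intros)
  from has_derivative_ramp_compose[OF this]
  have "((\<lambda>s. ramp ((s - k) / \<delta> + 3 / 2)) has_real_derivative ramp' ((s - k) / \<delta> + 3 / 2) / \<delta>) (at s)"
    by (rule has_derivative_imp_has_field_derivative) simp
  from DERIV_diff[OF DERIV_cmult[OF this, of "2 / bump (exp (- 1))"] DERIV_const[of 1]] show ?thesis
    unfolding smooth_sgn_def[abs_def] by simp
qed

lemma continuous_smooth_sgn: "0 < \<delta> \<Longrightarrow> continuous_on A (smooth_sgn \<delta> k)"
  by (rule DERIV_continuous_on[OF has_field_derivative_at_within[OF smooth_sgn_has_derivative]])

text \<open>The difference from the Kruzhkov flux has derivative (\<open>smooth_sgn\<close> - sign)
  f', which vanishes at distance \<delta> from k and beyond. The estimate is therefore uniform in s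
  and uses f' only near k, even if f' is unbounded towards a missing end point of I.\<close>

lemma kruzkov_flux_approx:
  fixes I :: "real set" and f f' q :: "real \<Rightarrow> real"
  assumes I: "convex I" and k: "k \<in> I" and \<delta>: "0 < \<delta>"
    and f: "\<And>s. s \<in> I \<Longrightarrow> (f has_real_derivative f' s) (at s within I)"
    and q: "q k = 0" "\<And>s. s \<in> I \<Longrightarrow> (q has_real_derivative smooth_sgn \<delta> k s * f' s) (at s within I)"
    and C: "\<And>s. s \<in> I \<Longrightarrow> \<bar>s - k\<bar> \<le> \<delta> \<Longrightarrow> \<bar>f' s\<bar> \<le> C"
    and s: "s \<in> I"
  shows "\<bar>q s - sgn (s - k) * (f s - f k)\<bar> \<le> 2 * C * \<delta>"
proof -
  have C0: "0 \<le> C" using C[OF k] \<delta> by auto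
  have seg: "{min k s..max k s} \<subseteq> I"
    using k s by (intro Icc_subset_convex[OF I]) (auto simp: min_def max_def)
  define \<sigma> where "\<sigma> = sgn (s - k)"
  \<comment> \<open>The point where the transition zone is left on the way from k to s, or s itself
    if it lies inside the zone.\<close>
  define m where "m = (if \<bar>s - k\<bar> \<le> \<delta> then s else k + \<sigma> * \<delta>)"
  have m: "m \<in> {min k s..max k s}" "\<bar>m - k\<bar> \<le> \<delta>"
    using \<delta> by (auto simp: m_def \<sigma>_def sgn_if min_def max_def abs_real_def split: if_splits)
  have mI: "m \<in> I" using m(1) seg by auto
  define D where "D x = q x - \<sigma> * (f x - f k)" for x
  have dD: "(D has_real_derivative (smooth_sgn \<delta> k x - \<sigma>) * f' x) (at x within T)" if "x \<in> I" "T \<subseteq> I" for x T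
  proof -
    have "(D has_real_derivative smooth_sgn \<delta> k x * f' x - \<sigma> * (f' x - 0)) (at x within I)"
      unfolding D_def[abs_def] by (intro DERIV_diff DERIV_cmult q(2) f DERIV_const that(1))
    then have "(D has_real_derivative (smooth_sgn \<delta> k x - \<sigma>) * f' x) (at x within I)"
      by (simp add: left_diff_distrib)
    then show ?thesis using that(2) by (rule has_field_derivative_subset)
  qed
  have sub1: "{min k m..max k m} \<subseteq> I" and sub2: "{min m s..max m s} \<subseteq> I"
    using m(1) seg by (auto simp: min_def max_def split: if_splits)
  have near: "\<bar>D m - D k\<bar> \<le> (2 * C) * \<bar>m - k\<bar>"
  proof -
    have "norm (D m - D k) \<le> (2 * C) * norm (m - k)"
    proof (rule field_differentiable_bound[of "{min k m..max k m}" D "\<lambda>x. (smooth_sgn \<delta> k x - \<sigma>) * f' x"])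
      show "(D has_real_derivative (smooth_sgn \<delta> k x - \<sigma>) * f' x) (at x within {min k m..max k m})"
        if "x \<in> {min k m..max k m}" for x using that sub1 by (intro dD) auto
      show "norm ((smooth_sgn \<delta> k x - \<sigma>) * f' x) \<le> 2 * C" if x: "x \<in> {min k m..max k m}" for x
      proof -
        have "\<bar>smooth_sgn \<delta> k x - \<sigma>\<bar> \<le> 2"
          using abs_smooth_sgn_le[of \<delta> k x] by (auto simp: \<sigma>_def sgn_if)
        moreover have "\<bar>f' x\<bar> \<le> C"
        proof (rule C)
          show "x \<in> I" using x sub1 by auto
          show "\<bar>x - k\<bar> \<le> \<delta>" using x m(2) by (auto simp: min_def max_def split: if_splits)
        qed
        ultimately show ?thesis unfolding real_norm_def abs_mult by (intro mult_mono) auto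
      qed
    qed (auto simp: min_def max_def)
    then show ?thesis by simp
  qed
  have far: "D s = D m"
  proof (cases "\<bar>s - k\<bar> \<le> \<delta>")
    case True
    then show ?thesis by (simp add: m_def)
  next
    case False
    have "norm (D s - D m) \<le> 0 * norm (s - m)"
    proof (rule field_differentiable_bound[of "{min m s..max m s}" D "\<lambda>x. (smooth_sgn \<delta> k x - \<sigma>) * f' x"])
      show "(D has_real_derivative (smooth_sgn \<delta> k x - \<sigma>) * f' x) (at x within {min m s..max m s})"
        if "x \<in> {min m s..max m s}" for x using that sub2 by (intro dD) auto
      show "norm ((smooth_sgn \<delta> k x - \<sigma>) * f' x) \<le> 0" if x: "x \<in> {min m s..max m s}" for x
      proof -
        have "smooth_sgn \<delta> k x = \<sigma>"
        proof (cases "k < s")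
          case True
          then have "\<sigma> = 1" "k + \<delta> \<le> x" using False x \<delta> by (auto simp: \<sigma>_def m_def min_def max_def split: if_splits)
          then show ?thesis using smooth_sgn_right[OF \<delta>] by simp
        next
          case False
          then have "\<sigma> = - 1" "x \<le> k - \<delta>" using \<open>\<not> \<bar>s - k\<bar> \<le> \<delta>\<close> x \<delta>
            by (auto simp: \<sigma>_def m_def min_def max_def sgn_if split: if_splits)
          then show ?thesis using smooth_sgn_left[OF \<delta>] by simp
        qed
        then show ?thesis by simp
      qed
    qed (auto simp: min_def max_def)
    then show ?thesis by simp
  qed
  have "D k = 0" by (simp add: D_def q(1))
  with near far have "\<bar>D s\<bar> \<le> 2 * C * \<bar>m - k\<bar>" by simp
  also have "\<dots> \<le> 2 * C * \<delta>" using m(2) C0 by (intro mult_left_mono) auto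
  finally show ?thesis by (simp add: D_def \<sigma>_def)
qed

text \<open>Antiderivatives of \<open>smooth_sgn\<close> are smooth convex entropies converging
  uniformly to \<bar>s - k\<bar>, with entropy fluxes converging uniformly on I to the Kruzhkov
  flux. The bounds on w and on f(w) make all entropies and fluxes bounded uniformly along the
  approximation.\<close>

lemma kruzkov_inequality:
  fixes w :: "real \<times> real \<times> (real^'n) \<Rightarrow> real" and \<rho> :: "real^'n \<Rightarrow> real"
  assumes \<rho>: "Linf Gam \<rho>" and I: "convex I" "I \<in> sets borel" and k: "k \<in> I"
    and f: "\<And>s. s \<in> I \<Longrightarrow> (f has_real_derivative f' s) (at s within I)" "continuous_on I f'"
    and w: "w \<in> borel_measurable (lebesgue_on domT)" "AE z in lebesgue_on domT. w z \<in> I"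
      "AE z in lebesgue_on domT. \<bar>w z\<bar> \<le> B" "AE z in lebesgue_on domT. \<bar>f (w z)\<bar> \<le> B"
    and ent: "\<And>l l' l'' q. convex_on UNIV l \<Longrightarrow> C2_real_with I l l' l'' \<Longrightarrow>
        (\<And>s. s \<in> I \<Longrightarrow> (q has_real_derivative l' s * f' s) (at s within I)) \<Longrightarrow>
        0 \<le> (LINT z|lebesgue_on domT. (l (w z) * dt \<phi> z + q (w z) * dx \<phi> z) * \<rho> (snd (snd z)))"
    and \<phi>: "test_fun domT \<phi>"
  shows "0 \<le> (LINT z|lebesgue_on domT. (\<bar>w z - k\<bar> * dt \<phi> z
      + sgn (w z - k) * (f (w z) - f k) * dx \<phi> z) * \<rho> (snd (snd z)))"
proof -
  \<comment> \<open>Continuity of f' at k gives a bound C for f' on a neighbourhood of k in I; the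
    widths \<delta> n are then chosen below d.\<close>
  obtain d where d: "0 < d" "\<And>s. s \<in> I \<Longrightarrow> \<bar>s - k\<bar> < d \<Longrightarrow> \<bar>f' s - f' k\<bar> < 1"
    using f(2) k unfolding continuous_on_iff dist_real_def by (metis zero_less_one)
  define C where "C = \<bar>f' k\<bar> + 1"
  define \<delta> where "\<delta> n = (d / 2) * inverse (real (Suc n))" for n
  have \<delta>: "0 < \<delta> n" "\<delta> n < d" for n
  proof -
    show "0 < \<delta> n" using d(1) by (simp add: \<delta>_def)
    have "(d / 2) * inverse (real (Suc n)) \<le> (d / 2) * 1"
      using d(1) by (intro mult_left_mono) (auto simp: inverse_le_1_iff)
    then show "\<delta> n < d" using d(1) by (simp add: \<delta>_def)
  qed
  have \<delta>0: "\<delta> \<longlonglongrightarrow> 0"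
    unfolding \<delta>_def using tendsto_mult[OF tendsto_const LIMSEQ_inverse_real_of_nat, of "d / 2"] by simp
  have bC: "\<bar>f' s\<bar> \<le> C" if "s \<in> I" "\<bar>s - k\<bar> \<le> \<delta> n" for s n
    using d(2)[OF that(1)] that(2) \<delta>(2)[of n] by (simp add: C_def)
  have "\<exists>q. q k = 0 \<and> (\<forall>s\<in>I. (q has_real_derivative smooth_sgn (\<delta> n) k s * f' s) (at s within I))" for n
    using interval_antiderivative[OF I(1) continuous_on_mult[OF continuous_smooth_sgn[OF \<delta>(1)] f(2)] k] by metis
  then obtain q where q: "\<And>n. q n k = 0"
    "\<And>n s. s \<in> I \<Longrightarrow> (q n has_real_derivative smooth_sgn (\<delta> n) k s * f' s) (at s within I)" by metis
  \<comment> \<open>The entropy must be convex on the whole line, so it is integrated over all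
    reals, unlike the flux, which is defined by integration within I.\<close>
  have "\<exists>l. l k = 0 \<and> (\<forall>s\<in>UNIV. (l has_real_derivative smooth_sgn (\<delta> n) k s) (at s within UNIV))" for n
    using interval_antiderivative[OF convex_UNIV continuous_smooth_sgn[OF \<delta>(1)] UNIV_I] by metis
  then obtain l where l: "\<And>n. l n k = 0" "\<And>n s. (l n has_real_derivative smooth_sgn (\<delta> n) k s) (at s)" by auto metis
  define l'' where "l'' n s = 2 / bump (exp (- 1)) * (ramp' ((s - k) / \<delta> n + 3 / 2) / \<delta> n)" for n s
  have l2: "(smooth_sgn (\<delta> n) k has_real_derivative l'' n s) (at s)" for n s
    unfolding l''_def by (rule smooth_sgn_has_derivative[OF \<delta>(1)])
  have l2c: "continuous_on A (l'' n)" for A n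
  proof -
    have "continuous_on A (\<lambda>s. ramp' ((s - k) / \<delta> n + 3 / 2))"
      by (rule continuous_on_compose2[OF continuous_ramp'[of UNIV]])
         (use \<delta>(1)[of n] in \<open>auto intro!: continuous_on_add continuous_on_divide continuous_on_diff continuous_on_const continuous_on_id\<close>)
    then show ?thesis unfolding l''_def[abs_def] divide_inverse
      by (intro continuous_on_mult continuous_on_const)
  qed
  have l2n: "0 \<le> l'' n s" for n s
    using \<delta>(1)[of n] bump_exp_pos ramp'_nonneg by (simp add: l''_def)
  have conv: "convex_on UNIV (l n)" for n
    by (rule f''_ge0_imp_convex[OF convex_UNIV, of _ "smooth_sgn (\<delta> n) k" "l'' n"]) (use l(2) l2 l2n in auto)
  have C2: "C2_real_with I (l n) (smooth_sgn (\<delta> n) k) (l'' n)" for n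
    unfolding C2_real_with_def using l(2) l2 l2c by (auto intro: has_field_derivative_at_within)
  have ineq: "0 \<le> (LINT z|lebesgue_on domT. (l n (w z) * dt \<phi> z + q n (w z) * dx \<phi> z) * \<rho> (snd (snd z)))" for n
    by (rule ent[OF conv C2 q(2)])
  have ql: "\<bar>q n s - sgn (s - k) * (f s - f k)\<bar> \<le> 2 * C * \<delta> n" if "s \<in> I" for n s
    by (rule kruzkov_flux_approx[OF I(1) k \<delta>(1) f(1) q(1,2) bC that])
  \<comment> \<open>The entropy error is the flux estimate for the identity in place of f, whose
    derivative is bounded by 1.\<close>
  have ll: "\<bar>l n s - \<bar>s - k\<bar>\<bar> \<le> 2 * 1 * \<delta> n" for n s
  proof -
    have "\<bar>l n s - sgn (s - k) * (s - k)\<bar> \<le> 2 * 1 * \<delta> n"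
      by (rule kruzkov_flux_approx[OF convex_UNIV UNIV_I \<delta>(1), of "\<lambda>s. s" "\<lambda>s. 1"]) (use l in auto)
    then show ?thesis by (simp add: abs_sgn mult.commute)
  qed
  note int = integrable_test_fun_derivatives[OF \<rho> \<phi>]
  define K where "K = \<bar>k\<bar> + \<bar>f k\<bar> + B + 2 * d + 2 * C * d"
  have C0: "0 \<le> C" by (simp add: C_def)
  have Cd: "0 \<le> C * d" using C0 d(1) by simp
  have K: "2 * C * d + (B + \<bar>f k\<bar>) \<le> K" "B + \<bar>f k\<bar> \<le> K" "2 * d + (B + \<bar>k\<bar>) \<le> K" "B + \<bar>k\<bar> \<le> K"
    using d(1) Cd abs_ge_zero[of k] abs_ge_zero[of "f k"] unfolding K_def by simp_all
  have sb: "\<bar>sgn (s - k) * (f s - f k)\<bar> \<le> \<bar>f s\<bar> + \<bar>f k\<bar>" for s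
    unfolding abs_mult using mult_mono[of "\<bar>sgn (s - k)\<bar>" 1 "\<bar>f s - f k\<bar>" "\<bar>f s\<bar> + \<bar>f k\<bar>"] abs_triangle_ineq4[of "f s" "f k"]
    by (simp add: abs_sgn_eq)
  have lm: "(\<lambda>z. l n (w z)) \<in> borel_measurable (lebesgue_on domT)" for n
    using measurable_compose[OF w(1) borel_measurable_continuous_onI[of "l n"]] l(2)
    by (auto simp: continuous_on_eq_continuous_at intro: DERIV_isCont)
  have qc: "continuous_on I (q n)" for n using q(2) by (rule DERIV_continuous_on)
  have fc: "continuous_on I f" using f(1) by (rule DERIV_continuous_on)
  have qm: "(\<lambda>z. q n (w z)) \<in> borel_measurable (lebesgue_on domT)" for n
    by (rule borel_measurable_compose_AE[OF _ w(1) I(2) qc w(2)]) simp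
  have fm: "(\<lambda>z. f (w z)) \<in> borel_measurable (lebesgue_on domT)"
    by (rule borel_measurable_compose_AE[OF _ w(1) I(2) fc w(2)]) simp
  have lb: "AE z in lebesgue_on domT. \<bar>l n (w z)\<bar> \<le> K" for n
    using w(2,3)
  proof eventually_elim
    case (elim z)
    have "\<bar>l n (w z)\<bar> \<le> \<bar>l n (w z) - \<bar>w z - k\<bar>\<bar> + \<bar>w z - k\<bar>"
      using abs_triangle_ineq[of "l n (w z) - \<bar>w z - k\<bar>" "\<bar>w z - k\<bar>"] by simp
    also have "\<dots> \<le> 2 * d + (B + \<bar>k\<bar>)"
    proof (rule add_mono)
      have "2 * 1 * \<delta> n \<le> 2 * d" using \<delta>(2)[of n] by simp
      with ll[of n "w z"] show "\<bar>l n (w z) - \<bar>w z - k\<bar>\<bar> \<le> 2 * d" by (rule order.trans)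
      show "\<bar>w z - k\<bar> \<le> B + \<bar>k\<bar>" by (rule order.trans[OF abs_triangle_ineq4 add_right_mono[OF elim(2)]])
    qed
    also note K(3)
    finally show ?case .
  qed
  have qb: "AE z in lebesgue_on domT. \<bar>q n (w z)\<bar> \<le> K" for n
    using w(2-4)
  proof eventually_elim
    case (elim z)
    let ?X = "sgn (w z - k) * (f (w z) - f k)"
    have "\<bar>q n (w z)\<bar> \<le> \<bar>q n (w z) - ?X\<bar> + \<bar>?X\<bar>" using abs_triangle_ineq[of "q n (w z) - ?X" ?X] by simp
    also have "\<dots> \<le> 2 * C * d + (B + \<bar>f k\<bar>)"
    proof (rule add_mono)
      have "2 * C * \<delta> n \<le> 2 * C * d" using C0 \<delta>(2)[of n] by (intro mult_left_mono) auto
      with ql[OF elim(1), of n] show "\<bar>q n (w z) - ?X\<bar> \<le> 2 * C * d" by (rule order.trans)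
      show "\<bar>?X\<bar> \<le> B + \<bar>f k\<bar>" by (rule order.trans[OF sb add_right_mono[OF elim(3)]])
    qed
    also note K(1)
    finally show ?case .
  qed
  have L1: "(\<lambda>n. LINT z|lebesgue_on domT. l n (w z) * (dt \<phi> z * \<rho> (snd (snd z))))
     \<longlonglongrightarrow> (LINT z|lebesgue_on domT. \<bar>w z - k\<bar> * (dt \<phi> z * \<rho> (snd (snd z))))"
  proof (rule bounded_convergence_weighted[OF int(1) lm _ lb])
    show "(\<lambda>z. \<bar>w z - k\<bar>) \<in> borel_measurable (lebesgue_on domT)" using w(1) by measurable
    have "(\<lambda>n. l n s) \<longlonglongrightarrow> \<bar>s - k\<bar>" for s
    proof (rule LIM_zero_cancel, rule Lim_null_comparison)
      show "\<forall>\<^sub>F n in sequentially. norm (l n s - \<bar>s - k\<bar>) \<le> 2 * 1 * \<delta> n" using ll by simp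
      show "(\<lambda>n. 2 * 1 * \<delta> n) \<longlonglongrightarrow> 0" using tendsto_mult[OF tendsto_const \<delta>0, of "2 * 1"] by simp
    qed
    then show "AE z in lebesgue_on domT. dt \<phi> z * \<rho> (snd (snd z)) \<noteq> 0 \<longrightarrow> (\<lambda>i. l i (w z)) \<longlonglongrightarrow> \<bar>w z - k\<bar>" by simp
  qed simp
  have L2: "(\<lambda>n. LINT z|lebesgue_on domT. q n (w z) * (dx \<phi> z * \<rho> (snd (snd z))))
     \<longlonglongrightarrow> (LINT z|lebesgue_on domT. (sgn (w z - k) * (f (w z) - f k)) * (dx \<phi> z * \<rho> (snd (snd z))))"
  proof (rule bounded_convergence_weighted[OF int(2) qm _ qb])
    show "(\<lambda>z. sgn (w z - k) * (f (w z) - f k)) \<in> borel_measurable (lebesgue_on domT)"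
      unfolding sgn_if using w(1) fm by measurable
    have "(\<lambda>n. q n s) \<longlonglongrightarrow> sgn (s - k) * (f s - f k)" if "s \<in> I" for s
    proof (rule LIM_zero_cancel, rule Lim_null_comparison)
      show "\<forall>\<^sub>F n in sequentially. norm (q n s - sgn (s - k) * (f s - f k)) \<le> 2 * C * \<delta> n" using ql[OF that] by simp
      show "(\<lambda>n. 2 * C * \<delta> n) \<longlonglongrightarrow> 0" using tendsto_mult[OF tendsto_const \<delta>0, of "2 * C"] by simp
    qed
    then show "AE z in lebesgue_on domT. dx \<phi> z * \<rho> (snd (snd z)) \<noteq> 0 \<longrightarrow>
      (\<lambda>i. q i (w z)) \<longlonglongrightarrow> sgn (w z - k) * (f (w z) - f k)"
      using w(2) by (auto elim: eventually_mono)
  qed simp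
  have split: "(LINT z|lebesgue_on domT. (G z * dt \<phi> z + H z * dx \<phi> z) * \<rho> (snd (snd z)))
      = (LINT z|lebesgue_on domT. G z * (dt \<phi> z * \<rho> (snd (snd z)))) + (LINT z|lebesgue_on domT. H z * (dx \<phi> z * \<rho> (snd (snd z))))"
    if "G \<in> borel_measurable (lebesgue_on domT)" "AE z in lebesgue_on domT. \<bar>G z\<bar> \<le> K"
      "H \<in> borel_measurable (lebesgue_on domT)" "AE z in lebesgue_on domT. \<bar>H z\<bar> \<le> K" for G H
  proof -
    have "integrable (lebesgue_on domT) (\<lambda>z. G z * (dt \<phi> z * \<rho> (snd (snd z))))"
      "integrable (lebesgue_on domT) (\<lambda>z. H z * (dx \<phi> z * \<rho> (snd (snd z))))"
      using integrable_mult_bounded[OF int(1) that(1,2)] integrable_mult_bounded[OF int(2) that(3,4)] by simp_all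
    from Bochner_Integration.integral_add[OF this] show ?thesis by (simp add: distrib_right mult.assoc)
  qed
  have aK: "AE z in lebesgue_on domT. \<bar>\<bar>w z - k\<bar>\<bar> \<le> K"
    using w(3)
  proof eventually_elim
    case (elim z)
    have "\<bar>w z - k\<bar> \<le> B + \<bar>k\<bar>" by (rule order.trans[OF abs_triangle_ineq4 add_right_mono[OF elim]])
    then show ?case using K(4) by simp
  qed
  have bK: "AE z in lebesgue_on domT. \<bar>sgn (w z - k) * (f (w z) - f k)\<bar> \<le> K"
    using w(4)
  proof eventually_elim
    case (elim z)
    then have "\<bar>f (w z)\<bar> + \<bar>f k\<bar> \<le> B + \<bar>f k\<bar>" by (rule add_right_mono)
    then show ?case by (rule order.trans[OF sb order.trans[OF _ K(2)]])
  qed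
  have lim: "(\<lambda>n. LINT z|lebesgue_on domT. (l n (w z) * dt \<phi> z + q n (w z) * dx \<phi> z) * \<rho> (snd (snd z)))
    \<longlonglongrightarrow> (LINT z|lebesgue_on domT. \<bar>w z - k\<bar> * (dt \<phi> z * \<rho> (snd (snd z))))
      + (LINT z|lebesgue_on domT. (sgn (w z - k) * (f (w z) - f k)) * (dx \<phi> z * \<rho> (snd (snd z))))"
    unfolding split[OF lm lb qm qb] by (intro tendsto_add L1 L2)
  have "0 \<le> (LINT z|lebesgue_on domT. \<bar>w z - k\<bar> * (dt \<phi> z * \<rho> (snd (snd z))))
      + (LINT z|lebesgue_on domT. (sgn (w z - k) * (f (w z) - f k)) * (dx \<phi> z * \<rho> (snd (snd z))))"
    by (rule LIMSEQ_le_const[OF lim]) (use ineq in blast)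
  also have "\<dots> = (LINT z|lebesgue_on domT. (\<bar>w z - k\<bar> * dt \<phi> z
      + sgn (w z - k) * (f (w z) - f k) * dx \<phi> z) * \<rho> (snd (snd z)))"
    by (rule split[symmetric]) (use w(1) fm aK bK in \<open>auto simp: sgn_if\<close>)
  finally show ?thesis .
qed


subsection \<open>Doubling of variables\<close>

definition kflux :: "(real \<Rightarrow> real) \<Rightarrow> real \<Rightarrow> real \<Rightarrow> real" where
  "kflux g a b = sgn (a - b) * (g a - g b)"

lemma kflux_commute: "kflux g a b = kflux g b a"
  by (simp add: kflux_def sgn_if algebra_simps)

lemma abs_kflux_le: "\<bar>kflux g a b\<bar> \<le> \<bar>g a\<bar> + \<bar>g b\<bar>"
proof -
  have "\<bar>sgn (a - b)\<bar> * \<bar>g a - g b\<bar> \<le> 1 * (\<bar>g a\<bar> + \<bar>g b\<bar>)"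
    by (intro mult_mono abs_triangle_ineq4) (auto simp: abs_sgn_eq)
  then show ?thesis by (simp add: kflux_def abs_mult)
qed

lemma integrable_bounded_continuous:
  fixes G c :: "'a::euclidean_space \<Rightarrow> real"
  assumes G: "G \<in> borel_measurable borel" "\<And>z. \<bar>G z\<bar> \<le> M" and c: "continuous_on UNIV c"
    and K: "bounded K" "\<And>z. z \<notin> K \<Longrightarrow> G z * c z = 0"
  shows "integrable lborel (\<lambda>z. G z * c z)"
proof -
  have "bounded (c ` closure K)"
    using K(1) by (intro compact_imp_bounded compact_continuous_image continuous_on_subset[OF c]) auto
  then obtain N where N: "\<forall>z\<in>closure K. \<bar>c z\<bar> \<le> N" by (auto simp: bounded_iff)
  have M0: "0 \<le> M" using order.trans[OF abs_ge_zero G(2)] .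
  have b: "\<bar>G z * c z\<bar> \<le> M * max 0 N" for z
  proof (cases "z \<in> K")
    case True
    then have "\<bar>c z\<bar> \<le> max 0 N" using N closure_subset by force
    then show ?thesis unfolding abs_mult using G(2) M0 by (intro mult_mono) auto
  next
    case False
    then show ?thesis unfolding K(2)[OF False] using M0 by simp
  qed
  show ?thesis
    by (rule integrable_lborel_bounded_support[OF _ K(1) b K(2)])
       (use G(1) borel_measurable_continuous_onI[OF c] in measurable)
qed

text \<open>A radial smooth bump supported in the closed \<delta>-ball, not normalised to mass 1:
  only its sign, support, evenness and positive mass are used.\<close>

definition mollifier :: "real \<Rightarrow> 'a::euclidean_space \<Rightarrow> real" where
  "mollifier \<delta> \<zeta> = bump (\<delta>\<^sup>2 - \<zeta> \<bullet> \<zeta>)"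

definition mollifier' :: "real \<Rightarrow> 'a::euclidean_space \<Rightarrow> 'a \<Rightarrow> real" where
  "mollifier' \<delta> \<zeta> h = - 2 * (\<zeta> \<bullet> h) * flat_exp 2 (\<delta>\<^sup>2 - \<zeta> \<bullet> \<zeta>)"

lemma mollifier_nonneg: "0 \<le> mollifier \<delta> \<zeta>"
  by (simp add: mollifier_def flat_exp_nonneg)

lemma mollifier_minus: "mollifier \<delta> (- \<zeta>) = mollifier \<delta> \<zeta>" "mollifier' \<delta> (- \<zeta>) h = - mollifier' \<delta> \<zeta> h"
  by (simp_all add: mollifier_def mollifier'_def)

lemma mollifier_eq_0: "0 \<le> \<delta> \<Longrightarrow> \<delta> \<le> norm \<zeta> \<Longrightarrow> mollifier \<delta> \<zeta> = 0"
  "0 \<le> \<delta> \<Longrightarrow> \<delta> \<le> norm \<zeta> \<Longrightarrow> mollifier' \<delta> \<zeta> h = 0"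
  using power_mono[of \<delta> "norm \<zeta>" 2]
  by (auto simp: mollifier_def mollifier'_def dot_square_norm intro!: flat_exp_eq_0)

lemma mollifier_has_derivative:
  "((\<lambda>z. mollifier \<delta> (z - z0)) has_derivative mollifier' \<delta> (z - z0)) (at z)"
proof -
  have "((\<lambda>z. \<delta>\<^sup>2 - (z - z0) \<bullet> (z - z0)) has_derivative (\<lambda>h. - 2 * ((z - z0) \<bullet> h))) (at z)"
    by (auto intro!: derivative_eq_intros simp: inner_commute algebra_simps)
  from has_derivative_bump_compose[OF this] show ?thesis
    by (simp add: mollifier_def[abs_def] mollifier'_def[abs_def])
qed

lemma smooth_mollifier: "smooth (\<lambda>z. mollifier \<delta> (z - z0))"
proof -
  have "smooth (\<lambda>z. (z - z0) \<bullet> (z - z0))"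
    using smooth_compose_affine[OF smooth_inner_self bounded_linear_ident, of "- z0"] by simp
  then show ?thesis
    unfolding mollifier_def by (intro smooth_compose[OF smooth_flat_exp] smooth_diff smooth_const)
qed

lemma continuous_mollifier: "continuous_on A (mollifier \<delta>)" "continuous_on A (\<lambda>\<zeta>. mollifier' \<delta> \<zeta> h)"
proof -
  have *: "continuous_on A (\<lambda>\<zeta>. flat_exp k (\<delta>\<^sup>2 - \<zeta> \<bullet> \<zeta>))" for k
    by (rule continuous_on_compose2[OF continuous_flat_exp[of UNIV]])
       (auto intro!: continuous_on_diff continuous_on_const continuous_on_inner continuous_on_id)
  show "continuous_on A (mollifier \<delta>)" unfolding mollifier_def[abs_def] by (rule *)
  show "continuous_on A (\<lambda>\<zeta>. mollifier' \<delta> \<zeta> h)"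
    unfolding mollifier'_def by (intro continuous_on_mult continuous_on_const continuous_on_inner continuous_on_id *)
qed

lemma mollifier_integral_pos:
  assumes "0 < \<delta>"
  shows "integrable lborel (mollifier \<delta> :: 'a::euclidean_space \<Rightarrow> real)"
    and "0 < (LINT \<zeta>|lborel. mollifier \<delta> (\<zeta>::'a))"
proof -
  show i: "integrable lborel (mollifier \<delta> :: 'a \<Rightarrow> real)"
    using integrable_bounded_continuous[of "\<lambda>_. 1" 1 "mollifier \<delta> :: 'a \<Rightarrow> real" "ball 0 \<delta>"]
      continuous_mollifier(1)[of UNIV \<delta>] mollifier_eq_0(1)[of \<delta>] assms by (auto simp: not_less)
  have "(LINT \<zeta>|lborel. mollifier \<delta> (\<zeta>::'a)) \<noteq> 0"
  proof
    assume "(LINT \<zeta>|lborel. mollifier \<delta> (\<zeta>::'a)) = 0"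
    then have "AE \<zeta> in lborel. mollifier \<delta> (\<zeta>::'a) = 0"
      using integral_nonneg_eq_0_iff_AE[OF i] by (simp add: mollifier_nonneg)
    then have "AE \<zeta> in lborel. (\<zeta>::'a) \<notin> ball 0 \<delta>"
    proof (rule eventually_mono)
      fix \<zeta> :: 'a assume "mollifier \<delta> \<zeta> = 0"
      then have "\<not> 0 < \<delta>\<^sup>2 - \<zeta> \<bullet> \<zeta>" using flat_exp_pos[of "\<delta>\<^sup>2 - \<zeta> \<bullet> \<zeta>" 0] by (auto simp: mollifier_def)
      then have "\<not> (norm \<zeta>)\<^sup>2 < \<delta>\<^sup>2" by (simp add: dot_square_norm)
      then show "\<zeta> \<notin> ball 0 \<delta>" using power_strict_mono[of "norm \<zeta>" \<delta> 2] by auto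
    qed
    then have "AE \<zeta> in lebesgue. (\<zeta>::'a) \<notin> ball 0 \<delta>" by (rule AE_completion)
    then have "negligible (ball (0::'a) \<delta>)"
      by (simp add: negligible_iff_null_sets AE_iff_null_sets)
    then show False using open_not_negligible[of "ball (0::'a) \<delta>"] assms by simp
  qed
  moreover have "0 \<le> (LINT \<zeta>|lborel. mollifier \<delta> (\<zeta>::'a))" by (intro integral_nonneg_AE AE_I2 mollifier_nonneg)
  ultimately show "0 < (LINT \<zeta>|lborel. mollifier \<delta> (\<zeta>::'a))" by simp
qed

text \<open>Everything is Borel and every bound holds pointwise, as required for values at two
  independent points; the functions are representatives, and P is the density extended by 0 outside
  \<open>domT\<close>. In \<open>kw\<close> and \<open>ku\<close> the constant of the Kruzhkov
  inequality for one solution is a value of the other at a fixed point. \<open>lip\<close> holds for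
  values of u in its second argument and, on the diagonal, provides the finite speed of
  propagation.\<close>

locale kruzkov_pair =
  fixes w u P :: "real \<times> real \<times> (real^'n) \<Rightarrow> real" and g :: "real \<Rightarrow> real" and B L :: real
  assumes m [measurable]: "w \<in> borel_measurable borel" "u \<in> borel_measurable borel"
      "P \<in> borel_measurable borel" "g \<in> borel_measurable borel"
    and b: "\<And>z. \<bar>w z\<bar> \<le> B" "\<And>z. \<bar>u z\<bar> \<le> B" "\<And>z. \<bar>g (w z)\<bar> \<le> B" "\<And>z. \<bar>g (u z)\<bar> \<le> B" "\<And>z. 0 \<le> P z" "\<And>z. P z \<le> B"
    and Ps: "\<And>z. z \<notin> domT \<Longrightarrow> P z = 0"
    and lip: "\<And>z z1 z2. \<bar>kflux g (w z) (u z1) - kflux g (w z) (u z2)\<bar> \<le> L * \<bar>u z1 - u z2\<bar>"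
      "\<And>z. \<bar>kflux g (w z) (u z)\<bar> \<le> L * \<bar>w z - u z\<bar>" "0 \<le> L"
    and kw: "\<And>z' \<phi>. test_fun domT \<phi> \<Longrightarrow> (\<And>z. 0 \<le> \<phi> z) \<Longrightarrow>
      0 \<le> (LINT z|lborel. (\<bar>w z - u z'\<bar> * dt \<phi> z + kflux g (w z) (u z') * dx \<phi> z) * P z)"
    and ku: "\<And>z \<phi>. test_fun domT \<phi> \<Longrightarrow> (\<And>z. 0 \<le> \<phi> z) \<Longrightarrow>
      0 \<le> (LINT z'|lborel. (\<bar>w z - u z'\<bar> * dt \<phi> z' + kflux g (w z) (u z') * dx \<phi> z') * P z')"
begin

lemma B0: "0 \<le> B" using order.trans[OF abs_ge_zero b(1)] .

text \<open>\<open>supp\<close> restricts x and t but not y: \<psi> need not vanish for y outside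
  \<open>Gam\<close>, where the factor P does. Inside \<open>domT\<close> the complement of the
  supporting box is open, so the derivatives vanish along with \<psi>.\<close>

lemma cutoff_support:
  assumes supp: "\<And>z. \<psi> z \<noteq> 0 \<Longrightarrow> \<bar>fst z\<bar> \<le> R \<and> \<tau> \<le> fst (snd z) \<and> fst (snd z) \<le> R"
    and z: "z \<notin> {-R..R} \<times> {\<tau>..R} \<times> Gam"
  shows "P z = 0 \<or> (\<psi> z = 0 \<and> dt \<psi> z = 0 \<and> dx \<psi> z = 0)"
proof (cases "z \<in> domT")
  case True
  then have *: "\<not> (\<bar>fst z\<bar> \<le> R \<and> \<tau> \<le> fst (snd z) \<and> fst (snd z) \<le> R)"
    using z by (cases z) (auto simp: domT_def)
  have cl: "closed {z :: real \<times> real \<times> (real^'n). \<bar>fst z\<bar> \<le> R \<and> \<tau> \<le> fst (snd z) \<and> fst (snd z) \<le> R}"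
    by (intro closed_Collect_conj closed_Collect_le continuous_intros)
  have "(\<psi> has_derivative (\<lambda>h. 0)) (at z)"
    by (rule has_derivative_transform_within_open[OF has_derivative_const[of 0] open_Compl[OF cl]])
       (use * supp in auto)
  from frechet_derivative_at[OF this] have "frechet_derivative \<psi> (at z) = (\<lambda>h. 0)" by simp
  then show ?thesis using supp[of z] * by (auto simp: dt_def dx_def)
qed (simp add: Ps)

text \<open>The inequality for w is tested in z with \<psi>(z) times the mollifier of z - z', the
  one for u in z' with \<psi>(z) as a constant. In the sum, the derivatives of the mollifier in z
  and z' cancel and only those of \<psi> survive. The substitution z' = z + \<zeta> then exposes an
  average over the shifts \<zeta>.\<close>

lemma kato_mollified:
  assumes \<psi>: "smooth \<psi>" "\<And>z. 0 \<le> \<psi> z"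
    and supp: "\<And>z. \<psi> z \<noteq> 0 \<Longrightarrow> \<bar>fst z\<bar> \<le> R \<and> \<tau> \<le> fst (snd z) \<and> fst (snd z) \<le> R"
    and \<delta>: "0 < \<delta>" "\<delta> < \<tau>"
  defines "F \<equiv> \<lambda>z z'. (\<bar>w z - u z'\<bar> * dt \<psi> z + kflux g (w z) (u z') * dx \<psi> z) * P z * P z'"
  shows "integrable lborel (\<lambda>\<zeta>. mollifier \<delta> \<zeta> * (LINT z|lborel. F z (z + \<zeta>)))"
    and "0 \<le> (LINT \<zeta>|lborel. mollifier \<delta> \<zeta> * (LINT z|lborel. F z (z + \<zeta>)))"
proof -
  let ?e1 = "(0, 1, 0) :: real \<times> real \<times> (real^'n)" and ?e2 = "(1, 0, 0) :: real \<times> real \<times> (real^'n)"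
  define K0 where "K0 = {-R..R} \<times> {\<tau>..R} \<times> (Gam :: (real^'n) set)"
  have K0: "compact K0" unfolding K0_def by (intro compact_Times compact_Gam) auto
  have K0d: "K0 \<subseteq> domT" using \<delta> by (auto simp: K0_def domT_def)
  have \<psi>d: "(\<psi> has_derivative frechet_derivative \<psi> (at z)) (at z)" for z by (rule smooth_has_derivative[OF \<psi>(1)])
  have z0: "P z = 0 \<or> (\<psi> z = 0 \<and> dt \<psi> z = 0 \<and> dx \<psi> z = 0)" if "z \<notin> K0" for z
    using cutoff_support[of \<psi> R \<tau> z] supp that unfolding K0_def by blast
  have c\<psi>: "continuous_on UNIV \<psi>" "continuous_on UNIV (dt \<psi>)" "continuous_on UNIV (dx \<psi>)"
    by (rule smooth_imp_continuous_on[OF \<psi>(1)], rule continuous_dx_dt(2)[OF \<psi>(1)], rule continuous_dx_dt(1)[OF \<psi>(1)])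
  define D where "D z z' = \<bar>w z - u z'\<bar>" for z z'
  define \<Phi> where "\<Phi> z z' = kflux g (w z) (u z')" for z z'
  have Db: "\<bar>D z z'\<bar> \<le> 2 * B" for z z' using b(1)[of z] b(2)[of z'] by (simp add: D_def)
  have \<Phi>b: "\<bar>\<Phi> z z'\<bar> \<le> 2 * B" for z z'
    using abs_kflux_le[of g "w z" "u z'"] b(3)[of z] b(4)[of z'] unfolding \<Phi>_def by linarith
  note bp1 = borel_measurable_pair_borel(1)[where 'a = "real \<times> real \<times> (real^'n)" and 'b = "real \<times> real \<times> (real^'n)"]
    and bp2 = borel_measurable_pair_borel(2)[where 'a = "real \<times> real \<times> (real^'n)" and 'b = "real \<times> real \<times> (real^'n)"]
  have Gm: "(\<lambda>p. D (fst p) (s p) * (P (fst p) * P (s p))) \<in> borel_measurable borel"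
     "(\<lambda>p. \<Phi> (fst p) (s p) * (P (fst p) * P (s p))) \<in> borel_measurable borel"
    if s: "s \<in> borel_measurable borel" for s :: "(real \<times> real \<times> (real^'n)) \<times> (real \<times> real \<times> (real^'n)) \<Rightarrow> real \<times> real \<times> (real^'n)"
  proof -
    note [measurable] = measurable_compose[OF bp1 m(1)] measurable_compose[OF bp1 m(3)]
      measurable_compose[OF s m(2)] measurable_compose[OF s m(3)]
      measurable_compose[OF measurable_compose[OF bp1 m(1)] m(4)]
      measurable_compose[OF measurable_compose[OF s m(2)] m(4)]
    show "(\<lambda>p. D (fst p) (s p) * (P (fst p) * P (s p))) \<in> borel_measurable borel"
      unfolding D_def by measurable
    show "(\<lambda>p. \<Phi> (fst p) (s p) * (P (fst p) * P (s p))) \<in> borel_measurable borel"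
      unfolding \<Phi>_def kflux_def sgn_if by measurable
  qed
  have PP: "\<bar>P z * P z'\<bar> \<le> B * B" for z z'
    unfolding abs_mult using b(5,6) B0 by (intro mult_mono) auto
  have Gb: "\<bar>D z z' * (P z * P z')\<bar> \<le> 2 * B * (B * B)" "\<bar>\<Phi> z z' * (P z * P z')\<bar> \<le> 2 * B * (B * B)" for z z'
    unfolding abs_mult[of "D z z'"] abs_mult[of "\<Phi> z z'"] using Db \<Phi>b PP B0 by (intro mult_mono; simp)+
  obtain r where r: "0 < r" "\<And>z. z \<in> K0 \<Longrightarrow> norm z \<le> r"
    using compact_imp_bounded[OF K0] by (auto simp: bounded_pos)
  define Kp where "Kp = K0 \<times> cball (0 :: real \<times> real \<times> (real^'n)) (r + \<delta>)"
  have Kp: "bounded Kp" unfolding Kp_def by (intro bounded_Times compact_imp_bounded[OF K0] bounded_cball)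
  have intp: "integrable lborel (\<lambda>p. (D (fst p) (snd p) * (P (fst p) * P (snd p))) * c p)"
     "integrable lborel (\<lambda>p. (\<Phi> (fst p) (snd p) * (P (fst p) * P (snd p))) * c p)"
    if c: "continuous_on UNIV c" and cs: "\<And>z z'. \<psi> z = 0 \<Longrightarrow> dt \<psi> z = 0 \<Longrightarrow> dx \<psi> z = 0 \<Longrightarrow> c (z, z') = 0"
       "\<And>z z'. \<delta> \<le> norm (z - z') \<Longrightarrow> c (z, z') = 0" for c
  proof -
    have hz: "c p = 0 \<or> P (fst p) = 0" if "p \<notin> Kp" for p
    proof (cases "fst p \<in> K0")
      case True
      then have "r + \<delta> < norm (snd p)" using that by (cases p) (auto simp: Kp_def)
      moreover have "norm (snd p) \<le> norm (fst p) + norm (fst p - snd p)"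
        using norm_triangle_ineq4[of "fst p" "fst p - snd p"] by simp
      ultimately have "\<delta> \<le> norm (fst p - snd p)" using r(2)[OF True] by linarith
      then show ?thesis using cs(2)[of "fst p" "snd p"] by simp
    next
      case False
      then show ?thesis using z0[OF False] cs(1)[of "fst p" "snd p"] by auto
    qed
    have "(D (fst p) (snd p) * (P (fst p) * P (snd p))) * c p = 0" if "p \<notin> Kp" for p
      using hz[OF that] by auto
    then show "integrable lborel (\<lambda>p. (D (fst p) (snd p) * (P (fst p) * P (snd p))) * c p)"
      by (rule integrable_bounded_continuous[OF Gm(1)[OF bp2] Gb(1) c Kp])
    have "(\<Phi> (fst p) (snd p) * (P (fst p) * P (snd p))) * c p = 0" if "p \<notin> Kp" for p
      using hz[OF that] by auto
    then show "integrable lborel (\<lambda>p. (\<Phi> (fst p) (snd p) * (P (fst p) * P (snd p))) * c p)"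
      by (rule integrable_bounded_continuous[OF Gm(2)[OF bp2] Gb(2) c Kp])
  qed
  let ?o = "mollifier \<delta> :: real \<times> real \<times> (real^'n) \<Rightarrow> real"
  let ?o' = "mollifier' \<delta> :: real \<times> real \<times> (real^'n) \<Rightarrow> _ \<Rightarrow> real"
  \<comment> \<open>\<open>a1\<close> and \<open>a2\<close> are the t and x derivatives of the
    doubled test function in the variable z, \<open>b1\<close> and \<open>b2\<close> those in
    z'.\<close>
  define a1 a2 b1 b2 where "a1 p = dt \<psi> (fst p) * ?o (fst p - snd p) + \<psi> (fst p) * ?o' (fst p - snd p) ?e1"
    and "a2 p = dx \<psi> (fst p) * ?o (fst p - snd p) + \<psi> (fst p) * ?o' (fst p - snd p) ?e2"
    and "b1 p = - (\<psi> (fst p) * ?o' (fst p - snd p) ?e1)" and "b2 p = - (\<psi> (fst p) * ?o' (fst p - snd p) ?e2)"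
    for p :: "(real \<times> real \<times> (real^'n)) \<times> (real \<times> real \<times> (real^'n))"
  have cf: "continuous_on UNIV (\<lambda>p. h (fst p))" if "continuous_on UNIV h" for h :: "real \<times> real \<times> (real^'n) \<Rightarrow> real"
    by (rule continuous_on_compose2[OF that]) (auto intro!: continuous_on_fst continuous_on_id)
  have cd: "continuous_on UNIV (\<lambda>p. h (fst p - snd p))" if "continuous_on UNIV h" for h :: "real \<times> real \<times> (real^'n) \<Rightarrow> real"
    by (rule continuous_on_compose2[OF that]) (auto intro!: continuous_on_diff continuous_on_fst continuous_on_snd continuous_on_id)
  have cc: "continuous_on UNIV a1" "continuous_on UNIV a2" "continuous_on UNIV b1" "continuous_on UNIV b2"
    unfolding a1_def[abs_def] a2_def[abs_def] b1_def[abs_def] b2_def[abs_def]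
    by (intro continuous_on_add continuous_on_minus continuous_on_mult cf[OF c\<psi>(1)] cf[OF c\<psi>(2)] cf[OF c\<psi>(3)]
        cd[OF continuous_mollifier(1)] cd[OF continuous_mollifier(2)])+
  note mz = mollifier_eq_0[OF less_imp_le[OF \<delta>(1)]]
  have c1: "a1 (z, z') = 0" "a2 (z, z') = 0" "b1 (z, z') = 0" "b2 (z, z') = 0"
    if "\<psi> z = 0" "dt \<psi> z = 0" "dx \<psi> z = 0" for z z' using that by (simp_all add: a1_def a2_def b1_def b2_def)
  have c2: "a1 (z, z') = 0" "a2 (z, z') = 0" "b1 (z, z') = 0" "b2 (z, z') = 0"
    if "\<delta> \<le> norm (z - z')" for z z' using that by (simp_all add: a1_def a2_def b1_def b2_def mz)
  define H1 where "H1 p = (D (fst p) (snd p) * (P (fst p) * P (snd p))) * a1 p + (\<Phi> (fst p) (snd p) * (P (fst p) * P (snd p))) * a2 p" for p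
  define H2 where "H2 p = (D (fst p) (snd p) * (P (fst p) * P (snd p))) * b1 p + (\<Phi> (fst p) (snd p) * (P (fst p) * P (snd p))) * b2 p" for p
  have iH: "integrable lborel H1" "integrable lborel H2"
    unfolding H1_def[abs_def] H2_def[abs_def]
    by (intro Bochner_Integration.integrable_add intp cc c1 c2; assumption)+
  have iH': "integrable (lborel \<Otimes>\<^sub>M lborel) (case_prod (\<lambda>z z'. H1 (z, z')))"
    "integrable (lborel \<Otimes>\<^sub>M lborel) (case_prod (\<lambda>z z'. H2 (z, z')))"
    using iH by (simp_all add: lborel_prod)
  have I1: "0 \<le> (LINT z|lborel. H1 (z, z'))" for z'
  proof -
    define \<phi> where "\<phi> z = \<psi> z * ?o (z - z')" for z
    have "smooth \<phi>" unfolding \<phi>_def[abs_def] by (rule smooth_mult[OF \<psi>(1) smooth_mollifier])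
    moreover have "\<phi> z = 0" if "z \<in> domT - K0" for z
    proof -
      have "\<not> (\<bar>fst z\<bar> \<le> R \<and> \<tau> \<le> fst (snd z) \<and> fst (snd z) \<le> R)"
        using that by (cases z) (auto simp: K0_def domT_def)
      then have "\<psi> z = 0" using supp[of z] by blast
      then show ?thesis by (simp add: \<phi>_def)
    qed
    ultimately have t: "test_fun domT \<phi>" unfolding test_fun_def using K0 K0d by blast
    have "(\<phi> has_derivative (\<lambda>h. \<psi> z * ?o' (z - z') h + frechet_derivative \<psi> (at z) h * ?o (z - z'))) (at z)" for z
      unfolding \<phi>_def[abs_def] by (rule has_derivative_mult[OF \<psi>d mollifier_has_derivative])
    from frechet_derivative_at[OF this]
    have fd: "frechet_derivative \<phi> (at z) = (\<lambda>h. \<psi> z * ?o' (z - z') h + frechet_derivative \<psi> (at z) h * ?o (z - z'))" for z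
      by simp
    have dd: "dt \<phi> z = a1 (z, z')" "dx \<phi> z = a2 (z, z')" for z
      unfolding dt_def dx_def fd a1_def a2_def by simp_all
    have "0 \<le> (LINT z|lborel. (D z z' * dt \<phi> z + \<Phi> z z' * dx \<phi> z) * P z)"
      unfolding D_def \<Phi>_def by (rule kw[OF t]) (simp add: \<phi>_def \<psi>(2) mollifier_nonneg)
    then have "0 \<le> P z' * (LINT z|lborel. (D z z' * dt \<phi> z + \<Phi> z z' * dx \<phi> z) * P z)"
      using b(5) by simp
    also have "\<dots> = (LINT z|lborel. P z' * ((D z z' * dt \<phi> z + \<Phi> z z' * dx \<phi> z) * P z))"
      by (rule integral_mult_right_zero[symmetric])
    also have "\<dots> = (LINT z|lborel. H1 (z, z'))"
      by (rule Bochner_Integration.integral_cong) (simp_all add: H1_def dd algebra_simps)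
    finally show ?thesis .
  qed
  have I2: "0 \<le> (LINT z'|lborel. H2 (z, z'))" for z
  proof -
    define \<phi> where "\<phi> z' = \<psi> z * ?o (z' - z)" for z'
    have sm: "smooth \<phi>" unfolding \<phi>_def[abs_def] by (rule smooth_mult[OF smooth_const smooth_mollifier])
    have t: "test_fun domT \<phi>"
    proof (cases "\<psi> z = 0")
      case True
      then show ?thesis unfolding test_fun_def using sm by (auto simp: \<phi>_def intro!: exI[of _ "{}"])
    next
      case False
      \<comment> \<open>The support in z' lies within \<delta> of z. Since the time of z is at least
        \<tau> > \<delta>, it stays in positive times.\<close>
      define C where "C = cball z \<delta> \<inter> (UNIV \<times> UNIV \<times> (Gam :: (real^'n) set))"
      have "closed (UNIV \<times> UNIV \<times> (Gam :: (real^'n) set) :: (real \<times> real \<times> (real^'n)) set)"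
        by (intro closed_Times closed_UNIV compact_imp_closed[OF compact_Gam])
      then have "compact C" unfolding C_def by (intro compact_Int_closed compact_cball)
      moreover have "C \<subseteq> domT"
      proof
        fix z' assume z': "z' \<in> C"
        then have "norm (z' - z) \<le> \<delta>" by (simp add: C_def dist_norm norm_minus_commute)
        moreover have "\<bar>fst (snd v)\<bar> \<le> norm v" for v :: "real \<times> real \<times> (real^'n)"
          using norm_fst_le[of "fst (snd v)" "snd (snd v)"] norm_snd_le[of "snd v" "fst v"] by simp
        from this[of "z' - z"] have "\<bar>fst (snd (z' - z))\<bar> \<le> norm (z' - z)" .
        moreover have "\<tau> \<le> fst (snd z)" using supp[OF False] by simp
        ultimately have "0 < fst (snd z')" using \<delta>(2) by (simp add: abs_le_iff)
        then show "z' \<in> domT" using z' by (cases z') (auto simp: C_def domT_def)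
      qed
      moreover have "\<phi> z' = 0" if "z' \<in> domT - C" for z'
      proof -
        have "\<delta> \<le> norm (z' - z)" using that by (cases z') (auto simp: C_def domT_def dist_norm norm_minus_commute)
        then show ?thesis by (simp add: \<phi>_def mz)
      qed
      ultimately show ?thesis unfolding test_fun_def using sm by blast
    qed
    have "(\<phi> has_derivative (\<lambda>h. \<psi> z * ?o' (z' - z) h)) (at z')" for z'
      unfolding \<phi>_def[abs_def] by (rule has_derivative_mult_right[OF mollifier_has_derivative])
    from frechet_derivative_at[OF this]
    have fd: "frechet_derivative \<phi> (at z') = (\<lambda>h. \<psi> z * ?o' (z' - z) h)" for z' by simp
    have sw: "?o' (z' - z) h = - ?o' (z - z') h" for z' h using mollifier_minus(2)[of \<delta> "z - z'" h] by simp
    have dd: "dt \<phi> z' = b1 (z, z')" "dx \<phi> z' = b2 (z, z')" for z'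
      unfolding dt_def dx_def fd b1_def b2_def sw by simp_all
    have "0 \<le> (LINT z'|lborel. (D z z' * dt \<phi> z' + \<Phi> z z' * dx \<phi> z') * P z')"
      unfolding D_def \<Phi>_def by (rule ku[OF t]) (simp add: \<phi>_def \<psi>(2) mollifier_nonneg)
    then have "0 \<le> P z * (LINT z'|lborel. (D z z' * dt \<phi> z' + \<Phi> z z' * dx \<phi> z') * P z')"
      using b(5) by simp
    also have "\<dots> = (LINT z'|lborel. P z * ((D z z' * dt \<phi> z' + \<Phi> z z' * dx \<phi> z') * P z'))"
      by (rule integral_mult_right_zero[symmetric])
    also have "\<dots> = (LINT z'|lborel. H2 (z, z'))"
      by (rule Bochner_Integration.integral_cong) (simp_all add: H2_def dd algebra_simps)
    finally show ?thesis .
  qed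
  have "0 \<le> (LINT z'|lborel. LINT z|lborel. H1 (z, z'))" by (intro integral_nonneg_AE AE_I2 I1)
  then have J1: "0 \<le> (LINT p|lborel. H1 p)" using lborel_pair.integral_snd[OF iH'(1)] by (simp add: lborel_prod)
  have "0 \<le> (LINT z|lborel. LINT z'|lborel. H2 (z, z'))" by (intro integral_nonneg_AE AE_I2 I2)
  then have J2: "0 \<le> (LINT p|lborel. H2 p)" using lborel_pair.integral_fst[OF iH'(2)] by (simp add: lborel_prod)
  \<comment> \<open>The cancellation of the singular terms: a + b contains the mollifier but none of
    its derivatives. Evenness turns z - z' into z' - z.\<close>
  have Hs: "H1 p + H2 p = F (fst p) (snd p) * ?o (snd p - fst p)" for p
    using mollifier_minus(1)[of \<delta> "fst p - snd p"]
    by (simp add: H1_def H2_def a1_def a2_def b1_def b2_def F_def D_def \<Phi>_def algebra_simps)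
  have iS: "integrable lborel (\<lambda>p. H1 p + H2 p)" using iH by simp
  have JS: "0 \<le> (LINT p|lborel. H1 p + H2 p)" using iH J1 J2 by simp
  have iS': "integrable (lborel \<Otimes>\<^sub>M lborel) (case_prod (\<lambda>z z'. H1 (z, z') + H2 (z, z')))"
    using iS by (simp add: lborel_prod case_prod_beta')
  have secm: "(\<lambda>z'. H1 (z, z') + H2 (z, z')) \<in> borel_measurable borel" for z
    using borel_measurable_integrable[OF iS]
    by (intro measurable_compose[OF borel_measurable_continuous_onI[OF continuous_on_Pair[OF continuous_on_const continuous_on_id]]]) simp
  have e1: "(LINT p|lborel. H1 p + H2 p) = (LINT z|lborel. LINT \<zeta>|lborel. F z (z + \<zeta>) * ?o \<zeta>)"
  proof -
    have "(LINT p|lborel. H1 p + H2 p) = (LINT z|lborel. LINT z'|lborel. H1 (z, z') + H2 (z, z'))"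
      using lborel_pair.integral_fst[OF iS'] by (simp add: lborel_prod case_prod_beta')
    also have "\<dots> = (LINT z|lborel. LINT \<zeta>|lborel. H1 (z, \<zeta> + z) + H2 (z, \<zeta> + z))"
      by (simp only: lborel_integral_translation(1)[OF secm])
    finally show ?thesis unfolding Hs by (simp add: add.commute)
  qed
  have sm: "(\<lambda>p. fst p + snd p) \<in> borel_measurable (borel :: ((real \<times> real \<times> (real^'n)) \<times> (real \<times> real \<times> (real^'n))) measure)"
    by (intro borel_measurable_continuous_onI continuous_on_add continuous_on_fst continuous_on_snd continuous_on_id)
  define Kq where "Kq = K0 \<times> cball (0 :: real \<times> real \<times> (real^'n)) \<delta>"
  have Kq: "bounded Kq" unfolding Kq_def by (intro bounded_Times compact_imp_bounded[OF K0] bounded_cball)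
  have cs: "continuous_on UNIV (\<lambda>p. h (snd p))" if "continuous_on UNIV h" for h :: "real \<times> real \<times> (real^'n) \<Rightarrow> real"
    by (rule continuous_on_compose2[OF that]) (auto intro!: continuous_on_snd continuous_on_id)
  have q0: "P (fst p) = 0 \<or> (dt \<psi> (fst p) * ?o (snd p) = 0 \<and> dx \<psi> (fst p) * ?o (snd p) = 0)" if "p \<notin> Kq" for p
  proof (cases "fst p \<in> K0")
    case True
    then have "\<delta> \<le> norm (snd p)" using that by (cases p) (auto simp: Kq_def)
    then show ?thesis by (simp add: mz)
  next
    case False
    then show ?thesis using z0[OF False] by auto
  qed
  have iF: "integrable lborel (\<lambda>p. (D (fst p) (fst p + snd p) * (P (fst p) * P (fst p + snd p))) * (dt \<psi> (fst p) * ?o (snd p))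
      + (\<Phi> (fst p) (fst p + snd p) * (P (fst p) * P (fst p + snd p))) * (dx \<psi> (fst p) * ?o (snd p)))"
  proof (intro Bochner_Integration.integrable_add)
    show "integrable lborel (\<lambda>p. (D (fst p) (fst p + snd p) * (P (fst p) * P (fst p + snd p))) * (dt \<psi> (fst p) * ?o (snd p)))"
      by (rule integrable_bounded_continuous[OF Gm(1)[OF sm] Gb(1) _ Kq],
          intro continuous_on_mult cf[OF c\<psi>(2)] cs[OF continuous_mollifier(1)]) (use q0 in force)
    show "integrable lborel (\<lambda>p. (\<Phi> (fst p) (fst p + snd p) * (P (fst p) * P (fst p + snd p))) * (dx \<psi> (fst p) * ?o (snd p)))"
      by (rule integrable_bounded_continuous[OF Gm(2)[OF sm] Gb(2) _ Kq],
          intro continuous_on_mult cf[OF c\<psi>(3)] cs[OF continuous_mollifier(1)]) (use q0 in force)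
  qed
  have "(\<lambda>p. (D (fst p) (fst p + snd p) * (P (fst p) * P (fst p + snd p))) * (dt \<psi> (fst p) * ?o (snd p))
      + (\<Phi> (fst p) (fst p + snd p) * (P (fst p) * P (fst p + snd p))) * (dx \<psi> (fst p) * ?o (snd p)))
    = (\<lambda>p. F (fst p) (fst p + snd p) * ?o (snd p))"
    by (rule ext) (simp add: F_def D_def \<Phi>_def algebra_simps)
  with iF have iF': "integrable (lborel \<Otimes>\<^sub>M lborel) (case_prod (\<lambda>z \<zeta>. F z (z + \<zeta>) * ?o \<zeta>))"
    by (simp add: lborel_prod case_prod_beta')
  have e2: "(LINT z|lborel. F z (z + \<zeta>) * ?o \<zeta>) = ?o \<zeta> * (LINT z|lborel. F z (z + \<zeta>))" for \<zeta>
    by (simp add: mult.commute)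
  show "integrable lborel (\<lambda>\<zeta>. ?o \<zeta> * (LINT z|lborel. F z (z + \<zeta>)))"
    using lborel_pair.integrable_snd[OF iF'] unfolding e2 .
  have "(LINT z|lborel. LINT \<zeta>|lborel. F z (z + \<zeta>) * ?o \<zeta>) = (LINT \<zeta>|lborel. LINT z|lborel. F z (z + \<zeta>) * ?o \<zeta>)"
    by (rule lborel_pair.Fubini_integral[OF iF', symmetric])
  then show "0 \<le> (LINT \<zeta>|lborel. ?o \<zeta> * (LINT z|lborel. F z (z + \<zeta>)))"
    using JS unfolding e1 e2 by simp
qed

text \<open>The mollified inequality averages a function G of the shift against a nonnegative
  kernel. Translation continuity of u and P in L^1 makes G continuous at 0; a negative G(0) would
  make every average over a small enough ball negative.\<close>

lemma kato:
  assumes \<psi>: "smooth \<psi>" "\<And>z. 0 \<le> \<psi> z"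
    and supp: "\<And>z. \<psi> z \<noteq> 0 \<Longrightarrow> \<bar>fst z\<bar> \<le> R \<and> \<tau> \<le> fst (snd z) \<and> fst (snd z) \<le> R"
    and \<tau>: "0 < \<tau>"
  shows "0 \<le> (LINT z|lborel. (\<bar>w z - u z\<bar> * dt \<psi> z + kflux g (w z) (u z) * dx \<psi> z) * P z * P z)"
proof -
  define F where "F z z' = (\<bar>w z - u z'\<bar> * dt \<psi> z + kflux g (w z) (u z') * dx \<psi> z) * P z * P z'" for z z'
  define G where "G \<zeta> = (LINT z|lborel. F z (z + \<zeta>))" for \<zeta>
  define K0 where "K0 = {-R..R} \<times> {\<tau>..R} \<times> (Gam :: (real^'n) set)"
  have K0: "compact K0" unfolding K0_def by (intro compact_Times compact_Gam) auto
  have [measurable]: "K0 \<in> sets borel" using K0 by (simp add: borel_closed compact_imp_closed)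
  have z0: "P z = 0 \<or> (\<psi> z = 0 \<and> dt \<psi> z = 0 \<and> dx \<psi> z = 0)" if "z \<notin> K0" for z
    using cutoff_support[of \<psi> R \<tau> z] supp that unfolding K0_def by blast
  have c\<psi>: "continuous_on UNIV (dt \<psi>)" "continuous_on UNIV (dx \<psi>)"
    by (rule continuous_dx_dt(2)[OF \<psi>(1)], rule continuous_dx_dt(1)[OF \<psi>(1)])
  have [measurable]: "dt \<psi> \<in> borel_measurable borel" "dx \<psi> \<in> borel_measurable borel"
    by (rule borel_measurable_continuous_onI[OF c\<psi>(1)], rule borel_measurable_continuous_onI[OF c\<psi>(2)])
  have "bounded (dt \<psi> ` K0)" "bounded (dx \<psi> ` K0)"
    by (intro compact_imp_bounded compact_continuous_image K0 continuous_on_subset[OF c\<psi>(1)]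
       continuous_on_subset[OF c\<psi>(2)]; simp)+
  then obtain M1 M2 where M12: "\<forall>z\<in>K0. \<bar>dt \<psi> z\<bar> \<le> M1" "\<forall>z\<in>K0. \<bar>dx \<psi> z\<bar> \<le> M2"
    by (auto simp: bounded_iff)
  define M where "M = max 0 (max M1 M2)"
  have M: "\<bar>dt \<psi> z\<bar> \<le> M" "\<bar>dx \<psi> z\<bar> \<le> M" if "z \<in> K0" for z
    using bspec[OF M12(1) that] bspec[OF M12(2) that] by (auto simp: M_def)
  have M0: "0 \<le> M" by (simp add: M_def)
  define a where "a z z' = \<bar>w z - u z'\<bar> * dt \<psi> z + kflux g (w z) (u z') * dx \<psi> z" for z z'
  have ab: "\<bar>a z z'\<bar> \<le> 4 * B * M" if "z \<in> K0" for z z'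
  proof -
    have "\<bar>\<bar>w z - u z'\<bar> * dt \<psi> z\<bar> \<le> (2 * B) * M"
      unfolding abs_mult using b(1)[of z] b(2)[of z'] M[OF that] B0 by (intro mult_mono) auto
    moreover have "\<bar>kflux g (w z) (u z') * dx \<psi> z\<bar> \<le> (2 * B) * M"
      unfolding abs_mult
    proof (intro mult_mono M that)
      show "\<bar>kflux g (w z) (u z')\<bar> \<le> 2 * B"
        using abs_kflux_le[of g "w z" "u z'"] b(3)[of z] b(4)[of z'] by linarith
    qed (use B0 in auto)
    ultimately show ?thesis unfolding a_def by linarith
  qed
  have al: "\<bar>a z z' - a z z\<bar> \<le> (1 + L) * M * \<bar>u z' - u z\<bar>" if "z \<in> K0" for z z'
  proof -
    have h1: "\<bar>(\<bar>w z - u z'\<bar> - \<bar>w z - u z\<bar>) * dt \<psi> z\<bar> \<le> \<bar>u z' - u z\<bar> * M"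
      unfolding abs_mult using M[OF that] by (intro mult_mono) auto
    have h2: "\<bar>(kflux g (w z) (u z') - kflux g (w z) (u z)) * dx \<psi> z\<bar> \<le> (L * \<bar>u z' - u z\<bar>) * M"
      unfolding abs_mult using M[OF that] lip(1)[of z z' z] lip(3) by (intro mult_mono) auto
    have h3: "a z z' - a z z = (\<bar>w z - u z'\<bar> - \<bar>w z - u z\<bar>) * dt \<psi> z
        + (kflux g (w z) (u z') - kflux g (w z) (u z)) * dx \<psi> z"
      by (simp add: a_def algebra_simps)
    have h4: "(1 + L) * M * \<bar>u z' - u z\<bar> = \<bar>u z' - u z\<bar> * M + (L * \<bar>u z' - u z\<bar>) * M"
      by (simp add: algebra_simps)
    show ?thesis unfolding h3 h4 by (rule order.trans[OF abs_triangle_ineq add_mono[OF h1 h2]])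
  qed
  \<comment> \<open>The two summands come from varying u at bounded P and from varying P at a
    bounded Kruzhkov integrand.\<close>
  define C where "C = (1 + L) * M * (B * B) + 4 * B * M * B"
  have C0: "0 \<le> C" using lip(3) M0 B0 by (simp add: C_def)
  have F0: "F z z' = 0" if "z \<notin> K0" for z z' using z0[OF that] by (auto simp: F_def)
  have Fd: "\<bar>F z z' - F z z\<bar> \<le> C * (\<bar>u z' - u z\<bar> + \<bar>P z' - P z\<bar>)" if z: "z \<in> K0" for z z'
  proof -
    have "F z z' - F z z = (a z z' - a z z) * (P z * P z') + a z z * (P z * (P z' - P z))"
      by (simp add: F_def a_def algebra_simps)
    also have "\<bar>\<dots>\<bar> \<le> \<bar>a z z' - a z z\<bar> * \<bar>P z * P z'\<bar> + \<bar>a z z\<bar> * \<bar>P z * (P z' - P z)\<bar>"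
      unfolding abs_mult[symmetric] by (rule abs_triangle_ineq)
    also have "\<dots> \<le> ((1 + L) * M * \<bar>u z' - u z\<bar>) * (B * B) + (4 * B * M) * (B * \<bar>P z' - P z\<bar>)"
    proof (intro add_mono mult_mono al[OF z] ab[OF z])
      show "\<bar>P z * P z'\<bar> \<le> B * B" unfolding abs_mult using b(5,6) B0 by (intro mult_mono) auto
      show "\<bar>P z * (P z' - P z)\<bar> \<le> B * \<bar>P z' - P z\<bar>"
        unfolding abs_mult using b(5,6) by (intro mult_right_mono) auto
    qed (use lip(3) M0 B0 in auto)
    also have "\<dots> = ((1 + L) * M * (B * B)) * \<bar>u z' - u z\<bar> + (4 * B * M * B) * \<bar>P z' - P z\<bar>"
      by (simp add: mult_ac)
    also have "\<dots> \<le> C * \<bar>u z' - u z\<bar> + C * \<bar>P z' - P z\<bar>"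
      unfolding C_def using lip(3) M0 B0 by (intro add_mono mult_right_mono) auto
    finally show ?thesis by (simp add: distrib_left)
  qed
  have Fb: "\<bar>F z z'\<bar> \<le> 4 * B * M * (B * B)" for z z'
  proof (cases "z \<in> K0")
    case True
    have "\<bar>P z * P z'\<bar> \<le> B * B" unfolding abs_mult using b(5,6) B0 by (intro mult_mono) auto
    moreover have "\<bar>F z z'\<bar> = \<bar>a z z'\<bar> * \<bar>P z * P z'\<bar>" by (simp add: F_def a_def abs_mult)
    ultimately show ?thesis using ab[OF True, of z'] B0 M0 by (simp add: mult_mono)
  next
    case False
    then show ?thesis using F0 B0 M0 by simp
  qed
  have Fi: "integrable lborel (\<lambda>z. F z (z + \<zeta>))" for \<zeta>
  proof (rule integrable_lborel_bounded_support[OF _ compact_imp_bounded[OF K0] Fb F0])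
    have [measurable]: "(\<lambda>z. u (z + \<zeta>)) \<in> borel_measurable borel" "(\<lambda>z. P (z + \<zeta>)) \<in> borel_measurable borel"
      by (rule measurable_compose[OF _ m(2)], simp) (rule measurable_compose[OF _ m(3)], simp)
    show "(\<lambda>z. F z (z + \<zeta>)) \<in> borel_measurable borel"
      unfolding F_def kflux_def sgn_if by measurable
  qed
  have lim0: "((\<lambda>\<zeta>. C * ((LINT z|lborel. indicator K0 z * \<bar>u (z + \<zeta>) - u z\<bar>)
      + (LINT z|lborel. indicator K0 z * \<bar>P (z + \<zeta>) - P z\<bar>))) \<longlongrightarrow> C * (0 + 0)) (at 0)"
    using b(5,6) by (intro tendsto_intros L1_translation_continuous[where M = B] m(2,3) b(2) K0) (auto simp: abs_le_iff intro: order.trans[OF _ b(5)])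
  have ti: "integrable lborel (\<lambda>z. indicator K0 z * \<bar>h (z + \<zeta>) - h z\<bar>)"
    if h [measurable]: "h \<in> borel_measurable borel" and hb: "\<And>z. \<bar>h z\<bar> \<le> B" for h and \<zeta> :: "real \<times> real \<times> (real^'n)"
  proof (rule integrable_lborel_bounded_support[OF _ compact_imp_bounded[OF K0], of _ "2 * B"])
    have [measurable]: "(\<lambda>z. h (z + \<zeta>)) \<in> borel_measurable borel" by (rule measurable_compose[OF _ h]) simp
    show "(\<lambda>z. indicator K0 z * \<bar>h (z + \<zeta>) - h z\<bar>) \<in> borel_measurable borel" by measurable
    show "\<bar>indicator K0 z * \<bar>h (z + \<zeta>) - h z\<bar>\<bar> \<le> 2 * B" for z
      using hb[of z] hb[of "z + \<zeta>"] B0 by (auto simp: indicator_def)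
  qed simp
  have Pb: "\<bar>P z\<bar> \<le> B" for z using b(5,6)[of z] by simp
  have Gd: "\<bar>G \<zeta> - G 0\<bar> \<le> C * ((LINT z|lborel. indicator K0 z * \<bar>u (z + \<zeta>) - u z\<bar>)
      + (LINT z|lborel. indicator K0 z * \<bar>P (z + \<zeta>) - P z\<bar>))" for \<zeta>
  proof -
    have "G \<zeta> - G 0 = (LINT z|lborel. F z (z + \<zeta>) - F z (z + 0))"
      unfolding G_def by (rule Bochner_Integration.integral_diff[OF Fi Fi, symmetric])
    also have "\<bar>\<dots>\<bar> \<le> (LINT z|lborel. \<bar>F z (z + \<zeta>) - F z (z + 0)\<bar>)" by (rule integral_abs_bound)
    also have "\<dots> \<le> (LINT z|lborel. C * (indicator K0 z * \<bar>u (z + \<zeta>) - u z\<bar> + indicator K0 z * \<bar>P (z + \<zeta>) - P z\<bar>))"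
    proof (rule integral_mono)
      show "integrable lborel (\<lambda>z. \<bar>F z (z + \<zeta>) - F z (z + 0)\<bar>)"
        by (intro integrable_abs Bochner_Integration.integrable_diff Fi)
      show "integrable lborel (\<lambda>z. C * (indicator K0 z * \<bar>u (z + \<zeta>) - u z\<bar> + indicator K0 z * \<bar>P (z + \<zeta>) - P z\<bar>))"
        by (intro integrable_mult_right Bochner_Integration.integrable_add ti m(2,3) b(2) Pb)
      show "\<bar>F z (z + \<zeta>) - F z (z + 0)\<bar> \<le> C * (indicator K0 z * \<bar>u (z + \<zeta>) - u z\<bar> + indicator K0 z * \<bar>P (z + \<zeta>) - P z\<bar>)" for z
        using Fd[of z "z + \<zeta>"] F0[of z] by (cases "z \<in> K0") auto
    qed
    also have "\<dots> = C * ((LINT z|lborel. indicator K0 z * \<bar>u (z + \<zeta>) - u z\<bar>)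
      + (LINT z|lborel. indicator K0 z * \<bar>P (z + \<zeta>) - P z\<bar>))"
      by (simp only: integral_mult_right_zero Bochner_Integration.integral_add[OF ti[OF m(2) b(2)] ti[OF m(3) Pb]])
    finally show ?thesis .
  qed
  have "0 \<le> G 0"
  proof (rule ccontr)
    assume "\<not> 0 \<le> G 0"
    then have n: "G 0 < 0" by simp
    from lim0 have "\<forall>\<^sub>F \<zeta> in at 0. C * ((LINT z|lborel. indicator K0 z * \<bar>u (z + \<zeta>) - u z\<bar>)
      + (LINT z|lborel. indicator K0 z * \<bar>P (z + \<zeta>) - P z\<bar>)) < - G 0 / 2"
      by (rule order_tendstoD(2)) (use n in simp)
    then obtain d where d: "0 < d" "\<And>\<zeta>. \<zeta> \<noteq> 0 \<Longrightarrow> dist \<zeta> 0 < d \<Longrightarrow>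
       C * ((LINT z|lborel. indicator K0 z * \<bar>u (z + \<zeta>) - u z\<bar>)
      + (LINT z|lborel. indicator K0 z * \<bar>P (z + \<zeta>) - P z\<bar>)) < - G 0 / 2"
      unfolding eventually_at by blast
    have Gn: "G \<zeta> \<le> G 0 / 2" if "norm \<zeta> < d" for \<zeta>
    proof (cases "\<zeta> = 0")
      case True
      then show ?thesis using n by simp
    next
      case False
      then show ?thesis using d(2)[of \<zeta>] that Gd[of \<zeta>] by (simp add: abs_le_iff)
    qed
    \<comment> \<open>Below d, so that G stays under half its negative value on the support, and
      below \<tau>, as the mollified inequality demands.\<close>
    define \<delta> where "\<delta> = min (d / 2) (\<tau> / 2)"
    have \<delta>: "0 < \<delta>" "\<delta> < \<tau>" "\<delta> < d" using d(1) \<tau> by (auto simp: \<delta>_def min_def)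
    have km: "integrable lborel (\<lambda>\<zeta>. mollifier \<delta> \<zeta> * G \<zeta>)" "0 \<le> (LINT \<zeta>|lborel. mollifier \<delta> \<zeta> * G \<zeta>)"
      using kato_mollified[OF \<psi> supp \<delta>(1,2)] unfolding G_def F_def by simp_all
    have "(LINT \<zeta>|lborel. mollifier \<delta> \<zeta> * G \<zeta>) \<le> (LINT \<zeta>|lborel. mollifier \<delta> (\<zeta> :: real \<times> real \<times> (real^'n)) * (G 0 / 2))"
    proof (rule integral_mono[OF km(1)])
      show "integrable lborel (\<lambda>\<zeta>::real \<times> real \<times> (real^'n). mollifier \<delta> \<zeta> * (G 0 / 2))"
        by (intro integrable_mult_left mollifier_integral_pos \<delta>)
      show "mollifier \<delta> \<zeta> * G \<zeta> \<le> mollifier \<delta> \<zeta> * (G 0 / 2)" for \<zeta>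
      proof (cases "norm \<zeta> < d")
        case True
        then show ?thesis by (intro mult_left_mono Gn mollifier_nonneg)
      next
        case False
        then show ?thesis using \<delta> mollifier_eq_0(1)[of \<delta> \<zeta>] by simp
      qed
    qed
    also have "\<dots> = (LINT \<zeta>|lborel. mollifier \<delta> (\<zeta> :: real \<times> real \<times> (real^'n))) * (G 0 / 2)"
      by (rule integral_mult_left_zero)
    also have "\<dots> < 0" using mollifier_integral_pos(2)[OF \<delta>(1), where 'a = "real \<times> real \<times> (real^'n)"] n
      by (simp add: mult_pos_neg)
    finally show False using km(2) by simp
  qed
  then show ?thesis by (simp add: G_def F_def)
qed

end


subsection \<open>Uniqueness\<close>

context kruzkov_pair
begin

text \<open>
  The slope \<open>1 + 2 L r\<close> dominates \<open>2 L \<bar>x\<bar>\<close> inside the cone, so the time derivative of the cutoff absorbs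
  the flux term and leaves a coercive remainder.
\<close>

definition light_cone :: "real \<Rightarrow> real \<times> real \<times> (real^'n) \<Rightarrow> real" where
  "light_cone r z = r\<^sup>2 - (fst z)\<^sup>2 - (1 + 2 * L * r) * fst (snd z)"

lemma cone_inside:
  assumes r: "1 \<le> r" and z: "0 \<le> fst (snd z)" "0 < light_cone r z"
  shows "\<bar>fst z\<bar> \<le> r" "fst (snd z) \<le> r\<^sup>2"
proof -
  have M: "1 \<le> 1 + 2 * L * r" using lip(3) r by simp
  have "0 \<le> (1 + 2 * L * r) * fst (snd z)" using M z(1) by simp
  then have "(fst z)\<^sup>2 \<le> r\<^sup>2" using z(2) by (simp add: light_cone_def)
  then show "\<bar>fst z\<bar> \<le> r" using r by (simp add: abs_le_square_iff[symmetric])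
  have "1 * fst (snd z) \<le> (1 + 2 * L * r) * fst (snd z)" using M z(1) by (intro mult_right_mono)
  moreover have "0 \<le> (fst z)\<^sup>2" by simp
  ultimately show "fst (snd z) \<le> r\<^sup>2" using z(2) unfolding light_cone_def by linarith
qed

lemma continuous_cone: "continuous_on UNIV (\<lambda>z. flat_exp k (light_cone r z))"
  unfolding light_cone_def
  by (rule continuous_on_compose2[OF continuous_flat_exp[of UNIV]])
     (auto intro!: continuous_on_diff continuous_on_mult continuous_on_const continuous_on_power
        continuous_on_fst continuous_on_snd continuous_on_id)

lemma cone_integrable:
  assumes r: "1 \<le> r" and c: "continuous_on UNIV c"
  shows "integrable lborel (\<lambda>z. (\<bar>w z - u z\<bar> * (P z * P z)) * (c (fst (snd z)) * flat_exp k (light_cone r z)))"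
proof (rule integrable_bounded_continuous)
  show "(\<lambda>z. \<bar>w z - u z\<bar> * (P z * P z)) \<in> borel_measurable borel" by measurable
  show "\<bar>\<bar>w z - u z\<bar> * (P z * P z)\<bar> \<le> 2 * B * (B * B)" for z
  proof -
    have "\<bar>w z - u z\<bar> \<le> 2 * B" using b(1)[of z] b(2)[of z] by simp
    moreover have "\<bar>P z * P z\<bar> \<le> B * B" unfolding abs_mult using b(5,6) B0 by (intro mult_mono) auto
    ultimately show ?thesis unfolding abs_mult[of "\<bar>_\<bar>"] using B0 by (intro mult_mono) auto
  qed
  show "continuous_on UNIV (\<lambda>z. c (fst (snd z)) * flat_exp k (light_cone r z))"
    by (intro continuous_on_mult continuous_cone continuous_on_compose2[OF c])
       (auto intro!: continuous_on_fst continuous_on_snd continuous_on_id)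
  show "bounded ({-r..r} \<times> {0..r\<^sup>2} \<times> (Gam :: (real^'n) set))"
    by (intro bounded_Times compact_imp_bounded[OF compact_Gam]) auto
  show "\<bar>w z - u z\<bar> * (P z * P z) * (c (fst (snd z)) * flat_exp k (light_cone r z)) = 0"
    if z: "z \<notin> {-r..r} \<times> {0..r\<^sup>2} \<times> Gam" for z
  proof (cases "z \<in> domT \<and> 0 < light_cone r z")
    case True
    then have "0 \<le> fst (snd z)" "snd (snd z) \<in> Gam" by (auto simp: domT_def)
    with True cone_inside[OF r, of z] z have False by (cases z) (auto simp: abs_le_iff)
    then show ?thesis ..
  next
    case False
    then show ?thesis using Ps[of z] flat_exp_eq_0[of "light_cone r z" k] by force
  qed
qed

text \<open>The cutoff is a ramp in t / \<tau> times a bump of \<open>light_cone\<close>. Its time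
  derivative has a negative part with factor 1 + 2 L r, of which 2 L r absorbs the flux term; what
  remains of it is moved to the left. The other part is concentrated in the initial layer between
  \<tau> and 2\<tau>.\<close>

lemma uniqueness_step:
  assumes r: "1 \<le> r" and \<tau>: "0 < \<tau>"
  shows "(LINT z|lborel. (\<bar>w z - u z\<bar> * (P z * P z)) * (ramp (fst (snd z) / \<tau>) * flat_exp 2 (light_cone r z)))
    \<le> (LINT z|lborel. (\<bar>w z - u z\<bar> * (P z * P z)) * (ramp' (fst (snd z) / \<tau>) / \<tau> * bump (light_cone r z)))"
proof -
  define \<psi> where "\<psi> z = ramp (fst (snd z) / \<tau>) * bump (light_cone r z)" for z
  have M: "1 \<le> 1 + 2 * L * r" using lip(3) r by simp
  have bl: "bounded_linear (\<lambda>z::real \<times> real \<times> (real^'n). fst (snd z))"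
    by (rule bounded_linear_compose[OF bounded_linear_fst bounded_linear_snd])
  have s1: "smooth (\<lambda>z::real \<times> real \<times> (real^'n). fst (snd z) * (1 / \<tau>))"
    by (rule smooth_mult[OF smooth_bounded_linear[OF bl] smooth_const])
  have s2: "smooth (light_cone r)"
    unfolding light_cone_def[abs_def] power2_eq_square[of "fst _"]
    by (intro smooth_diff smooth_mult smooth_const smooth_bounded_linear[OF bl] smooth_bounded_linear[OF bounded_linear_fst])
  have \<psi>s: "smooth \<psi>"
    unfolding \<psi>_def[abs_def]
    using smooth_mult[OF smooth_compose[OF smooth_ramp s1] smooth_compose[OF smooth_flat_exp[of 0] s2]] by simp
  have supp: "\<bar>fst z\<bar> \<le> r\<^sup>2 \<and> \<tau> \<le> fst (snd z) \<and> fst (snd z) \<le> r\<^sup>2" if "\<psi> z \<noteq> 0" for z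
  proof -
    have "\<not> fst (snd z) / \<tau> \<le> 1" "\<not> light_cone r z \<le> 0"
      using that ramp_eq_0 flat_exp_eq_0[of "light_cone r z" 0] by (auto simp: \<psi>_def)
    then have t: "\<tau> \<le> fst (snd z)" and c: "0 < light_cone r z" using \<tau> by (auto simp: field_simps)
    \<comment> \<open>With r \<ge> 1 the single number r^2 bounds both position and time on the
      support.\<close>
    have "r \<le> r\<^sup>2" using r by (simp add: power2_eq_square)
    with cone_inside[OF r _ c] t \<tau> show ?thesis by auto
  qed
  have cd: "(light_cone r has_derivative (\<lambda>h. - (2 * fst z * fst h) - (1 + 2 * L * r) * fst (snd h))) (at z)" for z
    unfolding light_cone_def[abs_def] by (auto intro!: derivative_eq_intros)
  have rd: "((\<lambda>z::real \<times> real \<times> (real^'n). fst (snd z) / \<tau>) has_derivative (\<lambda>h. fst (snd h) / \<tau>)) (at z)" for z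
    using \<tau> by (auto intro!: derivative_eq_intros)
  have "(\<psi> has_derivative (\<lambda>h. ramp (fst (snd z) / \<tau>) * ((- (2 * fst z * fst h) - (1 + 2 * L * r) * fst (snd h)) * flat_exp 2 (light_cone r z))
      + (fst (snd h) / \<tau> * ramp' (fst (snd z) / \<tau>)) * bump (light_cone r z))) (at z)" for z
    unfolding \<psi>_def[abs_def]
    by (rule has_derivative_mult[OF has_derivative_ramp_compose[OF rd] has_derivative_bump_compose[OF cd]])
  from frechet_derivative_at[OF this]
  have fd: "frechet_derivative \<psi> (at z) = (\<lambda>h. ramp (fst (snd z) / \<tau>) * ((- (2 * fst z * fst h) - (1 + 2 * L * r) * fst (snd h)) * flat_exp 2 (light_cone r z))
      + (fst (snd h) / \<tau> * ramp' (fst (snd z) / \<tau>)) * bump (light_cone r z))" for z by simp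
  have dt: "dt \<psi> z = ramp' (fst (snd z) / \<tau>) / \<tau> * bump (light_cone r z)
      - (1 + 2 * L * r) * (ramp (fst (snd z) / \<tau>) * flat_exp 2 (light_cone r z))" for z
    unfolding dt_def fd by (simp add: algebra_simps)
  have dx: "dx \<psi> z = - 2 * fst z * (ramp (fst (snd z) / \<tau>) * flat_exp 2 (light_cone r z))" for z
    unfolding dx_def fd by simp
  have cr: "continuous_on UNIV (\<lambda>t. ramp (t / \<tau>))"
    by (rule continuous_on_compose2[OF smooth_imp_continuous_on[OF smooth_ramp, of UNIV]])
       (use \<tau> in \<open>auto intro!: continuous_on_divide continuous_on_const continuous_on_id\<close>)
  have cr': "continuous_on UNIV (\<lambda>t. ramp' (t / \<tau>) / \<tau>)"
    using \<tau> by (intro continuous_on_divide continuous_on_const continuous_on_compose2[OF continuous_ramp'[of UNIV]])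
      (auto intro!: continuous_on_divide continuous_on_const continuous_on_id)
  define X where "X z = (\<bar>w z - u z\<bar> * (P z * P z)) * (ramp (fst (snd z) / \<tau>) * flat_exp 2 (light_cone r z))" for z
  define Y where "Y z = (\<bar>w z - u z\<bar> * (P z * P z)) * (ramp' (fst (snd z) / \<tau>) / \<tau> * bump (light_cone r z))" for z
  have iX: "integrable lborel X" unfolding X_def[abs_def] by (rule cone_integrable[OF r cr])
  have iY: "integrable lborel Y" unfolding Y_def[abs_def] by (rule cone_integrable[OF r cr'])
  have "0 \<le> (LINT z|lborel. (\<bar>w z - u z\<bar> * dt \<psi> z + kflux g (w z) (u z) * dx \<psi> z) * P z * P z)"
    by (rule kato[OF \<psi>s _ supp \<tau>]) (simp add: \<psi>_def ramp_nonneg flat_exp_nonneg)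
  also have "\<dots> \<le> (LINT z|lborel. Y z - X z)"
  proof (cases "integrable lborel (\<lambda>z. (\<bar>w z - u z\<bar> * dt \<psi> z + kflux g (w z) (u z) * dx \<psi> z) * P z * P z)")
    case True
    show ?thesis
    proof (rule integral_mono[OF True Bochner_Integration.integrable_diff[OF iY iX]])
      fix z :: "real \<times> real \<times> (real^'n)"
      let ?d = "\<bar>w z - u z\<bar>" and ?k = "ramp (fst (snd z) / \<tau>) * flat_exp 2 (light_cone r z)"
      have k0: "0 \<le> ?k" by (simp add: ramp_nonneg flat_exp_nonneg)
      \<comment> \<open>On the support \<bar>x\<bar> is at most r, and the diagonal Lipschitz bound
        turns the Kruzhkov flux into L times the distance; elsewhere the cutoff factor is 0.\<close>
      have "kflux g (w z) (u z) * (- 2 * fst z * ?k) \<le> (2 * L * r) * ?d * ?k"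
      proof (cases "?k = 0")
        case True
        then show ?thesis by (simp only: mult_zero_right order.refl)
      next
        case False
        then have "\<not> fst (snd z) / \<tau> \<le> 1" "\<not> light_cone r z \<le> 0" using ramp_eq_0 flat_exp_eq_0[of "light_cone r z" 2] by auto
        then have "0 \<le> fst (snd z)" "0 < light_cone r z" using \<tau> by (auto simp: field_simps)
        from cone_inside(1)[OF r this] have x: "\<bar>fst z\<bar> \<le> r" .
        have "kflux g (w z) (u z) * (- 2 * fst z) \<le> \<bar>kflux g (w z) (u z)\<bar> * \<bar>2 * fst z\<bar>"
          by (metis abs_ge_self abs_minus_cancel abs_mult mult_minus_left)
        also have "\<dots> \<le> (L * ?d) * (2 * r)"
          using x lip(2)[of z] lip(3) by (intro mult_mono) auto
        also have "\<dots> = (2 * L * r) * ?d" by (simp add: mult_ac)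
        finally have "kflux g (w z) (u z) * (- 2 * fst z) \<le> (2 * L * r) * ?d" .
        from mult_right_mono[OF this k0] show ?thesis by (simp only: mult.assoc)
      qed
      then have "?d * dt \<psi> z + kflux g (w z) (u z) * dx \<psi> z \<le> ?d * (ramp' (fst (snd z) / \<tau>) / \<tau> * bump (light_cone r z)) - ?d * ?k"
        unfolding dt dx by (simp add: algebra_simps)
      from mult_right_mono[OF this, of "P z * P z"] b(5)[of z]
      show "(?d * dt \<psi> z + kflux g (w z) (u z) * dx \<psi> z) * P z * P z \<le> Y z - X z"
        by (simp add: X_def Y_def algebra_simps)
    qed
  next
    case False
    \<comment> \<open>This case cannot occur: the integrand is bounded with bounded support.\<close>
    have "integrable lborel (\<lambda>z. (\<bar>w z - u z\<bar> * (P z * P z)) * (dt \<psi> z) + (kflux g (w z) (u z) * (P z * P z)) * dx \<psi> z)"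
    proof (rule Bochner_Integration.integrable_add)
      have K: "bounded ({-r\<^sup>2..r\<^sup>2} \<times> {\<tau>..r\<^sup>2} \<times> (Gam :: (real^'n) set))"
        by (intro bounded_Times compact_imp_bounded[OF compact_Gam]) auto
      have PP: "\<bar>P z * P z\<bar> \<le> B * B" for z unfolding abs_mult using b(5,6) B0 by (intro mult_mono) auto
      have z0: "P z = 0 \<or> (dt \<psi> z = 0 \<and> dx \<psi> z = 0)" if "z \<notin> {-r\<^sup>2..r\<^sup>2} \<times> {\<tau>..r\<^sup>2} \<times> Gam" for z
        using cutoff_support[OF supp that] by blast
      show "integrable lborel (\<lambda>z. (\<bar>w z - u z\<bar> * (P z * P z)) * dt \<psi> z)"
      proof (rule integrable_bounded_continuous[OF _ _ continuous_dx_dt(2)[OF \<psi>s] K, of _ "2 * B * (B * B)"])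
        show "\<bar>\<bar>w z - u z\<bar> * (P z * P z)\<bar> \<le> 2 * B * (B * B)" for z
          unfolding abs_mult[of "\<bar>_\<bar>"] using b(1)[of z] b(2)[of z] PP B0 by (intro mult_mono) auto
        show "(\<lambda>z. \<bar>w z - u z\<bar> * (P z * P z)) \<in> borel_measurable borel" by measurable
      qed (use z0 in force)
      show "integrable lborel (\<lambda>z. (kflux g (w z) (u z) * (P z * P z)) * dx \<psi> z)"
      proof (rule integrable_bounded_continuous[OF _ _ continuous_dx_dt(1)[OF \<psi>s] K, of _ "2 * B * (B * B)"])
        show "(\<lambda>z. kflux g (w z) (u z) * (P z * P z)) \<in> borel_measurable borel"
          unfolding kflux_def sgn_if by measurable
        show "\<bar>kflux g (w z) (u z) * (P z * P z)\<bar> \<le> 2 * B * (B * B)" for z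
          unfolding abs_mult[of "kflux _ _ _"] using abs_kflux_le[of g "w z" "u z"] b(3)[of z] b(4)[of z] PP B0
          by (intro mult_mono) auto
      qed (use z0 in force)
    qed
    with False show ?thesis by (simp add: algebra_simps)
  qed
  also have "\<dots> = (LINT z|lborel. Y z) - (LINT z|lborel. X z)"
    by (rule Bochner_Integration.integral_diff[OF iY iX])
  finally show ?thesis unfolding X_def Y_def by simp
qed

text \<open>As \<tau> tends to 0 the initial-layer term is bounded by a time average of the distance
  and vanishes by \<open>init\<close>. The nonnegative term at times past any fixed positive one
  then has integral 0, and the regions 0 < \<open>light_cone r z\<close> exhaust positive times as r
  grows.\<close>

theorem uniqueness:
  assumes init: "\<And>r. 1 \<le> r \<Longrightarrow> ((\<lambda>T. 1 / T * (LINT z|lborel. indicator ({-r..r} \<times> {0<..<T} \<times> UNIV) z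
      * (\<bar>w z - u z\<bar> * (P z * P z)))) \<longlongrightarrow> 0) (at_right 0)"
  shows "AE z in lborel. P z \<noteq> 0 \<longrightarrow> w z = u z"
proof -
  define c where "c = bump (exp (- 1))"
  have c0: "0 < c" unfolding c_def by (rule bump_exp_pos)
  obtain Mr where Mr: "0 < Mr" "\<And>s. ramp' s \<le> Mr" using ramp'_bounded by blast
  define E where "E z = \<bar>w z - u z\<bar> * (P z * P z)" for z
  have E0: "0 \<le> E z" for z using b(5) by (simp add: E_def)
  have Em [measurable]: "E \<in> borel_measurable borel" unfolding E_def[abs_def] by measurable
  have Eb: "\<bar>E z\<bar> \<le> 2 * B * (B * B)" for z
  proof -
    have "\<bar>w z - u z\<bar> \<le> 2 * B" using b(1)[of z] b(2)[of z] by simp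
    moreover have "P z * P z \<le> B * B" using b(5,6) B0 by (intro mult_mono) auto
    ultimately have "E z \<le> 2 * B * (B * B)" unfolding E_def by (rule mult_mono) (use B0 b(5) in auto)
    then show ?thesis using E0 by simp
  qed
  have Es: "E z = 0" if "z \<notin> domT" for z using Ps[OF that] by (simp add: E_def)
  have step: "AE z in lborel. 2 * \<tau>0 \<le> fst (snd z) \<longrightarrow> 0 < light_cone r z \<longrightarrow> E z = 0" if r: "1 \<le> r" and \<tau>0: "0 < \<tau>0" for r \<tau>0
  proof -
    define h where "h T = 1 / T * (LINT z|lborel. indicator ({-r..r} \<times> {0<..<T} \<times> UNIV) z * E z)" for T
    have hl: "(h \<longlongrightarrow> 0) (at_right 0)" unfolding h_def[abs_def] E_def by (rule init[OF r])
    define A where "A = {z :: real \<times> real \<times> (real^'n). 2 * \<tau>0 \<le> fst (snd z)}"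
    have Am [measurable]: "A \<in> sets borel" unfolding A_def
      by (intro borel_closed closed_Collect_le continuous_intros)
    \<comment> \<open>For \<tau> \<le> \<tau>0 the ramp has reached its plateau c on A, so
      \<open>X\<close> is independent of \<tau> while the bound on its integral tends to 0.\<close>
    define X where "X z = indicator A z * (E z * (c * flat_exp 2 (light_cone r z)))" for z
    have iX0: "integrable lborel (\<lambda>z. E z * (c * flat_exp 2 (light_cone r z)))"
      unfolding E_def using cone_integrable[OF r continuous_on_const[of _ c]] by simp
    have iX: "integrable lborel X"
      unfolding X_def[abs_def]
      by (rule integrable_mult_bounded[OF iX0, of _ 1]) (auto simp: indicator_def)
    have X0: "0 \<le> X z" for z using E0 c0 by (simp add: X_def flat_exp_nonneg)
    have bound: "(LINT z|lborel. X z) \<le> 2 * Mr * h (2 * \<tau>)" if \<tau>: "0 < \<tau>" "\<tau> \<le> \<tau>0" for \<tau>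
    proof -
      have cr: "continuous_on UNIV (\<lambda>t. ramp (t / \<tau>))"
        by (rule continuous_on_compose2[OF smooth_imp_continuous_on[OF smooth_ramp, of UNIV]])
           (use \<tau> in \<open>auto intro!: continuous_on_divide continuous_on_const continuous_on_id\<close>)
      have cr': "continuous_on UNIV (\<lambda>t. ramp' (t / \<tau>) / \<tau>)"
        using \<tau> by (intro continuous_on_divide continuous_on_const continuous_on_compose2[OF continuous_ramp'[of UNIV]])
          (auto intro!: continuous_on_divide continuous_on_const continuous_on_id)
      have "(LINT z|lborel. X z) \<le> (LINT z|lborel. E z * (ramp (fst (snd z) / \<tau>) * flat_exp 2 (light_cone r z)))"
      proof (rule integral_mono[OF iX])
        show "integrable lborel (\<lambda>z. E z * (ramp (fst (snd z) / \<tau>) * flat_exp 2 (light_cone r z)))"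
          unfolding E_def by (rule cone_integrable[OF r cr])
        show "X z \<le> E z * (ramp (fst (snd z) / \<tau>) * flat_exp 2 (light_cone r z))" for z
        proof (cases "z \<in> A")
          case True
          then have "2 \<le> fst (snd z) / \<tau>" using \<tau> by (simp add: A_def field_simps)
          then show ?thesis using True by (simp add: X_def ramp_const c_def)
        next
          case False
          then show ?thesis using E0 by (simp add: X_def ramp_nonneg flat_exp_nonneg)
        qed
      qed
      also have "\<dots> \<le> (LINT z|lborel. E z * (ramp' (fst (snd z) / \<tau>) / \<tau> * bump (light_cone r z)))"
        unfolding E_def by (rule uniqueness_step[OF r \<tau>(1)])
      \<comment> \<open>ramp' vanishes outside 1 < t/\<tau> < 2, and the factor 1/\<tau> from
        differentiating the ramp is, up to 2, the one of the average over times below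
        2\<tau>.\<close>
      also have "\<dots> \<le> (LINT z|lborel. Mr / \<tau> * (indicator ({-r..r} \<times> {0<..<2 * \<tau>} \<times> UNIV) z * E z))"
      proof (rule integral_mono)
        show "integrable lborel (\<lambda>z. E z * (ramp' (fst (snd z) / \<tau>) / \<tau> * bump (light_cone r z)))"
          unfolding E_def by (rule cone_integrable[OF r cr'])
        show "integrable lborel (\<lambda>z. Mr / \<tau> * (indicator ({-r..r} \<times> {0<..<2 * \<tau>} \<times> UNIV) z * E z))"
        proof (intro integrable_mult_right integrable_lborel_bounded_support[where M = "2 * B * (B * B)"
              and K = "{-r..r} \<times> {0..2 * \<tau>} \<times> Gam"])
          have [measurable]: "{-r..r} \<times> {0<..<2 * \<tau>} \<times> (UNIV :: (real^'n) set) \<in> sets borel" by (intro borel_Times) auto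
          show "(\<lambda>z. indicator ({-r..r} \<times> {0<..<2 * \<tau>} \<times> UNIV) z * E z) \<in> borel_measurable borel" by measurable
          show "bounded ({-r..r} \<times> {0..2 * \<tau>} \<times> (Gam :: (real^'n) set))"
            by (intro bounded_Times compact_imp_bounded[OF compact_Gam]) auto
          show "\<bar>indicator ({-r..r} \<times> {0<..<2 * \<tau>} \<times> UNIV) z * E z\<bar> \<le> 2 * B * (B * B)" for z
            using Eb[of z] B0 by (auto simp: indicator_def)
          show "indicator ({-r..r} \<times> {0<..<2 * \<tau>} \<times> UNIV) z * E z = 0" if "z \<notin> {-r..r} \<times> {0..2 * \<tau>} \<times> Gam" for z
            using that Es[of z] by (cases z) (auto simp: indicator_def domT_def)
        qed
        show "E z * (ramp' (fst (snd z) / \<tau>) / \<tau> * bump (light_cone r z))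
          \<le> Mr / \<tau> * (indicator ({-r..r} \<times> {0<..<2 * \<tau>} \<times> UNIV) z * E z)" for z
        proof (cases "ramp' (fst (snd z) / \<tau>) = 0 \<or> light_cone r z \<le> 0")
          case True
          then have "ramp' (fst (snd z) / \<tau>) * bump (light_cone r z) = 0" by (auto simp: flat_exp_eq_0)
          then have eq: "E z * (ramp' (fst (snd z) / \<tau>) / \<tau> * bump (light_cone r z)) = 0" by auto
          show ?thesis unfolding eq using E0[of z] Mr(1) \<tau> by simp
        next
          case False
          then have "\<not> (fst (snd z) / \<tau> \<le> 1 \<or> 2 \<le> fst (snd z) / \<tau>)" "0 < light_cone r z" using ramp'_eq_0 by auto
          then have t: "0 < fst (snd z)" "fst (snd z) < 2 * \<tau>" and cz: "0 < light_cone r z"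
            using \<tau> by (auto simp: field_simps intro: order.strict_trans)
          have "\<bar>fst z\<bar> \<le> r" by (rule cone_inside(1)[OF r _ cz]) (use t in simp)
          then have i: "indicator ({-r..r} \<times> {0<..<2 * \<tau>} \<times> UNIV) z = (1::real)"
            using t by (cases z) (auto simp: indicator_def abs_le_iff)
          have "ramp' (fst (snd z) / \<tau>) / \<tau> * bump (light_cone r z) \<le> Mr / \<tau> * 1"
            using Mr \<tau> bump_less_1[of "light_cone r z"] ramp'_nonneg
            by (intro mult_mono divide_right_mono) (auto simp: flat_exp_nonneg)
          from mult_left_mono[OF this E0[of z]] show ?thesis unfolding i by (simp add: mult.commute)
        qed
      qed
      also have "\<dots> = 2 * Mr * h (2 * \<tau>)"
        unfolding integral_mult_right_zero h_def using \<tau> by simp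
      finally show ?thesis .
    qed
    have "(LINT z|lborel. X z) \<le> 0"
    proof (rule tendsto_lowerbound[where F = "at_right (0::real)"])
      have "filterlim (\<lambda>\<tau>::real. 2 * \<tau>) (at_right 0) (at_right 0)"
        unfolding filterlim_at
      proof
        show "((\<lambda>\<tau>::real. 2 * \<tau>) \<longlongrightarrow> 0) (at_right 0)"
          using tendsto_mult[OF tendsto_const tendsto_ident_at, of "2::real" 0 "{0<..}"] by simp
        show "\<forall>\<^sub>F \<tau>::real in at_right 0. 2 * \<tau> \<in> {0<..} \<and> 2 * \<tau> \<noteq> 0"
          using eventually_at_right_less[of "0::real"] by eventually_elim simp
      qed
      from tendsto_mult[OF tendsto_const filterlim_compose[OF hl this], of "2 * Mr"]
      show "((\<lambda>\<tau>. 2 * Mr * h (2 * \<tau>)) \<longlongrightarrow> 0) (at_right 0)" by simp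
      show "\<forall>\<^sub>F \<tau> in at_right 0. (LINT z|lborel. X z) \<le> 2 * Mr * h (2 * \<tau>)"
        unfolding eventually_at_right_field using \<tau>0 bound by (intro exI[of _ \<tau>0]) auto
    qed simp
    moreover have "0 \<le> (LINT z|lborel. X z)" by (intro integral_nonneg_AE AE_I2 X0)
    ultimately have "(LINT z|lborel. X z) = 0" by simp
    then have "AE z in lborel. X z = 0" using integral_nonneg_eq_0_iff_AE[OF iX] X0 by simp
    then show ?thesis
    proof eventually_elim
      case (elim z)
      show ?case
      proof (intro impI)
        assume "2 * \<tau>0 \<le> fst (snd z)" "0 < light_cone r z"
        then show "E z = 0" using elim c0 flat_exp_pos[of "light_cone r z" 2] by (simp add: X_def A_def)
      qed
    qed
  qed
  have "AE z in lborel. \<forall>m n. 2 * inverse (real (Suc m)) \<le> fst (snd z) \<longrightarrow> 0 < light_cone (real (Suc n)) z \<longrightarrow> E z = 0"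
    unfolding AE_all_countable by (intro allI step) auto
  then show ?thesis
  proof eventually_elim
    case (elim z)
    show ?case
    proof
      assume P: "P z \<noteq> 0"
      then have "z \<in> domT" using Ps by blast
      then have t: "0 < fst (snd z)" by (auto simp: domT_def)
      obtain m where m: "inverse (real (Suc m)) < fst (snd z) / 2" using reals_Archimedean[of "fst (snd z) / 2"] t by auto
      let ?x = "fst z" and ?t = "fst (snd z)"
      \<comment> \<open>N^2 must beat x^2 + (1 + 2 L N) t. It is enough that N exceeds x^2 + t + 2 L
        t + 1: multiply by N \<ge> 1.\<close>
      obtain n where n: "?x\<^sup>2 + ?t + 2 * L * ?t + 1 < real n" using reals_Archimedean2 by blast
      define N where "N = real (Suc n)"
      have N: "?x\<^sup>2 + ?t + 2 * L * ?t + 1 \<le> N" "1 \<le> N" using n by (auto simp: N_def)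
      have "N * (?x\<^sup>2 + ?t + 2 * L * ?t + 1) \<le> N * N" using N by (intro mult_left_mono) auto
      moreover have "1 * (?x\<^sup>2 + ?t) \<le> N * (?x\<^sup>2 + ?t)" using N(2) t by (intro mult_right_mono) auto
      ultimately have "0 < light_cone N z"
        using N(2) by (simp add: light_cone_def power2_eq_square[of N] algebra_simps)
      moreover have "2 * inverse (real (Suc m)) \<le> ?t" using m by simp
      ultimately have "E z = 0" using elim unfolding N_def by blast
      then show "w z = u z" using P by (simp add: E_def)
    qed
  qed
qed

end


section \<open>Borel representatives and uniqueness of weak entropy solutions\<close>

lemma borel_representative_in:
  fixes w :: "'a::euclidean_space \<Rightarrow> real"
  assumes w: "w \<in> borel_measurable (lebesgue_on S)" "S \<in> sets lebesgue" "AE z in lebesgue_on S. w z \<in> A"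
    and A: "A \<in> sets borel" "k \<in> A"
  obtains w' where "w' \<in> borel_measurable borel" "\<And>z. w' z \<in> A" "AE z in lebesgue_on S. w z = w' z"
proof -
  obtain w1 where w1 [measurable]: "w1 \<in> borel_measurable borel" and e: "AE z in lebesgue_on S. w z = w1 z"
    using borel_representative[OF w(1,2)] by blast
  note [measurable] = A(1)
  show ?thesis
  proof (rule that[of "\<lambda>z. if w1 z \<in> A then w1 z else k"])
    show "(\<lambda>z. if w1 z \<in> A then w1 z else k) \<in> borel_measurable borel" by measurable
    show "AE z in lebesgue_on S. w z = (if w1 z \<in> A then w1 z else k)"
      using e w(3) by eventually_elim auto
  qed (use A(2) in auto)
qed

lemma LINT_domT_eq_lborel:
  fixes h h' :: "real \<times> real \<times> (real^'n) \<Rightarrow> real"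
  assumes h': "h' \<in> borel_measurable borel" and e: "AE z in lebesgue_on domT. h z = h' z"
  shows "(LINT z|lebesgue_on domT. h z) = (LINT z|lborel. indicator domT z * h' z)"
proof -
  have m': "h' \<in> borel_measurable (lebesgue_on domT)" by (rule borel_measurable_lebesgue_onI[OF h'])
  have "h \<in> borel_measurable (lebesgue_on domT)"
    by (rule borel_measurable_lebesgue_on_AE[OF m']) (use e in \<open>auto elim: eventually_mono\<close>)
  then have "(LINT z|lebesgue_on domT. h z) = (LINT z|lebesgue_on domT. h' z)"
    using m' e by (intro integral_cong_AE)
  also have "\<dots> = (LINT z|lebesgue. indicator domT z * h' z)" by (simp add: integral_restrict_space)
  also have "\<dots> = (LINT z|lborel. indicator domT z * h' z)"
    by (rule integral_completion) (use h' in measurable)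
  finally show ?thesis .
qed

lemma lipschitz_of_derivative_bound:
  fixes f f' :: "real \<Rightarrow> real"
  assumes "{a..b} \<subseteq> I" "\<And>s. s \<in> I \<Longrightarrow> (f has_real_derivative f' s) (at s within I)" "continuous_on I f'"
  obtains L where "0 \<le> L" "\<And>s t. s \<in> {a..b} \<Longrightarrow> t \<in> {a..b} \<Longrightarrow> \<bar>f s - f t\<bar> \<le> L * \<bar>s - t\<bar>"
proof -
  have "bounded (f' ` {a..b})"
    by (intro compact_imp_bounded compact_continuous_image continuous_on_subset[OF assms(3,1)]) auto
  then obtain L where L: "\<forall>s\<in>{a..b}. \<bar>f' s\<bar> \<le> L" by (auto simp: bounded_iff)
  have "\<bar>f s - f t\<bar> \<le> max 0 L * \<bar>s - t\<bar>" if "s \<in> {a..b}" "t \<in> {a..b}" for s t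
  proof -
    have "norm (f s - f t) \<le> max 0 L * norm (s - t)"
    proof (rule field_differentiable_bound[of "{a..b}" f f'])
      show "(f has_real_derivative f' z) (at z within {a..b})" if "z \<in> {a..b}" for z
        using that assms(1,2) by (blast intro: has_field_derivative_subset)
      show "norm (f' z) \<le> max 0 L" if "z \<in> {a..b}" for z using bspec[OF L that] by simp
    qed (use that in auto)
    then show ?thesis by simp
  qed
  then show ?thesis by (intro that[of "max 0 L"]) auto
qed

text \<open>The constant c is arbitrary, possibly outside the interval. If it lies between s and t
  it belongs to the interval, and the estimate is split at c, where the sign changes and the flux
  difference vanishes; otherwise the sign is the same for both.\<close>

lemma kflux_lipschitz:
  assumes L: "0 \<le> L" "\<And>s t. s \<in> {a..b} \<Longrightarrow> t \<in> {a..b} \<Longrightarrow> \<bar>g s - g t\<bar> \<le> L * \<bar>s - t\<bar>"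
    and st: "s \<in> {a..b}" "t \<in> {a..b}"
  shows "\<bar>kflux g c s - kflux g c t\<bar> \<le> L * \<bar>s - t\<bar>"
proof -
  have main: "\<bar>kflux g c s - kflux g c t\<bar> \<le> L * \<bar>s - t\<bar>" if st: "s \<in> {a..b}" "t \<in> {a..b}" "s \<le> t" for s t
  proof -
    consider "c < s" | "t < c" | "s \<le> c" "c \<le> t" by linarith
    then show ?thesis
    proof cases
      case 1
      then have "kflux g c s - kflux g c t = g s - g t" using st(3) by (simp add: kflux_def)
      then show ?thesis using L(2)[OF st(1,2)] by simp
    next
      case 2
      then have "kflux g c s - kflux g c t = g t - g s" using st(3) by (simp add: kflux_def)
      then show ?thesis using L(2)[OF st(2,1)] by (simp add: abs_minus_commute)
    next
      case 3
      then have c: "c \<in> {a..b}" using st by auto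
      have "kflux g c s = g c - g s" "kflux g c t = g t - g c" using 3 by (auto simp: kflux_def sgn_if)
      then have "\<bar>kflux g c s - kflux g c t\<bar> \<le> \<bar>g c - g s\<bar> + \<bar>g t - g c\<bar>" by simp
      also have "\<dots> \<le> L * \<bar>c - s\<bar> + L * \<bar>t - c\<bar>" by (intro add_mono L(2) c st)
      also have "\<dots> = L * \<bar>s - t\<bar>" using 3 st(3) by (simp add: algebra_simps)
      finally show ?thesis .
    qed
  qed
  show ?thesis
  proof (cases "s \<le> t")
    case True
    then show ?thesis using main st by blast
  next
    case False
    then have "\<bar>kflux g c t - kflux g c s\<bar> \<le> L * \<bar>t - s\<bar>" using main[OF st(2,1)] by simp
    then show ?thesis by (simp add: abs_minus_commute)
  qed
qed

text \<open>Asymmetric roles: u has values in the compact interval [a, b] with margin \<eta> inside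
  I, whereas w may approach an end point of I where f is not Lipschitz. The margin is what yields a
  finite propagation speed for the pair.\<close>

lemma weak_entropy_sol_reduced_unique:
  fixes \<rho> :: "real^'n \<Rightarrow> real" and w u :: "real \<times> real \<times> (real^'n) \<Rightarrow> real"
  assumes \<rho>: "Linf Gam \<rho>" "\<And>y. y \<in> Gam \<Longrightarrow> 0 \<le> \<rho> y"
    and I: "I = pr1 ` closure D" "convex I" "I \<in> sets borel"
    and f: "\<And>s. s \<in> I \<Longrightarrow> (f has_real_derivative f' s) (at s within I)" "continuous_on I f'"
    and J: "a \<le> b" "{a - \<eta>..b + \<eta>} \<subseteq> I" "0 < \<eta>"
    and w: "weak_entropy_sol_reduced \<rho> D f u0 w" and u: "weak_entropy_sol_reduced \<rho> D f u0 u"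
    and uJ: "AE z in lebesgue_on domT. u z \<in> {a..b}"
  shows "AE (x, t, y) in lebesgue_on domT. \<rho> y \<noteq> 0 \<longrightarrow> w (x, t, y) = u (x, t, y)"
proof -
  have JI: "{a..b} \<subseteq> I" using J(2,3) by force
  have aJ: "a \<in> {a..b}" "a \<in> I" using J(1) JI by auto
  have fc: "continuous_on I f" using f(1) by (rule DERIV_continuous_on)
  have vd: "vector_derivative f (at s within I) = f' s" if s: "s \<in> I" for s
  proof (rule vector_derivative_within)
    \<comment> \<open>A derivative within I is unique only if I has no isolated point; for an
      interval this means that it is not a singleton.\<close>
    have "\<not> (\<exists>c. I = {c})"
    proof
      assume "\<exists>c. I = {c}"
      moreover have "a - \<eta> \<in> I" "a \<in> I" using J aJ by (auto simp: subset_iff)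
      ultimately show False using J(3) by auto
    qed
    then have "s islimpt I" using connected_imp_perfect[OF convex_connected[OF I(2)] s] by blast
    then show "at s within I \<noteq> bot" by (simp add: trivial_limit_within)
    show "(f has_vector_derivative f' s) (at s within I)"
      using f(1)[OF s] by (simp add: has_real_derivative_iff_has_vector_derivative)
  qed
  have kr: "0 \<le> (LINT z|lebesgue_on domT. (\<bar>v z - k\<bar> * dt \<phi> z
      + sgn (v z - k) * (f (v z) - f k) * dx \<phi> z) * \<rho> (snd (snd z)))"
    if v: "weak_entropy_sol_reduced \<rho> D f u0 v" and k: "k \<in> I" and \<phi>: "test_fun domT \<phi>" "\<And>z. 0 \<le> \<phi> z"
    for v :: "real \<times> real \<times> (real^'n) \<Rightarrow> real" and k \<phi>
  proof -
    from v have v1: "Linf domT v" "AE z in lebesgue_on domT. v z \<in> I" "Linf domT (\<lambda>z. f (v z))"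
      by (auto simp: weak_entropy_sol_reduced_def I(1))
    obtain M1 where M1: "AE z in lebesgue_on domT. \<bar>v z\<bar> \<le> M1" using v1(1) by (auto simp: Linf_def)
    obtain M2 where M2: "AE z in lebesgue_on domT. \<bar>f (v z)\<bar> \<le> M2" using v1(3) by (auto simp: Linf_def)
    have vm: "v \<in> borel_measurable (lebesgue_on domT)" using v1(1) by (simp add: Linf_def)
    have ent: "0 \<le> (LINT z|lebesgue_on domT. (l (v z) * dt \<phi> z + q (v z) * dx \<phi> z) * \<rho> (snd (snd z)))"
      if l: "convex_on UNIV l" "C2_real_with I l l' l''"
        "\<And>s. s \<in> I \<Longrightarrow> (q has_real_derivative l' s * f' s) (at s within I)" for l l' l'' q
    proof -
      have q: "\<forall>s\<in>I. (q has_real_derivative l' s * vector_derivative f (at s within I)) (at s within I)"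
        using l(3) vd by simp
      from v have "0 \<le> (LINT (x, t, y)|lebesgue_on domT.
           (l (v (x, t, y)) * dt \<phi> (x, t, y) + q (v (x, t, y)) * dx \<phi> (x, t, y)) * \<rho> y)"
        unfolding weak_entropy_sol_reduced_def I(1)[symmetric] using l(1,2) q \<phi> by blast
      then show ?thesis by (simp add: case_prod_beta')
    qed
    show ?thesis
      by (rule kruzkov_inequality[OF \<rho>(1) I(2,3) k f vm v1(2), of "max M1 M2"])
         (use M1 M2 ent \<phi>(1) in \<open>auto elim: eventually_mono\<close>)
  qed
  from w obtain W1 W2 where w1: "w \<in> borel_measurable (lebesgue_on domT)" "AE z in lebesgue_on domT. w z \<in> I"
    "AE z in lebesgue_on domT. \<bar>w z\<bar> \<le> W1" "AE z in lebesgue_on domT. \<bar>f (w z)\<bar> \<le> W2"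
    by (auto simp: weak_entropy_sol_reduced_def I(1) Linf_def)
  from u have um: "u \<in> borel_measurable (lebesgue_on domT)" by (auto simp: weak_entropy_sol_reduced_def Linf_def)
  from \<rho>(1) obtain R1 where R1: "AE y in lebesgue_on Gam. \<bar>\<rho> y\<bar> \<le> R1" and \<rho>m: "\<rho> \<in> borel_measurable (lebesgue_on Gam)"
    by (auto simp: Linf_def)
  have "bounded (f ` {a..b})"
    by (intro compact_imp_bounded compact_continuous_image continuous_on_subset[OF fc JI]) auto
  then obtain F1 where F1: "\<forall>s\<in>{a..b}. \<bar>f s\<bar> \<le> F1" by (auto simp: bounded_iff)
  define B where "B = max (max \<bar>W1\<bar> \<bar>W2\<bar>) (max (max \<bar>R1\<bar> \<bar>F1\<bar>) (max \<bar>a\<bar> \<bar>b\<bar>))"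
  have B: "\<bar>W1\<bar> \<le> B" "\<bar>W2\<bar> \<le> B" "\<bar>R1\<bar> \<le> B" "\<bar>F1\<bar> \<le> B" "\<bar>a\<bar> \<le> B" "\<bar>b\<bar> \<le> B"
    by (simp_all only: B_def le_max_iff_disj order.refl simp_thms)
  have B0: "0 \<le> B" using B(5) by linarith
  \<comment> \<open>f is Borel only on I, since nothing is assumed about it elsewhere; the cutoff
    makes it Borel on the line without changing it at the values of w and u.\<close>
  define g where "g s = indicat_real I s * f s" for s
  have gm [measurable]: "g \<in> borel_measurable borel"
    using borel_measurable_continuous_on_indicator[OF I(3) fc] by (simp add: g_def[abs_def])
  have gf: "g s = f s" if "s \<in> I" for s using that by (simp add: g_def)
  note [measurable] = I(3)
  \<comment> \<open>The bound on g(s) cannot be inferred from that on s, because f may blow up at an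
    end point missing from I; the flux bound of the weak solution supplies it almost
    everywhere.\<close>
  define A where "A = {s. s \<in> I \<and> \<bar>s\<bar> \<le> B \<and> \<bar>g s\<bar> \<le> B}"
  have A: "A \<in> sets borel" unfolding A_def by measurable
  have jb: "\<bar>s\<bar> \<le> B" "\<bar>f s\<bar> \<le> B" if "s \<in> {a..b}" for s
    using that B bspec[OF F1 that] by auto
  have aA: "a \<in> A" using aJ jb[OF aJ(1)] by (simp add: A_def gf)
  have "AE z in lebesgue_on domT. w z \<in> A"
    using w1(2-4) by eventually_elim (use B in \<open>auto simp: A_def gf\<close>)
  from borel_representative_in[OF w1(1) _ this A aA] obtain w' where
    w': "w' \<in> borel_measurable borel" "\<And>z. w' z \<in> A" "AE z in lebesgue_on domT. w z = w' z" by auto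
  from borel_representative_in[OF um _ uJ _ aJ(1)] obtain u' where
    u': "u' \<in> borel_measurable borel" "\<And>z. u' z \<in> {a..b}" "AE z in lebesgue_on domT. u z = u' z" by auto
  have "AE y in lebesgue_on Gam. \<rho> y \<in> {0..B}"
  proof -
    have "AE y in lebesgue_on Gam. y \<in> (Gam :: (real^'n) set)" by (simp add: AE_Gam_iff)
    with R1 show ?thesis by eventually_elim (use B \<rho>(2) in auto)
  qed
  from borel_representative_in[OF \<rho>m _ this, of 0] B0 obtain \<rho>' where
    \<rho>': "\<rho>' \<in> borel_measurable borel" "\<And>y. \<rho>' y \<in> {0..B}" "AE y in lebesgue_on Gam. \<rho> y = \<rho>' y" by auto
  have \<rho>e: "AE z in lebesgue_on domT. \<rho> (snd (snd z)) = \<rho>' (snd (snd z))" by (rule AE_lift_Gam(1)[OF \<rho>'(3)])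
  define P where "P z = indicat_real domT z * \<rho>' (snd (snd z))" for z :: "real \<times> real \<times> (real^'n)"
  have \<rho>'m [measurable]: "(\<lambda>z::real \<times> real \<times> (real^'n). \<rho>' (snd (snd z))) \<in> borel_measurable borel"
    by (rule measurable_compose[OF measurable_compose[OF borel_measurable_pair_borel(2) borel_measurable_pair_borel(2)] \<rho>'(1)])
  have Pm: "P \<in> borel_measurable borel" unfolding P_def[abs_def] by measurable
  have uI: "u' z \<in> I" for z using u'(2)[of z] JI by auto
  have wI: "w' z \<in> I" for z using w'(2)[of z] by (simp add: A_def)
  obtain L1 where L1: "0 \<le> L1" "\<And>s t. s \<in> {a - \<eta>..b + \<eta>} \<Longrightarrow> t \<in> {a - \<eta>..b + \<eta>} \<Longrightarrow> \<bar>f s - f t\<bar> \<le> L1 * \<bar>s - t\<bar>"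
    using lipschitz_of_derivative_bound[OF J(2) f] by blast
  \<comment> \<open>If w is within \<eta> of u, both lie in the enlarged interval and L1 applies;
    otherwise \<bar>f(w) - f(u)\<bar> \<le> 2B, which is at most (2B/\<eta>) \<bar>w -
    u\<bar>.\<close>
  define L where "L = max L1 (2 * B / \<eta>)"
  have L0: "0 \<le> L" using L1(1) by (simp add: L_def)
  have Lg: "\<bar>g s - g t\<bar> \<le> L * \<bar>s - t\<bar>" if "s \<in> {a..b}" "t \<in> {a..b}" for s t
  proof -
    have "\<bar>f s - f t\<bar> \<le> L1 * \<bar>s - t\<bar>" using that J(3) by (intro L1(2)) auto
    also have "\<dots> \<le> L * \<bar>s - t\<bar>" by (intro mult_right_mono) (auto simp: L_def)
    finally show ?thesis using that JI by (auto simp: gf subset_iff)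
  qed
  note [measurable] = w'(1) u'(1) Pm
  have conv: "(LINT z|lebesgue_on domT. (\<bar>v z - k\<bar> * dt \<phi> z + sgn (v z - k) * (f (v z) - f k) * dx \<phi> z) * \<rho> (snd (snd z)))
     = (LINT z|lborel. (\<bar>v' z - k\<bar> * dt \<phi> z + kflux g (v' z) k * dx \<phi> z) * P z)"
    if v: "v' \<in> borel_measurable borel" "\<And>z. v' z \<in> I" "AE z in lebesgue_on domT. v z = v' z" and k: "k \<in> I" and \<phi>: "test_fun domT \<phi>"
    for v v' :: "real \<times> real \<times> (real^'n) \<Rightarrow> real" and k \<phi>
  proof -
    have sm: "smooth \<phi>" using \<phi> by (simp add: test_fun_def)
    have [measurable]: "dt \<phi> \<in> borel_measurable borel" "dx \<phi> \<in> borel_measurable borel" "v' \<in> borel_measurable borel"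
      using v(1) by (auto intro: borel_measurable_continuous_onI continuous_dx_dt sm)
    have "(LINT z|lebesgue_on domT. (\<bar>v z - k\<bar> * dt \<phi> z + sgn (v z - k) * (f (v z) - f k) * dx \<phi> z) * \<rho> (snd (snd z)))
      = (LINT z|lborel. indicator domT z * ((\<bar>v' z - k\<bar> * dt \<phi> z + kflux g (v' z) k * dx \<phi> z) * \<rho>' (snd (snd z))))"
    proof (rule LINT_domT_eq_lborel)
      show "(\<lambda>z. (\<bar>v' z - k\<bar> * dt \<phi> z + kflux g (v' z) k * dx \<phi> z) * \<rho>' (snd (snd z))) \<in> borel_measurable borel"
        unfolding kflux_def sgn_if by measurable
      show "AE z in lebesgue_on domT. (\<bar>v z - k\<bar> * dt \<phi> z + sgn (v z - k) * (f (v z) - f k) * dx \<phi> z) * \<rho> (snd (snd z))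
         = (\<bar>v' z - k\<bar> * dt \<phi> z + kflux g (v' z) k * dx \<phi> z) * \<rho>' (snd (snd z))"
        using v(3) \<rho>e
      proof eventually_elim
        case (elim z)
        then show ?case using v(2)[of z] k by (simp add: kflux_def gf)
      qed
    qed
    then show ?thesis by (simp add: P_def mult_ac)
  qed
  interpret K: kruzkov_pair w' u' P g B L
  proof
    show "\<bar>w' z\<bar> \<le> B" "\<bar>g (w' z)\<bar> \<le> B" for z using w'(2)[of z] by (simp_all add: A_def)
    show "\<bar>u' z\<bar> \<le> B" "\<bar>g (u' z)\<bar> \<le> B" for z using jb[OF u'(2)[of z]] by (simp_all add: gf uI)
    show "0 \<le> P z" "P z \<le> B" for z using \<rho>'(2)[of "snd (snd z)"] B0 by (auto simp: P_def indicator_def)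
    show "z \<notin> domT \<Longrightarrow> P z = 0" for z by (simp add: P_def)
    show "\<bar>kflux g (w' z) (u' z1) - kflux g (w' z) (u' z2)\<bar> \<le> L * \<bar>u' z1 - u' z2\<bar>" for z z1 z2
      by (rule kflux_lipschitz[OF L0 Lg u'(2) u'(2)])
    show "\<bar>kflux g (w' z) (u' z)\<bar> \<le> L * \<bar>w' z - u' z\<bar>" for z
    proof -
      have le: "\<bar>kflux g (w' z) (u' z)\<bar> \<le> \<bar>f (w' z) - f (u' z)\<bar>"
        by (simp add: kflux_def abs_mult abs_sgn_eq gf uI wI)
      show ?thesis
      proof (cases "\<bar>w' z - u' z\<bar> \<le> \<eta>")
        case True
        have "\<bar>f (w' z) - f (u' z)\<bar> \<le> L1 * \<bar>w' z - u' z\<bar>"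
          using True u'(2)[of z] J(3) by (intro L1(2)) auto
        also have "\<dots> \<le> L * \<bar>w' z - u' z\<bar>" by (intro mult_right_mono) (auto simp: L_def)
        finally show ?thesis using le by linarith
      next
        case False
        have "\<bar>f (w' z)\<bar> \<le> B" using w'(2)[of z] gf[OF wI, of z] by (simp add: A_def)
        moreover have "\<bar>f (u' z)\<bar> \<le> B" by (rule jb(2)[OF u'(2)])
        ultimately have "\<bar>f (w' z) - f (u' z)\<bar> \<le> 2 * B" by linarith
        also have "2 * B = 2 * B / \<eta> * \<eta>" using J(3) by simp
        also have "\<dots> \<le> L * \<bar>w' z - u' z\<bar>"
          using False J(3) L0 by (intro mult_mono) (auto simp: L_def)
        finally show ?thesis using le by linarith
      qed
    qed
    show "0 \<le> (LINT z|lborel. (\<bar>w' z - u' z'\<bar> * dt \<phi> z + kflux g (w' z) (u' z') * dx \<phi> z) * P z)"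
      if "test_fun domT \<phi>" "\<And>z. 0 \<le> \<phi> z" for z' \<phi>
      using kr[OF w uI[of z'] that] unfolding conv[OF w'(1) wI w'(3) uI that(1)] .
    show "0 \<le> (LINT z'|lborel. (\<bar>w' z - u' z'\<bar> * dt \<phi> z' + kflux g (w' z) (u' z') * dx \<phi> z') * P z')"
      if "test_fun domT \<phi>" "\<And>z. 0 \<le> \<phi> z" for z \<phi>
      using kr[OF u wI[of z] that] unfolding conv[OF u'(1) uI u'(3) wI that(1)]
      by (simp add: kflux_commute[of g "u' _"] abs_minus_commute[of "u' _"])
  qed (use L0 w'(1) u'(1) Pm gm in auto)
  have "AE z in lborel. P z \<noteq> 0 \<longrightarrow> w' z = u' z"
  proof (rule K.uniqueness)
    fix r :: real assume r: "1 \<le> r"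
    let ?A = "\<lambda>T. {-r..r} \<times> {0<..<T} \<times> (Gam :: (real^'n) set)"
    let ?h = "\<lambda>v T. 1 / T * (LINT (x, t, y)|lebesgue_on (?A T). norm (v (x, t, y) - u0 (x, y)) * \<rho> y)"
    have lim: "((\<lambda>T. B * (?h w T + ?h u T)) \<longlongrightarrow> B * (0 + 0)) (at_right 0)"
    proof (intro tendsto_mult tendsto_const tendsto_add)
      show "((\<lambda>T. ?h w T) \<longlongrightarrow> 0) (at_right 0)" "((\<lambda>T. ?h u T) \<longlongrightarrow> 0) (at_right 0)"
        using w u unfolding weak_entropy_sol_reduced_def attains_initial_data_def by auto
    qed
    from w obtain B1 where u0: "u0 \<in> borel_measurable (lebesgue_on dom0)" "AE p in lebesgue_on dom0. \<bar>u0 p\<bar> \<le> B1"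
      by (auto simp: weak_entropy_sol_reduced_def Linf_def)
    have bound: "0 \<le> 1 / T * (LINT z|lborel. indicator ({-r..r} \<times> {0<..<T} \<times> UNIV) z * (\<bar>w' z - u' z\<bar> * (P z * P z))) \<and>
      1 / T * (LINT z|lborel. indicator ({-r..r} \<times> {0<..<T} \<times> UNIV) z * (\<bar>w' z - u' z\<bar> * (P z * P z))) \<le> B * (?h w T + ?h u T)"
      if T: "0 < T" for T
    proof -
      have Ab [measurable]: "?A T \<in> sets borel" unfolding Gam_def by (intro borel_Times) auto
      have Ad: "?A T \<subseteq> domT" by (auto simp: domT_def)
      have AL: "?A T \<inter> space lebesgue \<in> sets lebesgue" using Ab by (auto intro!: sets_completionI_sets)
      have dL: "(domT :: (real \<times> real \<times> (real^'n)) set) \<inter> space lebesgue \<in> sets lebesgue" by simp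
      have eqA: "(\<lambda>z. indicat_real domT z *\<^sub>R (indicat_real (?A T) z * G z)) = (\<lambda>z. indicat_real (?A T) z *\<^sub>R G z)"
        for G :: "real \<times> real \<times> (real^'n) \<Rightarrow> real"
        by (rule ext) (use Ad in \<open>auto simp: indicator_def\<close>)
      have hv: "(LINT (x, t, y)|lebesgue_on (?A T). norm (v (x, t, y) - u0 (x, y)) * \<rho> y)
        = (LINT z|lebesgue_on domT. indicat_real (?A T) z * (\<bar>v z - u0 (fst z, snd (snd z))\<bar> * \<rho> (snd (snd z))))" for v
      proof -
        have cp: "(\<lambda>(x, t, y). norm (v (x, t, y) - u0 (x, y)) * \<rho> y)
          = (\<lambda>z. \<bar>v z - u0 (fst z, snd (snd z))\<bar> * \<rho> (snd (snd z)))" by auto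
        show ?thesis unfolding cp integral_restrict_space[OF AL] integral_restrict_space[OF dL] eqA ..
      qed
      have ki: "integrable (lebesgue_on domT) (\<lambda>z. indicat_real (?A T) z * \<rho> (snd (snd z)))"
        by (rule integrable_domT_kernel[OF \<rho>(1), of _ 1 "max r T"]) (auto simp: indicator_def)
      have u0m: "(\<lambda>z. u0 (fst z, snd (snd z))) \<in> borel_measurable (lebesgue_on domT)" by (rule borel_measurable_lift_dom0[OF u0(1)])
      have iv: "integrable (lebesgue_on domT) (\<lambda>z. indicat_real (?A T) z * (\<bar>v z - u0 (fst z, snd (snd z))\<bar> * \<rho> (snd (snd z))))"
        if v: "v \<in> borel_measurable (lebesgue_on domT)" "AE z in lebesgue_on domT. \<bar>v z\<bar> \<le> C" for v C
      proof -
        have "integrable (lebesgue_on domT) (\<lambda>z. \<bar>v z - u0 (fst z, snd (snd z))\<bar> * (indicat_real (?A T) z * \<rho> (snd (snd z))))"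
        proof (rule integrable_mult_bounded[OF ki, of _ "C + B1"])
          show "AE z in lebesgue_on domT. \<bar>\<bar>v z - u0 (fst z, snd (snd z))\<bar>\<bar> \<le> C + B1"
            using v(2) AE_lift_dom0[OF u0(2)] by eventually_elim linarith
        qed (use v(1) u0m in measurable)
        then show ?thesis by (simp add: mult_ac)
      qed
      have ub: "AE z in lebesgue_on domT. \<bar>u z\<bar> \<le> B" using uJ by (rule eventually_mono) (rule jb(1))
      note iw = iv[OF w1(1,3)] and iu = iv[OF um ub]
      have "(LINT z|lborel. indicator ({-r..r} \<times> {0<..<T} \<times> UNIV) z * (\<bar>w' z - u' z\<bar> * (P z * P z)))
        = (LINT z|lborel. indicator domT z * (indicator (?A T) z * (\<bar>w' z - u' z\<bar> * (\<rho>' (snd (snd z)) * \<rho>' (snd (snd z))))))"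
      proof (rule Bochner_Integration.integral_cong[OF refl])
        fix z :: "real \<times> real \<times> (real^'n)"
        show "indicator ({-r..r} \<times> {0<..<T} \<times> UNIV) z * (\<bar>w' z - u' z\<bar> * (P z * P z))
          = indicator domT z * (indicator (?A T) z * (\<bar>w' z - u' z\<bar> * (\<rho>' (snd (snd z)) * \<rho>' (snd (snd z)))))"
          by (cases z) (auto simp: P_def indicator_def domT_def)
      qed
      also have "\<dots> = (LINT z|lebesgue_on domT. indicator (?A T) z * (\<bar>w z - u z\<bar> * (\<rho> (snd (snd z)) * \<rho> (snd (snd z)))))"
      proof (rule LINT_domT_eq_lborel[symmetric])
        show "(\<lambda>z. indicator (?A T) z * (\<bar>w' z - u' z\<bar> * (\<rho>' (snd (snd z)) * \<rho>' (snd (snd z))))) \<in> borel_measurable borel"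
          by measurable
        show "AE z in lebesgue_on domT. indicator (?A T) z * (\<bar>w z - u z\<bar> * (\<rho> (snd (snd z)) * \<rho> (snd (snd z))))
          = indicator (?A T) z * (\<bar>w' z - u' z\<bar> * (\<rho>' (snd (snd z)) * \<rho>' (snd (snd z))))"
          using w'(3) u'(3) \<rho>e by eventually_elim simp
      qed
      also have "\<dots> \<le> (LINT z|lebesgue_on domT. B * (indicat_real (?A T) z * (\<bar>w z - u0 (fst z, snd (snd z))\<bar> * \<rho> (snd (snd z)))
         + indicat_real (?A T) z * (\<bar>u z - u0 (fst z, snd (snd z))\<bar> * \<rho> (snd (snd z)))))"
      proof (rule integral_mono_AE')
        show "integrable (lebesgue_on domT) (\<lambda>z. B * (indicat_real (?A T) z * (\<bar>w z - u0 (fst z, snd (snd z))\<bar> * \<rho> (snd (snd z)))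
         + indicat_real (?A T) z * (\<bar>u z - u0 (fst z, snd (snd z))\<bar> * \<rho> (snd (snd z)))))"
          by (intro integrable_mult_right Bochner_Integration.integrable_add iw iu)
        have rb: "AE z in lebesgue_on domT. 0 \<le> \<rho> (snd (snd z)) \<and> \<rho> (snd (snd z)) \<le> B"
          using \<rho>e by eventually_elim (use \<rho>'(2) in auto)
        show "AE z in lebesgue_on domT. indicator (?A T) z * (\<bar>w z - u z\<bar> * (\<rho> (snd (snd z)) * \<rho> (snd (snd z))))
          \<le> B * (indicat_real (?A T) z * (\<bar>w z - u0 (fst z, snd (snd z))\<bar> * \<rho> (snd (snd z)))
         + indicat_real (?A T) z * (\<bar>u z - u0 (fst z, snd (snd z))\<bar> * \<rho> (snd (snd z))))"
          using rb
        proof eventually_elim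
          case (elim z)
          let ?p = "\<rho> (snd (snd z))" and ?v = "u0 (fst z, snd (snd z))"
          \<comment> \<open>The triangle inequality through u0 handles the distance; bounding one
            factor \<rho> by B turns the weight \<rho>^2 of Kato's inequality into the weight \<rho>
            of the initial trace.\<close>
          have "\<bar>w z - u z\<bar> * (?p * ?p) \<le> (\<bar>w z - ?v\<bar> + \<bar>u z - ?v\<bar>) * (?p * B)"
            using elim by (intro mult_mono) auto
          then show ?case by (cases "z \<in> ?A T") (simp_all add: algebra_simps)
        qed
        show "AE z in lebesgue_on domT. 0 \<le> B * (indicat_real (?A T) z * (\<bar>w z - u0 (fst z, snd (snd z))\<bar> * \<rho> (snd (snd z)))
         + indicat_real (?A T) z * (\<bar>u z - u0 (fst z, snd (snd z))\<bar> * \<rho> (snd (snd z))))"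
          using rb by eventually_elim (use B0 in \<open>auto simp: indicator_def intro!: mult_nonneg_nonneg add_nonneg_nonneg\<close>)
      qed
      also have "\<dots> = B * ((LINT (x, t, y)|lebesgue_on (?A T). norm (w (x, t, y) - u0 (x, y)) * \<rho> y)
         + (LINT (x, t, y)|lebesgue_on (?A T). norm (u (x, t, y) - u0 (x, y)) * \<rho> y))"
        unfolding hv integral_mult_right_zero Bochner_Integration.integral_add[OF iw iu] ..
      finally have le: "(LINT z|lborel. indicator ({-r..r} \<times> {0<..<T} \<times> UNIV) z * (\<bar>w' z - u' z\<bar> * (P z * P z)))
        \<le> B * ((LINT (x, t, y)|lebesgue_on (?A T). norm (w (x, t, y) - u0 (x, y)) * \<rho> y)
         + (LINT (x, t, y)|lebesgue_on (?A T). norm (u (x, t, y) - u0 (x, y)) * \<rho> y))" .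
      have "0 \<le> (LINT z|lborel. indicator ({-r..r} \<times> {0<..<T} \<times> UNIV) z * (\<bar>w' z - u' z\<bar> * (P z * P z)))"
        by (intro integral_nonneg_AE AE_I2) auto
      moreover from mult_left_mono[OF le, of "1 / T"] T
      have "1 / T * (LINT z|lborel. indicator ({-r..r} \<times> {0<..<T} \<times> UNIV) z * (\<bar>w' z - u' z\<bar> * (P z * P z))) \<le> B * (?h w T + ?h u T)"
        by (simp add: algebra_simps)
      ultimately show ?thesis using T by simp
    qed
    have pos: "\<forall>\<^sub>F T::real in at_right 0. 0 < T" by (rule eventually_at_right_less)
    have lim': "((\<lambda>T. B * (?h w T + ?h u T)) \<longlongrightarrow> 0) (at_right 0)" using lim by simp
    show "((\<lambda>T. 1 / T * (LINT z|lborel. indicator ({-r..r} \<times> {0<..<T} \<times> UNIV) z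
      * (\<bar>w' z - u' z\<bar> * (P z * P z)))) \<longlongrightarrow> 0) (at_right 0)"
      by (rule tendsto_sandwich[OF _ _ tendsto_const lim']; rule eventually_mono[OF pos]) (use bound in blast)+
  qed
  then have "AE z in lebesgue_on domT. P z \<noteq> 0 \<longrightarrow> w' z = u' z"
    unfolding AE_domT_iff by (rule eventually_mono) simp
  moreover have "AE z in lebesgue_on domT. z \<in> (domT :: (real \<times> real \<times> (real^'n)) set)" by (simp add: AE_domT_iff)
  ultimately have "AE z in lebesgue_on domT. \<rho> (snd (snd z)) \<noteq> 0 \<longrightarrow> w z = u z"
    using w'(3) u'(3) \<rho>e by eventually_elim (simp add: P_def)
  then show ?thesis by (rule eventually_mono) auto
qed


section \<open>State space, its projection and the reduced flux\<close>

lemma st_expand: "st a b = a *\<^sub>R st 1 0 + b *\<^sub>R st 0 1"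
  by (simp add: vec_eq_iff forall_2)

lemma continuous_on_st:
  assumes "continuous_on A f" "continuous_on A g"
  shows "continuous_on A (\<lambda>s. st (f s) (g s))"
  by (subst st_expand) (intro continuous_intros assms)

lemma borel_measurable_st:
  assumes "f \<in> borel_measurable M" "g \<in> borel_measurable M"
  shows "(\<lambda>s. st (f s) (g s)) \<in> borel_measurable M"
  by (subst st_expand) (intro borel_measurable_add borel_measurable_scaleR borel_measurable_const assms)

lemma linear_pr1: "linear pr1"
  by (simp add: linear_iff)

lemma open_pr1_image: "open D \<Longrightarrow> open (pr1 ` D)"
proof (rule open_surjective_linear_image[OF _ linear_pr1])
  show "surj pr1" by (rule surjI[of _ "\<lambda>s. st s 0"]) simp
qed

lemma convex_pr1_image: "convex D \<Longrightarrow> convex (pr1 ` D)"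
  by (rule convex_linear_image[OF linear_pr1])

text \<open>The projection of an unbounded closed set need not be closed, so the interval of
  admissible u may miss an end point; as a countable union of compact sets it is still
  Borel.\<close>

lemma borel_pr1_closed_image:
  assumes "closed (A :: (real^2) set)"
  shows "pr1 ` A \<in> sets borel"
proof -
  have "x \<in> (\<Union>n::nat. A \<inter> cball 0 (real n))" if "x \<in> A" for x
    using real_arch_simple[of "norm x"] that by auto
  then have "A = (\<Union>n::nat. A \<inter> cball 0 (real n))" by blast
  then have "pr1 ` A = (\<Union>n::nat. pr1 ` (A \<inter> cball 0 (real n)))" by (metis image_UN)
  moreover have "pr1 ` (A \<inter> cball 0 (real n)) \<in> sets borel" for n :: nat
    using assms by (intro borel_compact compact_continuous_image closed_Int_compact continuous_intros) auto
  ultimately show ?thesis by simp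
qed

text \<open>The margin \<eta> is the slack needed by the uniqueness proof around the range of the
  limit solution.\<close>

lemma compact_subset_open_interval:
  fixes J A :: "real set"
  assumes J: "compact J" "J \<noteq> {}" "J \<subseteq> A" and A: "open A" "convex A"
  obtains a b \<eta> where "a \<le> b" "0 < \<eta>" "J \<subseteq> {a..b}" "{a - \<eta>..b + \<eta>} \<subseteq> A"
proof -
  obtain a where a: "a \<in> J" "\<forall>s\<in>J. a \<le> s" using compact_attains_inf[OF J(1,2)] by blast
  obtain b where b: "b \<in> J" "\<forall>s\<in>J. s \<le> b" using compact_attains_sup[OF J(1,2)] by blast
  obtain r where r: "0 < r" "cball a r \<subseteq> A" using A(1) a(1) J(3) by (meson open_contains_cball subsetD)
  obtain s where s: "0 < s" "cball b s \<subseteq> A" using A(1) b(1) J(3) by (meson open_contains_cball subsetD)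
  have "a - min r s \<in> cball a r" "b + min r s \<in> cball b s" using r(1) s(1) by (auto simp: dist_real_def)
  then have "{a - min r s..b + min r s} \<subseteq> A" using r(2) s(2) by (intro Icc_subset_convex A(2)) auto
  then show ?thesis using a b r(1) s(1) by (intro that[of a b "min r s"]) auto
qed

text \<open>Convexity alone puts the graph weakly above the tangent. Strictness comes from the
  midpoint of a and b: the weak inequality there combines with strict convexity along the
  segment.\<close>

lemma strictly_convex_above_tangent:
  assumes g: "strictly_convex_on I g" "open I" "(g has_real_derivative g') (at b)"
    and ab: "a \<in> I" "b \<in> I" "a \<noteq> b"
  shows "g b + g' * (a - b) < g a"
proof -
  have cI: "convex I" using g(1) by (simp add: strictly_convex_on_def)
  have "convex_on I g"
  proof (rule convex_onI[OF _ cI])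
    fix t x y :: real assume t: "0 < t" "t < 1" and xy: "x \<in> I" "y \<in> I"
    show "g ((1 - t) *\<^sub>R x + t *\<^sub>R y) \<le> (1 - t) * g x + t * g y"
    proof (cases "x = y")
      case True
      then show ?thesis by (simp add: algebra_simps)
    next
      case False
      then have "g ((1 - t) * x + t * y) < (1 - t) * g x + t * g y"
        using g(1) t xy by (simp add: strictly_convex_on_def)
      then show ?thesis by simp
    qed
  qed
  moreover have m: "(1 - 1 / 2) * a + 1 / 2 * b \<in> I"
    using convexD[OF cI ab(1,2), of "1 / 2" "1 / 2"] by simp
  ultimately have "g' * ((1 - 1 / 2) * a + 1 / 2 * b - b) \<le> g ((1 - 1 / 2) * a + 1 / 2 * b) - g b"
    using g(2,3) ab(2) convex_connected[OF cI]
    by (intro convex_on_imp_above_tangent[of I g]) (auto simp: interior_open intro: DERIV_subset)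
  moreover have "g ((1 - 1 / 2) * a + 1 / 2 * b) < (1 - 1 / 2) * g a + 1 / 2 * g b"
    using g(1)[unfolded strictly_convex_on_def, THEN conjunct2, rule_format, OF ab(1,2), of "1 / 2"] ab(3) by simp
  ultimately show ?thesis by (simp add: field_simps)
qed

lemma C2_real_with_subset: "C2_real_with I g g' g'' \<Longrightarrow> A \<subseteq> I \<Longrightarrow> C2_real_with A g g' g''"
  unfolding C2_real_with_def by (meson DERIV_subset continuous_on_subset subsetD)

lemma equilibrium_curve_in_closure:
  assumes "relaxation_system D F DF \<Lambda>m \<Lambda>p r e" "s \<in> pr1 ` closure D"
  shows "st s (e s) \<in> closure D"
  using assms unfolding relaxation_system_def by blast

text \<open>The chain rule along the equilibrium curve, with all derivatives relative to the closure
  of D and to its projection, gives f'(s) as the first row of DF applied to (1, e'(s)); its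
  continuity is that of DF and e'.\<close>

lemma flux_C1:
  assumes sys: "relaxation_system D F DF \<Lambda>m \<Lambda>p r e"
  obtains f' where "\<And>s. s \<in> pr1 ` closure D \<Longrightarrow> (flux F e has_real_derivative f' s) (at s within pr1 ` closure D)"
    "continuous_on (pr1 ` closure D) f'"
proof -
  let ?I = "pr1 ` closure D" and ?c = "\<lambda>s. st s (e s)"
  have "\<exists>e' e''. C2_real_with ?I e e' e''" "\<forall>i. \<exists>HF. C2_with (closure D) (\<lambda>U. F U $ i) (\<lambda>U. DF U $ i) HF"
    using sys unfolding relaxation_system_def by blast+
  then obtain e' e'' HF where e: "C2_real_with ?I e e' e''"
    and F: "C2_with (closure D) (\<lambda>U. F U $ 1) (\<lambda>U. DF U $ 1) HF" by metis
  have ci: "?c ` ?I \<subseteq> closure D" using equilibrium_curve_in_closure[OF sys] by blast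
  have ec: "continuous_on ?I e" "continuous_on ?I e'"
    using e unfolding C2_real_with_def by (auto intro: DERIV_continuous_on)
  show ?thesis
  proof
    fix s assume s: "s \<in> ?I"
    have "(e has_real_derivative e' s) (at s within ?I)" using e s unfolding C2_real_with_def by blast
    then have "(e has_derivative (\<lambda>h. h * e' s)) (at s within ?I)"
      by (simp add: has_field_derivative_def mult.commute[of _ "e' s"])
    then have "((\<lambda>s. s *\<^sub>R st 1 0 + e s *\<^sub>R st 0 1) has_derivative (\<lambda>h. h *\<^sub>R st 1 0 + (h * e' s) *\<^sub>R st 0 1)) (at s within ?I)"
      by (auto intro!: derivative_eq_intros)
    moreover have "h *\<^sub>R st 1 0 + (h * e' s) *\<^sub>R st 0 1 = h *\<^sub>R st 1 (e' s)" for h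
      by (simp add: vec_eq_iff forall_2)
    ultimately have c: "(?c has_derivative (\<lambda>h. h *\<^sub>R st 1 (e' s))) (at s within ?I)"
      by (simp flip: st_expand)
    have "?c s \<in> closure D" using ci s by blast
    then have "((\<lambda>U. F U $ 1) has_derivative (\<lambda>h. DF (?c s) $ 1 \<bullet> h)) (at (?c s) within closure D)"
      using F by (simp add: C2_with_def)
    from has_derivative_in_compose2[OF _ ci s c, of "\<lambda>U. F U $ 1" "\<lambda>U h. DF U $ 1 \<bullet> h"] F
    have "(flux F e has_derivative (\<lambda>h. DF (?c s) $ 1 \<bullet> (h *\<^sub>R st 1 (e' s)))) (at s within ?I)"
      by (simp add: C2_with_def flux_def[abs_def])
    then show "(flux F e has_real_derivative DF (?c s) $ 1 \<bullet> st 1 (e' s)) (at s within ?I)"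
      by (simp add: has_field_derivative_def mult.commute[of _ "_ \<bullet> _"])
  next
    have "continuous_on (closure D) (\<lambda>U. DF U $ 1)"
      using F by (auto simp: C2_with_def continuous_on_eq_continuous_within intro: has_derivative_continuous)
    then have "continuous_on ?I (\<lambda>s. DF (?c s) $ 1)"
      by (rule continuous_on_compose2[OF _ continuous_on_st[OF continuous_on_id ec(1)] ci])
    then show "continuous_on ?I (\<lambda>s. DF (?c s) $ 1 \<bullet> st 1 (e' s))"
      by (intro continuous_on_inner continuous_on_st continuous_on_const ec(2))
  qed
qed

text \<open>Choosing the second test function to be 0 removes the relaxation term, so the identity
  contains no factor 1/\<epsilon> and can be passed to the limit.\<close>

lemma weak_form_first_component:
  fixes \<phi> :: "real \<times> real \<times> (real^'n) \<Rightarrow> real"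
  assumes U: "weak_entropy_sol_full \<rho> D F DF r e \<epsilon> U0 U" and \<phi>: "test_fun domT0 \<phi>"
  shows "(LINT z|lebesgue_on domT. (U z $ 1 * dt \<phi> z + F (U z) $ 1 * dx \<phi> z) * \<rho> (snd (snd z)))
    + (LINT p|lebesgue_on dom0. U0 p $ 1 * \<phi> (fst p, 0, snd p) * \<rho> (snd p)) = 0"
proof -
  have z: "test_fun domT0 (\<lambda>_ :: real \<times> real \<times> (real^'n). 0)"
    unfolding test_fun_def using smooth_const by blast
  have d: "dt (\<lambda>_ :: real \<times> real \<times> (real^'n). 0) z = 0" "dx (\<lambda>_ :: real \<times> real \<times> (real^'n). 0) z = 0" for z
    by (simp_all add: dt_def dx_def)
  from U \<phi> z have "(LINT (x, t, y)|lebesgue_on domT.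
           (U (x, t, y) \<bullet> st (dt \<phi> (x, t, y)) (dt (\<lambda>_. 0) (x, t, y))
            + F (U (x, t, y)) \<bullet> st (dx \<phi> (x, t, y)) (dx (\<lambda>_. 0) (x, t, y))
            - 1 / \<epsilon> * r (U (x, t, y)) * 0) * \<rho> y)
        + (LINT (x, y)|lebesgue_on dom0. (U0 (x, y) \<bullet> st (\<phi> (x, 0, y)) 0) * \<rho> y) = 0"
    unfolding weak_entropy_sol_full_def by blast
  then show ?thesis by (simp add: d inner_vec_def sum_2 case_prod_beta')
qed

lemma compact_continuous_abs_bound:
  fixes h :: "'a::topological_space \<Rightarrow> real"
  assumes "compact K" "continuous_on K h"
  shows "\<exists>M\<ge>0. \<forall>s\<in>K. \<bar>h s\<bar> \<le> M"
proof -
  have "bounded (h ` K)" by (rule compact_imp_bounded[OF compact_continuous_image[OF assms(2,1)]])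
  then obtain M where "\<forall>s\<in>K. \<bar>h s\<bar> \<le> M" by (auto simp: bounded_iff)
  then show ?thesis by (intro exI[of _ "\<bar>M\<bar>"]) force
qed

text \<open>The first components and the flux g are bounded on the compact set S; dominated
  convergence applies term by term to the equations satisfied by the approximations.\<close>

lemma weak_form_limit:
  fixes V :: "nat \<Rightarrow> real \<times> real \<times> (real^'n) \<Rightarrow> real^2" and V0 :: "nat \<Rightarrow> real \<times> (real^'n) \<Rightarrow> real^2"
    and U :: "real \<times> real \<times> (real^'n) \<Rightarrow> real^2" and U0 :: "real \<times> (real^'n) \<Rightarrow> real^2"
    and \<rho> :: "real^'n \<Rightarrow> real"
  assumes \<rho>: "Linf Gam \<rho>" and S: "compact S" "continuous_on S g"
    and V: "\<And>i. V i \<in> borel_measurable (lebesgue_on domT)" "\<And>i. AE z in lebesgue_on domT. V i z \<in> S"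
    and V0: "\<And>i. V0 i \<in> borel_measurable (lebesgue_on dom0)" "\<And>i. AE z in lebesgue_on dom0. V0 i z \<in> S"
    and U: "U \<in> borel_measurable (lebesgue_on domT)" "AE z in lebesgue_on domT. U z \<in> S"
    and U0: "U0 \<in> borel_measurable (lebesgue_on dom0)" "AE z in lebesgue_on dom0. U0 z \<in> S"
    and lim: "AE z in lebesgue_on domT. (\<lambda>i. V i z) \<longlonglongrightarrow> U z"
    and lim0: "AE p in lebesgue_on dom0. (\<lambda>i. V0 i p) \<longlonglongrightarrow> U0 p"
    and \<phi>: "test_fun domT0 \<phi>"
    and eq: "\<And>i. (LINT z|lebesgue_on domT. (V i z $ 1 * dt \<phi> z + g (V i z) * dx \<phi> z) * \<rho> (snd (snd z)))
      + (LINT p|lebesgue_on dom0. V0 i p $ 1 * \<phi> (fst p, 0, snd p) * \<rho> (snd p)) = 0"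
  shows "(LINT z|lebesgue_on domT. (U z $ 1 * dt \<phi> z + g (U z) * dx \<phi> z) * \<rho> (snd (snd z)))
    + (LINT p|lebesgue_on dom0. U0 p $ 1 * \<phi> (fst p, 0, snd p) * \<rho> (snd p)) = 0"
proof -
  have Sb: "S \<in> sets borel" using S(1) by (rule borel_compact)
  have c1: "continuous_on S pr1" by (intro continuous_intros)
  note bd = compact_continuous_abs_bound[OF S(1)]
  have m: "(\<lambda>z. h (W z)) \<in> borel_measurable (lebesgue_on domT)"
    if "continuous_on S h" "W \<in> borel_measurable (lebesgue_on domT)" "AE z in lebesgue_on domT. W z \<in> S"
    for h :: "real^2 \<Rightarrow> real" and W :: "real \<times> real \<times> (real^'n) \<Rightarrow> real^2"
    by (rule borel_measurable_compose_AE[OF _ that(2) Sb that(1,3)]) simp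
  have m0: "(\<lambda>z. h (W z)) \<in> borel_measurable (lebesgue_on dom0)"
    if "continuous_on S h" "W \<in> borel_measurable (lebesgue_on dom0)" "AE z in lebesgue_on dom0. W z \<in> S"
    for h :: "real^2 \<Rightarrow> real" and W :: "real \<times> (real^'n) \<Rightarrow> real^2"
    by (rule borel_measurable_compose_AE[OF _ that(2) Sb that(1,3)]) simp
  note w = integrable_test_fun_derivatives[OF \<rho> \<phi> disjI2[OF refl]]
  note w0 = integrable_test_fun_initial[OF \<rho> \<phi>]
  have T: "(\<lambda>i. LINT z|lebesgue_on domT. h (V i z) * k z) \<longlonglongrightarrow> (LINT z|lebesgue_on domT. h (U z) * k z)"
    if h: "continuous_on S h" and k: "integrable (lebesgue_on domT) k" for h :: "real^2 \<Rightarrow> real" and k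
  proof -
    obtain B where B: "\<forall>s\<in>S. \<bar>h s\<bar> \<le> B" using bd[OF h] by blast
    have inS: "AE z in lebesgue_on domT. \<forall>i. V i z \<in> S" using V(2) by (simp add: AE_all_countable)
    show ?thesis
    proof (rule bounded_convergence_weighted[OF k m[OF h V] m[OF h U], where B = B])
      show "AE z in lebesgue_on domT. \<bar>h (V i z)\<bar> \<le> B" for i
        using V(2)[of i] by eventually_elim (use B in blast)
      show "AE z in lebesgue_on domT. k z \<noteq> 0 \<longrightarrow> (\<lambda>i. h (V i z)) \<longlonglongrightarrow> h (U z)"
        using inS lim U(2)
        by eventually_elim (auto intro: continuous_on_tendsto_compose[OF h])
    qed
  qed
  obtain B where B: "\<forall>s\<in>S. \<bar>s $ 1\<bar> \<le> B" using bd[OF c1] by blast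
  have T0: "(\<lambda>i. LINT p|lebesgue_on dom0. V0 i p $ 1 * (\<phi> (fst p, 0, snd p) * \<rho> (snd p)))
     \<longlonglongrightarrow> (LINT p|lebesgue_on dom0. U0 p $ 1 * (\<phi> (fst p, 0, snd p) * \<rho> (snd p)))"
  proof (rule bounded_convergence_weighted[OF w0 m0[OF c1 V0] m0[OF c1 U0], where B = B])
    show "AE p in lebesgue_on dom0. \<bar>V0 i p $ 1\<bar> \<le> B" for i
      using V0(2)[of i] by eventually_elim (use B in blast)
    show "AE p in lebesgue_on dom0. \<phi> (fst p, 0, snd p) * \<rho> (snd p) \<noteq> 0 \<longrightarrow> (\<lambda>i. V0 i p $ 1) \<longlonglongrightarrow> U0 p $ 1"
      using lim0 by eventually_elim (auto intro: tendsto_vec_nth)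
  qed
  have int: "integrable (lebesgue_on domT) (\<lambda>z. h (W z) * k z)"
    if h: "continuous_on S h" and k: "integrable (lebesgue_on domT) k"
      and W: "W \<in> borel_measurable (lebesgue_on domT)" "AE z in lebesgue_on domT. W z \<in> S"
    for h :: "real^2 \<Rightarrow> real" and k and W :: "real \<times> real \<times> (real^'n) \<Rightarrow> real^2"
  proof -
    obtain B where B: "\<forall>s\<in>S. \<bar>h s\<bar> \<le> B" using bd[OF h] by blast
    have "AE z in lebesgue_on domT. \<bar>h (W z)\<bar> \<le> B" using W(2) by eventually_elim (use B in blast)
    then show ?thesis by (rule integrable_mult_bounded[OF k m[OF h W]])
  qed
  have split: "(LINT z|lebesgue_on domT. (W z $ 1 * dt \<phi> z + g (W z) * dx \<phi> z) * \<rho> (snd (snd z)))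
     = (LINT z|lebesgue_on domT. W z $ 1 * (dt \<phi> z * \<rho> (snd (snd z)))) + (LINT z|lebesgue_on domT. g (W z) * (dx \<phi> z * \<rho> (snd (snd z))))"
    if W: "W \<in> borel_measurable (lebesgue_on domT)" "AE z in lebesgue_on domT. W z \<in> S"
    for W :: "real \<times> real \<times> (real^'n) \<Rightarrow> real^2"
    unfolding Bochner_Integration.integral_add[OF int[OF c1 w(1) W] int[OF S(2) w(2) W], symmetric]
    by (simp add: algebra_simps)
  have "(\<lambda>i. (LINT z|lebesgue_on domT. (V i z $ 1 * dt \<phi> z + g (V i z) * dx \<phi> z) * \<rho> (snd (snd z)))
      + (LINT p|lebesgue_on dom0. V0 i p $ 1 * \<phi> (fst p, 0, snd p) * \<rho> (snd p)))
     \<longlonglongrightarrow> (LINT z|lebesgue_on domT. (U z $ 1 * dt \<phi> z + g (U z) * dx \<phi> z) * \<rho> (snd (snd z)))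
      + (LINT p|lebesgue_on dom0. U0 p $ 1 * \<phi> (fst p, 0, snd p) * \<rho> (snd p))"
    using tendsto_add[OF tendsto_add[OF T[OF c1 w(1)] T[OF S(2) w(2)]] T0]
    unfolding split[OF V] split[OF U] by (simp add: mult.assoc)
  then show ?thesis unfolding eq LIMSEQ_const_iff by simp
qed

section \<open>Relaxation limit: initial trace and identification of the entropy solution\<close>

theorem theorem3p12:
  fixes \<rho> :: "(real^'n) \<Rightarrow> real"
    and D B B' :: "(real^2) set"
    and F :: "real^2 \<Rightarrow> real^2" and DF :: "real^2 \<Rightarrow> real^2^2"
    and \<Lambda>m \<Lambda>p r :: "real^2 \<Rightarrow> real"
    and e l1 l2 :: "real \<Rightarrow> real"
    and C \<gamma> :: real
    and \<epsilon> :: "nat \<Rightarrow> real"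
    and U0 :: "nat \<Rightarrow> real \<times> (real^'n) \<Rightarrow> real^2"
    and U :: "nat \<Rightarrow> real \<times> real \<times> (real^'n) \<Rightarrow> real^2"
    and u0 v0 :: "real \<times> (real^'n) \<Rightarrow> real"
    and u :: "real \<times> real \<times> (real^'n) \<Rightarrow> real"
    and \<sigma> :: "nat \<Rightarrow> nat"
  assumes "parameter_density \<rho>"
    and "relaxation_system D F DF \<Lambda>m \<Lambda>p r e"
    and "hyp_A1 D F DF \<Lambda>m \<Lambda>p r e B B' l1 l2 C \<gamma>"
    and "hyp_A2 \<rho> D F DF r e B \<gamma> \<epsilon> U0 U"
    and "hyp_A3 D e U0 u0 v0"
    and "hyp_A4 \<rho> D F r e B \<gamma> \<epsilon> U0 U"
    and "strict_mono \<sigma>"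
    and "u \<in> borel_measurable (lebesgue_on domT)"
    and "AE z in lebesgue_on domT. u z \<in> pr1 ` closure D"
    and "\<And>p. 1 \<le> p \<Longrightarrow>
           tendsto_Lp_loc p (\<lambda>_. 1) domT (\<lambda>k. U (\<sigma> k)) (\<lambda>z. st (u z) (e (u z))) sequentially"
  shows "(\<forall>V. V \<in> sets lebesgue \<and> bounded V \<longrightarrow>
            ((\<lambda>T. 1 / T * (LINT (x, t, y)|lebesgue_on (V \<times> {0<..<T} \<times> Gam).
                     \<bar>u (x, t, y) - u0 (x, y)\<bar> * \<rho> y)) \<longlongrightarrow> 0) (at_right 0)) \<and>
         ((\<forall>l l' l'' q \<phi>.
             convex_on (pr1 ` D) l \<and> C2_real_with (pr1 ` D) l l' l'' \<and>
             (\<forall>s\<in>pr1 ` D. (q has_real_derivative l' s * deriv (flux F e) s) (at s)) \<and>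
             test_fun domT \<phi> \<and> (\<forall>z\<in>domT. 0 \<le> \<phi> z) \<longrightarrow>
             (LINT (x, t, y)|lebesgue_on domT.
                (l (u (x, t, y)) * dt \<phi> (x, t, y) + q (u (x, t, y)) * dx \<phi> (x, t, y)) * \<rho> y) \<ge> 0)
          \<longrightarrow> unique_weak_entropy_sol_reduced \<rho> D (flux F e) u0 u)"
proof -
  let ?I = "pr1 ` closure D" and ?A = "pr1 ` D" and ?f = "flux F e" and ?c = "\<lambda>s. st s (e s)"
  have \<rho>: "Linf Gam \<rho>" "\<And>y. y \<in> Gam \<Longrightarrow> 0 \<le> \<rho> y" using assms(1) by (simp_all add: parameter_density_def)
  have D: "open D" "convex D" using assms(2) by (simp_all add: relaxation_system_def)
  have I: "convex ?I" "?I \<in> sets borel"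
    using convex_pr1_image[OF convex_closure[OF D(2)]] borel_pr1_closed_image[OF closed_closure] by auto
  have A: "open ?A" "convex ?A" using open_pr1_image[OF D(1)] convex_pr1_image[OF D(2)] by auto
  have AI: "?A \<subseteq> ?I" using closure_subset by (rule image_mono)
  obtain f' where f: "\<And>s. s \<in> ?I \<Longrightarrow> (?f has_real_derivative f' s) (at s within ?I)" "continuous_on ?I f'"
    using flux_C1[OF assms(2)] by blast
  have "\<exists>e' e''. C2_real_with ?I e e' e''" using assms(2) unfolding relaxation_system_def by (elim conjE)
  then obtain e' e'' where "C2_real_with ?I e e' e''" by blast
  then have ec: "continuous_on ?I e" unfolding C2_real_with_def by (auto intro: DERIV_continuous_on)
  define S where "S = closure (Bgam D e B \<gamma>)"
  have B: "B \<subseteq> D" "B \<inter> equil D e \<noteq> {}" "compactly_in B B'" "B' \<subseteq> D" "0 < \<gamma>"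
    using assms(3) unfolding hyp_A1_def by - (elim conjE, assumption)+
  \<comment> \<open>Compactness of S inside the open set D comes from the closure of B being compact
    and contained in B', itself a subset of D.\<close>
  have "S \<subseteq> closure B" unfolding S_def by (rule closure_mono) (auto simp: Bgam_def)
  then have SD: "S \<subseteq> D" and S: "compact S"
    using B(3,4) closed_Int_compact[of S "closure B"] by (auto simp: compactly_in_def S_def Int_absorb2)
  have Sb: "S \<in> sets borel" using S by (rule borel_compact)
  have Sne: "S \<noteq> {}"
  proof -
    from B(2) obtain s where s: "?c s \<in> B" by (auto simp: equil_def)
    then have "?c s \<in> Bgam D e B \<gamma>" using B(1,5) by (auto simp: Bgam_def)
    then show ?thesis using closure_subset S_def by blast
  qed
  define J where "J = pr1 ` S"
  have JA: "J \<subseteq> ?A" unfolding J_def using SD by (rule image_mono)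
  have Jc: "compact J" unfolding J_def using S by (intro compact_continuous_image continuous_intros)
  have "J \<noteq> {}" using Sne by (simp add: J_def)
  \<comment> \<open>The projection of S is a compact subset of the open projection of D, so a
    neighbourhood of its convex hull remains admissible; this margin feeds the uniqueness
    lemma.\<close>
  then obtain a b \<delta> where ab: "a \<le> b" "0 < \<delta>" "J \<subseteq> {a..b}" "{a - \<delta>..b + \<delta>} \<subseteq> ?A"
    by (rule compact_subset_open_interval[OF Jc _ JA A]) blast

  \<comment> \<open>Almost everywhere limits along a common subsequence\<close>
  have full: "weak_entropy_sol_full \<rho> D F DF r e (\<epsilon> n) (U0 n) (U n)" and \<epsilon>: "0 < \<epsilon> n"
    and US: "AE z in lebesgue_on domT. U n z \<in> S" and U0S: "AE p in lebesgue_on dom0. U0 n p \<in> S" for n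
    using assms(4) unfolding hyp_A2_def S_def by - (elim conjE, erule spec)+
  have Um: "U n \<in> borel_measurable (lebesgue_on domT)" and U0m: "U0 n \<in> borel_measurable (lebesgue_on dom0)" for n
    using full[of n] unfolding weak_entropy_sol_full_def Linf_def by - (elim conjE, assumption)+
  have "(\<lambda>z. e (u z)) \<in> borel_measurable (lebesgue_on domT)"
    by (rule borel_measurable_compose_AE[OF _ assms(8) I(2) ec assms(9)]) simp
  then have cum: "(\<lambda>z. ?c (u z)) \<in> borel_measurable (lebesgue_on domT)" by (rule borel_measurable_st[OF assms(8)])
  \<comment> \<open>Local convergence for p = 1 is turned into almost everywhere convergence along a
    further subsequence; the weight is constantly 1, so no exceptional set of y arises.\<close>
  obtain \<tau> where \<tau>: "strict_mono \<tau>" and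
    \<tau>lim: "AE z in lebesgue_on domT. (1::real) \<noteq> 0 \<longrightarrow> (\<lambda>k. U (\<sigma> (\<tau> k)) z) \<longlonglongrightarrow> ?c (u z)"
    by (rule AE_subseq_of_tendsto_Lp_loc[OF assms(10)[OF order.refl] Um cum _ _ domT_exhaustion[OF refl]]) auto
  define V where "V k = U (\<sigma> (\<tau> k))" for k
  define V0 where "V0 k = U0 (\<sigma> (\<tau> k))" for k
  have V: "V k \<in> borel_measurable (lebesgue_on domT)" "AE z in lebesgue_on domT. V k z \<in> S"
    and V0: "V0 k \<in> borel_measurable (lebesgue_on dom0)" "AE p in lebesgue_on dom0. V0 k p \<in> S" for k
    unfolding V_def V0_def by (rule Um US U0m U0S)+
  have Vlim: "AE z in lebesgue_on domT. (\<lambda>k. V k z) \<longlonglongrightarrow> ?c (u z)" using \<tau>lim by (simp add: V_def)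
  have \<sigma>\<tau>: "strict_mono (\<lambda>k. \<sigma> (\<tau> k))" using strict_mono_o[OF assms(7) \<tau>] by (simp add: o_def)
  have V0lim: "AE p in lebesgue_on dom0. (\<lambda>k. V0 k p) \<longlonglongrightarrow> ?c (u0 p)"
  proof -
    have "AE p in lebesgue_on dom0. (\<lambda>n. U0 n p) \<longlonglongrightarrow> st (u0 p) (v0 p)" "AE p in lebesgue_on dom0. v0 p = e (u0 p)"
      using assms(5) unfolding hyp_A3_def by auto
    then show ?thesis
    proof eventually_elim
      case (elim p)
      then show ?case using LIMSEQ_subseq_LIMSEQ[OF elim(1) \<sigma>\<tau>] by (simp add: o_def V0_def)
    qed
  qed
  have closedS: "closed S" using S by (rule compact_imp_closed)
  \<comment> \<open>S is closed, so the limit (u, e(u)) inherits the values of the approximations.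
    This confines u to J rather than merely to the projection of the closure of D.\<close>
  have cuS: "AE z in lebesgue_on domT. ?c (u z) \<in> S"
  proof -
    have "AE z in lebesgue_on domT. \<forall>k. V k z \<in> S" using V(2) by (simp add: AE_all_countable)
    with Vlim show ?thesis by eventually_elim (rule closed_sequentially[OF closedS], auto)
  qed
  have cu0S: "AE p in lebesgue_on dom0. ?c (u0 p) \<in> S"
  proof -
    have "AE p in lebesgue_on dom0. \<forall>k. V0 k p \<in> S" using V0(2) by (simp add: AE_all_countable)
    with V0lim show ?thesis by eventually_elim (rule closed_sequentially[OF closedS], auto)
  qed
  have inJ: "s \<in> J" if "?c s \<in> S" for s using imageI[OF that, of pr1] by (simp add: J_def)
  have uJ: "AE z in lebesgue_on domT. u z \<in> J" using cuS by eventually_elim (rule inJ)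
  have u0J: "AE p in lebesgue_on dom0. u0 p \<in> J" using cu0S by eventually_elim (rule inJ)
  \<comment> \<open>Measurability of u0 is not among the hypotheses on the data; it follows because
    u0 is almost everywhere a limit of measurable first components.\<close>
  have u0m: "u0 \<in> borel_measurable (lebesgue_on dom0)"
  proof (rule borel_measurable_lebesgue_on_AE)
    have "(\<lambda>p. V0 k p $ 1) \<in> borel_measurable (lebesgue_on dom0)" for k
      by (rule borel_measurable_compose_AE[OF _ V0(1) Sb _ V0(2)]) (auto intro!: continuous_intros)
    then show "(\<lambda>p. lim (\<lambda>k. V0 k p $ 1)) \<in> borel_measurable (lebesgue_on dom0)"
      by (rule borel_measurable_lim_metric)
    show "AE p in lebesgue_on dom0. lim (\<lambda>k. V0 k p $ 1) = u0 p"
      using V0lim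
    proof eventually_elim
      case (elim p)
      have "(\<lambda>k. V0 k p $ 1) \<longlonglongrightarrow> u0 p" using tendsto_vec_nth[OF elim, of 1] by simp
      then show ?case by (rule limI)
    qed
  qed simp
  have JI: "J \<subseteq> ?I" using JA AI by blast
  have "(\<lambda>p. e (u0 p)) \<in> borel_measurable (lebesgue_on dom0)"
    by (rule borel_measurable_compose_AE[OF _ u0m borel_compact[OF Jc] continuous_on_subset[OF ec JI] u0J]) simp
  then have cu0m: "(\<lambda>p. ?c (u0 p)) \<in> borel_measurable (lebesgue_on dom0)" by (rule borel_measurable_st[OF u0m])

  \<comment> \<open>The reduced weak form of the limit\<close>
  have Fd: "((\<lambda>U. F U $ i) has_derivative (\<lambda>h. DF W $ i \<bullet> h)) (at W within S)" if "W \<in> S" for W i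
  proof -
    have "\<exists>HF. C2_with (closure D) (\<lambda>U. F U $ i) (\<lambda>U. DF U $ i) HF"
      using assms(2) unfolding relaxation_system_def by (elim conjE) (erule spec)
    then obtain HF where "C2_with (closure D) (\<lambda>U. F U $ i) (\<lambda>U. DF U $ i) HF" by blast
    moreover have "S \<subseteq> closure D" using SD closure_subset by blast
    ultimately show ?thesis using that unfolding C2_with_def by (blast intro: has_derivative_subset)
  qed
  have Fc: "continuous_on S (\<lambda>U. F U $ 1)"
    using Fd by (auto simp: continuous_on_eq_continuous_within intro: has_derivative_continuous)
  have weak: "(LINT z|lebesgue_on domT. (u z * dt \<phi> z + ?f (u z) * dx \<phi> z) * \<rho> (snd (snd z)))
      + (LINT p|lebesgue_on dom0. u0 p * \<phi> (fst p, 0, snd p) * \<rho> (snd p)) = 0"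
    if \<phi>: "test_fun domT0 \<phi>" for \<phi>
  proof -
    have eq: "(LINT z|lebesgue_on domT. (V i z $ 1 * dt \<phi> z + F (V i z) $ 1 * dx \<phi> z) * \<rho> (snd (snd z)))
      + (LINT p|lebesgue_on dom0. V0 i p $ 1 * \<phi> (fst p, 0, snd p) * \<rho> (snd p)) = 0" for i
      unfolding V_def V0_def by (rule weak_form_first_component[OF full \<phi>])
    show ?thesis
      using weak_form_limit[OF \<rho>(1) S Fc V V0 cum cuS cu0m cu0S Vlim V0lim \<phi> eq] by (simp add: flux_def)
  qed

  \<comment> \<open>Entropy inequality with initial term and the trace\<close>
  have l1: "strictly_convex_on ?A l1" "\<exists>l1' l1''. C2_real_with ?A l1 l1' l1''"
    using assms(3) unfolding hyp_A1_def by - (elim conjE, assumption)+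
  from l1(2) obtain l' l'' where l': "C2_real_with ?A l1 l' l''" by blast
  have l1d: "(l1 has_real_derivative l' s) (at s)" if "s \<in> ?A" for s
    using l' that unfolding C2_real_with_def at_within_open[OF that A(1)] by (metis A(1) at_within_open)
  have "continuous_on ?A l1" "continuous_on ?A l'"
    using l' unfolding C2_real_with_def by (blast intro: DERIV_continuous_on)+
  then have lc: "continuous_on J l1" "continuous_on J l'" using JA by (blast intro: continuous_on_subset)+
  have "\<forall>l\<in>{l1, l2}. \<exists>\<eta> D\<eta> H\<eta> Q.
        strongly_convex_entropy (equil D e) DF r S \<eta> D\<eta> H\<eta> \<and> entropy_flux DF S D\<eta> Q \<and>
        (\<forall>s\<in>J. \<eta> (?c s) = l s) \<and>
        (\<forall>U\<in>S - equil D e. D\<eta> U $ 2 * r U > 0) \<and> (\<forall>s\<in>J. D\<eta> (?c s) $ 2 = 0)"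
    using assms(3) unfolding hyp_A1_def S_def J_def by (elim conjE)
  then obtain \<eta> D\<eta> H\<eta> Q where "strongly_convex_entropy (equil D e) DF r S \<eta> D\<eta> H\<eta>"
    and Q: "entropy_flux DF S D\<eta> Q" and \<eta>l: "\<forall>s\<in>J. \<eta> (?c s) = l1 s" by blast
  then have \<eta>: "convex_entropy (equil D e) DF r S \<eta> D\<eta> H\<eta>" by (simp add: strongly_convex_entropy_def)
  interpret E: convex_entropy_pair S \<eta> Q r D\<eta> H\<eta> DF F
    using S Fd Q \<eta> unfolding convex_entropy_def C2_with_def entropy_flux_def by unfold_locales blast+
  \<comment> \<open>Q is an entropy flux on S only; evaluated on the equilibrium curve it bounds the
    flux term in the layer, and its relation to l1 and f plays no part in that bound.\<close>
  have Qc: "continuous_on S Q"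
    using E.Q by (auto simp: continuous_on_eq_continuous_within intro: has_derivative_continuous)
  have ent: "0 \<le> (LINT z|lebesgue_on domT. (\<eta> (?c (u z)) * bump (R\<^sup>2 - (fst z)\<^sup>2) * (- flat_exp 2 (2 - fst (snd z) / T) / T)
        + Q (?c (u z)) * (- 2 * fst z * flat_exp 2 (R\<^sup>2 - (fst z)\<^sup>2)) * bump (2 - fst (snd z) / T)) * \<rho> (snd (snd z)))
      + (LINT p|lebesgue_on dom0. \<eta> (?c (u0 p)) * bump (R\<^sup>2 - (fst p)\<^sup>2) * bump (2 - 0 / T) * \<rho> (snd p))"
    if RT: "0 < R" "0 < T" for R T
  proof -
    interpret entropy_cutoff S \<eta> Q r D\<eta> H\<eta> DF F "\<lambda>x. bump (R\<^sup>2 - x\<^sup>2)" "\<lambda>x. - 2 * x * flat_exp 2 (R\<^sup>2 - x\<^sup>2)"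
     "\<lambda>x. - 2 * flat_exp 2 (R\<^sup>2 - x\<^sup>2) + 4 * x\<^sup>2 * (flat_exp 4 (R\<^sup>2 - x\<^sup>2) - 2 * flat_exp 3 (R\<^sup>2 - x\<^sup>2))"
     "\<lambda>t. bump (2 - t / T)" "\<lambda>t. - flat_exp 2 (2 - t / T) / T" R "2 * T"
      by (rule entropy_cutoff.intro[OF E.convex_entropy_pair_axioms product_cutoff_bump[OF RT]])
    have visc: "0 \<le> (LINT z|lebesgue_on domT. (\<eta> (U n z) * bump (R\<^sup>2 - (fst z)\<^sup>2) * (- flat_exp 2 (2 - fst (snd z) / T) / T)
        + Q (U n z) * (- 2 * fst z * flat_exp 2 (R\<^sup>2 - (fst z)\<^sup>2)) * bump (2 - fst (snd z) / T)) * \<rho> (snd (snd z)))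
      + (LINT p|lebesgue_on dom0. \<eta> (U0 n p) * bump (R\<^sup>2 - (fst p)\<^sup>2) * bump (2 - 0 / T) * \<rho> (snd p))" for n
    proof -
      from assms(6) obtain W0 W where W: "\<forall>\<nu>>0. smooth_on dom0 (W0 \<nu>) \<and>
           W \<nu> \<in> borel_measurable (lebesgue_on domT) \<and>
           classical_viscous_sol F r (\<epsilon> n) \<nu> (W0 \<nu>) (W \<nu>) \<and>
           (\<forall>z\<in>dom0. W0 \<nu> z \<in> S) \<and> (\<forall>z\<in>domT. W \<nu> z \<in> S)"
        "tendsto_Lp_loc 1 (\<lambda>(x, y). \<rho> y) dom0 W0 (U0 n) (at_right 0)"
        "tendsto_Lp_loc 1 (\<lambda>(x, t, y). (\<rho> y)\<^sup>2) domT W (U n) (at_right 0)"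
        unfolding hyp_A4_def S_def by blast
      show ?thesis
        by (rule entropy_inequality_vanishing_viscosity[OF \<rho> \<epsilon>[of n] _ _ _ _ _ W(2,3) Um US U0m U0S])
           (use W(1) in blast)+
    qed
    \<comment> \<open>The second passage, now in \<epsilon>: the dissipation was already discarded
      at the viscous level, so nothing singular in \<epsilon> is left. The viscosity parameter of
      the limit lemma is set to 0.\<close>
    show ?thesis
    proof (rule entropy_inequality_limit[OF \<rho>(1) V V0 cum cuS cu0m cu0S _ _ tendsto_const[of 0]])
      show "AE z in lebesgue_on domT. \<rho> (snd (snd z)) \<noteq> 0 \<longrightarrow> (\<lambda>k. V k z) \<longlonglongrightarrow> ?c (u z)"
        using Vlim by eventually_elim simp
      show "AE p in lebesgue_on dom0. \<rho> (snd p) \<noteq> 0 \<longrightarrow> (\<lambda>k. V0 k p) \<longlonglongrightarrow> ?c (u0 p)"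
        using V0lim by eventually_elim simp
    qed (simp only: mult_zero_left add_0_right V_def V0_def visc)
  qed
  obtain M1 M2 M3 M4 M5 where M: "\<forall>s\<in>J. \<bar>s\<bar> \<le> M1" "\<forall>s\<in>J. \<bar>l1 s\<bar> \<le> M2" "\<forall>s\<in>J. \<bar>l' s\<bar> \<le> M3"
     "\<forall>s\<in>S. \<bar>F s $ 1\<bar> \<le> M4" "\<forall>s\<in>S. \<bar>Q s\<bar> \<le> M5" "0 \<le> M1" "0 \<le> M2" "0 \<le> M3" "0 \<le> M4" "0 \<le> M5"
    using compact_continuous_abs_bound[OF Jc continuous_on_id] compact_continuous_abs_bound[OF Jc lc(1)]
      compact_continuous_abs_bound[OF Jc lc(2)] compact_continuous_abs_bound[OF S Fc]
      compact_continuous_abs_bound[OF S Qc] by metis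
  \<comment> \<open>On J the entropy restricted to the equilibrium curve equals l1, so l1' is the
    slope of its tangent; the sum of the five bounds serves as the common constant.\<close>
  interpret L: initial_layer \<rho> J "\<lambda>s. \<eta> (?c s)" l' u "\<lambda>z. ?f (u z)" "\<lambda>z. Q (?c (u z))" u0 "M1 + M2 + M3 + M4 + M5"
  proof
    show "continuous_on J (\<lambda>s. \<eta> (?c s))" using lc(1) \<eta>l by (simp cong: continuous_on_cong)
    show "\<eta> (?c s) + l' s * (t - s) < \<eta> (?c t)" if "t \<in> J" "s \<in> J" "t \<noteq> s" for t s
      using strictly_convex_above_tangent[OF l1(1) A(1) l1d[of s], of t] that JA \<eta>l by auto
    show "\<bar>s\<bar> \<le> M1 + M2 + M3 + M4 + M5" "\<bar>l' s\<bar> \<le> M1 + M2 + M3 + M4 + M5" if "s \<in> J" for s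
      using bspec[OF M(1) that] bspec[OF M(3) that] M(6-10) by linarith+
    show "\<bar>\<eta> (?c s)\<bar> \<le> M1 + M2 + M3 + M4 + M5" if "s \<in> J" for s
      using bspec[OF M(2) that] M(6-10) bspec[OF \<eta>l that] by linarith
    show "(\<lambda>z. ?f (u z)) \<in> borel_measurable (lebesgue_on domT)" unfolding flux_def
      by (rule borel_measurable_compose_AE[OF _ cum Sb Fc cuS]) simp
    show "AE z in lebesgue_on domT. \<bar>?f (u z)\<bar> \<le> M1 + M2 + M3 + M4 + M5"
      using cuS by eventually_elim (use M(4,6-10) in \<open>force simp: flux_def\<close>)
    show "(\<lambda>z. Q (?c (u z))) \<in> borel_measurable (lebesgue_on domT)"
      by (rule borel_measurable_compose_AE[OF _ cum Sb Qc cuS]) simp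
    show "AE z in lebesgue_on domT. \<bar>Q (?c (u z))\<bar> \<le> M1 + M2 + M3 + M4 + M5"
      using cuS by eventually_elim (use M(5-10) in force)
  qed (use \<rho> Jc lc(2) assms(8) uJ u0m u0J weak ent M(6-10) in auto)
  have init: "attains_initial_data \<rho> u u0" by (rule L.attains_initial_data_limit)

  \<comment> \<open>The limit as the unique entropy solution\<close>
  have abI: "{a - \<delta>..b + \<delta>} \<subseteq> ?I" using ab(4) AI by blast
  have uab: "AE z in lebesgue_on domT. u z \<in> {a..b}" using uJ by eventually_elim (use ab(3) in blast)
  have Linf_bounded: "Linf X w" if "w \<in> borel_measurable (lebesgue_on X)" "AE z in lebesgue_on X. w z \<in> J"
    for X and w :: "'x::euclidean_space \<Rightarrow> real"
  proof -
    have "AE z in lebesgue_on X. norm (w z) \<le> M1" using that(2) by eventually_elim (use M(1) in auto)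
    then show ?thesis using that(1) by (auto simp: Linf_def)
  qed
  have fc: "continuous_on J ?f" by (rule continuous_on_subset[OF DERIV_continuous_on[OF f(1)] JI])
  have sol: "weak_entropy_sol_reduced \<rho> D ?f u0 u"
    if ent: "\<And>l l' l'' q \<phi>. convex_on ?A l \<and> C2_real_with ?A l l' l'' \<and>
             (\<forall>s\<in>?A. (q has_real_derivative l' s * deriv ?f s) (at s)) \<and>
             test_fun domT \<phi> \<and> (\<forall>z\<in>domT. 0 \<le> \<phi> z) \<Longrightarrow>
             (LINT (x, t, y)|lebesgue_on domT.
                (l (u (x, t, y)) * dt \<phi> (x, t, y) + q (u (x, t, y)) * dx \<phi> (x, t, y)) * \<rho> y) \<ge> 0"
    unfolding weak_entropy_sol_reduced_def
  proof (intro conjI allI impI)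
    show "Linf dom0 u0" by (rule Linf_bounded[OF u0m u0J])
    show uL: "Linf domT u" by (rule Linf_bounded[OF assms(8) uJ])
    show "AE p in lebesgue_on dom0. u0 p \<in> ?I" using u0J by eventually_elim (use JI in blast)
    show "AE z in lebesgue_on domT. u z \<in> ?I" by (rule assms(9))
    show "Linf domT (\<lambda>z. ?f (u z))" by (rule Linf_compose[OF _ uL compact_imp_closed[OF Jc] fc uJ]) simp
    show "(LINT (x, t, y)|lebesgue_on domT. (u (x, t, y) * dt \<phi> (x, t, y) + ?f (u (x, t, y)) * dx \<phi> (x, t, y)) * \<rho> y)
        + (LINT (x, y)|lebesgue_on dom0. u0 (x, y) * \<phi> (x, 0, y) * \<rho> y) = 0" if "test_fun domT0 \<phi>" for \<phi>
      using weak[OF that] by (simp add: case_prod_beta')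
    show "attains_initial_data \<rho> u u0" by (rule init)
    show "0 \<le> (LINT (x, t, y)|lebesgue_on domT. (l (u (x, t, y)) * dt \<phi> (x, t, y) + q (u (x, t, y)) * dx \<phi> (x, t, y)) * \<rho> y)"
      if h: "convex_on UNIV l \<and> C2_real_with ?I l k k' \<and>
        (\<forall>s\<in>?I. (q has_real_derivative k s * vector_derivative ?f (at s within ?I)) (at s within ?I)) \<and>
        test_fun domT \<phi> \<and> (\<forall>z\<in>domT. 0 \<le> \<phi> z)" for l k k' q \<phi>
    proof (rule ent, intro conjI ballI)
      show "convex_on ?A l" using h A(2) convex_on_subset by blast
      show "C2_real_with ?A l k k'" using h C2_real_with_subset[OF _ AI] by blast
      show "(q has_real_derivative k s * deriv ?f s) (at s)" if s: "s \<in> ?A" for s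
      proof -
        \<comment> \<open>Points of the open projection of D are interior to the larger interval, so
          the relative derivatives of the definition are ordinary ones, as the hypothesis
          requires.\<close>
        have int: "at s within ?I = at s"
          by (rule at_within_interior) (use interior_maximal[OF AI A(1)] s in blast)
        have sI: "s \<in> ?I" using AI s by blast
        have "(?f has_real_derivative f' s) (at s)" using f(1)[OF sI] by (simp add: int)
        then have "vector_derivative ?f (at s) = f' s" "deriv ?f s = f' s"
          by (auto intro!: vector_derivative_at DERIV_imp_deriv simp: has_real_derivative_iff_has_vector_derivative[symmetric])
        moreover have "(q has_real_derivative k s * vector_derivative ?f (at s within ?I)) (at s within ?I)"
          using h sI by blast
        ultimately show ?thesis by (simp add: int)
      qed
    qed (use h in auto)
  qed
  show ?thesis
  proof (intro conjI impI)
    show "\<forall>V. V \<in> sets lebesgue \<and> bounded V \<longrightarrow>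
            ((\<lambda>T. 1 / T * (LINT (x, t, y)|lebesgue_on (V \<times> {0<..<T} \<times> Gam).
                     \<bar>u (x, t, y) - u0 (x, y)\<bar> * \<rho> y)) \<longlongrightarrow> 0) (at_right 0)"
      using init unfolding attains_initial_data_def real_norm_def .
    show "unique_weak_entropy_sol_reduced \<rho> D ?f u0 u"
      if h: "\<forall>l l' l'' q \<phi>.
             convex_on ?A l \<and> C2_real_with ?A l l' l'' \<and>
             (\<forall>s\<in>?A. (q has_real_derivative l' s * deriv ?f s) (at s)) \<and>
             test_fun domT \<phi> \<and> (\<forall>z\<in>domT. 0 \<le> \<phi> z) \<longrightarrow>
             (LINT (x, t, y)|lebesgue_on domT.
                (l (u (x, t, y)) * dt \<phi> (x, t, y) + q (u (x, t, y)) * dx \<phi> (x, t, y)) * \<rho> y) \<ge> 0"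
    proof -
      have s: "weak_entropy_sol_reduced \<rho> D ?f u0 u" by (rule sol) (use h in blast)
      show ?thesis unfolding unique_weak_entropy_sol_reduced_def
        using s weak_entropy_sol_reduced_unique[OF \<rho> refl I f ab(1) abI ab(2) _ s uab] by blast
    qed
  qed
qed

end
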